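(* In the setting described in the context (assumptions (A1)–(A3), cylinders $\mathcal{C}^-_\rho$, cut-off function $\phi=\phi_{r,\theta}$, fundamental solution $\Gamma_1$), there exist constants $C>0$ and $\theta_*\in(0,2^{-Q})$, depending only on $m_0,k,Q$, $\lambda$ and $N$, such that the following holds. Let $w$ be a non-negative weak sub-solution of $\sum_{i,j=1}^{m_0}X_i(a_{ij}X_jw)+X_0w-\partial_tw=0$ in $\mathcal{C}^-_1$, and let $0<r<\theta<\theta_*$. Then $$\int_{\mathcal{C}^-_{\theta r}}(w(z)-I_0)_+^2\,dz\le C\theta^2r^2\int_{\mathcal{C}^-_{r/\theta}}|Xw|^2\,dz,$$ where $$I_0=\sup_{z\in\mathcal{C}^-_{\theta r}}\big[I_1(z)+C_2(z)\big],$$ $$I_1(z)=\int_{\mathcal{C}^-_{r/\theta}}\big[-\Gamma_1(z,\zeta)\,w(\zeta)\,Y\phi(\zeta)\big]d\zeta,\qquad C_2(z)=\int_{\mathcal{C}^-_{r/\theta}}\Big[\sum_{j=1}^{m_0}|X_j^2\phi(\zeta)|\,\Gamma_1(z,\zeta)\,w(\zeta)\Big]d\zeta .$$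
   Context: Setting. $1\le m_0\le N$; $X_0,X_1,\dots,X_{m_0}$ are smooth vector fields on $\mathbb{R}^N$; points of $\mathbb{R}^{N+1}$ are $z=(x,t)$; $Y=X_0-\partial_t$, $A=(a_{ij})_{m_0\times m_0}$, $Xu=(X_1u,\dots,X_{m_0}u)^T$, $L_1=\sum_{k=1}^{m_0}X_k^2+Y$. An absolutely continuous curve $\gamma:[0,T]\to\mathbb{R}^{N+1}$ is $L_1$-admissible if $\gamma'=\sum_{k=1}^{m_0}\lambda_k(s)X_k(\gamma)+Y(\gamma)$ a.e. for some bounded measurable $\lambda_k$. A homogeneous Lie group $(\mathbb{R}^{N+1},\circ,\delta_\mu)$ is a Lie group with dilations $\delta_\mu=\mathrm{diag}(\mu^{\alpha_1},\dots,\mu^{\alpha_N},\mu^2)$, positive integers $\alpha_1\le\dots\le\alpha_N$, that are group automorphisms for all $\mu>0$. A vector field $Z$ is $\delta_\mu$-homogeneous of degree $m$ if $Z(\varphi\circ\delta_\mu)=\mu^m(Z\varphi)\circ\delta_\mu$ for all smooth $\varphi$. (A1) $a_{ij}=a_{ji}\in L^\infty(\mathbb{R}^{N+1})$ are real measurable and $\frac1\lambda|\xi|^2\le\sum a_{ij}(x,t)\xi_i\xi_j\le\lambda|\xi|^2$ for all $(x,t)$, $\xi\in\mathbb{R}^{m_0}$, with some $\lambda>0$; $X_0=\sum_{j=1}^Nb_j(x)\partial_{x_j}$ with smooth $b_j$. (A2) There is a homogeneous Lie group $(\mathbb{R}^{N+1},\circ,\delta_\mu)$ for which $X_1,\dots,X_{m_0},Y$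 are left invariant, $X_1,\dots,X_{m_0}$ are $\delta_\mu$-homogeneous of degree one and $Y$ is $\delta_\mu$-homogeneous of degree two. (A3) For all $(x,t),(\xi,\tau)$ with $t>\tau$ there is an $L_1$-admissible path $\gamma:[0,t-\tau]\to\mathbb{R}^{N+1}$ from $(x,t)$ to $(\xi,\tau)$. Consequences used as notation: $\alpha_1=\dots=\alpha_{m_0}=1<\alpha_{m_0+1}\le\dots\le\alpha_N$; $Q=\alpha_1+\dots+\alpha_N$; $k=\alpha_N$ is the number of layers in the decomposition $\mathbb{R}^N=V_1\oplus\dots\oplus V_k$ induced by the dilations; $X_j=\sum_{i\le m_0}C_i^{(j)}\partial_{x_i}+\sum_{i>m_0}C_i^{(j)}(x)\partial_{x_i}$ for $1\le j\le m_0$, with $C^{(j)}_i$ constant for $i\le m_0$ and $C_i^{(j)}(x)$ polynomial of homogeneous degree $\alpha_i-1$ for $i>m_0$; $X_0=\sum_{i>m_0}b_i(x)\partial_{x_i}$ with $b_i$ polynomial of homogeneous degree $\alpha_i-2$. The constant $\lambda$ is taken large enough that all these constants and the coefficients of all these polynomials are bounded by $\lambda$. Weak sub-solution in an open set $\Omega$: $w$ with $w,Xw,Yw\in L^2_{\rm loc}(\Omega)$ and $\int_\Omega(\varphi Yw-(Xw)^TAX\varphi)\ge0$ for all $0\le\varphi\in C_0^\infty(\Omega)$. (In a cylinder $\mathcal{C}^-_\rho$ this refers to its interior.) Cylinders. Write $x=(x',\bar x)$ with $x'=(x_1,\dots,x_{m_0})$. For a fixed constant $\lambda'>1$ depending only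 on $m_0,k,Q,\lambda,N$, $$\mathcal{C}_\rho^-=\{(x,t):-\rho^2\le t<0,\ |x'|\le\rho,\ |x_j|\le(\lambda'\rho)^{\alpha_j}\ (j=m_0+1,\dots,N)\}.$$ Cut-off. For $r,\theta>0$ with $\theta^{1/Q}<\frac12$, $\chi$ is a smooth function on $\mathbb{R}$ with $\chi(s)=1$ for $s\le\theta^{1/Q}r$, $\chi(s)=0$ for $s>r$, $0\le-\chi'(s)\le\frac{2}{(1-\theta^{1/Q})r}$, $|\chi''(s)|\le\frac{C}{r^2}$ (with $C$ absolute), and for all $\theta^{1/Q}<\beta_1<\beta_2<1$ there is $C(\beta_1,\beta_2)>0$ with $|\chi'(s)|\ge C(\beta_1,\beta_2)r^{-1}$ for $\beta_1r\le s\le\beta_2r$. Let $$\mathcal{Q}=\{(x',\bar x,t):-r^2\le t\le0,\ |x'|\le r/\theta,\ |x_j|\le(r/\theta)^{\alpha_j},\ j=m_0+1,\dots,N\}.$$ For $t\le0$ define $$\phi_0(x,t)=\chi\Big(\Big[\sum_{j=m_0+1}^N\frac{\theta^{2\alpha_j}x_j^2}{r^{2\alpha_j-Q}}-C_1t\,r^{Q-2}\Big]^{1/Q}\Big),\quad\phi_1(x,t)=\chi(\theta|x'|),\quad\phi=\phi_0\phi_1,$$ where $C_1>1$ is a constant, depending only on $m_0,k,Q,\lambda,N$, such that $C_1r^{Q-2}\ge\big|\sum_{j>m_0}2\theta^{2\alpha_j}b_j(x)x_jr^{Q-2\alpha_j}\big|$ for all $(x,t)\in\mathcal{Q}$. Fundamental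 solution. $\Gamma_1(z,\zeta)$ is the fundamental solution of $L_1$ with pole at $\zeta$: it is smooth for $z\ne\zeta$, $\varphi(z)=-\int_{\mathbb{R}^{N+1}}\Gamma_1(z,\zeta)L_1\varphi(\zeta)d\zeta$ for $\varphi\in C_0^\infty(\mathbb{R}^{N+1})$, $\Gamma_1(z,\zeta)=\Gamma_1(\zeta^{-1}\circ z,0)$, $\Gamma_1\ge0$ with $\Gamma_1(x,t,\xi,\tau)>0$ if $t>\tau$, $\int_{\mathbb{R}^N}\Gamma_1(x,t,\xi,\tau)dx=\int_{\mathbb{R}^N}\Gamma_1(x,t,\xi,\tau)d\xi=1$ if $t>\tau$, and $\Gamma_1(\delta_\mu z,0)=\mu^{-Q}\Gamma_1(z,0)$ for $z\neq 0$, $\mu>0$. *)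

theory Defs
  imports "HOL-Analysis.Analysis"
begin

(* Points z = (x,t) of R^(N+1), with N = CARD('n).  The linear order on 'n provides the
   numbering x_1, ..., x_N of the coordinates. *)
type_synonym 'n space = "(real, 'n) vec"
type_synonym 'n point = "'n space \<times> real"

definition pos :: "'n::{finite,linorder} \<Rightarrow> nat" where
  "pos i = card {j. j \<le> i}"


(* Meant for open S. *)
primrec Ck_on :: "nat \<Rightarrow> 'a::real_normed_vector set \<Rightarrow> ('a \<Rightarrow> 'b::real_normed_vector) \<Rightarrow> bool" where
  "Ck_on 0 S f = continuous_on S f"
| "Ck_on (Suc n) S f =
     ((\<forall>x\<in>S. f differentiable (at x)) \<and> (\<forall>v. Ck_on n S (\<lambda>x. frechet_derivative f (at x) v)))"

definition smooth_on :: "'a::real_normed_vector set \<Rightarrow> ('a \<Rightarrow> 'b::real_normed_vector) \<Rightarrow> bool" where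
  "smooth_on S f \<longleftrightarrow> (\<forall>n. Ck_on n S f)"

definition test_function :: "'a::real_normed_vector set \<Rightarrow> ('a \<Rightarrow> real) \<Rightarrow> bool" where
  "test_function \<Omega> \<phi> \<longleftrightarrow>
     smooth_on UNIV \<phi> \<and> compact (closure {z. \<phi> z \<noteq> 0}) \<and> closure {z. \<phi> z \<noteq> 0} \<subseteq> \<Omega>"


(* Z f for a vector field Z = sum_i Z_i d_i and a function f differentiable at z. *)
definition vf_deriv :: "('a::real_normed_vector \<Rightarrow> 'a) \<Rightarrow> ('a \<Rightarrow> real) \<Rightarrow> 'a \<Rightarrow> real" where
  "vf_deriv Z f z = frechet_derivative f (at z) (Z z)"

definition divergence :: "('a::euclidean_space \<Rightarrow> 'a) \<Rightarrow> 'a \<Rightarrow> real" where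
  "divergence V z = (\<Sum>b\<in>Basis. frechet_derivative V (at z) b \<bullet> b)"

definition L2_loc :: "'a::euclidean_space set \<Rightarrow> ('a \<Rightarrow> real) \<Rightarrow> bool" where
  "L2_loc \<Omega> f \<longleftrightarrow> f \<in> borel_measurable (lebesgue_on \<Omega>) \<and>
     (\<forall>K. compact K \<and> K \<subseteq> \<Omega> \<longrightarrow> set_integrable lebesgue K (\<lambda>z. (f z)\<^sup>2))"

(* g is the distributional derivative Z w in \<Omega>; the formal adjoint of Z is
   \<phi> \<mapsto> - div (\<phi> Z). *)
definition weak_vf_deriv ::
  "'a::euclidean_space set \<Rightarrow> ('a \<Rightarrow> 'a) \<Rightarrow> ('a \<Rightarrow> real) \<Rightarrow> ('a \<Rightarrow> real) \<Rightarrow> bool" where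
  "weak_vf_deriv \<Omega> Z w g \<longleftrightarrow>
     (\<forall>\<phi>. test_function \<Omega> \<phi> \<longrightarrow>
        (LINT z:\<Omega>|lebesgue. w z * (- divergence (\<lambda>y. \<phi> y *\<^sub>R Z y) z))
          = (LINT z:\<Omega>|lebesgue. g z * \<phi> z))"


(* A family X_0, X_1, ... of vector fields on R^N, viewed on R^(N+1). *)
definition lift :: "(nat \<Rightarrow> 'n space \<Rightarrow> 'n space) \<Rightarrow> nat \<Rightarrow> 'n::finite point \<Rightarrow> 'n point" where
  "lift X j z = (X j (fst z), 0)"

(* Y = X_0 - d_t *)
definition drift :: "(nat \<Rightarrow> 'n space \<Rightarrow> 'n space) \<Rightarrow> 'n::finite point \<Rightarrow> 'n point" where
  "drift X z = (X 0 (fst z), - 1)"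

definition L1_op :: "nat \<Rightarrow> (nat \<Rightarrow> 'n space \<Rightarrow> 'n space) \<Rightarrow> ('n::finite point \<Rightarrow> real) \<Rightarrow> 'n point \<Rightarrow> real" where
  "L1_op m0 X f z =
     (\<Sum>k=1..m0. vf_deriv (lift X k) (vf_deriv (lift X k) f) z) + vf_deriv (drift X) f z"


definition assumption_A1 ::
  "nat \<Rightarrow> real \<Rightarrow> (nat \<Rightarrow> nat \<Rightarrow> 'n::finite point \<Rightarrow> real) \<Rightarrow> (nat \<Rightarrow> 'n space \<Rightarrow> 'n space) \<Rightarrow> bool" where
  "assumption_A1 m0 lam a X \<longleftrightarrow>
     (\<forall>i\<in>{1..m0}. \<forall>j\<in>{1..m0}.
        a i j = a j i \<and> a i j \<in> borel_measurable lebesgue \<and>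
        (\<exists>B. AE z in lebesgue. \<bar>a i j z\<bar> \<le> B)) \<and>
     lam > 0 \<and>
     (\<forall>z. \<forall>\<xi>::nat \<Rightarrow> real.
        1 / lam * (\<Sum>i=1..m0. (\<xi> i)\<^sup>2) \<le> (\<Sum>i=1..m0. \<Sum>j=1..m0. a i j z * \<xi> i * \<xi> j) \<and>
        (\<Sum>i=1..m0. \<Sum>j=1..m0. a i j z * \<xi> i * \<xi> j) \<le> lam * (\<Sum>i=1..m0. (\<xi> i)\<^sup>2)) \<and>
     (\<forall>j\<in>{0..m0}. smooth_on UNIV (X j))"

definition dil :: "('n \<Rightarrow> nat) \<Rightarrow> real \<Rightarrow> 'n::finite point \<Rightarrow> 'n point" where
  "dil \<alpha> \<mu> z = ((\<chi> i. \<mu> ^ \<alpha> i * fst z $ i), \<mu>\<^sup>2 * snd z)"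

(* The neutral element is called e; it is necessarily 0, being fixed by all dilations. *)
definition homogeneous_Lie_group ::
  "('n::{finite,linorder} point \<Rightarrow> 'n point \<Rightarrow> 'n point) \<Rightarrow> 'n point \<Rightarrow> ('n point \<Rightarrow> 'n point)
     \<Rightarrow> ('n \<Rightarrow> nat) \<Rightarrow> bool" where
  "homogeneous_Lie_group op e iv \<alpha> \<longleftrightarrow>
     group op e iv \<and>
     smooth_on UNIV (\<lambda>p. op (fst p) (snd p)) \<and> smooth_on UNIV iv \<and>
     (\<forall>i. 1 \<le> \<alpha> i) \<and> mono \<alpha> \<and>
     (\<forall>\<mu>>0. \<forall>z \<zeta>. dil \<alpha> \<mu> (op z \<zeta>) = op (dil \<alpha> \<mu> z) (dil \<alpha> \<mu> \<zeta>))"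

definition left_invariant :: "('a::real_normed_vector \<Rightarrow> 'a \<Rightarrow> 'a) \<Rightarrow> ('a \<Rightarrow> 'a) \<Rightarrow> bool" where
  "left_invariant op Z \<longleftrightarrow>
     (\<forall>\<zeta> \<phi>. smooth_on UNIV \<phi> \<longrightarrow> vf_deriv Z (\<phi> \<circ> op \<zeta>) = vf_deriv Z \<phi> \<circ> op \<zeta>)"

definition homogeneous_vf :: "('n \<Rightarrow> nat) \<Rightarrow> nat \<Rightarrow> ('n::finite point \<Rightarrow> 'n point) \<Rightarrow> bool" where
  "homogeneous_vf \<alpha> m Z \<longleftrightarrow>
     (\<forall>\<mu>>0. \<forall>\<phi>. smooth_on UNIV \<phi> \<longrightarrow>
        vf_deriv Z (\<phi> \<circ> dil \<alpha> \<mu>) = (\<lambda>z. \<mu> ^ m * vf_deriv Z \<phi> (dil \<alpha> \<mu> z)))"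

definition assumption_A2 ::
  "nat \<Rightarrow> (nat \<Rightarrow> 'n space \<Rightarrow> 'n space) \<Rightarrow> ('n::{finite,linorder} point \<Rightarrow> 'n point \<Rightarrow> 'n point)
     \<Rightarrow> 'n point \<Rightarrow> ('n point \<Rightarrow> 'n point) \<Rightarrow> ('n \<Rightarrow> nat) \<Rightarrow> bool" where
  "assumption_A2 m0 X op e iv \<alpha> \<longleftrightarrow>
     homogeneous_Lie_group op e iv \<alpha> \<and>
     (\<forall>j\<in>{1..m0}. left_invariant op (lift X j) \<and> homogeneous_vf \<alpha> 1 (lift X j)) \<and>
     left_invariant op (drift X) \<and> homogeneous_vf \<alpha> 2 (drift X)"

definition abs_cont_on :: "real \<Rightarrow> real \<Rightarrow> (real \<Rightarrow> 'a::real_normed_vector) \<Rightarrow> bool" where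
  "abs_cont_on a b f \<longleftrightarrow>
     (\<forall>\<epsilon>>0. \<exists>\<delta>>0. \<forall>D :: (real \<times> real) set.
        finite D \<and> (\<forall>(u,v)\<in>D. a \<le> u \<and> u \<le> v \<and> v \<le> b) \<and>
        pairwise (\<lambda>p q. {fst p<..<snd p} \<inter> {fst q<..<snd q} = {}) D \<and>
        (\<Sum>(u,v)\<in>D. v - u) < \<delta>
        \<longrightarrow> (\<Sum>(u,v)\<in>D. norm (f v - f u)) < \<epsilon>)"

definition L1_admissible ::
  "nat \<Rightarrow> (nat \<Rightarrow> 'n space \<Rightarrow> 'n space) \<Rightarrow> real \<Rightarrow> (real \<Rightarrow> 'n::finite point) \<Rightarrow> bool" where
  "L1_admissible m0 X T \<gamma> \<longleftrightarrow>
     abs_cont_on 0 T \<gamma> \<and>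
     (\<exists>l :: nat \<Rightarrow> real \<Rightarrow> real.
        (\<forall>k\<in>{1..m0}. l k \<in> borel_measurable (lebesgue_on {0..T}) \<and>
                     (\<exists>B. \<forall>s\<in>{0..T}. \<bar>l k s\<bar> \<le> B)) \<and>
        (AE s in lebesgue_on {0..T}.
           (\<gamma> has_vector_derivative
              ((\<Sum>k=1..m0. l k s *\<^sub>R lift X k (\<gamma> s)) + drift X (\<gamma> s))) (at s within {0..T})))"

definition assumption_A3 :: "nat \<Rightarrow> (nat \<Rightarrow> 'n space \<Rightarrow> 'n::finite space) \<Rightarrow> bool" where
  "assumption_A3 m0 X \<longleftrightarrow>
     (\<forall>(x::'n space) t (\<xi>::'n space) \<tau>. t > \<tau> \<longrightarrow>
        (\<exists>\<gamma>. L1_admissible m0 X (t - \<tau>) \<gamma> \<and> \<gamma> 0 = (x, t) \<and> \<gamma> (t - \<tau>) = (\<xi>, \<tau>)))"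


(* p is a polynomial, homogeneous of degree d when x_i has weight \<alpha> i, all of whose
   coefficients are bounded by lam in absolute value.  The sum is finite if all \<alpha> i > 0. *)
definition bounded_hom_poly ::
  "('n \<Rightarrow> nat) \<Rightarrow> real \<Rightarrow> nat \<Rightarrow> ('n::finite space \<Rightarrow> real) \<Rightarrow> bool" where
  "bounded_hom_poly \<alpha> lam d p \<longleftrightarrow>
     (\<exists>c :: ('n \<Rightarrow> nat) \<Rightarrow> real. (\<forall>\<beta>. \<bar>c \<beta>\<bar> \<le> lam) \<and>
        (\<forall>x. p x = (\<Sum>\<beta> | (\<Sum>i\<in>UNIV. \<alpha> i * \<beta> i) = d. c \<beta> * (\<Prod>i\<in>UNIV. (x $ i) ^ \<beta> i))))"

definition coefficient_structure ::
  "nat \<Rightarrow> real \<Rightarrow> ('n \<Rightarrow> nat) \<Rightarrow> (nat \<Rightarrow> 'n space \<Rightarrow> 'n::{finite,linorder} space) \<Rightarrow> bool" where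
  "coefficient_structure m0 lam \<alpha> X \<longleftrightarrow>
     (\<forall>i. (pos i \<le> m0 \<longrightarrow> \<alpha> i = 1) \<and> (m0 < pos i \<longrightarrow> 1 < \<alpha> i)) \<and>
     (\<forall>j\<in>{1..m0}. \<forall>i.
        (pos i \<le> m0 \<longrightarrow> (\<exists>c. \<bar>c\<bar> \<le> lam \<and> (\<forall>x. X j x $ i = c))) \<and>
        (m0 < pos i \<longrightarrow> bounded_hom_poly \<alpha> lam (\<alpha> i - 1) (\<lambda>x. X j x $ i))) \<and>
     (\<forall>i.
        (pos i \<le> m0 \<longrightarrow> (\<forall>x. X 0 x $ i = 0)) \<and>
        (m0 < pos i \<longrightarrow> bounded_hom_poly \<alpha> lam (\<alpha> i - 2) (\<lambda>x. X 0 x $ i)))"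

definition fundamental_solution ::
  "nat \<Rightarrow> (nat \<Rightarrow> 'n space \<Rightarrow> 'n space) \<Rightarrow> ('n::finite point \<Rightarrow> 'n point \<Rightarrow> 'n point)
     \<Rightarrow> ('n point \<Rightarrow> 'n point) \<Rightarrow> ('n \<Rightarrow> nat) \<Rightarrow> nat \<Rightarrow> ('n point \<Rightarrow> 'n point \<Rightarrow> real) \<Rightarrow> bool" where
  "fundamental_solution m0 X op iv \<alpha> Q \<Gamma> \<longleftrightarrow>
     (\<forall>\<zeta>. smooth_on (- {\<zeta>}) (\<lambda>z. \<Gamma> z \<zeta>)) \<and>
     (\<forall>\<phi>. test_function UNIV \<phi> \<longrightarrow>
        (\<forall>z. has_bochner_integral lebesgue (\<lambda>\<zeta>. \<Gamma> z \<zeta> * L1_op m0 X \<phi> \<zeta>) (- \<phi> z))) \<and>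
     (\<forall>z \<zeta>. \<Gamma> z \<zeta> = \<Gamma> (op (iv \<zeta>) z) 0) \<and>
     (\<forall>z \<zeta>. \<Gamma> z \<zeta> \<ge> 0) \<and>
     (\<forall>x t \<xi> \<tau>. t > \<tau> \<longrightarrow>
        \<Gamma> (x, t) (\<xi>, \<tau>) > 0 \<and>
        has_bochner_integral lebesgue (\<lambda>y. \<Gamma> (y, t) (\<xi>, \<tau>)) 1 \<and>
        has_bochner_integral lebesgue (\<lambda>y. \<Gamma> (x, t) (y, \<tau>)) 1) \<and>
     (\<forall>z \<mu>. z \<noteq> 0 \<and> \<mu> > 0 \<longrightarrow> \<Gamma> (dil \<alpha> \<mu> z) 0 = \<Gamma> z 0 / \<mu> ^ Q)"

definition weak_subsolution ::
  "nat \<Rightarrow> (nat \<Rightarrow> nat \<Rightarrow> 'n::finite point \<Rightarrow> real) \<Rightarrow> (nat \<Rightarrow> 'n space \<Rightarrow> 'n space) \<Rightarrow> 'n point set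
     \<Rightarrow> ('n point \<Rightarrow> real) \<Rightarrow> (nat \<Rightarrow> 'n point \<Rightarrow> real) \<Rightarrow> ('n point \<Rightarrow> real) \<Rightarrow> bool" where
  "weak_subsolution m0 a X \<Omega> w Xw Yw \<longleftrightarrow>
     L2_loc \<Omega> w \<and>
     (\<forall>j\<in>{1..m0}. L2_loc \<Omega> (Xw j) \<and> weak_vf_deriv \<Omega> (lift X j) w (Xw j)) \<and>
     L2_loc \<Omega> Yw \<and> weak_vf_deriv \<Omega> (drift X) w Yw \<and>
     (\<forall>\<phi>. test_function \<Omega> \<phi> \<and> (\<forall>z. 0 \<le> \<phi> z) \<longrightarrow>
        0 \<le> (LINT z:\<Omega>|lebesgue. \<phi> z * Yw z
               - (\<Sum>i=1..m0. \<Sum>j=1..m0. Xw i z * a i j z * vf_deriv (lift X j) \<phi> z)))"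


definition front_norm :: "nat \<Rightarrow> 'n::{finite,linorder} space \<Rightarrow> real" where
  "front_norm m0 x = sqrt (\<Sum>i | pos i \<le> m0. (x $ i)\<^sup>2)"

definition cyl :: "nat \<Rightarrow> ('n \<Rightarrow> nat) \<Rightarrow> real \<Rightarrow> real \<Rightarrow> 'n::{finite,linorder} point set" where
  "cyl m0 \<alpha> lam' \<rho> =
     {(x, t). - \<rho>\<^sup>2 \<le> t \<and> t < 0 \<and> front_norm m0 x \<le> \<rho> \<and>
              (\<forall>j. m0 < pos j \<longrightarrow> \<bar>x $ j\<bar> \<le> (lam' * \<rho>) ^ \<alpha> j)}"

definition bigbox :: "nat \<Rightarrow> ('n \<Rightarrow> nat) \<Rightarrow> real \<Rightarrow> real \<Rightarrow> 'n::{finite,linorder} point set" where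
  "bigbox m0 \<alpha> r \<theta> =
     {(x, t). - r\<^sup>2 \<le> t \<and> t \<le> 0 \<and> front_norm m0 x \<le> r / \<theta> \<and>
              (\<forall>j. m0 < pos j \<longrightarrow> \<bar>x $ j\<bar> \<le> (r / \<theta>) ^ \<alpha> j)}"

definition cutoff_profile :: "nat \<Rightarrow> real \<Rightarrow> real \<Rightarrow> real \<Rightarrow> (real \<Rightarrow> real) \<Rightarrow> bool" where
  "cutoff_profile Q K r \<theta> h \<longleftrightarrow>
     smooth_on UNIV h \<and>
     (\<forall>s. s \<le> root Q \<theta> * r \<longrightarrow> h s = 1) \<and>
     (\<forall>s. s > r \<longrightarrow> h s = 0) \<and>
     (\<forall>s. 0 \<le> - deriv h s \<and> - deriv h s \<le> 2 / ((1 - root Q \<theta>) * r)) \<and>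
     (\<forall>s. \<bar>deriv (deriv h) s\<bar> \<le> K / r\<^sup>2) \<and>
     (\<forall>\<beta>1 \<beta>2. root Q \<theta> < \<beta>1 \<and> \<beta>1 < \<beta>2 \<and> \<beta>2 < 1 \<longrightarrow>
        (\<exists>c>0. \<forall>s. \<beta>1 * r \<le> s \<and> s \<le> \<beta>2 * r \<longrightarrow> \<bar>deriv h s\<bar> \<ge> c / r))"

(* Exponents such as Q - 2 and Q - 2 \<alpha>_j may be negative, hence powi. *)
definition admissible_C1 ::
  "nat \<Rightarrow> ('n \<Rightarrow> nat) \<Rightarrow> nat \<Rightarrow> (nat \<Rightarrow> 'n space \<Rightarrow> 'n::{finite,linorder} space) \<Rightarrow> real \<Rightarrow> real \<Rightarrow> real \<Rightarrow> bool" where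
  "admissible_C1 m0 \<alpha> Q X C1 r \<theta> \<longleftrightarrow>
     (\<forall>(x, t) \<in> bigbox m0 \<alpha> r \<theta>.
        C1 * r powi (int Q - 2) \<ge>
          \<bar>\<Sum>j | m0 < pos j. 2 * \<theta> ^ (2 * \<alpha> j) * X 0 x $ j * x $ j * r powi (int Q - 2 * int (\<alpha> j))\<bar>)"

(* Only used at points with t < 0; there the argument of the root is positive. *)
definition cutoff_phi ::
  "nat \<Rightarrow> ('n \<Rightarrow> nat) \<Rightarrow> nat \<Rightarrow> real \<Rightarrow> real \<Rightarrow> real \<Rightarrow> (real \<Rightarrow> real) \<Rightarrow> 'n::{finite,linorder} point \<Rightarrow> real" where
  "cutoff_phi m0 \<alpha> Q C1 r \<theta> h z =
     h (root Q ((\<Sum>j | m0 < pos j. \<theta> ^ (2 * \<alpha> j) * (fst z $ j)\<^sup>2 / r powi (2 * int (\<alpha> j) - int Q))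
                 - C1 * snd z * r powi (int Q - 2)))
     * h (\<theta> * front_norm m0 (fst z))"


(* Lebesgue integral of a real function with values in the extended reals (not meaningful
   if positive and negative part both have infinite integral). *)
definition ext_integral :: "'a::euclidean_space set \<Rightarrow> ('a \<Rightarrow> real) \<Rightarrow> ereal" where
  "ext_integral S f =
     enn2ereal (\<integral>\<^sup>+z\<in>S. ennreal (f z) \<partial>lebesgue) - enn2ereal (\<integral>\<^sup>+z\<in>S. ennreal (- f z) \<partial>lebesgue)"

definition I1_term ::
  "(nat \<Rightarrow> 'n space \<Rightarrow> 'n space) \<Rightarrow> ('n::finite point \<Rightarrow> 'n point \<Rightarrow> real) \<Rightarrow> 'n point set
     \<Rightarrow> ('n point \<Rightarrow> real) \<Rightarrow> ('n point \<Rightarrow> real) \<Rightarrow> 'n point \<Rightarrow> ereal" where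
  "I1_term X \<Gamma> S w \<phi> z = ext_integral S (\<lambda>\<zeta>. - \<Gamma> z \<zeta> * w \<zeta> * vf_deriv (drift X) \<phi> \<zeta>)"

definition C2_term ::
  "nat \<Rightarrow> (nat \<Rightarrow> 'n space \<Rightarrow> 'n space) \<Rightarrow> ('n::finite point \<Rightarrow> 'n point \<Rightarrow> real) \<Rightarrow> 'n point set
     \<Rightarrow> ('n point \<Rightarrow> real) \<Rightarrow> ('n point \<Rightarrow> real) \<Rightarrow> 'n point \<Rightarrow> ereal" where
  "C2_term m0 X \<Gamma> S w \<phi> z =
     ext_integral S (\<lambda>\<zeta>. \<Sum>j=1..m0.
        \<bar>vf_deriv (lift X j) (vf_deriv (lift X j) \<phi>) \<zeta>\<bar> * \<Gamma> z \<zeta> * w \<zeta>)"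

end

theory Submission
  imports Defs
begin

text \<open>The estimate follows by duality. Let \<open>\<psi> \<ge> 0\<close> be a bounded truncation of \<open>(w - I\<^sub>0)\<^sub>+\<close> on
  \<open>\<C>\<^sup>-\<^bsub>\<theta>r\<^esub>\<close> away from \<open>t = 0\<close>, and let
  \<open>V\<^sub>h(\<zeta>) = \<integral>\<psi>(z) \<Gamma>\<^sub>1(z,\<zeta>) c\<^sub>h(t\<^sub>z - t\<^sub>\<zeta>) dz\<close>, where the smooth ramp \<open>c\<^sub>h\<close> vanishes near the diagonal.
  Then \<open>\<Sum>X\<^sub>j\<^sup>2 V\<^sub>h - Y V\<^sub>h = -P\<^sub>h\<close> with \<open>P\<^sub>h \<rightarrow> \<psi>\<close> as \<open>h \<rightarrow> 0\<close>. Testing the sub-solution with \<open>\<phi> V\<^sub>h\<close> and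
  integrating by parts bounds \<open>\<integral>w \<phi> P\<^sub>h\<close> by \<open>\<integral>w V\<^sub>h (\<Sum>|X\<^sub>j\<^sup>2\<phi>| - Y\<phi>)\<close> plus an error
  controlled by \<open>\<integral>|Xw| (|XV\<^sub>h| + V\<^sub>h |X\<phi>|)\<close>. By Fubini the first term is at most \<open>I\<^sub>0 \<integral>\<psi>\<close>. For the error
  no pointwise bound on \<open>\<Gamma>\<^sub>1\<close> is needed: the unit mass of the kernel on time slices and
  Schur's test bound \<open>V\<^sub>h\<close> in \<open>L\<^sup>2\<close>, and the energy identity bounds \<open>XV\<^sub>h\<close>. As \<open>\<psi>\<close> lives in
  a time interval of length \<open>(\<theta>r)\<^sup>2\<close>, the error is at most a constant times \<open>\<theta>r \<parallel>\<psi>\<parallel> \<parallel>Xw\<parallel>\<close>, whence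
  \<open>\<parallel>\<psi>\<parallel>\<^sup>2 \<le> \<integral>(w - I\<^sub>0)\<psi> \<le> C \<theta>r \<parallel>\<psi>\<parallel> \<parallel>Xw\<parallel>\<close>.\<close>

section \<open>Calculus of smooth functions\<close>

text \<open>The cut-off of the kernel near the diagonal depends on time alone: every X_j ignores it
  and Y only produces its derivative, so the representation formula, applied to a test function
  times such a factor, already contains the adjoint equation of the potential. That factor also
  makes the kernel smooth everywhere, hence \<open>V h\<close> is smooth although \<Gamma> is
  singular. The convergence of the sources to \<psi> cannot be read off an explicit kernel; it rests
  on positivity and unit mass. Since \<phi> equals 1 near the top of the small cylinder, \<phi> V is
  an admissible test function only because V vanishes for times above -\<delta>. The constant comes
  from scaling. With S = (\<theta> r)^2 and T = r^2, the squared norm of V over times in [-T, 0] is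
  at most S T, and that of XV at most a multiple of S, relative to the squared norm of \<psi>. The
  squared gradient of \<phi> is at most D, of order r^(-2), with a factor independent of \<theta>,
  so D T is bounded and every error term is a multiple of S. V has no compact support in space;
  dilated bumps E with tiny L E justify its energy estimate.\<close>

lemma Ck_on_cong:
  assumes "open S" "\<And>x. x \<in> S \<Longrightarrow> f x = g x"
  shows "Ck_on n S f \<longleftrightarrow> Ck_on n S g"
  using assms(2)
proof (induction n arbitrary: f g)
  case 0
  then show ?case by (simp cong: continuous_on_cong)
next
  case (Suc n)
  have d: "(f differentiable (at x)) = (g differentiable (at x))" if "x \<in> S" for x
    using that Suc.prems assms(1) unfolding differentiable_def
    by (metis has_derivative_transform_within_open)
  have "Ck_on n S (\<lambda>x. frechet_derivative f (at x) v) = Ck_on n S (\<lambda>x. frechet_derivative g (at x) v)"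
    if f: "\<forall>x\<in>S. f differentiable (at x)" for v
  proof (rule Suc.IH)
    fix x assume "x \<in> S"
    then have "frechet_derivative f (at x) = frechet_derivative g (at x)"
      using frechet_derivative_transform_within_open[of f x S g] f Suc.prems assms(1) by auto
    then show "frechet_derivative f (at x) v = frechet_derivative g (at x) v" by simp
  qed
  with d show ?case by auto
qed

text \<open>The definition iterates \<open>frechet_derivative\<close>, a choice operator; by
  uniqueness of derivatives any explicitly known derivative may be iterated instead.\<close>

lemma Ck_on_SucI:
  assumes "open S" "\<And>x. x \<in> S \<Longrightarrow> (f has_derivative f' x) (at x)"
    and "\<And>v. Ck_on n S (\<lambda>x. f' x v)"
  shows "Ck_on (Suc n) S f"
proof -
  have "frechet_derivative f (at x) = f' x" if "x \<in> S" for x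
    using frechet_derivative_at[OF assms(2)[OF that]] by simp
  then have "Ck_on n S (\<lambda>x. frechet_derivative f (at x) v)" for v
    using assms(3)[of v] by (subst Ck_on_cong[OF assms(1), where g = "\<lambda>x. f' x v"]) auto
  then show ?thesis
    using assms(2) by (auto simp: differentiable_def)
qed

lemma Ck_on_subset: "Ck_on n S f \<Longrightarrow> T \<subseteq> S \<Longrightarrow> Ck_on n T f"
  by (induction n arbitrary: f) (auto intro: continuous_on_subset)

lemma Ck_on_Suc_imp: "Ck_on (Suc n) S f \<Longrightarrow> Ck_on n S f"
proof (induction n arbitrary: f)
  case 0
  then show ?case
    by (simp add: continuous_at_imp_continuous_on differentiable_imp_continuous_within)
next
  case (Suc n)
  then show ?case by (metis Ck_on.simps(2))
qed

lemma Ck_on_Un: "open S \<Longrightarrow> open T \<Longrightarrow> Ck_on n S f \<Longrightarrow> Ck_on n T f \<Longrightarrow> Ck_on n (S \<union> T) f"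
  by (induction n arbitrary: f) (auto intro: continuous_on_open_Un)

lemma Ck_on_imp_continuous_on: "Ck_on n S f \<Longrightarrow> continuous_on S f"
  by (induction n) (simp, metis Ck_on_Suc_imp)

lemma Ck_on_const: "Ck_on n S (\<lambda>x. c)"
  by (induction n arbitrary: c) auto

lemma Ck_on_bounded_linear_compose:
  assumes "bounded_linear L" "open S" "Ck_on n S f"
  shows "Ck_on n S (\<lambda>x. L (f x))"
  using assms(3)
proof (induction n arbitrary: f)
  case 0
  then show ?case using bounded_linear.continuous_on[OF assms(1)] by auto
next
  case (Suc n)
  then have "(f has_derivative frechet_derivative f (at x)) (at x)" if "x \<in> S" for x
    using that by (simp add: frechet_derivative_works)
  then show ?case
    using Suc assms
    by (intro Ck_on_SucI[where f' = "\<lambda>x v. L (frechet_derivative f (at x) v)"])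
      (auto intro: bounded_linear.has_derivative)
qed

lemma Ck_on_bounded_linear: "bounded_linear L \<Longrightarrow> open S \<Longrightarrow> Ck_on n S L"
proof (cases n)
  case (Suc m)
  assume "bounded_linear L" "open S"
  then show ?thesis unfolding Suc
    by (intro Ck_on_SucI[where f' = "\<lambda>x v. L v"])
      (auto intro: bounded_linear_imp_has_derivative Ck_on_const)
qed (simp add: linear_continuous_on)

lemma Ck_on_add:
  assumes "open S" "Ck_on n S f" "Ck_on n S g"
  shows "Ck_on n S (\<lambda>x. f x + g x)"
  using assms(2,3)
proof (induction n arbitrary: f g)
  case (Suc n)
  then have "(f has_derivative frechet_derivative f (at x)) (at x)"
    "(g has_derivative frechet_derivative g (at x)) (at x)" if "x \<in> S" for x
    using that by (simp_all add: frechet_derivative_works)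
  then show ?case
    using Suc assms
    by (intro Ck_on_SucI[where f' = "\<lambda>x v. frechet_derivative f (at x) v + frechet_derivative g (at x) v"])
      (auto intro: has_derivative_add)
qed (auto intro: continuous_on_add)

lemma Ck_on_bounded_bilinear:
  fixes f :: "'a::real_normed_vector \<Rightarrow> 'b::real_normed_vector"
    and g :: "'a \<Rightarrow> 'c::real_normed_vector" and pr :: "'b \<Rightarrow> 'c \<Rightarrow> 'd::real_normed_vector"
  assumes "bounded_bilinear pr" "open S" "Ck_on n S f" "Ck_on n S g"
  shows "Ck_on n S (\<lambda>x. pr (f x) (g x))"
  using assms(3,4)
proof (induction n arbitrary: f g)
  case 0
  then show ?case using bounded_bilinear.continuous_on[OF assms(1)] by auto
next
  case (Suc n)
  then have d: "(f has_derivative frechet_derivative f (at x)) (at x)"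
    "(g has_derivative frechet_derivative g (at x)) (at x)" if "x \<in> S" for x
    using that by (simp_all add: frechet_derivative_works)
  have "Ck_on n S (\<lambda>x. pr (f x) (frechet_derivative g (at x) v)
      + pr (frechet_derivative f (at x) v) (g x))" for v
    using Suc.prems Ck_on_Suc_imp[OF Suc.prems(1)] Ck_on_Suc_imp[OF Suc.prems(2)]
    by (intro Ck_on_add assms(2) Suc.IH) auto
  with d show ?case
    by (intro Ck_on_SucI[where f' = "\<lambda>x v. pr (f x) (frechet_derivative g (at x) v)
      + pr (frechet_derivative f (at x) v) (g x)"])
      (auto intro: bounded_bilinear.FDERIV[OF assms(1)] assms(2))
qed

lemmas Ck_on_mult = Ck_on_bounded_bilinear[OF bounded_bilinear_mult]
lemmas Ck_on_scaleR = Ck_on_bounded_bilinear[OF bounded_bilinear_scaleR]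

lemma Ck_on_sum: "open S \<Longrightarrow> (\<And>i. i \<in> I \<Longrightarrow> Ck_on n S (f i)) \<Longrightarrow> Ck_on n S (\<lambda>x. \<Sum>i\<in>I. f i x)"
  by (induction I rule: infinite_finite_induct) (auto intro: Ck_on_add Ck_on_const)

text \<open>The chain rule evaluates the derivative of g in a direction that varies with x, whereas
  \<open>Ck_on\<close> only controls fixed directions. Expanding the direction in a basis reduces to
  fixed ones, which is why the middle space is Euclidean.\<close>

lemma Ck_on_compose:
  fixes f :: "'a::real_normed_vector \<Rightarrow> 'b::euclidean_space" and g :: "'b \<Rightarrow> 'c::real_normed_vector"
  assumes "open S" "open T" "f ` S \<subseteq> T" "Ck_on n S f" "Ck_on n T g"
  shows "Ck_on n S (\<lambda>x. g (f x))"
  using assms(4,5)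
proof (induction n arbitrary: g)
  case 0
  then show ?case using assms(3) by (auto intro: continuous_on_compose2)
next
  case (Suc n)
  have df: "(f has_derivative frechet_derivative f (at x)) (at x)" if "x \<in> S" for x
    using that Suc.prems by (simp_all add: frechet_derivative_works)
  have dg: "(g has_derivative frechet_derivative g (at (f x))) (at (f x))" if "x \<in> S" for x
    using that Suc.prems assms(3) by (simp add: frechet_derivative_works[symmetric] image_subset_iff)
  let ?D = "\<lambda>x v. \<Sum>b\<in>Basis. (frechet_derivative f (at x) v \<bullet> b) *\<^sub>R frechet_derivative g (at (f x)) b"
  have eq: "frechet_derivative g (at (f x)) (frechet_derivative f (at x) v) = ?D x v" if "x \<in> S" for x v
  proof -
    have "linear (frechet_derivative g (at (f x)))"
      using dg[OF that] has_derivative_linear by blast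
    then have "frechet_derivative g (at (f x)) (\<Sum>b\<in>Basis. (frechet_derivative f (at x) v \<bullet> b) *\<^sub>R b) = ?D x v"
      by (simp add: linear_sum linear_cmul)
    then show ?thesis by (simp add: euclidean_representation)
  qed
  show ?case
  proof (rule Ck_on_SucI[OF assms(1), where f' = ?D])
    fix x assume "x \<in> S"
    then show "((\<lambda>x. g (f x)) has_derivative ?D x) (at x)"
      using diff_chain_at[OF df dg] eq by (simp add: o_def)
  next
    fix v
    have "Ck_on n S (\<lambda>x. frechet_derivative f (at x) v \<bullet> b)" for b
      using Suc.prems
      by (intro Ck_on_bounded_linear_compose[OF bounded_linear_inner_left assms(1)]) auto
    moreover have "Ck_on n S (\<lambda>x. frechet_derivative g (at (f x)) b)" for b
      using Suc.prems Ck_on_Suc_imp by (intro Suc.IH) auto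
    ultimately show "Ck_on n S (\<lambda>x. ?D x v)"
      by (intro Ck_on_sum Ck_on_scaleR assms(1))
  qed
qed

section \<open>Smooth functions and their closure properties\<close>

lemma smooth_onD: "smooth_on S f \<Longrightarrow> Ck_on n S f"
  by (simp add: smooth_on_def)

lemma smooth_on_cong: "open S \<Longrightarrow> (\<And>x. x \<in> S \<Longrightarrow> f x = g x) \<Longrightarrow> smooth_on S f \<longleftrightarrow> smooth_on S g"
  unfolding smooth_on_def using Ck_on_cong by metis

lemma smooth_on_subset: "smooth_on S f \<Longrightarrow> T \<subseteq> S \<Longrightarrow> smooth_on T f"
  unfolding smooth_on_def using Ck_on_subset by blast

lemma smooth_on_Un: "open S \<Longrightarrow> open T \<Longrightarrow> smooth_on S f \<Longrightarrow> smooth_on T f \<Longrightarrow> smooth_on (S \<union> T) f"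
  unfolding smooth_on_def using Ck_on_Un by blast

lemma smooth_on_imp_continuous_on: "smooth_on S f \<Longrightarrow> continuous_on S f"
  using Ck_on_imp_continuous_on smooth_onD by blast

lemma smooth_on_imp_differentiable: "smooth_on S f \<Longrightarrow> x \<in> S \<Longrightarrow> f differentiable (at x)"
  using smooth_onD[of S f 1] by auto

lemma smooth_on_imp_has_derivative:
  "smooth_on S f \<Longrightarrow> x \<in> S \<Longrightarrow> (f has_derivative frechet_derivative f (at x)) (at x)"
  using smooth_on_imp_differentiable frechet_derivative_works by blast

lemma smooth_on_frechet_derivative: "smooth_on S f \<Longrightarrow> smooth_on S (\<lambda>x. frechet_derivative f (at x) v)"
  unfolding smooth_on_def by (metis Ck_on.simps(2))

named_theorems smooth_intros

lemma smooth_on_const [smooth_intros]: "smooth_on S (\<lambda>x. c)"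
  by (simp add: smooth_on_def Ck_on_const)

lemma smooth_on_bounded_linear: "bounded_linear L \<Longrightarrow> open S \<Longrightarrow> smooth_on S L"
  by (simp add: smooth_on_def Ck_on_bounded_linear)

lemma smooth_on_bounded_linear_compose:
  "bounded_linear L \<Longrightarrow> open S \<Longrightarrow> smooth_on S f \<Longrightarrow> smooth_on S (\<lambda>x. L (f x))"
  by (simp add: smooth_on_def Ck_on_bounded_linear_compose)

lemma smooth_on_id [smooth_intros]: "open S \<Longrightarrow> smooth_on S (\<lambda>x. x)"
  by (intro smooth_on_bounded_linear bounded_linear_ident)

lemma smooth_on_add [smooth_intros]:
  "open S \<Longrightarrow> smooth_on S f \<Longrightarrow> smooth_on S g \<Longrightarrow> smooth_on S (\<lambda>x. f x + g x)"
  by (simp add: smooth_on_def Ck_on_add)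

lemma smooth_on_mult [smooth_intros]:
  fixes f g :: "_ \<Rightarrow> 'b::real_normed_algebra"
  shows "open S \<Longrightarrow> smooth_on S f \<Longrightarrow> smooth_on S g \<Longrightarrow> smooth_on S (\<lambda>x. f x * g x)"
  by (simp add: smooth_on_def Ck_on_mult)

lemma smooth_on_scaleR [smooth_intros]:
  "open S \<Longrightarrow> smooth_on S f \<Longrightarrow> smooth_on S g \<Longrightarrow> smooth_on S (\<lambda>x. f x *\<^sub>R g x)"
  by (simp add: smooth_on_def Ck_on_scaleR)

lemma smooth_on_sum [smooth_intros]:
  "open S \<Longrightarrow> (\<And>i. i \<in> I \<Longrightarrow> smooth_on S (f i)) \<Longrightarrow> smooth_on S (\<lambda>x. \<Sum>i\<in>I. f i x)"
  by (simp add: smooth_on_def Ck_on_sum)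

lemma smooth_on_minus [smooth_intros]: "open S \<Longrightarrow> smooth_on S f \<Longrightarrow> smooth_on S (\<lambda>x. - f x)"
  by (intro smooth_on_bounded_linear_compose[where L = uminus]) (auto intro: bounded_linear_minus[OF bounded_linear_ident])

lemma smooth_on_diff [smooth_intros]:
  "open S \<Longrightarrow> smooth_on S f \<Longrightarrow> smooth_on S g \<Longrightarrow> smooth_on S (\<lambda>x. f x - g x)"
  using smooth_on_add[of S f "\<lambda>x. - g x"] smooth_on_minus by auto

lemma smooth_on_fst [smooth_intros]: "open S \<Longrightarrow> smooth_on S f \<Longrightarrow> smooth_on S (\<lambda>x. fst (f x))"
  by (rule smooth_on_bounded_linear_compose[OF bounded_linear_fst])

lemma smooth_on_snd [smooth_intros]: "open S \<Longrightarrow> smooth_on S f \<Longrightarrow> smooth_on S (\<lambda>x. snd (f x))"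
  by (rule smooth_on_bounded_linear_compose[OF bounded_linear_snd])

lemma smooth_on_nth [smooth_intros]: "open S \<Longrightarrow> smooth_on S f \<Longrightarrow> smooth_on S (\<lambda>x. f x $ i)"
  by (rule smooth_on_bounded_linear_compose[OF bounded_linear_vec_nth])

lemma smooth_on_inner_left [smooth_intros]: "open S \<Longrightarrow> smooth_on S f \<Longrightarrow> smooth_on S (\<lambda>x. f x \<bullet> b)"
  by (rule smooth_on_bounded_linear_compose[OF bounded_linear_inner_left])

lemma smooth_on_Pair [smooth_intros]:
  assumes "open S" "smooth_on S f" "smooth_on S g"
  shows "smooth_on S (\<lambda>x. (f x, g x))"
proof -
  have "smooth_on S (\<lambda>x. (f x, 0) + (0, g x))"
    by (intro smooth_intros assms smooth_on_bounded_linear_compose[where L = "\<lambda>x. (x, 0)"]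
        smooth_on_bounded_linear_compose[where L = "\<lambda>x. (0, x)"] bounded_linear_intros)
  then show ?thesis by simp
qed

lemma smooth_on_compose:
  fixes f :: "'a::real_normed_vector \<Rightarrow> 'b::euclidean_space" and g :: "'b \<Rightarrow> 'c::real_normed_vector"
  assumes "open S" "open T" "smooth_on S f" "smooth_on T g" "f ` S \<subseteq> T"
  shows "smooth_on S (\<lambda>x. g (f x))"
  using assms Ck_on_compose[of S T f _ g] by (auto simp: smooth_on_def)

lemma smooth_on_compose_UNIV:
  fixes f :: "'a::real_normed_vector \<Rightarrow> 'b::euclidean_space" and g :: "'b \<Rightarrow> 'c::real_normed_vector"
  assumes "open S" "smooth_on S f" "smooth_on UNIV g"
  shows "smooth_on S (\<lambda>x. g (f x))"
  using assms smooth_on_compose[of S UNIV f g] by auto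

lemma smooth_on_power [smooth_intros]:
  fixes f :: "_ \<Rightarrow> real"
  shows "open S \<Longrightarrow> smooth_on S f \<Longrightarrow> smooth_on S (\<lambda>x. f x ^ n)"
  by (induction n) (auto intro: smooth_intros)

text \<open>The induction runs over all exponents at once, since differentiation turns the exponent
  a into a - 1.\<close>

lemma smooth_on_powr: "smooth_on {0<..} (\<lambda>x::real. x powr a)"
  unfolding smooth_on_def
proof
  fix n show "Ck_on n {0<..} (\<lambda>x::real. x powr a)"
  proof (induction n arbitrary: a)
    case 0
    then show ?case by (auto intro!: continuous_intros)
  next
    case (Suc n)
    show ?case
    proof (rule Ck_on_SucI[where f' = "\<lambda>x v. (a * x powr (a - 1)) * v"])
      show "((\<lambda>x. x powr a) has_derivative (*) (a * x powr (a - 1))) (at x)" if "x \<in> {0<..}" for x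
        using that has_real_derivative_powr[of x a] by (simp add: has_field_derivative_def)
      show "Ck_on n {0<..} (\<lambda>x. (a * x powr (a - 1)) * v)" for v
        by (intro Ck_on_mult Suc Ck_on_const) auto
    qed simp
  qed
qed

lemma smooth_on_root: "0 < n \<Longrightarrow> smooth_on {0<..} (root n)"
  using smooth_on_powr[of "1 / real n"] by (subst smooth_on_cong) (auto simp: root_powr_inverse)

text \<open>The root is not differentiable at 0; a profile that is constant below a positive
  threshold repairs this.\<close>

lemma smooth_on_flat_root:
  assumes "0 < n" "0 < c" "0 < b" "smooth_on UNIV h" "\<And>s. s \<le> c \<Longrightarrow> h s = (d::real)"
  shows "smooth_on UNIV (\<lambda>s. h (b * root n s))"
proof -
  \<comment> \<open>Below s0 the argument \<open>b * root n s\<close> stays under c, where h is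
    constant. The root is monotone on the whole line, so negative s are included.\<close>
  define s0 where "s0 = (c / b) ^ n"
  have "0 < s0" using assms by (auto simp: s0_def)
  have pos: "smooth_on {0<..} (\<lambda>s. h (b * root n s))"
    by (rule smooth_on_compose_UNIV[where g = h])
      (auto intro!: smooth_on_mult smooth_on_const smooth_on_root assms)
  have "h (b * root n s) = d" if "s < s0" for s
  proof -
    have "root n s \<le> root n s0" using that assms by auto
    also have "\<dots> = c / b" using assms by (simp add: s0_def real_root_power_cancel)
    finally show ?thesis using assms by (simp add: field_simps)
  qed
  then have neg: "smooth_on {..<s0} (\<lambda>s. h (b * root n s))"
    by (subst smooth_on_cong[where g = "\<lambda>s. d"]) (auto intro: smooth_intros)
  have "smooth_on ({0<..} \<union> {..<s0}) (\<lambda>s. h (b * root n s))"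
    using pos neg by (intro smooth_on_Un) auto
  moreover have "{0<..} \<union> {..<s0} = (UNIV::real set)" using \<open>0 < s0\<close> by auto
  ultimately show ?thesis by simp
qed

subsection \<open>Integrals depending on a parameter\<close>

lemma integrable_mult_continuous_compact:
  fixes \<psi> g :: "'a::euclidean_space \<Rightarrow> real"
  assumes "integrable lborel \<psi>" "compact K" "\<And>z. z \<notin> K \<Longrightarrow> \<psi> z = 0" "continuous_on UNIV g"
  shows "integrable lborel (\<lambda>z. \<psi> z * g z)"
proof -
  have "compact (g ` K)"
    using assms by (intro compact_continuous_image) (auto intro: continuous_on_subset)
  then obtain B where B: "\<And>z. z \<in> K \<Longrightarrow> \<bar>g z\<bar> \<le> B"
    using compact_imp_bounded bounded_iff by (metis imageI real_norm_def)
  have "g \<in> borel_measurable borel"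
    using assms(4) by (rule borel_measurable_continuous_onI)
  then show ?thesis
  proof (intro Bochner_Integration.integrable_bound[OF integrable_mult_left[OF assms(1), of "\<bar>B\<bar>"]])
    show "AE z in lborel. norm (\<psi> z * g z) \<le> norm (\<psi> z * \<bar>B\<bar>)"
    proof (rule AE_I2)
      fix z show "norm (\<psi> z * g z) \<le> norm (\<psi> z * \<bar>B\<bar>)"
        using B[of z] assms(3)[of z] by (cases "z \<in> K") (auto simp: abs_mult simp del: times_divide_eq_right intro!: mult_left_mono)
    qed
  qed (use assms(1) in auto)
qed

lemma continuous_on_section:
  "continuous_on UNIV k \<Longrightarrow> continuous_on UNIV (\<lambda>z. k (z, \<zeta>))"
  by (rule continuous_on_compose2[where g = k]) (auto intro!: continuous_intros)

text \<open>Uniform continuity on the compact product of K and \<open>cball \<zeta> 1\<close> makes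
  the modulus of continuity in the second variable independent of the point of K.\<close>

lemma parametric_uniform:
  fixes k :: "'a::euclidean_space \<times> 'b::euclidean_space \<Rightarrow> real"
  assumes "compact K" "continuous_on UNIV k" "e > 0"
  obtains d where "d > 0" "\<And>z \<zeta>'. z \<in> K \<Longrightarrow> dist \<zeta>' \<zeta> < d \<Longrightarrow> \<bar>k (z, \<zeta>') - k (z, \<zeta>)\<bar> < e"
proof -
  have "uniformly_continuous_on (K \<times> cball \<zeta> 1) k"
    using assms by (intro compact_uniformly_continuous compact_Times) (auto intro: continuous_on_subset)
  then obtain d where d: "d > 0"
    "\<And>x x'. x \<in> K \<times> cball \<zeta> 1 \<Longrightarrow> x' \<in> K \<times> cball \<zeta> 1 \<Longrightarrow> dist x' x < d \<Longrightarrow> dist (k x') (k x) < e"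
    using assms(3) unfolding uniformly_continuous_on_def by metis
  show ?thesis
  proof (rule that[of "min d 1"])
    fix z \<zeta>' assume "z \<in> K" "dist \<zeta>' \<zeta> < min d 1"
    then show "\<bar>k (z, \<zeta>') - k (z, \<zeta>)\<bar> < e"
      using d(2)[of "(z, \<zeta>)" "(z, \<zeta>')"]
      by (auto simp: dist_prod_def dist_commute dist_real_def)
  qed (use d in auto)
qed

lemma continuous_on_parametric_integral:
  fixes k :: "'a::euclidean_space \<times> 'b::euclidean_space \<Rightarrow> real"
  assumes "integrable lborel \<psi>" "compact K" "\<And>z. z \<notin> K \<Longrightarrow> \<psi> z = 0" "continuous_on UNIV k"
  shows "continuous_on UNIV (\<lambda>\<zeta>. LINT z|lborel. \<psi> z * k (z, \<zeta>))"
proof (rule continuous_at_imp_continuous_on, rule ballI)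
  fix \<zeta>
  define C where "C = (LINT z|lborel. \<bar>\<psi> z\<bar>) + 1"
  have "C > 0" unfolding C_def by (smt (verit) integral_nonneg_AE AE_I2)
  have int: "integrable lborel (\<lambda>z. \<psi> z * k (z, \<zeta>))" for \<zeta>
    by (intro integrable_mult_continuous_compact[OF assms(1-3)] continuous_on_section assms(4))
  show "isCont (\<lambda>\<zeta>. LINT z|lborel. \<psi> z * k (z, \<zeta>)) \<zeta>"
    unfolding continuous_at_eps_delta
  proof (intro allI impI)
    fix e :: real assume "e > 0"
    obtain d where d: "d > 0" "\<And>z \<zeta>'. z \<in> K \<Longrightarrow> dist \<zeta>' \<zeta> < d \<Longrightarrow> \<bar>k (z, \<zeta>') - k (z, \<zeta>)\<bar> < e / C"
      using parametric_uniform[OF assms(2,4), of "e / C" \<zeta>] \<open>e > 0\<close> \<open>C > 0\<close> by auto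
    show "\<exists>d>0. \<forall>\<zeta>'. dist \<zeta>' \<zeta> < d \<longrightarrow>
        dist (LINT z|lborel. \<psi> z * k (z, \<zeta>')) (LINT z|lborel. \<psi> z * k (z, \<zeta>)) < e"
    proof (intro exI[of _ d] conjI allI impI d(1))
      fix \<zeta>' assume \<zeta>': "dist \<zeta>' \<zeta> < d"
      have "\<bar>(LINT z|lborel. \<psi> z * k (z, \<zeta>')) - (LINT z|lborel. \<psi> z * k (z, \<zeta>))\<bar>
          = \<bar>LINT z|lborel. \<psi> z * (k (z, \<zeta>') - k (z, \<zeta>))\<bar>"
        using int by (simp add: right_diff_distrib)
      also have "\<dots> \<le> (LINT z|lborel. \<bar>\<psi> z\<bar> * (e / C))"
      proof (rule integral_abs_bound_integral)
        show "integrable lborel (\<lambda>z. \<psi> z * (k (z, \<zeta>') - k (z, \<zeta>)))"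
          using int by (simp add: right_diff_distrib)
        show "\<bar>\<psi> z * (k (z, \<zeta>') - k (z, \<zeta>))\<bar> \<le> \<bar>\<psi> z\<bar> * (e / C)" for z
          using d(2)[OF _ \<zeta>', of z] assms(3)[of z]
          by (cases "z \<in> K") (auto simp: abs_mult simp del: times_divide_eq_right intro!: mult_left_mono)
      qed (use assms(1) in auto)
      also have "\<dots> < e"
        using \<open>e > 0\<close> \<open>C > 0\<close> by (simp add: C_def field_simps)
      finally show "dist (LINT z|lborel. \<psi> z * k (z, \<zeta>')) (LINT z|lborel. \<psi> z * k (z, \<zeta>)) < e"
        by (simp add: dist_real_def)
    qed
  qed
qed

text \<open>For z in K the increment of k minus its linearisation is bounded by the mean value
  inequality, and the oscillation of the derivative near \<zeta> is small uniformly in z; outside K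
  the density \<psi> vanishes.\<close>

lemma has_derivative_parametric_integral:
  fixes k :: "'a::euclidean_space \<times> 'b::euclidean_space \<Rightarrow> real"
  assumes \<psi>: "integrable lborel \<psi>" "compact K" "\<And>z. z \<notin> K \<Longrightarrow> \<psi> z = 0" and k: "Ck_on 1 UNIV k"
  shows "((\<lambda>\<zeta>. LINT z|lborel. \<psi> z * k (z, \<zeta>)) has_derivative
    (\<lambda>v. LINT z|lborel. \<psi> z * frechet_derivative k (at (z, \<zeta>)) (0, v))) (at \<zeta>)"
proof -
  define D where "D z \<zeta> v = frechet_derivative k (at (z, \<zeta>)) (0, v)" for z \<zeta> v
  have kd: "(k has_derivative frechet_derivative k (at p)) (at p)" for p
    unfolding frechet_derivative_works[symmetric] using k by (cases p) auto
  have blD: "bounded_linear (D z \<zeta>)" for z \<zeta>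
    unfolding D_def using has_derivative_bounded_linear[OF kd]
    by (rule bounded_linear_compose) (auto intro!: bounded_linear_Pair bounded_linear_ident bounded_linear_zero)
  have kD: "((\<lambda>\<zeta>. k (z, \<zeta>)) has_derivative D z \<zeta>) (at \<zeta> within S)" for z \<zeta> S
    unfolding D_def
    by (rule has_derivative_compose[OF _ kd, of "\<lambda>\<zeta>. (z, \<zeta>)", simplified])
      (auto intro!: derivative_eq_intros)
  have cD: "continuous_on UNIV (\<lambda>p. D (fst p) (snd p) v)" for v
    using k by (simp add: D_def)
  have ck: "continuous_on UNIV k" using k Ck_on_imp_continuous_on by blast
  have int: "integrable lborel (\<lambda>z. \<psi> z * k (z, \<zeta>))" for \<zeta>
    by (intro integrable_mult_continuous_compact[OF \<psi>] continuous_on_section ck)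
  have intD: "integrable lborel (\<lambda>z. \<psi> z * D z \<zeta> v)" for \<zeta> v
    using integrable_mult_continuous_compact[OF \<psi> continuous_on_section[OF cD]] by simp
  have lin: "linear (\<lambda>v. LINT z|lborel. \<psi> z * D z \<zeta> v)"
  proof (rule linearI)
    show "(LINT z|lborel. \<psi> z * D z \<zeta> (u + v)) = (LINT z|lborel. \<psi> z * D z \<zeta> u) + (LINT z|lborel. \<psi> z * D z \<zeta> v)" for u v
      using intD by (simp add: linear_add[OF bounded_linear.linear[OF blD]] distrib_left)
    show "(LINT z|lborel. \<psi> z * D z \<zeta> (c *\<^sub>R v)) = c *\<^sub>R (LINT z|lborel. \<psi> z * D z \<zeta> v)" for c v
      by (simp add: linear_cmul[OF bounded_linear.linear[OF blD]] mult.left_commute)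
  qed
  show ?thesis
    unfolding D_def[symmetric] has_derivative_at_alt
  proof (intro conjI allI impI)
    show "bounded_linear (\<lambda>v. LINT z|lborel. \<psi> z * D z \<zeta> v)"
      using lin by (simp add: linear_conv_bounded_linear)
    fix e :: real assume "e > 0"
    define C where "C = (LINT z|lborel. \<bar>\<psi> z\<bar>) + 1"
    have "C > 0" unfolding C_def by (smt (verit) integral_nonneg_AE AE_I2)
    \<comment> \<open>Only directional derivatives are known to be continuous. The operator norm is
      therefore estimated by a sum over the basis, and each of its terms gets an equal share of the
      error.\<close>
    define e' where "e' = e / C / DIM('b)"
    have "e' > 0" using \<open>e > 0\<close> \<open>C > 0\<close> by (simp add: e'_def)
    have "\<exists>d>0. \<forall>z\<in>K. \<forall>\<zeta>'. dist \<zeta>' \<zeta> < d \<longrightarrow> \<bar>D z \<zeta>' b - D z \<zeta> b\<bar> < e'" for b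
      using parametric_uniform[OF \<psi>(2) cD \<open>e' > 0\<close>, of \<zeta> b] by (metis fst_conv snd_conv)
    then obtain dd where dd: "\<And>b. dd b > 0"
      "\<And>b z \<zeta>'. z \<in> K \<Longrightarrow> dist \<zeta>' \<zeta> < dd b \<Longrightarrow> \<bar>D z \<zeta>' b - D z \<zeta> b\<bar> < e'"
      by metis
    define d where "d = Min (dd ` (Basis::'b set))"
    have d: "d > 0" "\<And>b. b \<in> Basis \<Longrightarrow> d \<le> dd b" by (auto simp: d_def dd)
    have on: "onorm (\<lambda>v. D z \<zeta>' v - D z \<zeta> v) \<le> e / C" if "z \<in> K" "dist \<zeta>' \<zeta> < d" for z \<zeta>'
    proof -
      have "onorm (\<lambda>v. D z \<zeta>' v - D z \<zeta> v) \<le> (\<Sum>b\<in>Basis. norm (D z \<zeta>' b - D z \<zeta> b))"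
        by (rule onorm_componentwise[OF bounded_linear_sub[OF blD blD]])
      also have "\<dots> \<le> (\<Sum>b\<in>(Basis::'b set). e')"
        using that d dd(2)[OF that(1), of \<zeta>'] by (intro sum_mono) (force intro: less_imp_le)
      also have "\<dots> = e / C" by (simp add: e'_def)
      finally show ?thesis .
    qed
    show "\<exists>d>0. \<forall>y. norm (y - \<zeta>) < d \<longrightarrow>
      norm ((LINT z|lborel. \<psi> z * k (z, y)) - (LINT z|lborel. \<psi> z * k (z, \<zeta>))
        - (LINT z|lborel. \<psi> z * D z \<zeta> (y - \<zeta>))) \<le> e * norm (y - \<zeta>)"
    proof (intro exI[of _ d] conjI allI impI d(1))
      fix y assume y: "norm (y - \<zeta>) < d"
      have bd: "\<bar>k (z, y) - k (z, \<zeta>) - D z \<zeta> (y - \<zeta>)\<bar> \<le> norm (y - \<zeta>) * (e / C)" if "z \<in> K" for z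
      proof -
        have "norm (k (z, y) - k (z, \<zeta>) - D z \<zeta> (y - \<zeta>)) \<le> norm (y - \<zeta>) * (e / C)"
        proof (rule differentiable_bound_linearization[where S = "ball \<zeta> d"])
          fix t :: real assume "t \<in> {0..1}"
          then have "t * norm (y - \<zeta>) < d"
            using y mult_left_le_one_le[of "norm (y - \<zeta>)" t] by auto
          then show "\<zeta> + t *\<^sub>R (y - \<zeta>) \<in> ball \<zeta> d"
            using \<open>t \<in> {0..1}\<close> by (simp add: dist_norm)
        next
          fix x assume "x \<in> ball \<zeta> d"
          then show "onorm (D z x - D z \<zeta>) \<le> e / C"
            using on[OF that, of x] by (simp add: dist_commute fun_diff_def)
        qed (use d kD in auto)
        then show ?thesis by simp
      qed
      have "norm ((LINT z|lborel. \<psi> z * k (z, y)) - (LINT z|lborel. \<psi> z * k (z, \<zeta>))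
        - (LINT z|lborel. \<psi> z * D z \<zeta> (y - \<zeta>)))
        = \<bar>LINT z|lborel. \<psi> z * (k (z, y) - k (z, \<zeta>) - D z \<zeta> (y - \<zeta>))\<bar>"
        using int intD by (simp add: right_diff_distrib)
      also have "\<dots> \<le> (LINT z|lborel. \<bar>\<psi> z\<bar> * (norm (y - \<zeta>) * (e / C)))"
      proof (rule integral_abs_bound_integral)
        show "integrable lborel (\<lambda>z. \<psi> z * (k (z, y) - k (z, \<zeta>) - D z \<zeta> (y - \<zeta>)))"
          using int intD by (simp add: right_diff_distrib)
        show "\<bar>\<psi> z * (k (z, y) - k (z, \<zeta>) - D z \<zeta> (y - \<zeta>))\<bar> \<le> \<bar>\<psi> z\<bar> * (norm (y - \<zeta>) * (e / C))" for z
          using bd[of z] \<psi>(3)[of z]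
          by (cases "z \<in> K") (auto simp: abs_mult simp del: times_divide_eq_right intro!: mult_left_mono)
      qed (use \<psi>(1) in auto)
      also have "\<dots> = (LINT z|lborel. \<bar>\<psi> z\<bar>) / C * (e * norm (y - \<zeta>))" by (simp add: field_simps)
      also have "\<dots> \<le> 1 * (e * norm (y - \<zeta>))"
        using \<open>e > 0\<close> \<open>C > 0\<close> by (intro mult_right_mono) (auto simp: C_def field_simps)
      finally show "norm ((LINT z|lborel. \<psi> z * k (z, y)) - (LINT z|lborel. \<psi> z * k (z, \<zeta>))
        - (LINT z|lborel. \<psi> z * D z \<zeta> (y - \<zeta>))) \<le> e * norm (y - \<zeta>)" by simp
    qed
  qed
qed

text \<open>The derivative in direction v is again an integral of this type, with the kernel
  differentiated in direction (0, v); the induction therefore runs over all kernels.\<close>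

lemma smooth_on_parametric_integral:
  fixes k :: "'a::euclidean_space \<times> 'b::euclidean_space \<Rightarrow> real"
  assumes \<psi>: "integrable lborel \<psi>" "compact K" "\<And>z. z \<notin> K \<Longrightarrow> \<psi> z = 0" and k: "smooth_on UNIV k"
  shows "smooth_on UNIV (\<lambda>\<zeta>. LINT z|lborel. \<psi> z * k (z, \<zeta>))"
  unfolding smooth_on_def
proof
  fix n
  have "Ck_on n UNIV k" using k by (rule smooth_onD)
  then show "Ck_on n UNIV (\<lambda>\<zeta>. LINT z|lborel. \<psi> z * k (z, \<zeta>))"
  proof (induction n arbitrary: k)
    case 0
    then show ?case using continuous_on_parametric_integral[OF \<psi>] by auto
  next
    case (Suc n)
    have c: "continuous_on UNIV (\<lambda>p. frechet_derivative k (at p) v)" for v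
      using Suc.prems by (cases v) (intro Ck_on_imp_continuous_on[of n], auto)
    have "Ck_on 1 UNIV k" using Suc.prems c by auto
    moreover have "Ck_on n UNIV (\<lambda>p. frechet_derivative k (at p) (0, v))" for v
      using Suc.prems by auto
    ultimately show ?case
      by (intro Ck_on_SucI[where f' = "\<lambda>\<zeta> v. LINT z|lborel. \<psi> z * frechet_derivative k (at (z, \<zeta>)) (0, v)"]
          has_derivative_parametric_integral[OF \<psi>] Suc.IH[of "\<lambda>p. frechet_derivative k (at p) (0, v)" for v, simplified])
        auto
  qed
qed

subsection \<open>Test functions and vector fields\<close>

lemma test_functionI:
  assumes "smooth_on UNIV f" "compact K" "K \<subseteq> \<Omega>" "\<And>z. f z \<noteq> 0 \<Longrightarrow> z \<in> K"
  shows "test_function \<Omega> f"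
proof -
  have sub: "closure {z. f z \<noteq> 0} \<subseteq> K"
    using assms by (intro closure_minimal compact_imp_closed) auto
  then have "compact (closure {z. f z \<noteq> 0})"
    using compact_Int_closed[OF assms(2) closed_closure, of "{z. f z \<noteq> 0}"] by (simp add: inf.absorb2)
  moreover have "closure {z. f z \<noteq> 0} \<subseteq> \<Omega>"
    using sub assms(3) by (rule subset_trans)
  ultimately show ?thesis
    using assms(1) by (simp add: test_function_def)
qed

lemma test_functionE:
  assumes "test_function \<Omega> f"
  obtains K where "compact K" "K \<subseteq> \<Omega>" "\<And>z. z \<notin> K \<Longrightarrow> f z = 0"
proof (rule that)
  show "f z = 0" if "z \<notin> closure {z. f z \<noteq> 0}" for z
    using that closure_subset[of "{z. f z \<noteq> 0}"] by auto
qed (use assms in \<open>auto simp: test_function_def\<close>)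

lemma test_function_smooth: "test_function \<Omega> f \<Longrightarrow> smooth_on UNIV f"
  by (simp add: test_function_def)

lemma test_function_mult:
  assumes "test_function \<Omega> f" "smooth_on UNIV g"
  shows "test_function \<Omega> (\<lambda>z. f z * g z)"
proof -
  obtain K where "compact K" "K \<subseteq> \<Omega>" "\<And>z. z \<notin> K \<Longrightarrow> f z = 0"
    using assms test_functionE by blast
  then show ?thesis
    using assms by (intro test_functionI[where K = K]) (auto intro: smooth_intros test_function_smooth)
qed

lemma test_function_add:
  assumes "test_function \<Omega> f" "test_function \<Omega> g"
  shows "test_function \<Omega> (\<lambda>z. f z + g z)"
proof -
  obtain K where K: "compact K" "K \<subseteq> \<Omega>" "\<And>z. z \<notin> K \<Longrightarrow> f z = 0"
    using test_functionE[OF assms(1)] by blast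
  obtain L where L: "compact L" "L \<subseteq> \<Omega>" "\<And>z. z \<notin> L \<Longrightarrow> g z = 0"
    using test_functionE[OF assms(2)] by blast
  show ?thesis
  proof (rule test_functionI[where K = "K \<union> L"])
    show "z \<in> K \<union> L" if "f z + g z \<noteq> 0" for z using that K(3)[of z] L(3)[of z] by (cases "z \<in> K") auto
    show "smooth_on UNIV (\<lambda>z. f z + g z)"
      using assms by (intro smooth_intros) (auto intro: test_function_smooth)
  qed (use K L in auto)
qed

lemma test_function_zero: "test_function \<Omega> (\<lambda>z. 0)"
  by (rule test_functionI[where K = "{}"]) (auto intro: smooth_intros)

lemma test_function_sum:
  "(\<And>i. i \<in> I \<Longrightarrow> test_function \<Omega> (f i)) \<Longrightarrow> test_function \<Omega> (\<lambda>z. \<Sum>i\<in>I. f i z)"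
  by (induction I rule: infinite_finite_induct) (auto intro: test_function_add test_function_zero)

lemma test_function_mult_const: "test_function \<Omega> f \<Longrightarrow> test_function \<Omega> (\<lambda>z. c * f z)"
  using test_function_mult[of \<Omega> f "\<lambda>z. c"] by (simp add: smooth_on_const mult.commute)

lemma test_function_minus: "test_function \<Omega> f \<Longrightarrow> test_function \<Omega> (\<lambda>z. - f z)"
  using test_function_mult_const[of \<Omega> f "- 1"] by simp

lemma test_function_diff:
  "test_function \<Omega> f \<Longrightarrow> test_function \<Omega> g \<Longrightarrow> test_function \<Omega> (\<lambda>z. f z - g z)"
  using test_function_add[of \<Omega> f "\<lambda>z. - g z"] test_function_minus by auto

lemma test_function_bounded:
  assumes "test_function \<Omega> f"
  obtains B where "\<And>z. \<bar>f z\<bar> \<le> B" "B \<ge> 0"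
proof -
  obtain K where K: "compact K" "\<And>z. z \<notin> K \<Longrightarrow> f z = 0"
    using assms test_functionE by metis
  have "continuous_on UNIV f" using assms by (intro smooth_on_imp_continuous_on test_function_smooth)
  then have "compact (f ` K)" using K by (auto intro: compact_continuous_image continuous_on_subset)
  then obtain B where B: "\<And>z. z \<in> K \<Longrightarrow> \<bar>f z\<bar> \<le> B"
    using compact_imp_bounded bounded_iff by (metis imageI real_norm_def)
  show ?thesis
  proof (rule that[of "\<bar>B\<bar>"])
    show "\<bar>f z\<bar> \<le> \<bar>B\<bar>" for z using B[of z] K(2)[of z] by (cases "z \<in> K") auto
  qed simp
qed

lemma integrable_indicator_compact:
  "compact K \<Longrightarrow> integrable lborel (indicat_real (K::'a::euclidean_space set))"
  using emeasure_compact_finite[of K] by (simp add: integrable_indicator_iff less_top borel_compact)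

lemma test_function_integrable:
  fixes f :: "'a::euclidean_space \<Rightarrow> real"
  assumes "test_function \<Omega> f"
  shows "integrable lborel f"
proof -
  obtain K where K: "compact K" "\<And>z. z \<notin> K \<Longrightarrow> f z = 0"
    using assms test_functionE by metis
  have "integrable lborel (\<lambda>z. indicat_real K z * f z)"
    using assms K by (intro integrable_mult_continuous_compact[where K = K] integrable_indicator_compact)
      (auto intro: smooth_on_imp_continuous_on test_function_smooth)
  moreover have "(\<lambda>z. indicat_real K z * f z) = f"
  proof
    show "indicat_real K z * f z = f z" for z using K(2)[of z] by (cases "z \<in> K") auto
  qed
  ultimately show ?thesis by simp
qed

section \<open>Vector fields as derivations, and the divergence theorem for test functions\<close>

lemma vf_deriv_eq: "(f has_derivative f') (at z) \<Longrightarrow> vf_deriv Z f z = f' (Z z)"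
  unfolding vf_deriv_def by (metis frechet_derivative_at)

lemma vf_deriv_sum_Basis:
  fixes f :: "'a::euclidean_space \<Rightarrow> real"
  assumes "f differentiable (at z)"
  shows "vf_deriv Z f z = (\<Sum>b\<in>Basis. (Z z \<bullet> b) * frechet_derivative f (at z) b)"
proof -
  have "linear (frechet_derivative f (at z))"
    using assms by (rule linear_frechet_derivative)
  then have "frechet_derivative f (at z) (\<Sum>b\<in>Basis. (Z z \<bullet> b) *\<^sub>R b)
      = (\<Sum>b\<in>Basis. (Z z \<bullet> b) * frechet_derivative f (at z) b)"
    by (simp add: linear_sum linear_cmul)
  then show ?thesis by (simp add: euclidean_representation vf_deriv_def)
qed

lemma smooth_on_vf_deriv [smooth_intros]:
  fixes f :: "'a::euclidean_space \<Rightarrow> real"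
  assumes "open S" "smooth_on S f" "smooth_on S Z"
  shows "smooth_on S (vf_deriv Z f)"
proof -
  have "smooth_on S (\<lambda>z. \<Sum>b\<in>Basis. (Z z \<bullet> b) * frechet_derivative f (at z) b)"
    by (intro smooth_on_sum smooth_on_mult smooth_on_inner_left smooth_on_frechet_derivative assms)
  then show ?thesis
    using assms vf_deriv_sum_Basis[OF smooth_on_imp_differentiable[OF assms(2)]]
    by (subst smooth_on_cong) auto
qed

lemma vf_deriv_const [simp]: "vf_deriv Z (\<lambda>z. c) = (\<lambda>z. 0)"
  by (rule ext) (simp add: vf_deriv_eq[OF has_derivative_const])

lemma vf_deriv_add:
  "f differentiable (at z) \<Longrightarrow> g differentiable (at z) \<Longrightarrow>
    vf_deriv Z (\<lambda>z. f z + g z) z = vf_deriv Z f z + vf_deriv Z g z"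
  unfolding frechet_derivative_works by (subst vf_deriv_eq, erule (1) has_derivative_add) (simp add: vf_deriv_def)

lemma vf_deriv_mult:
  "f differentiable (at z) \<Longrightarrow> g differentiable (at z) \<Longrightarrow>
    vf_deriv Z (\<lambda>z. f z * g z) z = f z * vf_deriv Z g z + vf_deriv Z f z * g z"
  unfolding frechet_derivative_works by (subst vf_deriv_eq, erule (1) has_derivative_mult) (simp add: vf_deriv_def)

lemma vf_deriv_sum:
  "(\<And>i. i \<in> I \<Longrightarrow> f i differentiable (at z)) \<Longrightarrow>
    vf_deriv Z (\<lambda>z. \<Sum>i\<in>I. f i z) z = (\<Sum>i\<in>I. vf_deriv Z (f i) z)"
  unfolding frechet_derivative_works
  by (subst vf_deriv_eq[where f' = "\<lambda>v. \<Sum>i\<in>I. frechet_derivative (f i) (at z) v"])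
    (auto intro: has_derivative_sum simp: vf_deriv_def)

lemma vf_deriv_cmult:
  "f differentiable (at z) \<Longrightarrow> vf_deriv Z (\<lambda>z. c * f z) z = c * vf_deriv Z f z"
  using vf_deriv_mult[of "\<lambda>z. c" z f Z] by simp

lemma vf_deriv_compose:
  assumes "f differentiable (at z)" "(h has_real_derivative d) (at (f z))"
  shows "vf_deriv Z (\<lambda>z. h (f z)) z = d * vf_deriv Z f z"
proof -
  have "((\<lambda>z. h (f z)) has_derivative (\<lambda>v. d * frechet_derivative f (at z) v)) (at z)"
    using has_derivative_compose[OF assms(1)[unfolded frechet_derivative_works], of h "(*) d"] assms(2)
    by (simp add: has_field_derivative_def)
  then show ?thesis by (subst vf_deriv_eq, assumption) (simp add: vf_deriv_def)
qed

lemma frechet_derivative_zero_outside: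
  assumes "open S" "z \<in> S" "\<And>x. x \<in> S \<Longrightarrow> f x = 0"
  shows "frechet_derivative f (at z) v = 0"
proof -
  have "((\<lambda>x. 0) has_derivative (\<lambda>v. 0)) (at z)" by simp
  then have "(f has_derivative (\<lambda>v. 0)) (at z)"
    by (rule has_derivative_transform_within_open[OF _ assms(1,2)]) (simp add: assms(3))
  then show ?thesis using frechet_derivative_at by metis
qed

lemma test_function_frechet_derivative:
  assumes "test_function \<Omega> f"
  shows "test_function \<Omega> (\<lambda>z. frechet_derivative f (at z) v)"
proof -
  obtain K where K: "compact K" "K \<subseteq> \<Omega>" "\<And>z. z \<notin> K \<Longrightarrow> f z = 0"
    using assms test_functionE by blast
  have "frechet_derivative f (at z) v = 0" if "z \<notin> K" for z
    using K that by (intro frechet_derivative_zero_outside[of "- K"]) (auto simp: compact_imp_closed open_Compl)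
  with K show ?thesis
    by (intro test_functionI[OF smooth_on_frechet_derivative[OF test_function_smooth[OF assms]], of K]) auto
qed

lemma test_function_vf_deriv:
  fixes f :: "'a::euclidean_space \<Rightarrow> real"
  assumes "test_function \<Omega> f" "smooth_on UNIV Z"
  shows "test_function \<Omega> (vf_deriv Z f)"
proof -
  have "vf_deriv Z f = (\<lambda>z. \<Sum>b\<in>Basis. frechet_derivative f (at z) b * (Z z \<bullet> b))"
    using vf_deriv_sum_Basis[OF smooth_on_imp_differentiable[OF test_function_smooth[OF assms(1)]]]
    by (auto simp: mult.commute)
  moreover have "test_function \<Omega> \<dots>"
    by (intro test_function_sum test_function_mult test_function_frechet_derivative assms smooth_intros) auto
  ultimately show ?thesis by simp
qed

text \<open>By translation invariance the integral of g(z + \<zeta>) over z does not depend on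
  \<zeta>; differentiating under the integral sign at \<zeta> = 0 gives the claim.\<close>

lemma integral_frechet_derivative_zero:
  fixes g :: "'a::euclidean_space \<Rightarrow> real"
  assumes g: "test_function UNIV g"
  shows "(LINT z|lborel. frechet_derivative g (at z) b) = 0"
proof -
  obtain K where K: "compact K" "\<And>z. z \<notin> K \<Longrightarrow> g z = 0"
    using g test_functionE by metis
  \<comment> \<open>L contains the support of every translate of g by a vector of norm at most 1, so
    its indicator serves as the compactly supported density in the differentiation.\<close>
  define L where "L = {x + y |x y. x \<in> K \<and> y \<in> cball (0::'a) 1}"
  have L: "compact L" unfolding L_def using K by (intro compact_sums) auto
  let ?k = "\<lambda>p::'a \<times> 'a. g (fst p + snd p)"
  have sg: "smooth_on UNIV g" using g by (rule test_function_smooth)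
  have k: "smooth_on UNIV ?k"
    by (rule smooth_on_compose_UNIV[OF _ _ sg]) (intro smooth_intros open_UNIV)+
  have inL: "z \<in> L" if "z + \<zeta> \<in> K" "\<zeta> \<in> cball 0 1" for z \<zeta>
  proof -
    have "z = (z + \<zeta>) + (- \<zeta>)" by simp
    then show ?thesis unfolding L_def using that by (metis (mono_tags, lifting) mem_Collect_eq mem_cball_0 norm_minus_cancel)
  qed
  have const: "(LINT z|lborel. indicat_real L z * g (z + \<zeta>)) = (LINT z|lborel. g z)" if "\<zeta> \<in> cball 0 1" for \<zeta>
  proof -
    have "(\<lambda>z. indicat_real L z * g (z + \<zeta>)) = (\<lambda>z. g (z + \<zeta>))"
    proof
      show "indicat_real L z * g (z + \<zeta>) = g (z + \<zeta>)" for z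
        using inL[OF _ that, of z] K(2)[of "z + \<zeta>"] by (cases "z + \<zeta> \<in> K") auto
    qed
    then have "(LINT z|lborel. indicat_real L z * g (z + \<zeta>)) = (LINT z|lborel. g (z + \<zeta>))" by simp
    also have "\<dots> = (LINT z|lborel. g z)"
      using lborel_integral_real_affine
      by (subst (2) lborel_distr_plus[of \<zeta>, symmetric])
        (simp add: integral_distr add.commute smooth_on_imp_continuous_on[OF sg] borel_measurable_continuous_onI)
    finally show ?thesis by simp
  qed
  have fd: "frechet_derivative ?k (at (z, 0)) (0, v) = frechet_derivative g (at z) v" for z v
  proof -
    have "((\<lambda>p::'a \<times> 'a. fst p + snd p) has_derivative (\<lambda>p. fst p + snd p)) (at (z, 0))"
      by (auto intro!: derivative_eq_intros)
    then have "(?k has_derivative (\<lambda>p. frechet_derivative g (at z) (fst p + snd p))) (at (z, 0))"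
      using has_derivative_compose[of "\<lambda>p. fst p + snd p" "\<lambda>p. fst p + snd p" "(z, 0)" UNIV g "frechet_derivative g (at z)"]
        smooth_on_imp_has_derivative[OF sg, of z] by simp
    from frechet_derivative_at[OF this, symmetric] show ?thesis by simp
  qed
  have "((\<lambda>\<zeta>. LINT z|lborel. indicat_real L z * ?k (z, \<zeta>)) has_derivative
    (\<lambda>v. LINT z|lborel. indicat_real L z * frechet_derivative ?k (at (z, 0)) (0, v))) (at 0)"
    using L smooth_onD[OF k] by (intro has_derivative_parametric_integral[where K = L] integrable_indicator_compact) auto
  moreover have "((\<lambda>\<zeta>. LINT z|lborel. indicat_real L z * ?k (z, \<zeta>)) has_derivative (\<lambda>v. 0)) (at 0)"
  proof (rule has_derivative_transform_within_open)
    show "((\<lambda>\<zeta>. LINT z|lborel. g z) has_derivative (\<lambda>v. 0)) (at (0::'a))" by simp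
    show "open (ball (0::'a) 1)" "0 \<in> ball (0::'a) 1" by auto
  qed (use const in auto)
  ultimately have "(\<lambda>v. LINT z|lborel. indicat_real L z * frechet_derivative ?k (at (z, 0)) (0, v)) = (\<lambda>v. 0)"
    by (rule has_derivative_unique)
  then have "(LINT z|lborel. indicat_real L z * frechet_derivative g (at z) b) = 0"
    unfolding fd by metis
  moreover have "(\<lambda>z. indicat_real L z * frechet_derivative g (at z) b) = (\<lambda>z. frechet_derivative g (at z) b)"
  proof
    fix z
    have "frechet_derivative g (at z) b = 0" if "z \<notin> L"
    proof (rule frechet_derivative_zero_outside[of "- L"])
      show "g x = 0" if "x \<in> - L" for x using inL[of x 0] K(2)[of x] that by auto
    qed (use that L in \<open>auto simp: compact_imp_closed open_Compl\<close>)
    then show "indicat_real L z * frechet_derivative g (at z) b = frechet_derivative g (at z) b"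
      by (auto simp: indicator_def)
  qed
  ultimately show ?thesis by simp
qed

lemma divergence_scaleR:
  fixes Z :: "'a::euclidean_space \<Rightarrow> 'a"
  assumes "f differentiable (at z)" "Z differentiable (at z)"
  shows "divergence (\<lambda>y. f y *\<^sub>R Z y) z = vf_deriv Z f z + f z * divergence Z z"
proof -
  have "((\<lambda>y. f y *\<^sub>R Z y) has_derivative
      (\<lambda>v. f z *\<^sub>R frechet_derivative Z (at z) v + frechet_derivative f (at z) v *\<^sub>R Z z)) (at z)"
    using assms unfolding frechet_derivative_works by (rule has_derivative_scaleR)
  then have "frechet_derivative (\<lambda>y. f y *\<^sub>R Z y) (at z)
      = (\<lambda>v. f z *\<^sub>R frechet_derivative Z (at z) v + frechet_derivative f (at z) v *\<^sub>R Z z)"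
    by (rule frechet_derivative_at[symmetric])
  then show ?thesis
    by (simp add: divergence_def vf_deriv_sum_Basis[OF assms(1)] inner_add_left sum.distrib
        sum_distrib_left mult.commute)
qed

text \<open>For a divergence-free field, Z g is the divergence of g Z, and each component
  contributes the integral of a partial derivative of a test function.\<close>

lemma integral_vf_deriv_zero:
  fixes Z :: "'a::euclidean_space \<Rightarrow> 'a"
  assumes g: "test_function UNIV g" and Z: "smooth_on UNIV Z" and dZ: "\<And>z. divergence Z z = 0"
  shows "(LINT z|lborel. vf_deriv Z g z) = 0"
proof -
  have dg: "g differentiable (at z)" for z
    using g by (auto intro: smooth_on_imp_differentiable test_function_smooth)
  have dZd: "Z differentiable (at z)" for z using Z by (auto intro: smooth_on_imp_differentiable)
  have t: "test_function UNIV (\<lambda>z. g z * (Z z \<bullet> b))" for b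
    by (intro test_function_mult g smooth_intros Z) auto
  have fd: "frechet_derivative (\<lambda>y. g y *\<^sub>R Z y) (at z) b \<bullet> b
      = frechet_derivative (\<lambda>y. g y * (Z y \<bullet> b)) (at z) b" for z b
  proof -
    have "(\<lambda>y. g y *\<^sub>R Z y) differentiable (at z)"
      using differentiable_scaleR[OF dg dZd] .
    then have "((\<lambda>y. (g y *\<^sub>R Z y) \<bullet> b) has_derivative
        (\<lambda>v. frechet_derivative (\<lambda>y. g y *\<^sub>R Z y) (at z) v \<bullet> b)) (at z)"
      unfolding frechet_derivative_works by (rule has_derivative_inner_left)
    then show ?thesis using frechet_derivative_at by (metis (no_types, lifting) ext inner_scaleR_left)
  qed
  have "vf_deriv Z g z = (\<Sum>b\<in>Basis. frechet_derivative (\<lambda>y. g y * (Z y \<bullet> b)) (at z) b)" for z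
    using divergence_scaleR[OF dg dZd, of z] dZ[of z] by (simp add: divergence_def fd)
  then have "(LINT z|lborel. vf_deriv Z g z)
      = (LINT z|lborel. (\<Sum>b\<in>Basis. frechet_derivative (\<lambda>y. g y * (Z y \<bullet> b)) (at z) b))"
    by simp
  also have "\<dots> = (\<Sum>b\<in>Basis. (LINT z|lborel. frechet_derivative (\<lambda>y. g y * (Z y \<bullet> b)) (at z) b))"
    by (intro Bochner_Integration.integral_sum test_function_integrable[OF test_function_frechet_derivative[OF t]])
  also have "\<dots> = 0" using integral_frechet_derivative_zero[OF t] by simp
  finally show ?thesis .
qed

subsection \<open>Smooth steps and density of test functions\<close>

text \<open>A smooth transition function is carried along as a parameter; a concrete one is
  extracted later from the given cut-off profile. Monotonicity is expressed through the derivative,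
  because its sign is what the estimates use.\<close>

definition smooth_step :: "(real \<Rightarrow> real) \<Rightarrow> bool" where
  "smooth_step \<sigma> \<longleftrightarrow> smooth_on UNIV \<sigma> \<and> (\<forall>s\<le>0. \<sigma> s = 0) \<and> (\<forall>s\<ge>1. \<sigma> s = 1) \<and> (\<forall>s. 0 \<le> deriv \<sigma> s)"

lemma smooth_on_imp_has_real_derivative:
  "smooth_on UNIV f \<Longrightarrow> (f has_real_derivative deriv f x) (at x)"
  using smooth_on_imp_differentiable[of UNIV f x] real_differentiable_def DERIV_imp_deriv by blast

lemma smooth_on_deriv [smooth_intros]: "smooth_on UNIV f \<Longrightarrow> smooth_on UNIV (deriv f :: real \<Rightarrow> real)"
proof -
  assume f: "smooth_on UNIV f"
  have "frechet_derivative f (at x) 1 = deriv f x" for x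
    using frechet_derivative_at[OF has_field_derivative_imp_has_derivative[OF smooth_on_imp_has_real_derivative[OF f]], of x]
    by (metis mult.right_neutral)
  then show ?thesis using smooth_on_frechet_derivative[OF f, of 1] by simp
qed

lemma smooth_step_mono: "smooth_step \<sigma> \<Longrightarrow> a \<le> b \<Longrightarrow> \<sigma> a \<le> \<sigma> b"
  using smooth_on_imp_has_real_derivative[of \<sigma>]
  by (intro DERIV_nonneg_imp_nondecreasing[of a b \<sigma>]) (auto simp: smooth_step_def intro!: exI[of _ "deriv \<sigma> x" for x])

lemma smooth_step_bounds: "smooth_step \<sigma> \<Longrightarrow> 0 \<le> \<sigma> s" "smooth_step \<sigma> \<Longrightarrow> \<sigma> s \<le> 1"
  using smooth_step_mono[of \<sigma> "min s 0" s] smooth_step_mono[of \<sigma> s "max s 1"]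
  by (auto simp: smooth_step_def)

text \<open>The profile is known to vanish only for s > b. Placing the end of the transition at b +
  1 ensures the value 0 there.\<close>

lemma smooth_step_of_cutoff:
  assumes h: "smooth_on UNIV h" "\<And>s. s \<le> a \<Longrightarrow> h s = 1" "\<And>s. s > b \<Longrightarrow> h s = 0"
    and d: "\<And>s. deriv h s \<le> 0" and "a < b + 1"
  shows "smooth_step (\<lambda>s. 1 - h (a + s * (b + 1 - a)))"
  unfolding smooth_step_def
proof (intro conjI allI impI)
  show "smooth_on UNIV (\<lambda>s. 1 - h (a + s * (b + 1 - a)))"
    by (intro smooth_intros open_UNIV smooth_on_compose_UNIV[OF open_UNIV _ h(1)])
  show "1 - h (a + s * (b + 1 - a)) = 0" if "s \<le> 0" for s
    using that assms by (simp add: mult_nonpos_nonneg)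
  show "1 - h (a + s * (b + 1 - a)) = 1" if "s \<ge> 1" for s
  proof -
    have "1 * (b + 1 - a) \<le> s * (b + 1 - a)" using that assms by (intro mult_right_mono) auto
    then have "a + s * (b + 1 - a) > b" by simp
    then show ?thesis using assms(3) by simp
  qed
  show "0 \<le> deriv (\<lambda>s. 1 - h (a + s * (b + 1 - a))) s" for s
  proof -
    have "((\<lambda>s. 1 - h (a + s * (b + 1 - a))) has_real_derivative
        - (deriv h (a + s * (b + 1 - a)) * (b + 1 - a))) (at s)"
      using smooth_on_imp_has_real_derivative[OF h(1)]
      by (auto intro!: derivative_eq_intros DERIV_chain2[of h])
    then have "deriv (\<lambda>s. 1 - h (a + s * (b + 1 - a))) s = - (deriv h (a + s * (b + 1 - a)) * (b + 1 - a))"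
      by (rule DERIV_imp_deriv)
    then show ?thesis using d[of "a + s * (b + 1 - a)"] assms(5) by (simp add: mult_nonpos_nonneg)
  qed
qed

text \<open>The squared norm is written in coordinates, so that smoothness also holds at the centre
  and follows from the rules for sums and powers. The transition takes place for norms between R and
  \<open>sqrt 2 * R\<close>.\<close>

definition bump :: "(real \<Rightarrow> real) \<Rightarrow> 'a::euclidean_space \<Rightarrow> real \<Rightarrow> 'a \<Rightarrow> real" where
  "bump \<sigma> c R z = 1 - \<sigma> ((\<Sum>b\<in>Basis. ((z - c) \<bullet> b)\<^sup>2) / R\<^sup>2 - 1)"

lemma bump_eq_norm: "bump \<sigma> c R z = 1 - \<sigma> ((norm (z - c))\<^sup>2 / R\<^sup>2 - 1)"
  unfolding bump_def power2_norm_eq_inner euclidean_inner[of "z - c" "z - c"] by (simp add: power2_eq_square)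

lemma bump_props:
  assumes "smooth_step \<sigma>" "R > 0"
  shows "test_function UNIV (bump \<sigma> c R)" "0 \<le> bump \<sigma> c R z" "bump \<sigma> c R z \<le> 1"
    "norm (z - c) \<le> R \<Longrightarrow> bump \<sigma> c R z = 1" "norm (z - c) \<ge> 2 * R \<Longrightarrow> bump \<sigma> c R z = 0"
proof -
  show z: "bump \<sigma> c R z = 0" if "norm (z - c) \<ge> 2 * R" for z
  proof -
    have "(2 * R)\<^sup>2 \<le> (norm (z - c))\<^sup>2" using that assms by (intro power_mono) auto
    moreover have "0 \<le> R\<^sup>2" by simp
    ultimately have "2 * R\<^sup>2 \<le> (norm (z - c))\<^sup>2" unfolding power_mult_distrib power2_eq_square[of "2::real"] by linarith
    then have "(norm (z - c))\<^sup>2 / R\<^sup>2 - 1 \<ge> 1" using assms(2) by (simp add: field_simps)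
    then show ?thesis using assms(1) by (simp add: bump_eq_norm smooth_step_def)
  qed
  show "test_function UNIV (bump \<sigma> c R)"
  proof (rule test_functionI[where K = "cball c (2 * R)"])
    have sm: "smooth_on UNIV \<sigma>" using assms(1) by (simp add: smooth_step_def)
    show "smooth_on UNIV (bump \<sigma> c R)"
      unfolding bump_def divide_inverse
      by (intro smooth_on_diff smooth_on_const open_UNIV smooth_on_compose_UNIV[OF open_UNIV _ sm]
          smooth_on_mult smooth_on_sum smooth_on_power smooth_on_inner_left smooth_on_id)
    show "z \<in> cball c (2 * R)" if "bump \<sigma> c R z \<noteq> 0" for z
      using z[of z] that by (force simp: dist_norm norm_minus_commute)
  qed auto
  show "bump \<sigma> c R z = 1" if "norm (z - c) \<le> R"
  proof -
    have "(norm (z - c))\<^sup>2 / R\<^sup>2 \<le> 1" using that assms by (simp add: divide_le_eq_1 power_mono)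
    then show ?thesis using assms(1) by (simp add: bump_eq_norm smooth_step_def)
  qed
  show "0 \<le> bump \<sigma> c R z" "bump \<sigma> c R z \<le> 1"
    using smooth_step_bounds[OF assms(1)] by (auto simp: bump_def)
qed

lemma smooth_step_plateau:
  fixes B :: "'a::euclidean_space set"
  assumes "smooth_step \<sigma>" "bounded B"
  obtains cut where "test_function UNIV cut" "\<And>z. 0 \<le> cut z" "\<And>z. cut z \<le> 1" "\<And>z. z \<in> B \<Longrightarrow> cut z = 1"
proof -
  obtain R where R: "R > 0" "\<And>z. z \<in> B \<Longrightarrow> norm z \<le> R"
    using assms(2) bounded_pos by metis
  show ?thesis
  proof (rule that[of "bump \<sigma> 0 R"])
    show "bump \<sigma> 0 R z = 1" if "z \<in> B" for z
      using bump_props(4)[OF assms(1) R(1), of z 0] R(2)[OF that] by simp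
  qed (use bump_props[OF assms(1) R(1), where c = 0] in auto)
qed

text \<open>If g were positive at z0, a bump supported near z0 would give a continuous non-negative
  integrand with zero integral. Its non-zero set is open and null, hence empty, which contradicts
  the value at z0. The negative case is the same for -g.\<close>

lemma fundamental_lemma:
  fixes g :: "'a::euclidean_space \<Rightarrow> real"
  assumes s: "smooth_step \<sigma>" and g: "continuous_on UNIV g"
    and z: "\<And>\<eta>. test_function UNIV \<eta> \<Longrightarrow> (LINT z|lborel. g z * \<eta> z) = 0"
  shows "g z0 = 0"
proof -
  have pos: "\<not> f z0 > 0" if f: "continuous_on UNIV f"
    and fz: "\<And>\<eta>. test_function UNIV \<eta> \<Longrightarrow> (LINT z|lborel. f z * \<eta> z) = 0" for f :: "'a \<Rightarrow> real"
  proof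
    assume "f z0 > 0"
    then have "\<forall>\<^sub>F z in at z0. f z > 0"
      using f by (intro order_tendstoD(1)[of f "f z0"]) (auto simp: continuous_on_eq_continuous_at isCont_def)
    then obtain d where d: "d > 0" "\<And>z. dist z z0 < d \<Longrightarrow> f z > 0"
      using \<open>f z0 > 0\<close> unfolding eventually_at by (metis UNIV_I)
    let ?b = "bump \<sigma> z0 (d / 2)"
    note b = bump_props[OF s, where R = "d / 2" and c = z0]
    have t: "test_function UNIV ?b" using b d by simp
    have ck: "continuous_on UNIV (\<lambda>z. f z * ?b z)"
      by (intro continuous_intros f smooth_on_imp_continuous_on test_function_smooth[OF t])
    have int: "integrable lborel (\<lambda>z. f z * ?b z)"
      using integrable_mult_continuous_compact[OF test_function_integrable[OF t] compact_cball[of z0 d] _ f] b(5) d(1)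
      by (simp add: dist_norm norm_minus_commute mult.commute)
    have nn: "0 \<le> f z * ?b z" for z
      using d(2)[of z] b(2,5)[of z] d(1) by (cases "dist z z0 < d") (auto simp: dist_norm)
    have "AE z in lborel. f z * ?b z = 0"
      using integral_nonneg_eq_0_iff_AE[OF int] nn fz[OF t] by auto
    moreover have op: "open {z. f z * ?b z \<noteq> 0}"
      using open_Collect_neq[OF ck continuous_on_const] .
    ultimately have "{z. f z * ?b z \<noteq> 0} \<in> null_sets lborel"
      by (subst AE_iff_null_sets) auto
    then have "negligible {z. f z * ?b z \<noteq> 0}"
      using null_sets_completionI negligible_iff_null_sets by blast
    then have "{z. f z * ?b z \<noteq> 0} = {}"
      using open_not_negligible[OF op] by blast
    then have "f z0 * ?b z0 = 0" by blast
    then show False using b(4)[of z0] d(1) \<open>f z0 > 0\<close> by simp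
  qed
  have "\<not> g z0 > 0" using pos[OF g z] .
  moreover have "\<not> - g z0 > 0"
    by (rule pos) (use g z in \<open>auto intro: continuous_intros\<close>)
  ultimately show ?thesis by simp
qed

section \<open>Density of test functions in L2\<close>

text \<open>Membership in the L2 closure of V, without a quotient space. Only the differences have
  to be square integrable, so that approximations can be chained.\<close>

definition L2_approx :: "('a::euclidean_space \<Rightarrow> real) \<Rightarrow> ('a \<Rightarrow> real) set \<Rightarrow> bool" where
  "L2_approx u V \<longleftrightarrow> (\<forall>e>0. \<exists>v\<in>V. v \<in> borel_measurable borel \<and> integrable lborel (\<lambda>z. (u z - v z)\<^sup>2) \<and>
     (LINT z|lborel. (u z - v z)\<^sup>2) < e)"

lemma integrable_square_diff:
  fixes u v w :: "'a::euclidean_space \<Rightarrow> real"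
  assumes [measurable]: "u \<in> borel_measurable borel" "v \<in> borel_measurable borel" "w \<in> borel_measurable borel"
    and "integrable lborel (\<lambda>z. (u z - v z)\<^sup>2)" "integrable lborel (\<lambda>z. (v z - w z)\<^sup>2)"
  shows "integrable lborel (\<lambda>z. (u z - w z)\<^sup>2)"
    "(LINT z|lborel. (u z - w z)\<^sup>2) \<le> 2 * (LINT z|lborel. (u z - v z)\<^sup>2) + 2 * (LINT z|lborel. (v z - w z)\<^sup>2)"
proof -
  have le: "(u z - w z)\<^sup>2 \<le> 2 * (u z - v z)\<^sup>2 + 2 * (v z - w z)\<^sup>2" for z
  proof -
    have "0 \<le> ((u z - v z) - (v z - w z))\<^sup>2" by simp
    then show ?thesis by (simp add: power2_eq_square algebra_simps)
  qed
  have i: "integrable lborel (\<lambda>z. 2 * (u z - v z)\<^sup>2 + 2 * (v z - w z)\<^sup>2)"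
    using assms by auto
  show j: "integrable lborel (\<lambda>z. (u z - w z)\<^sup>2)"
    by (rule Bochner_Integration.integrable_bound[OF i]) (use le in \<open>auto intro!: AE_I2\<close>)
  have "(LINT z|lborel. (u z - w z)\<^sup>2) \<le> (LINT z|lborel. 2 * (u z - v z)\<^sup>2 + 2 * (v z - w z)\<^sup>2)"
    by (intro integral_mono j i le)
  also have "\<dots> = 2 * (LINT z|lborel. (u z - v z)\<^sup>2) + 2 * (LINT z|lborel. (v z - w z)\<^sup>2)"
    using assms by simp
  finally show "(LINT z|lborel. (u z - w z)\<^sup>2) \<le> 2 * (LINT z|lborel. (u z - v z)\<^sup>2) + 2 * (LINT z|lborel. (v z - w z)\<^sup>2)" .
qed

lemma L2_approx_trans:
  assumes "u \<in> borel_measurable borel" "L2_approx u V" "\<And>v. v \<in> V \<Longrightarrow> L2_approx v W"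
  shows "L2_approx u W"
  unfolding L2_approx_def
proof (intro allI impI)
  fix e :: real assume "e > 0"
  then obtain v where v: "v \<in> V" "v \<in> borel_measurable borel" "integrable lborel (\<lambda>z. (u z - v z)\<^sup>2)"
    "(LINT z|lborel. (u z - v z)\<^sup>2) < e / 4"
    using assms(2)[unfolded L2_approx_def, rule_format, of "e / 4"] by auto
  obtain w where w: "w \<in> W" "w \<in> borel_measurable borel" "integrable lborel (\<lambda>z. (v z - w z)\<^sup>2)"
    "(LINT z|lborel. (v z - w z)\<^sup>2) < e / 4"
    using assms(3)[OF v(1), unfolded L2_approx_def, rule_format, of "e / 4"] \<open>e > 0\<close> by auto
  show "\<exists>w\<in>W. w \<in> borel_measurable borel \<and> integrable lborel (\<lambda>z. (u z - w z)\<^sup>2) \<and>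
     (LINT z|lborel. (u z - w z)\<^sup>2) < e"
    using integrable_square_diff[OF assms(1) v(2) w(2) v(3) w(3)] v w
    by (intro bexI[of _ w]) auto
qed

lemma L2_approx_sequence:
  fixes u :: "'a::euclidean_space \<Rightarrow> real"
  assumes [measurable]: "u \<in> borel_measurable borel" "\<And>n. v n \<in> borel_measurable borel"
    and "\<And>n. v n \<in> V"
    and lim: "AE z in lborel. (\<lambda>n. v n z) \<longlonglongrightarrow> u z"
    and bd: "\<And>n. AE z in lborel. (u z - v n z)\<^sup>2 \<le> g z" and g: "integrable lborel g"
  shows "L2_approx u V"
  unfolding L2_approx_def
proof (intro allI impI)
  fix e :: real assume "e > 0"
  have l: "(\<lambda>n. LINT z|lborel. (u z - v n z)\<^sup>2) \<longlonglongrightarrow> (LINT z|(lborel::'a measure). 0)"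
  proof (rule integral_dominated_convergence[where w = g and f = "\<lambda>z. 0" and s = "\<lambda>n z. (u z - v n z)\<^sup>2"])
    show "AE z in lborel. (\<lambda>n. (u z - v n z)\<^sup>2) \<longlonglongrightarrow> 0"
      using lim
    proof eventually_elim
      case (elim z)
      then have "(\<lambda>n. (u z - v n z)\<^sup>2) \<longlonglongrightarrow> (u z - u z)\<^sup>2" by (intro tendsto_intros)
      then show ?case by simp
    qed
    show "AE z in lborel. norm ((u z - v n z)\<^sup>2) \<le> g z" for n using bd[of n] by simp
  qed (use g in measurable)
  then have "\<forall>\<^sub>F n in sequentially. (LINT z|lborel. (u z - v n z)\<^sup>2) < e"
    using \<open>e > 0\<close> by (intro order_tendstoD(2)[OF l]) auto
  then obtain n where n: "(LINT z|lborel. (u z - v n z)\<^sup>2) < e"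
    using eventually_happens by fastforce
  have "integrable lborel (\<lambda>z. (u z - v n z)\<^sup>2)"
    by (rule Bochner_Integration.integrable_bound[OF g]) (use bd[of n] in auto)
  with n show "\<exists>v\<in>V. v \<in> borel_measurable borel \<and> integrable lborel (\<lambda>z. (u z - v z)\<^sup>2) \<and>
     (LINT z|lborel. (u z - v z)\<^sup>2) < e"
    using assms by (intro bexI[of _ "v n"]) auto
qed

lemma smooth_on_real_polynomial_function:
  "real_polynomial_function p \<Longrightarrow> smooth_on UNIV p"
  by (induction rule: real_polynomial_function.induct)
    (auto intro: smooth_intros smooth_on_bounded_linear)

text \<open>A polynomial that approximates u uniformly on a compact set carrying a plateau function
  becomes a test function once multiplied by the latter; Stone-Weierstrass thus takes the place of
  mollification.\<close>

lemma L2_approx_continuous: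
  fixes u :: "'a::euclidean_space \<Rightarrow> real"
  assumes s: "smooth_step \<sigma>" and u: "continuous_on UNIV u" "bounded {z. u z \<noteq> 0}"
  shows "L2_approx u {v. test_function UNIV v}"
  unfolding L2_approx_def
proof (intro allI impI)
  fix e :: real assume "e > 0"
  obtain cut where cut: "test_function UNIV cut" "\<And>z. 0 \<le> cut z" "\<And>z. cut z \<le> 1" "\<And>z. z \<in> {z. u z \<noteq> 0} \<Longrightarrow> cut z = 1"
    using smooth_step_plateau[OF s u(2)] by blast
  obtain K where K: "compact K" "\<And>z. z \<notin> K \<Longrightarrow> cut z = 0"
    using test_functionE[OF cut(1)] by metis
  \<comment> \<open>The summand 1 keeps m positive when K is a null set and makes the final
    inequality strict.\<close>
  define m where "m = measure lborel K + 1"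
  have "m > 0" by (simp add: m_def add_nonneg_pos)
  have "sqrt (e / m) > 0" using \<open>e > 0\<close> \<open>m > 0\<close> by simp
  then obtain p where p: "real_polynomial_function p" "\<And>z. z \<in> K \<Longrightarrow> \<bar>u z - p z\<bar> < sqrt (e / m)"
    using Stone_Weierstrass_real_polynomial_function[OF K(1), of u] u(1)
    by (metis continuous_on_subset subset_UNIV)
  have sp: "smooth_on UNIV p" using p(1) by (rule smooth_on_real_polynomial_function)
  let ?v = "\<lambda>z. cut z * p z"
  have tv: "test_function UNIV ?v" by (intro test_function_mult cut sp)
  have [measurable]: "?v \<in> borel_measurable borel" "u \<in> borel_measurable borel"
    by (intro borel_measurable_continuous_onI smooth_on_imp_continuous_on test_function_smooth[OF tv] u(1))+
  have bd: "(u z - ?v z)\<^sup>2 \<le> indicat_real K z * (e / m)" for z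
  proof (cases "z \<in> K")
    case True
    have "u z - ?v z = cut z * (u z - p z)" using cut(4)[of z] by (cases "u z = 0") (auto simp: algebra_simps)
    then have "\<bar>u z - ?v z\<bar> \<le> 1 * \<bar>u z - p z\<bar>"
      using cut(2,3)[of z] by (simp only: abs_mult) (intro mult_right_mono, auto)
    then have "\<bar>u z - ?v z\<bar> \<le> sqrt (e / m)" using p(2)[OF True] by simp
    then have "(u z - ?v z)\<^sup>2 \<le> (sqrt (e / m))\<^sup>2" by (metis abs_ge_zero power2_abs power_mono)
    then show ?thesis using True \<open>e > 0\<close> \<open>m > 0\<close> by simp
  next
    case False
    then show ?thesis using K(2)[of z] cut(4)[of z] by (cases "u z = 0") auto
  qed
  have i: "integrable lborel (\<lambda>z. indicat_real K z * (e / m))"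
    using integrable_indicator_compact[OF K(1)] by simp
  have j: "integrable lborel (\<lambda>z. (u z - ?v z)\<^sup>2)"
  proof (rule Bochner_Integration.integrable_bound[OF i])
    show "AE z in lborel. norm ((u z - ?v z)\<^sup>2) \<le> norm (indicat_real K z * (e / m))"
      using bd by (intro AE_I2) (smt (verit) real_norm_def zero_le_power2)
  qed measurable
  have "(LINT z|lborel. (u z - ?v z)\<^sup>2) \<le> (LINT z|lborel. indicat_real K z * (e / m))"
    by (intro integral_mono i j bd)
  also have "\<dots> = measure lborel K * (e / m)" by simp
  also have "\<dots> < e" using \<open>e > 0\<close> \<open>m > 0\<close> by (simp add: m_def field_simps)
  finally show "\<exists>v\<in>{v. test_function UNIV v}. v \<in> borel_measurable borel \<and> integrable lborel (\<lambda>z. (u z - v z)\<^sup>2) \<and>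
     (LINT z|lborel. (u z - v z)\<^sup>2) < e"
    using j tv by (intro bexI[of _ ?v]) auto
qed

text \<open>\<open>measurable_on\<close> supplies continuous functions that converge almost
  everywhere. Clipping them to [-M, M] and multiplying by a plateau function gives a dominated
  sequence with the same limit.\<close>

lemma L2_approx_bounded:
  fixes u :: "'a::euclidean_space \<Rightarrow> real"
  assumes s: "smooth_step \<sigma>" and u[measurable]: "u \<in> borel_measurable borel" and M: "\<And>z. \<bar>u z\<bar> \<le> M"
    and b: "bounded {z. u z \<noteq> 0}"
  shows "L2_approx u {v. continuous_on UNIV v \<and> bounded {z. v z \<noteq> 0}}"
proof -
  obtain cut where cut: "test_function UNIV cut" "\<And>z. 0 \<le> cut z" "\<And>z. cut z \<le> 1" "\<And>z. z \<in> {z. u z \<noteq> 0} \<Longrightarrow> cut z = 1"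
    using smooth_step_plateau[OF s b] by blast
  obtain K where K: "compact K" "\<And>z. z \<notin> K \<Longrightarrow> cut z = 0"
    using test_functionE[OF cut(1)] by metis
  have "u measurable_on UNIV"
    using measurable_completion[of u lborel borel] by (simp add: measurable_on_iff_borel_measurable lebesgue_on_UNIV_eq)
  then obtain N g where g: "negligible N" "\<And>n. continuous_on UNIV (g n)"
    "\<And>z. z \<notin> N \<Longrightarrow> (\<lambda>n. g n z) \<longlonglongrightarrow> u z"
    unfolding measurable_on_def by auto
  define v where "v n z = max (- M) (min M (g n z)) * cut z" for n z
  have cv: "continuous_on UNIV (v n)" for n
    unfolding v_def by (intro continuous_intros g smooth_on_imp_continuous_on test_function_smooth[OF cut(1)])
  have "AE z in lebesgue. z \<notin> N"
    using g(1) by (simp add: negligible_iff_null_sets AE_not_in)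
  then have N: "AE z in lborel. z \<notin> N" using AE_completion_iff by auto
  have M0: "M \<ge> 0" using M[of 0] by auto
  show ?thesis
  proof (rule L2_approx_sequence[where v = v and g = "\<lambda>z. indicat_real K z * (2 * M)\<^sup>2"])
    show "v n \<in> {v. continuous_on UNIV v \<and> bounded {z. v z \<noteq> 0}}" for n
      using cv[of n] K by (auto simp: v_def intro!: bounded_subset[OF compact_imp_bounded[OF K(1)]])
    show "v n \<in> borel_measurable borel" for n using cv by (rule borel_measurable_continuous_onI)
    show "AE z in lborel. (\<lambda>n. v n z) \<longlonglongrightarrow> u z"
      using N
    proof eventually_elim
      case (elim z)
      have "(\<lambda>n. v n z) \<longlonglongrightarrow> max (- M) (min M (u z)) * cut z"
        unfolding v_def by (intro tendsto_intros g(3)[OF elim])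
      moreover have "max (- M) (min M (u z)) * cut z = u z"
        using M[of z] cut(4)[of z] by (cases "u z = 0") (auto simp: min_def max_def)
      ultimately show ?case by simp
    qed
    show "AE z in lborel. (u z - v n z)\<^sup>2 \<le> indicat_real K z * (2 * M)\<^sup>2" for n
    proof (rule AE_I2)
      fix z
      show "(u z - v n z)\<^sup>2 \<le> indicat_real K z * (2 * M)\<^sup>2"
      proof (cases "z \<in> K")
        case True
        have "\<bar>max (- M) (min M (g n z)) * cut z\<bar> \<le> M * 1"
          using cut(2,3)[of z] M0 unfolding abs_mult by (intro mult_mono) auto
        then have "\<bar>u z - v n z\<bar> \<le> 2 * M" using M[of z] unfolding v_def by linarith
        then have "(u z - v n z)\<^sup>2 \<le> (2 * M)\<^sup>2" by (metis abs_ge_zero power2_abs power_mono)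
        then show ?thesis using True by simp
      next
        case False
        then show ?thesis using K(2)[of z] cut(4)[of z] by (cases "u z = 0") (auto simp: v_def)
      qed
    qed
    show "integrable lborel (\<lambda>z. indicat_real K z * (2 * M)\<^sup>2)"
      using integrable_indicator_compact[OF K(1)] by simp
  qed (use u in auto)
qed

text \<open>Three approximations are chained: truncation in size and space, then continuous
  functions, then test functions.\<close>

lemma L2_approx_test_functions:
  fixes u :: "'a::euclidean_space \<Rightarrow> real"
  assumes s: "smooth_step \<sigma>" and u[measurable]: "u \<in> borel_measurable borel" and i: "integrable lborel (\<lambda>z. (u z)\<^sup>2)"
  shows "L2_approx u {v. test_function UNIV v}"
proof (rule L2_approx_trans[OF u])
  define v where "v n z = (if norm z \<le> real n \<and> \<bar>u z\<bar> \<le> real n then u z else 0)" for n :: nat and z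
  let ?V = "{v. v \<in> borel_measurable borel \<and> (\<exists>M. \<forall>z. \<bar>v z\<bar> \<le> M) \<and> bounded {z. v z \<noteq> 0}}"
  have [measurable]: "v n \<in> borel_measurable borel" for n unfolding v_def by measurable
  show "L2_approx u ?V"
  proof (rule L2_approx_sequence[where v = v and g = "\<lambda>z. (u z)\<^sup>2"])
    show "v n \<in> ?V" for n
      by (auto simp: v_def intro!: exI[of _ "real n"] boundedI[where B = "real n"] split: if_splits)
    show "AE z in lborel. (\<lambda>n. v n z) \<longlonglongrightarrow> u z"
    proof (rule AE_I2)
      fix z
      obtain m :: nat where m: "max (norm z) \<bar>u z\<bar> \<le> real m" using real_arch_simple by blast
      have "\<forall>\<^sub>F n in sequentially. v n z = u z"
        using eventually_ge_at_top[of m] by eventually_elim (use m in \<open>auto simp: v_def\<close>)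
      then show "(\<lambda>n. v n z) \<longlonglongrightarrow> u z" by (rule tendsto_eventually)
    qed
    show "AE z in lborel. (u z - v n z)\<^sup>2 \<le> (u z)\<^sup>2" for n by (rule AE_I2) (auto simp: v_def)
  qed (use i in auto)
  fix v :: "'a \<Rightarrow> real" assume v: "v \<in> ?V"
  then obtain M where M: "\<And>z. \<bar>v z\<bar> \<le> M" by auto
  show "L2_approx v {v. test_function UNIV v}"
  proof (rule L2_approx_trans)
    show "L2_approx v {v. continuous_on UNIV v \<and> bounded {z. v z \<noteq> 0}}"
      using v by (intro L2_approx_bounded[OF s _ M]) auto
    show "L2_approx f {v. test_function UNIV v}" if "f \<in> {v. continuous_on UNIV v \<and> bounded {z. v z \<noteq> 0}}" for f :: "'a \<Rightarrow> real"
      using that L2_approx_continuous[OF s, of f] by simp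
    show "v \<in> borel_measurable borel" using v by simp
  qed
qed

subsection \<open>The operator and its kernel\<close>

lemma smooth_differentiable: "smooth_on UNIV f \<Longrightarrow> f differentiable (at z)"
  by (rule smooth_on_imp_differentiable) auto

lemma vf_mult:
  assumes "smooth_on UNIV f" "smooth_on UNIV g"
  shows "vf_deriv Z (\<lambda>z. f z * g z) = (\<lambda>z. f z * vf_deriv Z g z + vf_deriv Z f z * g z)"
  using assms by (intro ext vf_deriv_mult smooth_differentiable)

lemma vf_add:
  assumes "smooth_on UNIV f" "smooth_on UNIV g"
  shows "vf_deriv Z (\<lambda>z. f z + g z) = (\<lambda>z. vf_deriv Z f z + vf_deriv Z g z)"
  using assms by (intro ext vf_deriv_add smooth_differentiable)

lemma vf_diff:
  assumes "smooth_on UNIV f" "smooth_on UNIV g"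
  shows "vf_deriv Z (\<lambda>z. f z - g z) = (\<lambda>z. vf_deriv Z f z - vf_deriv Z g z)"
proof -
  have "vf_deriv Z (\<lambda>z. f z + (- 1) * g z) = (\<lambda>z. vf_deriv Z f z + vf_deriv Z (\<lambda>z. (- 1) * g z) z)"
    by (intro vf_add smooth_intros assms) auto
  then show ?thesis
    using vf_deriv_cmult[OF smooth_differentiable[OF assms(2)], of Z "- 1"] by simp
qed

lemma vf_cmult:
  assumes "smooth_on UNIV f"
  shows "vf_deriv Z (\<lambda>z. c * f z) = (\<lambda>z. c * vf_deriv Z f z)"
  using assms by (intro ext vf_deriv_cmult smooth_differentiable)

lemma smooth_on_time:
  "smooth_on UNIV c \<Longrightarrow> smooth_on UNIV (\<lambda>z::'a::euclidean_space \<times> real. c (snd z))"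
  by (rule smooth_on_compose_UNIV[of UNIV snd c]) (auto intro: smooth_on_bounded_linear bounded_linear_snd)

lemma vf_deriv_time:
  fixes c :: "real \<Rightarrow> real"
  assumes "smooth_on UNIV c"
  shows "vf_deriv Z (\<lambda>z. c (snd z)) z = deriv c (snd z) * snd (Z z)"
proof -
  have "(snd has_derivative snd) (at z)" by (rule bounded_linear_imp_has_derivative[OF bounded_linear_snd])
  then have "((\<lambda>z. c (snd z)) has_derivative (\<lambda>v. deriv c (snd z) * snd v)) (at z)"
    using has_derivative_compose[of snd snd z UNIV c "(*) (deriv c (snd z))"]
      smooth_on_imp_has_real_derivative[OF assms, of "snd z"] by (simp add: has_field_derivative_def)
  then show ?thesis by (simp add: vf_deriv_eq)
qed

lemma fubini_compact:
  fixes k :: "'a::euclidean_space \<times> 'b::euclidean_space \<Rightarrow> real"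
  assumes \<psi>: "integrable lborel \<psi>" "compact K" "\<And>z. z \<notin> K \<Longrightarrow> \<psi> z = 0"
    and \<eta>: "integrable lborel \<eta>" "compact L" "\<And>z. z \<notin> L \<Longrightarrow> \<eta> z = 0"
    and k: "continuous_on UNIV k"
  shows "(LINT \<zeta>|lborel. (LINT z|lborel. \<psi> z * k (z, \<zeta>)) * \<eta> \<zeta>)
    = (LINT z|lborel. \<psi> z * (LINT \<zeta>|lborel. k (z, \<zeta>) * \<eta> \<zeta>))"
proof -
  have [measurable]: "\<psi> \<in> borel_measurable borel" "\<eta> \<in> borel_measurable borel" using \<psi> \<eta> by auto
  have "integrable (lborel \<Otimes>\<^sub>M lborel) (\<lambda>p. \<psi> (fst p) * \<eta> (snd p))"
  proof (rule lborel_pair.Fubini_integrable)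
    show "integrable lborel (\<lambda>x. LINT y|lborel. norm (\<psi> (fst (x, y)) * \<eta> (snd (x, y))))"
      using \<psi>(1) \<eta>(1) by (simp add: abs_mult)
  qed (use \<eta> in auto)
  then have "integrable lborel (\<lambda>p. \<psi> (fst p) * \<eta> (snd p))" by (simp add: lborel_prod)
  then have "integrable lborel (\<lambda>p. (\<psi> (fst p) * \<eta> (snd p)) * k p)"
  proof (rule integrable_mult_continuous_compact[OF _ compact_Times[OF \<psi>(2) \<eta>(2)] _ k])
    show "\<psi> (fst z) * \<eta> (snd z) = 0" if "z \<notin> K \<times> L" for z
      using that \<psi>(3)[of "fst z"] \<eta>(3)[of "snd z"] by (cases z) auto
  qed
  then have "integrable (lborel \<Otimes>\<^sub>M lborel) (case_prod (\<lambda>z \<zeta>. \<psi> z * \<eta> \<zeta> * k (z, \<zeta>)))"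
    by (simp add: lborel_prod case_prod_beta')
  from lborel_pair.Fubini_integral[OF this]
  have "(LINT \<zeta>|lborel. (LINT z|lborel. \<psi> z * \<eta> \<zeta> * k (z, \<zeta>)))
    = (LINT z|lborel. (LINT \<zeta>|lborel. \<psi> z * \<eta> \<zeta> * k (z, \<zeta>)))" .
  moreover have "(LINT z|lborel. \<psi> z * \<eta> \<zeta> * k (z, \<zeta>)) = (LINT z|lborel. \<psi> z * k (z, \<zeta>)) * \<eta> \<zeta>" for \<zeta>
  proof -
    have "(LINT z|lborel. \<psi> z * \<eta> \<zeta> * k (z, \<zeta>)) = (LINT z|lborel. (\<psi> z * k (z, \<zeta>)) * \<eta> \<zeta>)"
      by (simp add: mult_ac)
    also have "\<dots> = (LINT z|lborel. \<psi> z * k (z, \<zeta>)) * \<eta> \<zeta>" by (rule integral_mult_left_zero)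
    finally show ?thesis .
  qed
  moreover have "(LINT \<zeta>|lborel. \<psi> z * \<eta> \<zeta> * k (z, \<zeta>)) = \<psi> z * (LINT \<zeta>|lborel. k (z, \<zeta>) * \<eta> \<zeta>)" for z
  proof -
    have "(LINT \<zeta>|lborel. \<psi> z * \<eta> \<zeta> * k (z, \<zeta>)) = (LINT \<zeta>|lborel. \<psi> z * (k (z, \<zeta>) * \<eta> \<zeta>))"
      by (simp add: mult_ac)
    also have "\<dots> = \<psi> z * (LINT \<zeta>|lborel. k (z, \<zeta>) * \<eta> \<zeta>)" by (rule integral_mult_right_zero)
    finally show ?thesis .
  qed
  ultimately show ?thesis by simp
qed

lemma measurable_time [measurable (raw)]:
  fixes f :: "'m \<Rightarrow> 'a::second_countable_topology \<times> real"
  shows "f \<in> borel_measurable M \<Longrightarrow> (\<lambda>x. snd (f x)) \<in> borel_measurable M"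
  by (rule measurable_compose[of f M borel]) (auto intro!: borel_measurable_continuous_onI continuous_on_snd continuous_on_id)

lemma smooth_on_lift: "smooth_on UNIV (X j) \<Longrightarrow> smooth_on UNIV (lift X j)"
  unfolding lift_def
  by (intro smooth_intros open_UNIV smooth_on_compose_UNIV[OF open_UNIV smooth_on_fst[OF open_UNIV smooth_on_id[OF open_UNIV]]])

lemma smooth_on_drift: "smooth_on UNIV (X 0) \<Longrightarrow> smooth_on UNIV (drift X)"
  unfolding drift_def
  by (intro smooth_intros open_UNIV smooth_on_compose_UNIV[OF open_UNIV smooth_on_fst[OF open_UNIV smooth_on_id[OF open_UNIV]]])

text \<open>The properties of the operator and its kernel on which the potential theory rests,
  detached from the group. \<open>smooth_kernel\<close> is joint smoothness in both points.
  \<open>exhaustion\<close> provides cut-offs at infinity on which the operator is arbitrarily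
  small; the dilations will supply them.\<close>

locale evolution =
  fixes m0 :: nat and X :: "nat \<Rightarrow> 'n space \<Rightarrow> 'n::finite space"
    and \<Gamma> :: "'n point \<Rightarrow> 'n point \<Rightarrow> real" and \<sigma> :: "real \<Rightarrow> real"
  assumes step: "smooth_step \<sigma>"
    and smooth_X: "\<And>j. j \<le> m0 \<Longrightarrow> smooth_on UNIV (X j)"
    and div_lift: "\<And>j z. j \<in> {1..m0} \<Longrightarrow> divergence (lift X j) z = 0"
    and div_drift: "\<And>z. divergence (drift X) z = 0"
    and smooth_kernel: "smooth_on {p. fst p \<noteq> snd p} (\<lambda>p. \<Gamma> (fst p) (snd p))"
    and representation: "\<And>\<eta> z. test_function UNIV \<eta> \<Longrightarrow>
      has_bochner_integral lebesgue (\<lambda>\<zeta>. \<Gamma> z \<zeta> * L1_op m0 X \<eta> \<zeta>) (- \<eta> z)"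
    and kernel_nonneg: "\<And>z \<zeta>. 0 \<le> \<Gamma> z \<zeta>"
    and mass_left: "\<And>t \<xi> \<tau>. \<tau> < t \<Longrightarrow> has_bochner_integral lebesgue (\<lambda>y. \<Gamma> (y, t) (\<xi>, \<tau>)) 1"
    and mass_right: "\<And>x t \<tau>. \<tau> < t \<Longrightarrow> has_bochner_integral lebesgue (\<lambda>y. \<Gamma> (x, t) (y, \<tau>)) 1"
    and exhaustion: "\<And>K e. compact K \<Longrightarrow> 0 < e \<Longrightarrow> \<exists>E. test_function UNIV E \<and>
      (\<forall>z. 0 \<le> E z \<and> E z \<le> 1) \<and> (\<forall>z\<in>K. E z = 1) \<and> (\<forall>z. \<bar>L1_op m0 X E z\<bar> \<le> e)"
begin

abbreviation "L \<equiv> L1_op m0 X"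

abbreviation "grad2 f z \<equiv> \<Sum>j=1..m0. (vf_deriv (lift X j) f z)\<^sup>2"

lemma smooth_lift: "j \<in> {1..m0} \<Longrightarrow> smooth_on UNIV (lift X j)"
  by (rule smooth_on_lift) (rule smooth_X, simp)

lemma smooth_drift: "smooth_on UNIV (drift X)"
  by (rule smooth_on_drift) (rule smooth_X, simp)

lemma smooth_vf_lift: "j \<in> {1..m0} \<Longrightarrow> smooth_on UNIV f \<Longrightarrow> smooth_on UNIV (vf_deriv (lift X j) f)"
  by (intro smooth_on_vf_deriv smooth_lift) auto

lemma smooth_vf_drift: "smooth_on UNIV f \<Longrightarrow> smooth_on UNIV (vf_deriv (drift X) f)"
  by (intro smooth_on_vf_deriv smooth_drift) auto

lemma test_vf_lift: "j \<in> {1..m0} \<Longrightarrow> test_function \<Omega> f \<Longrightarrow> test_function \<Omega> (vf_deriv (lift X j) f)"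
  by (intro test_function_vf_deriv smooth_lift)

lemma test_vf_drift: "test_function \<Omega> f \<Longrightarrow> test_function \<Omega> (vf_deriv (drift X) f)"
  by (intro test_function_vf_deriv smooth_drift)

lemma test_L: "test_function \<Omega> f \<Longrightarrow> test_function \<Omega> (L f)"
  unfolding L1_op_def by (intro test_function_add test_function_sum test_vf_lift test_vf_drift)

lemma lift_time: "smooth_on UNIV c \<Longrightarrow> vf_deriv (lift X j) (\<lambda>z. c (snd z)) = (\<lambda>z. 0::real)"
  by (rule ext) (simp add: vf_deriv_time lift_def)

lemma drift_time: "smooth_on UNIV c \<Longrightarrow> vf_deriv (drift X) (\<lambda>z. c (snd z)) = (\<lambda>z. - deriv c (snd z))"
  by (rule ext) (simp add: vf_deriv_time drift_def)

text \<open>The fields X_j have no time component, so a factor depending on time alone commutes with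
  them. Y contains the negative time derivative, whence a single extra term of order zero.\<close>

lemma L_time_mult:
  fixes c :: "real \<Rightarrow> real"
  assumes c: "smooth_on UNIV c" and \<eta>: "smooth_on UNIV \<eta>"
  shows "L (\<lambda>z. c (snd z) * \<eta> z) z = c (snd z) * L \<eta> z - deriv c (snd z) * \<eta> z"
proof -
  note sc = smooth_on_time[OF c]
  have 1: "vf_deriv (lift X j) (\<lambda>z. c (snd z) * f z) = (\<lambda>z. c (snd z) * vf_deriv (lift X j) f z)"
    if "smooth_on UNIV f" for j f
    using vf_mult[OF sc that] by (simp add: lift_time[OF c])
  have 2: "vf_deriv (lift X j) (vf_deriv (lift X j) (\<lambda>z. c (snd z) * \<eta> z)) z
      = c (snd z) * vf_deriv (lift X j) (vf_deriv (lift X j) \<eta>) z" if "j \<in> {1..m0}" for j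
    unfolding 1[OF \<eta>] 1[OF smooth_vf_lift[OF that \<eta>]] ..
  have 3: "vf_deriv (drift X) (\<lambda>z. c (snd z) * \<eta> z) z = c (snd z) * vf_deriv (drift X) \<eta> z - deriv c (snd z) * \<eta> z"
    using vf_mult[OF sc \<eta>] by (simp add: drift_time[OF c])
  have "(\<Sum>j=1..m0. vf_deriv (lift X j) (vf_deriv (lift X j) (\<lambda>z. c (snd z) * \<eta> z)) z)
      = c (snd z) * (\<Sum>j=1..m0. vf_deriv (lift X j) (vf_deriv (lift X j) \<eta>) z)"
    unfolding sum_distrib_left by (intro sum.cong refl 2)
  then show ?thesis
    unfolding L1_op_def 3 by (simp add: distrib_left)
qed

subsection \<open>Mass of the kernel\<close>

text \<open>Nothing is assumed about \<open>\<Gamma> z \<zeta>\<close> when the time of \<open>z\<close> does not exceed that of \<open>\<zeta>\<close>; this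
  part of the kernel is discarded.\<close>

definition G :: "'n point \<Rightarrow> 'n point \<Rightarrow> real" where
  "G z \<zeta> = (if snd \<zeta> < snd z then \<Gamma> z \<zeta> else 0)"

lemma G_nonneg: "0 \<le> G z \<zeta>" by (simp add: G_def kernel_nonneg)

lemma measurable_G [measurable (raw)]:
  assumes "f \<in> borel_measurable M" "g \<in> borel_measurable M"
  shows "(\<lambda>x. G (f x) (g x)) \<in> borel_measurable M"
proof -
  let ?A = "{p :: 'n point \<times> 'n point. snd (snd p) < snd (fst p)}"
  have "open ?A" by (intro open_Collect_less continuous_intros)
  moreover have "continuous_on ?A (\<lambda>p. \<Gamma> (fst p) (snd p))"
    by (rule continuous_on_subset[OF smooth_on_imp_continuous_on[OF smooth_kernel]]) auto
  ultimately have "(\<lambda>p. indicator ?A p *\<^sub>R \<Gamma> (fst p) (snd p)) \<in> borel_measurable borel"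
    by (intro borel_measurable_continuous_on_indicator) auto
  also have "(\<lambda>p. indicator ?A p *\<^sub>R \<Gamma> (fst p) (snd p)) = (\<lambda>p. G (fst p) (snd p))"
    by (auto simp: G_def indicator_def)
  finally have "(\<lambda>p. G (fst p) (snd p)) \<in> borel_measurable borel" .
  from measurable_compose[OF borel_measurable_Pair[OF assms] this] show ?thesis by simp
qed

lemma G_mass_left: "(\<integral>\<^sup>+x. ennreal (G (x, t) \<zeta>) \<partial>lborel) = (if snd \<zeta> < t then 1 else 0)"
proof (cases "snd \<zeta> < t")
  case True
  then have "has_bochner_integral lebesgue (\<lambda>y. \<Gamma> (y, t) \<zeta>) 1"
    using mass_left[of "snd \<zeta>" t "fst \<zeta>"] by simp
  then have "(\<integral>\<^sup>+x. ennreal (\<Gamma> (x, t) \<zeta>) \<partial>lebesgue) = 1"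
    using nn_integral_eq_integral[of lebesgue "\<lambda>y. \<Gamma> (y, t) \<zeta>"] kernel_nonneg
    by (simp add: has_bochner_integral_iff)
  then show ?thesis using True by (simp add: nn_integral_completion G_def)
qed (simp add: G_def)

lemma G_mass_right: "(\<integral>\<^sup>+y. ennreal (G z (y, \<tau>)) \<partial>lborel) = (if \<tau> < snd z then 1 else 0)"
proof (cases "\<tau> < snd z")
  case True
  then have "has_bochner_integral lebesgue (\<lambda>y. \<Gamma> z (y, \<tau>)) 1"
    using mass_right[of \<tau> "snd z" "fst z"] by simp
  then have "(\<integral>\<^sup>+y. ennreal (\<Gamma> z (y, \<tau>)) \<partial>lebesgue) = 1"
    using nn_integral_eq_integral[of lebesgue "\<lambda>y. \<Gamma> z (y, \<tau>)"] kernel_nonneg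
    by (simp add: has_bochner_integral_iff)
  then show ?thesis using True by (simp add: nn_integral_completion G_def)
qed (simp add: G_def)

lemma nn_integral_time_slices:
  fixes f :: "'n point \<Rightarrow> ennreal"
  assumes [measurable]: "f \<in> borel_measurable borel"
  shows "(\<integral>\<^sup>+z. f z \<partial>lborel) = (\<integral>\<^sup>+t. (\<integral>\<^sup>+x. f (x, t) \<partial>lborel) \<partial>lborel)"
proof -
  have "f \<in> borel_measurable (lborel \<Otimes>\<^sub>M lborel)" by (simp add: lborel_prod)
  from lborel_pair.nn_integral_snd[OF this] show ?thesis by (simp add: lborel_prod)
qed

text \<open>On every earlier or later slice the kernel has mass one or zero, so integrating it
  against a function of time leaves a one-dimensional integral over the admissible times.\<close>

lemma G_time_integral_left:
  fixes a :: "real \<Rightarrow> ennreal"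
  assumes [measurable]: "a \<in> borel_measurable borel"
  shows "(\<integral>\<^sup>+z. ennreal (G z \<zeta>) * a (snd z) \<partial>lborel) = (\<integral>\<^sup>+t. (if snd \<zeta> < t then a t else 0) \<partial>lborel)"
proof -
  have "(\<integral>\<^sup>+z. ennreal (G z \<zeta>) * a (snd z) \<partial>lborel)
      = (\<integral>\<^sup>+t. (\<integral>\<^sup>+x. ennreal (G (x, t) \<zeta>) * a t \<partial>lborel) \<partial>lborel)"
    by (subst nn_integral_time_slices) auto
  also have "\<dots> = (\<integral>\<^sup>+t. (\<integral>\<^sup>+x. ennreal (G (x, t) \<zeta>) \<partial>lborel) * a t \<partial>lborel)"
    by (intro nn_integral_cong nn_integral_multc) measurable
  also have "\<dots> = (\<integral>\<^sup>+t. (if snd \<zeta> < t then a t else 0) \<partial>lborel)"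
    by (intro nn_integral_cong) (simp add: G_mass_left)
  finally show ?thesis .
qed

lemma G_time_integral_right:
  fixes a :: "real \<Rightarrow> ennreal"
  assumes [measurable]: "a \<in> borel_measurable borel"
  shows "(\<integral>\<^sup>+\<zeta>. ennreal (G z \<zeta>) * a (snd \<zeta>) \<partial>lborel) = (\<integral>\<^sup>+\<tau>. (if \<tau> < snd z then a \<tau> else 0) \<partial>lborel)"
proof -
  have "(\<integral>\<^sup>+\<zeta>. ennreal (G z \<zeta>) * a (snd \<zeta>) \<partial>lborel)
      = (\<integral>\<^sup>+\<tau>. (\<integral>\<^sup>+y. ennreal (G z (y, \<tau>)) * a \<tau> \<partial>lborel) \<partial>lborel)"
    by (subst nn_integral_time_slices) auto
  also have "\<dots> = (\<integral>\<^sup>+\<tau>. (\<integral>\<^sup>+y. ennreal (G z (y, \<tau>)) \<partial>lborel) * a \<tau> \<partial>lborel)"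
    by (intro nn_integral_cong nn_integral_multc) measurable
  also have "\<dots> = (\<integral>\<^sup>+\<tau>. (if \<tau> < snd z then a \<tau> else 0) \<partial>lborel)"
    by (intro nn_integral_cong) (simp add: G_mass_right)
  finally show ?thesis .
qed

text \<open>Cauchy-Schwarz with respect to the measure of density G a bounds the square of the inner
  integral, and Fubini exchanges the remaining integrals. Both marginals of the kernel reduce to
  time integrals, which are what A and B control; b is a weight in the time of the pole.\<close>

lemma schur_test:
  fixes a :: "real \<Rightarrow> real \<Rightarrow> ennreal" and b :: "real \<Rightarrow> ennreal" and f :: "'n point \<Rightarrow> ennreal"
  assumes a[measurable]: "(\<lambda>p. a (fst p) (snd p)) \<in> borel_measurable borel"
    and b[measurable]: "b \<in> borel_measurable borel"
    and f[measurable]: "f \<in> borel_measurable borel"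
    and A: "\<And>\<tau>. (\<integral>\<^sup>+t. (if \<tau> < t then a t \<tau> else 0) \<partial>lborel) \<le> A"
    and B: "\<And>t. (\<integral>\<^sup>+\<tau>. (if \<tau> < t then a t \<tau> * b \<tau> else 0) \<partial>lborel) \<le> B"
  shows "(\<integral>\<^sup>+\<zeta>. b (snd \<zeta>) * (\<integral>\<^sup>+z. ennreal (G z \<zeta>) * a (snd z) (snd \<zeta>) * f z \<partial>lborel)\<^sup>2 \<partial>lborel)
    \<le> A * B * (\<integral>\<^sup>+z. (f z)\<^sup>2 \<partial>lborel)"
proof -
  have [measurable]: "(\<lambda>x. a (g x) (h x)) \<in> borel_measurable M"
    if "g \<in> borel_measurable M" "h \<in> borel_measurable M" for g h and M :: "'m measure"
    using measurable_compose[OF borel_measurable_Pair[OF that] a] by simp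
  let ?k = "\<lambda>z \<zeta>. ennreal (G z \<zeta>) * a (snd z) (snd \<zeta>)"
  have cs: "(\<integral>\<^sup>+z. ?k z \<zeta> * f z \<partial>lborel)\<^sup>2 \<le> A * (\<integral>\<^sup>+z. ?k z \<zeta> * (f z)\<^sup>2 \<partial>lborel)" for \<zeta>
  proof -
    let ?M = "density lborel (\<lambda>z. ?k z \<zeta>)"
    have "(\<integral>\<^sup>+z. ?k z \<zeta> * f z \<partial>lborel)\<^sup>2 = (\<integral>\<^sup>+z. f z * 1 \<partial>?M)\<^sup>2"
      by (subst nn_integral_density) auto
    also have "\<dots> \<le> (\<integral>\<^sup>+z. (f z)\<^sup>2 \<partial>?M) * (\<integral>\<^sup>+z. 1\<^sup>2 \<partial>?M)"
      by (rule Cauchy_Schwarz_nn_integral) auto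
    also have "\<dots> \<le> (\<integral>\<^sup>+z. (f z)\<^sup>2 \<partial>?M) * A"
    proof (rule mult_left_mono)
      have "(\<integral>\<^sup>+z. 1\<^sup>2 \<partial>?M) = (\<integral>\<^sup>+z. ?k z \<zeta> \<partial>lborel)"
        by (subst nn_integral_density) auto
      also have "\<dots> \<le> A"
        using A[of "snd \<zeta>"] by (subst G_time_integral_left) auto
      finally show "(\<integral>\<^sup>+z. 1\<^sup>2 \<partial>?M) \<le> A" .
    qed simp
    also have "(\<integral>\<^sup>+z. (f z)\<^sup>2 \<partial>?M) = (\<integral>\<^sup>+z. ?k z \<zeta> * (f z)\<^sup>2 \<partial>lborel)"
      by (subst nn_integral_density) auto
    finally show ?thesis by (simp add: mult.commute)
  qed
  have "(\<integral>\<^sup>+\<zeta>. b (snd \<zeta>) * (\<integral>\<^sup>+z. ?k z \<zeta> * f z \<partial>lborel)\<^sup>2 \<partial>lborel)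
      \<le> (\<integral>\<^sup>+\<zeta>. A * (\<integral>\<^sup>+z. b (snd \<zeta>) * (?k z \<zeta> * (f z)\<^sup>2) \<partial>lborel) \<partial>lborel)"
  proof (intro nn_integral_mono)
    fix \<zeta>
    have "b (snd \<zeta>) * (\<integral>\<^sup>+z. ?k z \<zeta> * f z \<partial>lborel)\<^sup>2 \<le> b (snd \<zeta>) * (A * (\<integral>\<^sup>+z. ?k z \<zeta> * (f z)\<^sup>2 \<partial>lborel))"
      by (intro mult_left_mono cs) auto
    also have "\<dots> = A * (b (snd \<zeta>) * (\<integral>\<^sup>+z. ?k z \<zeta> * (f z)\<^sup>2 \<partial>lborel))" by (simp add: mult_ac)
    also have "\<dots> = A * (\<integral>\<^sup>+z. b (snd \<zeta>) * (?k z \<zeta> * (f z)\<^sup>2) \<partial>lborel)"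
      by (subst nn_integral_cmult) auto
    finally show "b (snd \<zeta>) * (\<integral>\<^sup>+z. ?k z \<zeta> * f z \<partial>lborel)\<^sup>2
        \<le> A * (\<integral>\<^sup>+z. b (snd \<zeta>) * (?k z \<zeta> * (f z)\<^sup>2) \<partial>lborel)" .
  qed
  also have "\<dots> = A * (\<integral>\<^sup>+\<zeta>. (\<integral>\<^sup>+z. b (snd \<zeta>) * (?k z \<zeta> * (f z)\<^sup>2) \<partial>lborel) \<partial>lborel)"
    by (rule nn_integral_cmult) measurable
  also have "(\<integral>\<^sup>+\<zeta>. (\<integral>\<^sup>+z. b (snd \<zeta>) * (?k z \<zeta> * (f z)\<^sup>2) \<partial>lborel) \<partial>lborel)
      = (\<integral>\<^sup>+z. (\<integral>\<^sup>+\<zeta>. b (snd \<zeta>) * (?k z \<zeta> * (f z)\<^sup>2) \<partial>lborel) \<partial>lborel)"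
    by (rule lborel_pair.Fubini') measurable
  also have "\<dots> \<le> (\<integral>\<^sup>+z. B * (f z)\<^sup>2 \<partial>lborel)"
  proof (intro nn_integral_mono)
    fix z
    have "(\<integral>\<^sup>+\<zeta>. b (snd \<zeta>) * (?k z \<zeta> * (f z)\<^sup>2) \<partial>lborel) = (\<integral>\<^sup>+\<zeta>. (ennreal (G z \<zeta>) * (a (snd z) (snd \<zeta>) * b (snd \<zeta>))) * (f z)\<^sup>2 \<partial>lborel)"
      by (simp add: mult_ac)
    also have "\<dots> = (\<integral>\<^sup>+\<zeta>. ennreal (G z \<zeta>) * (a (snd z) (snd \<zeta>) * b (snd \<zeta>)) \<partial>lborel) * (f z)\<^sup>2"
      by (rule nn_integral_multc) measurable
    also have "\<dots> \<le> B * (f z)\<^sup>2"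
      using B[of "snd z"] by (subst G_time_integral_right) (auto intro: mult_right_mono)
    finally show "(\<integral>\<^sup>+\<zeta>. b (snd \<zeta>) * (?k z \<zeta> * (f z)\<^sup>2) \<partial>lborel) \<le> B * (f z)\<^sup>2" .
  qed
  also have "\<dots> = B * (\<integral>\<^sup>+z. (f z)\<^sup>2 \<partial>lborel)"
    by (rule nn_integral_cmult) measurable
  finally show ?thesis by (simp add: mult.assoc mult_left_mono)
qed

end

subsection \<open>Potentials with a kernel cut off near the diagonal\<close>

lemma integral_le_of_nn_integral_le:
  fixes f :: "'a \<Rightarrow> real"
  assumes "f \<in> borel_measurable M" "\<And>x. 0 \<le> f x" "(\<integral>\<^sup>+x. ennreal (f x) \<partial>M) \<le> ennreal c" "0 \<le> c"
  shows "integrable M f" "integral\<^sup>L M f \<le> c"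
proof -
  show i: "integrable M f"
    using assms by (intro integrableI_nonneg) (auto intro: le_less_trans ennreal_less_top)
  have "ennreal (integral\<^sup>L M f) \<le> ennreal c"
    using nn_integral_eq_integral[OF i] assms by simp
  then show "integral\<^sup>L M f \<le> c" using assms(4) by simp
qed

lemma continuous_on_section2:
  "continuous_on UNIV k \<Longrightarrow> continuous_on UNIV (\<lambda>\<zeta>. k (z, \<zeta>))"
  by (rule continuous_on_compose2[where g = k]) (auto intro!: continuous_intros)

text \<open>Rises from 0 to 1 for time differences between h and 2 h. Vanishing up to h removes a
  neighbourhood of the diagonal and all pairs in the wrong time order; the derivative is a unit mass
  concentrated between h and 2 h.\<close>

definition ramp :: "(real \<Rightarrow> real) \<Rightarrow> real \<Rightarrow> real \<Rightarrow> real" where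
  "ramp \<sigma> h s = \<sigma> (s / h - 1)"

lemma ramp_props:
  assumes "smooth_step \<sigma>" "h > 0"
  shows "smooth_on UNIV (ramp \<sigma> h)" "0 \<le> ramp \<sigma> h s" "ramp \<sigma> h s \<le> 1" "s \<le> h \<Longrightarrow> ramp \<sigma> h s = 0"
    "s \<ge> 2 * h \<Longrightarrow> ramp \<sigma> h s = 1" "0 \<le> deriv (ramp \<sigma> h) s" "s \<le> h \<Longrightarrow> deriv (ramp \<sigma> h) s = 0"
    "s \<ge> 2 * h \<Longrightarrow> deriv (ramp \<sigma> h) s = 0"
proof -
  have s: "smooth_on UNIV \<sigma>" using assms(1) by (simp add: smooth_step_def)
  show sm: "smooth_on UNIV (ramp \<sigma> h)"
    unfolding ramp_def divide_inverse
    by (intro smooth_on_compose_UNIV[OF open_UNIV _ s] smooth_intros open_UNIV)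
  show "0 \<le> ramp \<sigma> h s" "ramp \<sigma> h s \<le> 1" using smooth_step_bounds[OF assms(1)] by (auto simp: ramp_def)
  show r0: "ramp \<sigma> h s = 0" if "s \<le> h" for s
    using that assms by (simp add: ramp_def smooth_step_def)
  show r1: "ramp \<sigma> h s = 1" if "s \<ge> 2 * h" for s
    using that assms by (simp add: ramp_def smooth_step_def field_simps)
  have "(ramp \<sigma> h has_real_derivative deriv \<sigma> (s / h - 1) * (1 / h)) (at s)" for s
    unfolding ramp_def using assms(2)
    by (intro DERIV_chain2[OF smooth_on_imp_has_real_derivative[OF s]]) (auto intro!: derivative_eq_intros)
  then have dr: "deriv (ramp \<sigma> h) s = deriv \<sigma> (s / h - 1) * (1 / h)" for s by (rule DERIV_imp_deriv)
  then show nn: "0 \<le> deriv (ramp \<sigma> h) s" for s using assms by (simp add: smooth_step_def)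
  have cd: "continuous_on UNIV (deriv (ramp \<sigma> h))"
    by (intro smooth_on_imp_continuous_on smooth_on_deriv sm)
  have lo: "deriv (ramp \<sigma> h) s = 0" if "s < h" for s
  proof (rule DERIV_imp_deriv)
    show "(ramp \<sigma> h has_real_derivative 0) (at s)"
      by (rule has_field_derivative_transform_within_open[where f = "\<lambda>s. 0" and S = "{..<h}"])
        (use that r0 in auto)
  qed
  have hi: "deriv (ramp \<sigma> h) s = 0" if "s > 2 * h" for s
  proof (rule DERIV_imp_deriv)
    show "(ramp \<sigma> h has_real_derivative 0) (at s)"
      by (rule has_field_derivative_transform_within_open[where f = "\<lambda>s. 1" and S = "{2*h<..}"])
        (use that r1 in auto)
  qed
  \<comment> \<open>The derivative vanishes for s < h and is continuous, so the value 0 extends to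
    the end point s = h.\<close>
  show "deriv (ramp \<sigma> h) s = 0" if "s \<le> h" for s
    by (rule continuous_constant_on_closure[of "{..<h}" "deriv (ramp \<sigma> h)"])
      (use lo that cd in \<open>auto intro: continuous_on_subset\<close>)
  show "deriv (ramp \<sigma> h) s = 0" if "s \<ge> 2 * h" for s
    by (rule continuous_constant_on_closure[of "{2 * h<..}" "deriv (ramp \<sigma> h)"])
      (use hi that cd in \<open>auto intro: continuous_on_subset\<close>)
qed

lemma nn_integral_ramp_deriv_left:
  assumes "smooth_step \<sigma>" "h > 0"
  shows "(\<integral>\<^sup>+t. (if \<tau> < t then ennreal (deriv (ramp \<sigma> h) (t - \<tau>)) else 0) \<partial>lborel) = 1"
proof -
  note r = ramp_props[OF assms]
  have bm[measurable]: "deriv (ramp \<sigma> h) \<in> borel_measurable borel"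
    by (intro borel_measurable_continuous_onI smooth_on_imp_continuous_on smooth_on_deriv r)
  have "(\<integral>\<^sup>+t. (if \<tau> < t then ennreal (deriv (ramp \<sigma> h) (t - \<tau>)) else 0) \<partial>lborel)
      = (\<integral>\<^sup>+t. ennreal (deriv (ramp \<sigma> h) (t - \<tau>)) * indicator {\<tau>..} t \<partial>lborel)"
    using r(7)[of 0] assms(2) by (intro nn_integral_cong) (auto simp: indicator_def)
  also have "\<dots> = ennreal (1 - ramp \<sigma> h (\<tau> - \<tau>))"
  proof (rule nn_integral_FTC_atLeast[where F = "\<lambda>t. ramp \<sigma> h (t - \<tau>)"])
    have "((\<lambda>t. ramp \<sigma> h (t - \<tau>)) has_real_derivative deriv (ramp \<sigma> h) (t - \<tau>) * 1) (at t)" for t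
      by (rule DERIV_chain2[OF smooth_on_imp_has_real_derivative[OF r(1)]]) (auto intro!: derivative_eq_intros)
    then show "((\<lambda>t. ramp \<sigma> h (t - \<tau>)) has_real_derivative deriv (ramp \<sigma> h) (t - \<tau>)) (at t)" for t
      by simp
    have "\<forall>\<^sub>F t in at_top. ramp \<sigma> h (t - \<tau>) = 1"
      using eventually_ge_at_top[of "\<tau> + 2 * h"] by eventually_elim (use r(5) in auto)
    then show "((\<lambda>t. ramp \<sigma> h (t - \<tau>)) \<longlongrightarrow> 1) at_top" by (rule tendsto_eventually)
  qed (use r in auto)
  also have "\<dots> = 1" using r(4)[of 0] assms(2) by simp
  finally show ?thesis .
qed

lemma nn_integral_ramp_deriv_right:
  assumes "smooth_step \<sigma>" "h > 0"
  shows "(\<integral>\<^sup>+\<tau>. (if \<tau> < t then ennreal (deriv (ramp \<sigma> h) (t - \<tau>)) else 0) \<partial>lborel) = 1"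
proof -
  have bm[measurable]: "deriv (ramp \<sigma> h) \<in> borel_measurable borel"
    by (intro borel_measurable_continuous_onI smooth_on_imp_continuous_on smooth_on_deriv ramp_props assms)
  have "(\<integral>\<^sup>+\<tau>. (if \<tau> < t then ennreal (deriv (ramp \<sigma> h) (t - \<tau>)) else 0) \<partial>lborel)
      = ennreal \<bar>- 1\<bar> * (\<integral>\<^sup>+\<tau>. (if t + - 1 * \<tau> < t then ennreal (deriv (ramp \<sigma> h) (t - (t + - 1 * \<tau>))) else 0) \<partial>lborel)"
    by (rule nn_integral_real_affine) auto
  also have "\<dots> = (\<integral>\<^sup>+\<tau>. (if 0 < \<tau> then ennreal (deriv (ramp \<sigma> h) (\<tau> - 0)) else 0) \<partial>lborel)"
    by (simp cong: if_cong)
  also have "\<dots> = 1" by (rule nn_integral_ramp_deriv_left[OF assms])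
  finally show ?thesis .
qed

context evolution
begin

text \<open>The integration runs over the first argument: a potential for the transposed kernel,
  viewed as a function of the pole. With the ramp for c it is the potential of the duality argument,
  with the derivative of the ramp it is the source of that potential.\<close>

definition pot :: "(real \<Rightarrow> real) \<Rightarrow> ('n point \<Rightarrow> real) \<Rightarrow> 'n point \<Rightarrow> real" where
  "pot c \<psi> \<zeta> = (LINT z|lborel. \<psi> z * (\<Gamma> z \<zeta> * c (snd z - snd \<zeta>)))"

text \<open>Off the diagonal both factors are smooth, and where the time difference is below h the
  product is identically 0. The two open sets cover the space because times agree on the diagonal
  and h > 0.\<close>

lemma smooth_cut_kernel:
  assumes c: "smooth_on UNIV c" and "h > 0" "\<And>s. s \<le> h \<Longrightarrow> c s = 0"
  shows "smooth_on UNIV (\<lambda>p. \<Gamma> (fst p) (snd p) * c (snd (fst p) - snd (snd p)))"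
proof -
  let ?A = "{p :: 'n point \<times> 'n point. fst p \<noteq> snd p}" and ?B = "{p :: 'n point \<times> 'n point. snd (fst p) - snd (snd p) < h}"
  have A: "open ?A" by (intro open_Collect_neq continuous_intros)
  have B: "open ?B" by (intro open_Collect_less continuous_intros)
  have "smooth_on UNIV (\<lambda>p :: 'n point \<times> 'n point. snd (fst p) - snd (snd p))"
    by (intro smooth_intros open_UNIV)
  then have "smooth_on UNIV (\<lambda>p :: 'n point \<times> 'n point. c (snd (fst p) - snd (snd p)))"
    using c by (rule smooth_on_compose_UNIV[OF open_UNIV])
  then have "smooth_on ?A (\<lambda>p. \<Gamma> (fst p) (snd p) * c (snd (fst p) - snd (snd p)))"
    by (intro smooth_on_mult A smooth_kernel) (rule smooth_on_subset, auto)
  moreover have "smooth_on ?B (\<lambda>p. \<Gamma> (fst p) (snd p) * c (snd (fst p) - snd (snd p)))"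
    using B assms(3) by (subst smooth_on_cong[where g = "\<lambda>p. 0"]) (auto intro: smooth_on_const)
  ultimately have "smooth_on (?A \<union> ?B) (\<lambda>p. \<Gamma> (fst p) (snd p) * c (snd (fst p) - snd (snd p)))"
    by (rule smooth_on_Un[OF A B])
  moreover have "?A \<union> ?B = UNIV" using \<open>h > 0\<close> by auto
  ultimately show ?thesis by simp
qed

section \<open>Integration by parts for the operator and its formal adjoint\<close>

text \<open>The fields are divergence-free, hence antisymmetric, so the formal adjoint of L is the
  sum of the X_j^2 minus Y. The two integrands differ by derivatives, along the fields, of compactly
  supported functions.\<close>

lemma adjoint:
  assumes V: "smooth_on UNIV V" and \<eta>: "test_function UNIV \<eta>"
  shows "(LINT z|lborel. V z * L \<eta> z) =
    (LINT z|lborel. ((\<Sum>j=1..m0. vf_deriv (lift X j) (vf_deriv (lift X j) V) z) - vf_deriv (drift X) V z) * \<eta> z)"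
proof -
  let ?F = "\<lambda>j z. \<eta> z * vf_deriv (lift X j) V z" and ?G = "\<lambda>j z. vf_deriv (lift X j) \<eta> z * V z"
  have s\<eta>: "smooth_on UNIV \<eta>" using \<eta> by (rule test_function_smooth)
  have tF: "test_function UNIV (?F j)" if "j \<in> {1..m0}" for j
    using that by (intro test_function_mult \<eta> smooth_vf_lift V)
  have tG: "test_function UNIV (?G j)" if "j \<in> {1..m0}" for j
    using that by (intro test_function_mult test_vf_lift \<eta> V)
  have tY: "test_function UNIV (\<lambda>z. \<eta> z * V z)" by (intro test_function_mult \<eta> V)
  have X0: "(LINT z|lborel. vf_deriv (lift X j) f z) = 0" if "j \<in> {1..m0}" "test_function UNIV f" for j f
    using that by (intro integral_vf_deriv_zero smooth_lift div_lift)
  have Xi: "integrable lborel (vf_deriv (lift X j) f)" if "j \<in> {1..m0}" "test_function UNIV f" for j f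
    by (rule test_function_integrable[OF test_vf_lift[OF that]])
  have Y0: "(LINT z|lborel. vf_deriv (drift X) (\<lambda>z. \<eta> z * V z) z) = 0"
    by (intro integral_vf_deriv_zero smooth_drift div_drift tY)
  have Yi: "integrable lborel (vf_deriv (drift X) (\<lambda>z. \<eta> z * V z))"
    by (rule test_function_integrable[OF test_vf_drift[OF tY]])
  have sV: "smooth_on UNIV (vf_deriv (lift X j) V)" "smooth_on UNIV (vf_deriv (lift X j) \<eta>)" if "j \<in> {1..m0}" for j
    using that by (auto intro: smooth_vf_lift V s\<eta>)
  have pw: "V z * L \<eta> z = ((\<Sum>j=1..m0. vf_deriv (lift X j) (vf_deriv (lift X j) V) z) - vf_deriv (drift X) V z) * \<eta> z
      + (\<Sum>j=1..m0. vf_deriv (lift X j) (?G j) z - vf_deriv (lift X j) (?F j) z) + vf_deriv (drift X) (\<lambda>z. \<eta> z * V z) z" for z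
  proof -
    have "vf_deriv (lift X j) (?G j) z - vf_deriv (lift X j) (?F j) z
        = V z * vf_deriv (lift X j) (vf_deriv (lift X j) \<eta>) z - vf_deriv (lift X j) (vf_deriv (lift X j) V) z * \<eta> z"
      if "j \<in> {1..m0}" for j
      unfolding vf_mult[OF s\<eta> sV(1)[OF that]] vf_mult[OF sV(2)[OF that] V] by (simp add: algebra_simps)
    then have "(\<Sum>j=1..m0. vf_deriv (lift X j) (?G j) z - vf_deriv (lift X j) (?F j) z)
      = (\<Sum>j=1..m0. V z * vf_deriv (lift X j) (vf_deriv (lift X j) \<eta>) z - vf_deriv (lift X j) (vf_deriv (lift X j) V) z * \<eta> z)"
      by (intro sum.cong) auto
    also have "\<dots> = V z * (\<Sum>j=1..m0. vf_deriv (lift X j) (vf_deriv (lift X j) \<eta>) z)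
        - (\<Sum>j=1..m0. vf_deriv (lift X j) (vf_deriv (lift X j) V) z) * \<eta> z"
      by (simp only: sum_subtractf sum_distrib_left sum_distrib_right)
    finally have s: "(\<Sum>j=1..m0. vf_deriv (lift X j) (?G j) z - vf_deriv (lift X j) (?F j) z)
      = V z * (\<Sum>j=1..m0. vf_deriv (lift X j) (vf_deriv (lift X j) \<eta>) z)
        - (\<Sum>j=1..m0. vf_deriv (lift X j) (vf_deriv (lift X j) V) z) * \<eta> z" .
    show ?thesis
      unfolding L1_op_def s vf_mult[OF s\<eta> V] by (simp add: algebra_simps)
  qed
  have i1: "integrable lborel (\<lambda>z. ((\<Sum>j=1..m0. vf_deriv (lift X j) (vf_deriv (lift X j) V) z) - vf_deriv (drift X) V z) * \<eta> z)"
    by (subst mult.commute, intro test_function_integrable[OF test_function_mult[OF \<eta>]] smooth_on_diff smooth_on_sum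
        smooth_vf_lift smooth_vf_drift V open_UNIV)
  have i2: "integrable lborel (\<lambda>z. \<Sum>j=1..m0. vf_deriv (lift X j) (?G j) z - vf_deriv (lift X j) (?F j) z)"
    by (intro Bochner_Integration.integrable_sum Bochner_Integration.integrable_diff Xi tF tG)
  have "(LINT z|lborel. (\<Sum>j=1..m0. vf_deriv (lift X j) (?G j) z - vf_deriv (lift X j) (?F j) z))
    = (\<Sum>j=1..m0. (LINT z|lborel. vf_deriv (lift X j) (?G j) z - vf_deriv (lift X j) (?F j) z))"
    by (intro Bochner_Integration.integral_sum Bochner_Integration.integrable_diff Xi tF tG)
  also have "\<dots> = (\<Sum>j=1..m0. 0)"
  proof (intro sum.cong refl)
    fix j assume j: "j \<in> {1..m0}"
    show "(LINT z|lborel. vf_deriv (lift X j) (?G j) z - vf_deriv (lift X j) (?F j) z) = 0"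
      using Bochner_Integration.integral_diff[OF Xi[OF j tG[OF j]] Xi[OF j tF[OF j]]]
        X0[OF j tG[OF j]] X0[OF j tF[OF j]] by simp
  qed
  finally have "(LINT z|lborel. (\<Sum>j=1..m0. vf_deriv (lift X j) (?G j) z - vf_deriv (lift X j) (?F j) z)) = 0" by simp
  then show ?thesis
    unfolding pw using i1 i2 Yi Y0 by simp
qed

text \<open>The equation is multiplied by E V and integrated by parts. The mixed terms (X_j E) V
  (X_j V) contain half the derivative of V^2 and are integrated once more, so that E remains only
  through L E and no gradient of V has to be absorbed.\<close>

lemma energy_identity:
  assumes V: "smooth_on UNIV V" and P: "smooth_on UNIV P" and E: "test_function UNIV E"
    and eq: "\<And>z. (\<Sum>j=1..m0. vf_deriv (lift X j) (vf_deriv (lift X j) V) z) - vf_deriv (drift X) V z = - P z"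
  shows "(LINT z|lborel. E z * grad2 V z) = (LINT z|lborel. E z * (P z * V z)) + (LINT z|lborel. L E z * ((V z)\<^sup>2 / 2))"
proof -
  \<comment> \<open>The first summand is the flux of the integration by parts with E V, the second
    one disposes of the mixed terms.\<close>
  let ?F = "\<lambda>j z. (E z * V z) * vf_deriv (lift X j) V z - vf_deriv (lift X j) E z * ((1 / 2) * (V z * V z))"
  let ?Y = "\<lambda>z. E z * ((1 / 2) * (V z * V z))"
  have sE: "smooth_on UNIV E" using E by (rule test_function_smooth)
  have sEV: "smooth_on UNIV (\<lambda>z. E z * V z)" and sVV: "smooth_on UNIV (\<lambda>z. V z * V z)"
    and sVV2: "smooth_on UNIV (\<lambda>z. (1 / 2) * (V z * V z))"
    by (intro smooth_intros sE V open_UNIV)+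
  have sV: "smooth_on UNIV (vf_deriv (lift X j) V)" "smooth_on UNIV (vf_deriv (lift X j) E)" if "j \<in> {1..m0}" for j
    using that by (auto intro: smooth_vf_lift V sE)
  have tF: "test_function UNIV (?F j)" if "j \<in> {1..m0}" for j
    using that by (intro test_function_diff test_function_mult test_vf_lift E sV V sVV2)
  have tY: "test_function UNIV ?Y" by (intro test_function_mult E sVV2)
  have Xi: "integrable lborel (vf_deriv (lift X j) (?F j))" if "j \<in> {1..m0}" for j
    by (rule test_function_integrable[OF test_vf_lift[OF that tF[OF that]]])
  have X0: "(LINT z|lborel. vf_deriv (lift X j) (?F j) z) = 0" if "j \<in> {1..m0}" for j
    using that by (intro integral_vf_deriv_zero smooth_lift div_lift tF)
  have Y0: "(LINT z|lborel. vf_deriv (drift X) ?Y z) = 0"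
    by (intro integral_vf_deriv_zero smooth_drift div_drift tY)
  have Yi: "integrable lborel (vf_deriv (drift X) ?Y)"
    by (rule test_function_integrable[OF test_vf_drift[OF tY]])
  have pw: "E z * grad2 V z = E z * (P z * V z) + L E z * ((V z)\<^sup>2 / 2)
      + (\<Sum>j=1..m0. vf_deriv (lift X j) (?F j) z) - vf_deriv (drift X) ?Y z" for z
  proof -
    have "vf_deriv (lift X j) (?F j) z = E z * (vf_deriv (lift X j) V z)\<^sup>2
        + E z * V z * vf_deriv (lift X j) (vf_deriv (lift X j) V) z
        - vf_deriv (lift X j) (vf_deriv (lift X j) E) z * ((V z)\<^sup>2 / 2)"
      if j: "j \<in> {1..m0}" for j
    proof -
      have "smooth_on UNIV (\<lambda>z. (E z * V z) * vf_deriv (lift X j) V z)"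
        "smooth_on UNIV (\<lambda>z. vf_deriv (lift X j) E z * ((1 / 2) * (V z * V z)))"
        by (intro smooth_on_mult sEV sV[OF j] sVV2 open_UNIV)+
      from vf_diff[OF this, of "lift X j"] show ?thesis
        unfolding vf_mult[OF sEV sV(1)[OF j]] vf_mult[OF sE V] vf_mult[OF sV(2)[OF j] sVV2]
            vf_cmult[OF sVV] vf_mult[OF V V] by (simp add: power2_eq_square algebra_simps)
    qed
    then have "(\<Sum>j=1..m0. vf_deriv (lift X j) (?F j) z) = (\<Sum>j=1..m0. E z * (vf_deriv (lift X j) V z)\<^sup>2
        + E z * V z * vf_deriv (lift X j) (vf_deriv (lift X j) V) z
        - vf_deriv (lift X j) (vf_deriv (lift X j) E) z * ((V z)\<^sup>2 / 2))"
      by (intro sum.cong) auto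
    also have "\<dots> = E z * grad2 V z + E z * V z * (\<Sum>j=1..m0. vf_deriv (lift X j) (vf_deriv (lift X j) V) z)
        - (\<Sum>j=1..m0. vf_deriv (lift X j) (vf_deriv (lift X j) E) z) * ((V z)\<^sup>2 / 2)"
      by (simp only: sum.distrib sum_subtractf sum_distrib_left sum_distrib_right)
    also have "(\<Sum>j=1..m0. vf_deriv (lift X j) (vf_deriv (lift X j) V) z) = vf_deriv (drift X) V z - P z"
      using eq[of z] by simp
    finally have 1: "(\<Sum>j=1..m0. vf_deriv (lift X j) (?F j) z) = E z * grad2 V z + E z * V z * (vf_deriv (drift X) V z - P z)
        - (\<Sum>j=1..m0. vf_deriv (lift X j) (vf_deriv (lift X j) E) z) * ((V z)\<^sup>2 / 2)" .
    have 2: "vf_deriv (drift X) ?Y z = E z * V z * vf_deriv (drift X) V z + vf_deriv (drift X) E z * ((V z)\<^sup>2 / 2)"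
      unfolding vf_mult[OF sE sVV2] vf_cmult[OF sVV] vf_mult[OF V V]
      by (simp add: power2_eq_square algebra_simps)
    show ?thesis unfolding 1 2 L1_op_def by (simp add: algebra_simps)
  qed
  have i1: "integrable lborel (\<lambda>z. E z * (P z * V z))"
    by (intro test_function_integrable[OF test_function_mult[OF E]] smooth_on_mult P V open_UNIV)
  have i2: "integrable lborel (\<lambda>z. L E z * ((V z)\<^sup>2 / 2))"
    unfolding divide_inverse
    by (intro test_function_integrable[OF test_function_mult[OF test_L[OF E]]] smooth_intros V open_UNIV)
  have i3: "integrable lborel (\<lambda>z. \<Sum>j=1..m0. vf_deriv (lift X j) (?F j) z)"
    by (intro Bochner_Integration.integrable_sum Xi)
  have "(LINT z|lborel. (\<Sum>j=1..m0. vf_deriv (lift X j) (?F j) z)) = (\<Sum>j=1..m0. (LINT z|lborel. vf_deriv (lift X j) (?F j) z))"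
    by (intro Bochner_Integration.integral_sum Xi)
  also have "\<dots> = 0" using X0 by (intro sum.neutral) auto
  finally have i4: "(LINT z|lborel. (\<Sum>j=1..m0. vf_deriv (lift X j) (?F j) z)) = 0" .
  show ?thesis
    unfolding pw using i1 i2 i3 i4 Yi Y0 by simp
qed

end

section \<open>Potentials of a fixed dual function\<close>

text \<open>\<psi> is the dual function. S will be the time length of the small cylinder and
  \<delta> the distance kept from its top; both enter the estimates only through the times at which
  \<psi> is non-zero.\<close>

locale potential = evolution m0 X \<Gamma> \<sigma>
  for m0 :: nat and X :: "nat \<Rightarrow> 'n space \<Rightarrow> 'n::finite space" and \<Gamma> :: "'n point \<Rightarrow> 'n point \<Rightarrow> real" and \<sigma> +
  fixes \<psi> :: "'n point \<Rightarrow> real" and K :: "'n point set" and M S \<delta> :: real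
  assumes psi_measurable [measurable]: "\<psi> \<in> borel_measurable borel"
    and psi_bounds: "\<And>z. 0 \<le> \<psi> z" "\<And>z. \<psi> z \<le> M"
    and psi_support: "compact K" "\<And>z. z \<notin> K \<Longrightarrow> \<psi> z = 0"
    and psi_time: "\<And>z. \<psi> z \<noteq> 0 \<Longrightarrow> - S \<le> snd z \<and> snd z \<le> - \<delta>"
    and S_pos: "0 < S" and delta_pos: "0 < \<delta>"
begin

lemma integrable_psi: "integrable lborel \<psi>"
proof (rule Bochner_Integration.integrable_bound)
  show "integrable lborel (\<lambda>z. indicat_real K z * M)" using integrable_indicator_compact[OF psi_support(1)] by simp
  show "AE z in lborel. norm (\<psi> z) \<le> norm (indicat_real K z * M)"
  proof (rule AE_I2)
    show "norm (\<psi> z) \<le> norm (indicat_real K z * M)" for z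
      using psi_bounds[of z] psi_support(2)[of z] by (cases "z \<in> K") auto
  qed
qed simp

lemma integrable_psi2: "integrable lborel (\<lambda>z. (\<psi> z)\<^sup>2)"
proof (rule Bochner_Integration.integrable_bound)
  show "integrable lborel (\<lambda>z. M * \<psi> z)" using integrable_psi by simp
  show "AE z in lborel. norm ((\<psi> z)\<^sup>2) \<le> norm (M * \<psi> z)"
  proof (rule AE_I2)
    show "norm ((\<psi> z)\<^sup>2) \<le> norm (M * \<psi> z)" for z
      using psi_bounds[of z] by (auto simp: power2_eq_square abs_mult intro!: mult_right_mono)
  qed
qed simp

definition "N = (LINT z|lborel. (\<psi> z)\<^sup>2)"

lemma N_nonneg: "0 \<le> N" unfolding N_def by (rule Bochner_Integration.integral_nonneg) simp

lemma nn_N: "(\<integral>\<^sup>+z. (ennreal (\<psi> z))\<^sup>2 \<partial>lborel) = ennreal N"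
  unfolding N_def using nn_integral_eq_integral[OF integrable_psi2] psi_bounds(1)
  by (simp add: ennreal_power)

context
  fixes c :: "real \<Rightarrow> real" and h :: real
  assumes c: "smooth_on UNIV c" and h: "0 < h" and c0: "\<And>s. s \<le> h \<Longrightarrow> c s = 0" and c_nonneg: "\<And>s. 0 \<le> c s"
begin

lemma cut_kernel_continuous: "continuous_on UNIV (\<lambda>p. \<Gamma> (fst p) (snd p) * c (snd (fst p) - snd (snd p)))"
  by (intro smooth_on_imp_continuous_on smooth_cut_kernel[OF c h c0])

lemma pot_smooth: "smooth_on UNIV (pot c \<psi>)"
  using smooth_on_parametric_integral[OF integrable_psi psi_support smooth_cut_kernel[OF c h c0]]
  unfolding pot_def by simp

lemma pot_nonneg: "0 \<le> pot c \<psi> \<zeta>"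
  unfolding pot_def by (intro Bochner_Integration.integral_nonneg mult_nonneg_nonneg psi_bounds kernel_nonneg c_nonneg)

lemma pot_zero: "- \<delta> - h \<le> snd \<zeta> \<Longrightarrow> pot c \<psi> \<zeta> = 0"
proof -
  assume a: "- \<delta> - h \<le> snd \<zeta>"
  have "\<psi> z * (\<Gamma> z \<zeta> * c (snd z - snd \<zeta>)) = 0" for z
    using psi_time[of z] c0[of "snd z - snd \<zeta>"] a by (cases "\<psi> z = 0") auto
  then show ?thesis unfolding pot_def by (simp only: integral_zero)
qed

text \<open>Since c vanishes for non-positive time differences, \<Gamma> may be replaced by G, and
  with that the masses on time slices become available.\<close>

lemma pot_nn: "ennreal (pot c \<psi> \<zeta>) = (\<integral>\<^sup>+z. ennreal (G z \<zeta>) * ennreal (c (snd z - snd \<zeta>)) * ennreal (\<psi> z) \<partial>lborel)"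
proof -
  have "integrable lborel (\<lambda>z. \<psi> z * (\<Gamma> z \<zeta> * c (snd z - snd \<zeta>)))"
    using integrable_mult_continuous_compact[OF integrable_psi psi_support continuous_on_section[OF cut_kernel_continuous, of \<zeta>]]
    by simp
  then have "ennreal (pot c \<psi> \<zeta>) = (\<integral>\<^sup>+z. ennreal (\<psi> z * (\<Gamma> z \<zeta> * c (snd z - snd \<zeta>))) \<partial>lborel)"
    unfolding pot_def
    by (rule nn_integral_eq_integral[symmetric]) (simp add: psi_bounds kernel_nonneg c_nonneg)
  also have "\<dots> = (\<integral>\<^sup>+z. ennreal (G z \<zeta>) * ennreal (c (snd z - snd \<zeta>)) * ennreal (\<psi> z) \<partial>lborel)"
  proof (intro nn_integral_cong)
    fix z
    have "\<Gamma> z \<zeta> * c (snd z - snd \<zeta>) = G z \<zeta> * c (snd z - snd \<zeta>)"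
      using c0[of "snd z - snd \<zeta>"] h by (auto simp: G_def)
    then have "\<psi> z * (\<Gamma> z \<zeta> * c (snd z - snd \<zeta>)) = G z \<zeta> * c (snd z - snd \<zeta>) * \<psi> z"
      by (metis mult.commute)
    then show "ennreal (\<psi> z * (\<Gamma> z \<zeta> * c (snd z - snd \<zeta>)))
        = ennreal (G z \<zeta>) * ennreal (c (snd z - snd \<zeta>)) * ennreal (\<psi> z)"
      by (simp only: ennreal_mult G_nonneg c_nonneg psi_bounds mult_nonneg_nonneg)
  qed
  finally show ?thesis .
qed

lemma pot_swap:
  assumes "integrable lborel \<eta>" "compact K'" "\<And>z. z \<notin> K' \<Longrightarrow> \<eta> z = 0"
  shows "(LINT \<zeta>|lborel. pot c \<psi> \<zeta> * \<eta> \<zeta>) = (LINT z|lborel. \<psi> z * (LINT \<zeta>|lborel. (\<Gamma> z \<zeta> * c (snd z - snd \<zeta>)) * \<eta> \<zeta>))"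
  using fubini_compact[OF integrable_psi psi_support assms cut_kernel_continuous] unfolding pot_def by simp

end

text \<open>The representation formula at z, applied to c(t_z - \<tau>) \<eta>(\<zeta>), moves L
  from \<eta> to a factor c' on the kernel. Integrating against \<psi> and moving L onto the
  potential gives the equation in weak form, and both sides are smooth.\<close>

lemma pot_pointwise:
  assumes c: "smooth_on UNIV c" and h: "0 < h" and c0: "\<And>s. s \<le> h \<Longrightarrow> c s = 0"
    and d0: "\<And>s. s \<le> h \<Longrightarrow> deriv c s = 0" and c_nonneg: "\<And>s. 0 \<le> c s" "\<And>s. 0 \<le> deriv c s"
  shows "(\<Sum>j=1..m0. vf_deriv (lift X j) (vf_deriv (lift X j) (pot c \<psi>)) \<zeta>) - vf_deriv (drift X) (pot c \<psi>) \<zeta> = - pot (deriv c) \<psi> \<zeta>"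
proof -
  note dc = smooth_on_deriv[OF c]
  let ?W = "\<lambda>\<zeta>. (\<Sum>j=1..m0. vf_deriv (lift X j) (vf_deriv (lift X j) (pot c \<psi>)) \<zeta>) - vf_deriv (drift X) (pot c \<psi>) \<zeta>"
  have sV: "smooth_on UNIV (pot c \<psi>)" by (rule pot_smooth[OF c h c0 c_nonneg(1)])
  have sP: "smooth_on UNIV (pot (deriv c) \<psi>)" by (rule pot_smooth[OF dc h d0 c_nonneg(2)])
  have sW: "smooth_on UNIV ?W"
    by (intro smooth_on_diff smooth_on_sum smooth_vf_lift smooth_vf_drift sV open_UNIV)
  have "?W \<zeta> + pot (deriv c) \<psi> \<zeta> = 0"
  proof (rule fundamental_lemma[OF step, where g = "\<lambda>\<zeta>. ?W \<zeta> + pot (deriv c) \<psi> \<zeta>"])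
    show "continuous_on UNIV (\<lambda>\<zeta>. ?W \<zeta> + pot (deriv c) \<psi> \<zeta>)"
      by (intro smooth_on_imp_continuous_on smooth_on_add sW sP open_UNIV)
    fix \<eta> :: "'n point \<Rightarrow> real" assume \<eta>: "test_function UNIV \<eta>"
    have s\<eta>: "smooth_on UNIV \<eta>" using \<eta> by (rule test_function_smooth)
    obtain K1 where K1: "compact K1" "\<And>z. z \<notin> K1 \<Longrightarrow> \<eta> z = 0"
      using test_functionE[OF \<eta>] by metis
    obtain K2 where K2: "compact K2" "\<And>z. z \<notin> K2 \<Longrightarrow> L \<eta> z = 0"
      using test_functionE[OF test_L[OF \<eta>]] by metis
    have z: "(LINT \<zeta>|lborel. (\<Gamma> z \<zeta> * c (snd z - snd \<zeta>)) * L \<eta> \<zeta>)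
        = - (LINT \<zeta>|lborel. (\<Gamma> z \<zeta> * deriv c (snd z - snd \<zeta>)) * \<eta> \<zeta>)" for z
    proof -
      let ?c = "\<lambda>\<tau>. c (snd z - \<tau>)"
      have sc: "smooth_on UNIV ?c"
        by (intro smooth_on_compose_UNIV[OF open_UNIV _ c] smooth_intros open_UNIV)
      have "(?c has_real_derivative deriv c (snd z - \<tau>) * (- 1)) (at \<tau>)" for \<tau>
        by (rule DERIV_chain2[OF smooth_on_imp_has_real_derivative[OF c]]) (auto intro!: derivative_eq_intros)
      then have dc': "deriv ?c \<tau> = - deriv c (snd z - \<tau>)" for \<tau>
        using DERIV_imp_deriv by fastforce
      have "test_function UNIV (\<lambda>\<zeta>. \<eta> \<zeta> * ?c (snd \<zeta>))"
        by (intro test_function_mult \<eta> smooth_on_time[OF sc])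
      then have t: "test_function UNIV (\<lambda>\<zeta>. ?c (snd \<zeta>) * \<eta> \<zeta>)" by (simp add: mult.commute)
      have e: "L (\<lambda>\<zeta>. ?c (snd \<zeta>) * \<eta> \<zeta>) \<zeta> = c (snd z - snd \<zeta>) * L \<eta> \<zeta> + deriv c (snd z - snd \<zeta>) * \<eta> \<zeta>" for \<zeta>
        by (subst L_time_mult[OF sc s\<eta>]) (simp add: dc')
      have kc: "continuous_on UNIV (\<lambda>\<zeta>. \<Gamma> z \<zeta> * c (snd z - snd \<zeta>))"
        "continuous_on UNIV (\<lambda>\<zeta>. \<Gamma> z \<zeta> * deriv c (snd z - snd \<zeta>))"
        using continuous_on_section2[OF cut_kernel_continuous[OF c h c0 c_nonneg(1)], of z]
          continuous_on_section2[OF cut_kernel_continuous[OF dc h d0 c_nonneg(2)], of z] by simp_all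
      have i1: "integrable lborel (\<lambda>\<zeta>. L \<eta> \<zeta> * (\<Gamma> z \<zeta> * c (snd z - snd \<zeta>)))"
        by (rule integrable_mult_continuous_compact[OF test_function_integrable[OF test_L[OF \<eta>]] K2 kc(1)])
      have i2: "integrable lborel (\<lambda>\<zeta>. \<eta> \<zeta> * (\<Gamma> z \<zeta> * deriv c (snd z - snd \<zeta>)))"
        by (rule integrable_mult_continuous_compact[OF test_function_integrable[OF \<eta>] K1 kc(2)])
      have split: "\<Gamma> z \<zeta> * L (\<lambda>\<zeta>. ?c (snd \<zeta>) * \<eta> \<zeta>) \<zeta>
          = L \<eta> \<zeta> * (\<Gamma> z \<zeta> * c (snd z - snd \<zeta>)) + \<eta> \<zeta> * (\<Gamma> z \<zeta> * deriv c (snd z - snd \<zeta>))" for \<zeta>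
        unfolding e by (simp add: algebra_simps)
      \<comment> \<open>As c 0 = 0, the test function vanishes at z itself, so the formula returns
        0.\<close>
      have "has_bochner_integral lebesgue (\<lambda>\<zeta>. \<Gamma> z \<zeta> * L (\<lambda>\<zeta>. ?c (snd \<zeta>) * \<eta> \<zeta>) \<zeta>) 0"
        using representation[OF t, of z] c0[of 0] h by simp
      then have "(LINT \<zeta>|lebesgue. \<Gamma> z \<zeta> * L (\<lambda>\<zeta>. ?c (snd \<zeta>) * \<eta> \<zeta>) \<zeta>) = 0"
        by (rule has_bochner_integral_integral_eq)
      then have "(LINT \<zeta>|lborel. L \<eta> \<zeta> * (\<Gamma> z \<zeta> * c (snd z - snd \<zeta>)) + \<eta> \<zeta> * (\<Gamma> z \<zeta> * deriv c (snd z - snd \<zeta>))) = 0"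
        unfolding split using i1 i2 by (subst (asm) integral_completion) auto
      then show ?thesis using i1 i2 by (simp add: mult.commute)
    qed
    have iW: "integrable lborel (\<lambda>\<zeta>. \<eta> \<zeta> * ?W \<zeta>)"
      by (rule test_function_integrable[OF test_function_mult[OF \<eta> sW]])
    have iP: "integrable lborel (\<lambda>\<zeta>. \<eta> \<zeta> * pot (deriv c) \<psi> \<zeta>)"
      by (rule test_function_integrable[OF test_function_mult[OF \<eta> sP]])
    have "(LINT \<zeta>|lborel. ?W \<zeta> * \<eta> \<zeta>) = (LINT \<zeta>|lborel. pot c \<psi> \<zeta> * L \<eta> \<zeta>)"
      by (rule adjoint[OF sV \<eta>, symmetric])
    also have "\<dots> = (LINT z|lborel. \<psi> z * (LINT \<zeta>|lborel. (\<Gamma> z \<zeta> * c (snd z - snd \<zeta>)) * L \<eta> \<zeta>))"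
      by (rule pot_swap[OF c h c0 c_nonneg(1) test_function_integrable[OF test_L[OF \<eta>]] K2])
    also have "\<dots> = - (LINT z|lborel. \<psi> z * (LINT \<zeta>|lborel. (\<Gamma> z \<zeta> * deriv c (snd z - snd \<zeta>)) * \<eta> \<zeta>))"
      unfolding z by simp
    also have "(LINT z|lborel. \<psi> z * (LINT \<zeta>|lborel. (\<Gamma> z \<zeta> * deriv c (snd z - snd \<zeta>)) * \<eta> \<zeta>))
        = (LINT \<zeta>|lborel. pot (deriv c) \<psi> \<zeta> * \<eta> \<zeta>)"
      by (rule pot_swap[OF dc h d0 c_nonneg(2) test_function_integrable[OF \<eta>] K1, symmetric])
    finally have e: "(LINT \<zeta>|lborel. \<eta> \<zeta> * ?W \<zeta>) = - (LINT \<zeta>|lborel. \<eta> \<zeta> * pot (deriv c) \<psi> \<zeta>)"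
      by (simp add: mult.commute)
    have pw: "(?W \<zeta> + pot (deriv c) \<psi> \<zeta>) * \<eta> \<zeta> = \<eta> \<zeta> * ?W \<zeta> + \<eta> \<zeta> * pot (deriv c) \<psi> \<zeta>" for \<zeta>
      by (simp only: distrib_left mult.commute[of _ "\<eta> \<zeta>"])
    show "(LINT \<zeta>|lborel. (?W \<zeta> + pot (deriv c) \<psi> \<zeta>) * \<eta> \<zeta>) = 0"
      unfolding pw using Bochner_Integration.integral_add[OF iW iP] e by simp
  qed
  then show ?thesis by simp
qed

end

section \<open>Young inequalities for sums and elliptic forms\<close>

lemma sum_Young:
  fixes x y :: "nat \<Rightarrow> real"
  assumes "s > 0"
  shows "(\<Sum>j\<in>J. x j * y j) \<le> (s * (\<Sum>j\<in>J. (x j)\<^sup>2) + (\<Sum>j\<in>J. (y j)\<^sup>2) / s) / 2"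
proof -
  have "x j * y j \<le> (s * (x j)\<^sup>2 + (y j)\<^sup>2 / s) / 2" for j
  proof -
    have "0 \<le> (s * x j - y j)\<^sup>2 / s" using assms by simp
    also have "\<dots> = s * (x j)\<^sup>2 - 2 * (x j * y j) + (y j)\<^sup>2 / s"
      using assms by (simp add: power2_eq_square field_simps)
    finally show ?thesis by simp
  qed
  then have "(\<Sum>j\<in>J. x j * y j) \<le> (\<Sum>j\<in>J. (s * (x j)\<^sup>2 + (y j)\<^sup>2 / s) / 2)" by (intro sum_mono)
  also have "\<dots> = (s * (\<Sum>j\<in>J. (x j)\<^sup>2) + (\<Sum>j\<in>J. (y j)\<^sup>2) / s) / 2"
    by (simp add: sum_divide_distrib sum.distrib sum_distrib_left add_divide_distrib)
  finally show ?thesis .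
qed

text \<open>Non-negativity of the form at x + c y and at x - c y bounds the mixed term by the
  diagonal ones, which the upper ellipticity bound controls; c = 1 / s distributes the
  weight.\<close>

lemma elliptic_form_Young:
  fixes A :: "nat \<Rightarrow> nat \<Rightarrow> real" and m :: nat
  assumes sym: "\<And>i j. i \<in> {1..m} \<Longrightarrow> j \<in> {1..m} \<Longrightarrow> A i j = A j i"
    and ell: "\<And>\<xi>. 0 \<le> (\<Sum>i=1..m. \<Sum>j=1..m. A i j * \<xi> i * \<xi> j)"
      "\<And>\<xi>. (\<Sum>i=1..m. \<Sum>j=1..m. A i j * \<xi> i * \<xi> j) \<le> lam * (\<Sum>i=1..m. (\<xi> i)\<^sup>2)"
    and s: "s > 0" and lam: "lam \<ge> 0"
  shows "\<bar>\<Sum>i=1..m. \<Sum>j=1..m. x i * A i j * y j\<bar> \<le> lam * (s * (\<Sum>i=1..m. (x i)\<^sup>2) + (\<Sum>i=1..m. (y i)\<^sup>2) / s) / 2"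
proof -
  define q where "q u v = (\<Sum>i=1..m. \<Sum>j=1..m. A i j * u i * v j)" for u v :: "nat \<Rightarrow> real"
  have q_sym: "q u v = q v u" for u v
  proof -
    have "q u v = (\<Sum>j=1..m. \<Sum>i=1..m. A i j * u i * v j)" unfolding q_def by (rule sum.swap)
    also have "\<dots> = (\<Sum>j=1..m. \<Sum>i=1..m. A j i * v j * u i)"
      by (intro sum.cong refl) (simp add: sym mult_ac)
    finally show ?thesis by (simp add: q_def)
  qed
  have q_add: "q (\<lambda>i. u i + c * v i) (\<lambda>i. u i + c * v i) = q u u + 2 * c * q u v + c\<^sup>2 * q v v" for u v c
  proof -
    have "q (\<lambda>i. u i + c * v i) (\<lambda>i. u i + c * v i) = q u u + c * q u v + c * q v u + c\<^sup>2 * q v v"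
      unfolding q_def sum_distrib_left sum.distrib[symmetric]
      by (intro sum.cong refl) (simp add: power2_eq_square algebra_simps)
    then show ?thesis by (simp add: q_sym[of v u])
  qed
  define c where "c = 1 / s"
  have c: "c > 0" "c * s = 1" using s by (auto simp: c_def)
  have qle: "q u u \<le> lam * (\<Sum>i=1..m. (u i)\<^sup>2)" "0 \<le> q u u" for u using ell by (auto simp: q_def)
  have key: "4 * c * \<bar>q x y\<bar> \<le> 2 * lam * (\<Sum>i=1..m. (x i)\<^sup>2) + 2 * c\<^sup>2 * (lam * (\<Sum>i=1..m. (y i)\<^sup>2))"
  proof -
    have p: "0 \<le> q x x + 2 * c * q x y + c\<^sup>2 * q y y"
      using qle(2)[of "\<lambda>i. x i + c * y i"] unfolding q_add .
    have n: "0 \<le> q x x - 2 * c * q x y + c\<^sup>2 * q y y"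
      using qle(2)[of "\<lambda>i. x i + (- c) * y i"] unfolding q_add by simp
    have 1: "q x x \<le> lam * (\<Sum>i=1..m. (x i)\<^sup>2)" by (rule qle)
    have 2: "c\<^sup>2 * q y y \<le> c\<^sup>2 * (lam * (\<Sum>i=1..m. (y i)\<^sup>2))" by (intro mult_left_mono qle) simp
    have e: "4 * c * \<bar>q x y\<bar> = 2 * \<bar>2 * c * q x y\<bar>" using c by (simp add: abs_mult)
    have "\<bar>2 * c * q x y\<bar> \<le> q x x + c\<^sup>2 * q y y" using p n by (intro abs_leI) linarith+
    then show ?thesis using 1 2 e by linarith
  qed
  have "\<bar>q x y\<bar> = (c * s) * \<bar>q x y\<bar>" using c by simp
  also have "\<dots> = s / 4 * (4 * c * \<bar>q x y\<bar>)" by (simp add: mult_ac)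
  also have "\<dots> \<le> s / 4 * (2 * lam * (\<Sum>i=1..m. (x i)\<^sup>2) + 2 * c\<^sup>2 * (lam * (\<Sum>i=1..m. (y i)\<^sup>2)))"
    using key s by (intro mult_left_mono) auto
  also have "\<dots> = lam * (s * (\<Sum>i=1..m. (x i)\<^sup>2) + (\<Sum>i=1..m. (y i)\<^sup>2) / s) / 2"
    using s by (simp add: c_def power2_eq_square field_simps)
  finally show ?thesis by (simp add: q_def mult_ac)
qed

section \<open>Square-integral and energy bounds for the potential and its source\<close>

context potential
begin

abbreviation "V h \<equiv> pot (ramp \<sigma> h) \<psi>"
abbreviation "P h \<equiv> pot (deriv (ramp \<sigma> h)) \<psi>"

lemma V_props:
  assumes h: "h > 0"
  shows "smooth_on UNIV (V h)" "0 \<le> V h \<zeta>" "- \<delta> \<le> snd \<zeta> \<Longrightarrow> V h \<zeta> = 0"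
proof -
  note r = ramp_props[OF step h]
  note c = r(1) h r(4) r(2)
  show "smooth_on UNIV (V h)" by (rule pot_smooth[OF c])
  show "0 \<le> V h \<zeta>" by (rule pot_nonneg[OF c])
  show "V h \<zeta> = 0" if "- \<delta> \<le> snd \<zeta>" using pot_zero[OF c, of \<zeta>] that h by linarith
qed

lemma P_props:
  assumes h: "h > 0"
  shows "smooth_on UNIV (P h)" "0 \<le> P h \<zeta>" "- \<delta> \<le> snd \<zeta> \<Longrightarrow> P h \<zeta> = 0" "snd \<zeta> \<le> - S - 2 * h \<Longrightarrow> P h \<zeta> = 0"
proof -
  note r = ramp_props[OF step h]
  note c = smooth_on_deriv[OF r(1)] h r(7) r(6)
  show "smooth_on UNIV (P h)" by (rule pot_smooth[OF c])
  show "0 \<le> P h \<zeta>" by (rule pot_nonneg[OF c])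
  show "P h \<zeta> = 0" if "- \<delta> \<le> snd \<zeta>" using pot_zero[OF c, of \<zeta>] that h by linarith
  assume a: "snd \<zeta> \<le> - S - 2 * h"
  have "\<psi> z * (\<Gamma> z \<zeta> * deriv (ramp \<sigma> h) (snd z - snd \<zeta>)) = 0" for z
    using psi_time[of z] r(8)[of "snd z - snd \<zeta>"] a by (cases "\<psi> z = 0") auto
  then show "P h \<zeta> = 0" unfolding pot_def by (simp only: integral_zero)
qed

lemma V_equation:
  assumes h: "h > 0"
  shows "(\<Sum>j=1..m0. vf_deriv (lift X j) (vf_deriv (lift X j) (V h)) \<zeta>) - vf_deriv (drift X) (V h) \<zeta> = - P h \<zeta>"
  by (rule pot_pointwise[OF ramp_props(1)[OF step h] h ramp_props(4,7,2,6)[OF step h]])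

lemma measurable_V: "h > 0 \<Longrightarrow> V h \<in> borel_measurable borel"
  and measurable_P: "h > 0 \<Longrightarrow> P h \<in> borel_measurable borel"
  by (intro borel_measurable_continuous_onI smooth_on_imp_continuous_on V_props P_props; assumption)+

text \<open>The derivative of the ramp has unit mass in each of its two time variables, so both
  Schur constants are 1, uniformly in h.\<close>

lemma P_L2:
  assumes h: "h > 0"
  shows "integrable lborel (\<lambda>\<zeta>. (P h \<zeta>)\<^sup>2)" "(LINT \<zeta>|lborel. (P h \<zeta>)\<^sup>2) \<le> N"
proof -
  note r = ramp_props[OF step h]
  have [measurable]: "deriv (ramp \<sigma> h) \<in> borel_measurable borel"
    by (intro borel_measurable_continuous_onI smooth_on_imp_continuous_on smooth_on_deriv r)
  let ?a = "\<lambda>t \<tau>. ennreal (deriv (ramp \<sigma> h) (t - \<tau>))"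
  have am: "(\<lambda>p. ?a (fst p) (snd p)) \<in> borel_measurable borel"
    unfolding borel_prod[symmetric] by measurable
  have "(\<integral>\<^sup>+\<zeta>. 1 * (\<integral>\<^sup>+z. ennreal (G z \<zeta>) * ?a (snd z) (snd \<zeta>) * ennreal (\<psi> z) \<partial>lborel)\<^sup>2 \<partial>lborel)
      \<le> 1 * 1 * (\<integral>\<^sup>+z. (ennreal (\<psi> z))\<^sup>2 \<partial>lborel)"
    by (rule schur_test[OF am])
      (use nn_integral_ramp_deriv_left[OF step h] nn_integral_ramp_deriv_right[OF step h] in \<open>auto cong: if_cong\<close>)
  moreover have "ennreal (P h \<zeta>) = (\<integral>\<^sup>+z. ennreal (G z \<zeta>) * ?a (snd z) (snd \<zeta>) * ennreal (\<psi> z) \<partial>lborel)" for \<zeta>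
    by (rule pot_nn[OF smooth_on_deriv[OF r(1)] h r(7) r(6)])
  ultimately have "(\<integral>\<^sup>+\<zeta>. ennreal ((P h \<zeta>)\<^sup>2) \<partial>lborel) \<le> ennreal N"
    using P_props(2)[OF h] by (simp add: nn_N flip: ennreal_power)
  then show "integrable lborel (\<lambda>\<zeta>. (P h \<zeta>)\<^sup>2)" "(LINT \<zeta>|lborel. (P h \<zeta>)\<^sup>2) \<le> N"
    using measurable_P[OF h] N_nonneg
    by (auto intro!: integral_le_of_nn_integral_le[of "\<lambda>\<zeta>. (P h \<zeta>)\<^sup>2" lborel N])
qed

text \<open>The support of \<psi> allows the kernel to be multiplied by the indicator of [-S, 0].
  With the ramp bounded by 1, the Schur constants are then the interval lengths S and T. This is one
  source of the small factor in the final estimate.\<close>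

lemma V_L2:
  assumes h: "h > 0" and T: "T \<ge> 0"
  shows "integrable lborel (\<lambda>\<zeta>. indicat_real {- T..0} (snd \<zeta>) * (V h \<zeta>)\<^sup>2)"
    "(LINT \<zeta>|lborel. indicat_real {- T..0} (snd \<zeta>) * (V h \<zeta>)\<^sup>2) \<le> S * T * N"
proof -
  note r = ramp_props[OF step h]
  have [measurable]: "ramp \<sigma> h \<in> borel_measurable borel"
    by (intro borel_measurable_continuous_onI smooth_on_imp_continuous_on r)
  let ?a = "\<lambda>t \<tau>. ennreal (indicat_real {- S..0} t * ramp \<sigma> h (t - \<tau>))"
  let ?b = "\<lambda>\<tau>. ennreal (indicat_real {- T..0} \<tau>)"
  have am: "(\<lambda>p. ?a (fst p) (snd p)) \<in> borel_measurable borel"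
    unfolding borel_prod[symmetric] by measurable
  have A: "(\<integral>\<^sup>+t. (if \<tau> < t then ?a t \<tau> else 0) \<partial>lborel) \<le> ennreal S" for \<tau>
  proof -
    have "(\<integral>\<^sup>+t. (if \<tau> < t then ?a t \<tau> else 0) \<partial>lborel) \<le> (\<integral>\<^sup>+t. indicator {- S..0} t \<partial>lborel)"
      using r(2,3) by (intro nn_integral_mono) (auto simp: indicator_def)
    also have "\<dots> = ennreal S" using S_pos by simp
    finally show ?thesis .
  qed
  have B: "(\<integral>\<^sup>+\<tau>. (if \<tau> < t then ?a t \<tau> * ?b \<tau> else 0) \<partial>lborel) \<le> ennreal T" for t
  proof -
    have "(\<integral>\<^sup>+\<tau>. (if \<tau> < t then ?a t \<tau> * ?b \<tau> else 0) \<partial>lborel) \<le> (\<integral>\<^sup>+\<tau>. indicator {- T..0} \<tau> \<partial>lborel)"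
      using r(2,3) by (intro nn_integral_mono) (auto simp: indicator_def)
    also have "\<dots> = ennreal T" using T by simp
    finally show ?thesis .
  qed
  have "(\<integral>\<^sup>+\<zeta>. ?b (snd \<zeta>) * (\<integral>\<^sup>+z. ennreal (G z \<zeta>) * ?a (snd z) (snd \<zeta>) * ennreal (\<psi> z) \<partial>lborel)\<^sup>2 \<partial>lborel)
      \<le> ennreal S * ennreal T * (\<integral>\<^sup>+z. (ennreal (\<psi> z))\<^sup>2 \<partial>lborel)"
    by (rule schur_test[OF am _ _ A B]) auto
  moreover have "ennreal (V h \<zeta>) = (\<integral>\<^sup>+z. ennreal (G z \<zeta>) * ?a (snd z) (snd \<zeta>) * ennreal (\<psi> z) \<partial>lborel)" for \<zeta>
  proof -
    have "ennreal (V h \<zeta>) = (\<integral>\<^sup>+z. ennreal (G z \<zeta>) * ennreal (ramp \<sigma> h (snd z - snd \<zeta>)) * ennreal (\<psi> z) \<partial>lborel)"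
      by (rule pot_nn[OF r(1) h r(4) r(2)])
    also have "\<dots> = (\<integral>\<^sup>+z. ennreal (G z \<zeta>) * ?a (snd z) (snd \<zeta>) * ennreal (\<psi> z) \<partial>lborel)"
    proof (intro nn_integral_cong)
      fix z
      show "ennreal (G z \<zeta>) * ennreal (ramp \<sigma> h (snd z - snd \<zeta>)) * ennreal (\<psi> z)
        = ennreal (G z \<zeta>) * ?a (snd z) (snd \<zeta>) * ennreal (\<psi> z)"
        using psi_time[of z] delta_pos by (cases "\<psi> z = 0") (auto simp: indicator_def)
    qed
    finally show ?thesis .
  qed
  moreover have "?b (snd \<zeta>) * (ennreal (V h \<zeta>))\<^sup>2 = ennreal (indicat_real {- T..0} (snd \<zeta>) * (V h \<zeta>)\<^sup>2)" for \<zeta>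
    using V_props(2)[OF h] by (auto simp: indicator_def ennreal_power)
  ultimately have "(\<integral>\<^sup>+\<zeta>. ennreal (indicat_real {- T..0} (snd \<zeta>) * (V h \<zeta>)\<^sup>2) \<partial>lborel) \<le> ennreal (S * T * N)"
    using S_pos T N_nonneg by (simp add: nn_N ennreal_mult)
  moreover have "(\<lambda>\<zeta>. indicat_real {- T..0} (snd \<zeta>) * (V h \<zeta>)\<^sup>2) \<in> borel_measurable lborel"
    using measurable_V[OF h] by measurable
  ultimately show "integrable lborel (\<lambda>\<zeta>. indicat_real {- T..0} (snd \<zeta>) * (V h \<zeta>)\<^sup>2)"
    "(LINT \<zeta>|lborel. indicat_real {- T..0} (snd \<zeta>) * (V h \<zeta>)\<^sup>2) \<le> S * T * N"
    using S_pos T N_nonneg by (auto intro!: integral_le_of_nn_integral_le)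
qed

text \<open>As 2 h \<le> S, the source lives in times above -2 S, so the bound for V is used with T
  = 2 S. Young's inequality with weight S gives S / 2 from the source and S from V.\<close>

lemma PV_bound:
  assumes h: "h > 0" "2 * h \<le> S"
  shows "integrable lborel (\<lambda>\<zeta>. P h \<zeta> * V h \<zeta>)" "(LINT \<zeta>|lborel. P h \<zeta> * V h \<zeta>) \<le> 3 / 2 * S * N"
proof -
  note V2 = V_L2[OF h(1), of "2 * S"] and P2 = P_L2[OF h(1)]
  let ?g = "\<lambda>\<zeta>. (S / 2) * (P h \<zeta>)\<^sup>2 + (1 / (2 * S)) * (indicat_real {- (2 * S)..0} (snd \<zeta>) * (V h \<zeta>)\<^sup>2)"
  have le: "P h \<zeta> * V h \<zeta> \<le> ?g \<zeta>" for \<zeta>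
  proof (cases "- (2 * S) \<le> snd \<zeta> \<and> snd \<zeta> \<le> 0")
    case True
    have "0 \<le> (S * P h \<zeta> - V h \<zeta>)\<^sup>2 / (2 * S)" using S_pos by simp
    also have "\<dots> = (S / 2) * (P h \<zeta>)\<^sup>2 - P h \<zeta> * V h \<zeta> + (1 / (2 * S)) * (V h \<zeta>)\<^sup>2"
      using S_pos by (simp add: power2_eq_square field_simps)
    finally show ?thesis using True by (simp add: indicator_def)
  next
    case False
    then have "P h \<zeta> = 0" using P_props(3,4)[OF h(1), of \<zeta>] h delta_pos by force
    then show ?thesis using S_pos by (simp add: indicator_def)
  qed
  have ig: "integrable lborel ?g" using P2(1) V2(1) S_pos by simp
  show i: "integrable lborel (\<lambda>\<zeta>. P h \<zeta> * V h \<zeta>)"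
  proof (rule Bochner_Integration.integrable_bound[OF ig])
    show "(\<lambda>\<zeta>. P h \<zeta> * V h \<zeta>) \<in> borel_measurable lborel"
      using measurable_P[OF h(1)] measurable_V[OF h(1)] by simp
    show "AE \<zeta> in lborel. norm (P h \<zeta> * V h \<zeta>) \<le> norm (?g \<zeta>)"
      using le P_props(2)[OF h(1)] V_props(2)[OF h(1)] by (intro AE_I2) (smt (verit) mult_nonneg_nonneg real_norm_def)
  qed
  have "(LINT \<zeta>|lborel. P h \<zeta> * V h \<zeta>) \<le> (LINT \<zeta>|lborel. ?g \<zeta>)"
    by (intro integral_mono i ig le)
  also have "\<dots> = (S / 2) * (LINT \<zeta>|lborel. (P h \<zeta>)\<^sup>2) + (1 / (2 * S)) * (LINT \<zeta>|lborel. indicat_real {- (2 * S)..0} (snd \<zeta>) * (V h \<zeta>)\<^sup>2)"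
    using P2(1) V2(1) S_pos by simp
  also have "\<dots> \<le> (S / 2) * N + (1 / (2 * S)) * (S * (2 * S) * N)"
    using P2(2) V2(2) S_pos by (intro add_mono mult_left_mono) auto
  also have "\<dots> = 3 / 2 * S * N" using S_pos by (simp add: field_simps)
  finally show "(LINT \<zeta>|lborel. P h \<zeta> * V h \<zeta>) \<le> 3 / 2 * S * N" .
qed

text \<open>The energy identity is used with the product of a time cut-off \<rho> and a spatial
  exhaustion E. The derivative of \<rho> enters with a favourable sign because \<rho> increases, and
  L E is so small that its contribution stays below e.\<close>

lemma gradient_bound:
  assumes h: "h > 0" "2 * h \<le> S" and T: "T \<ge> 0" and K0: "compact K0" "\<And>z. z \<in> K0 \<Longrightarrow> - T \<le> snd z" and e: "e > 0"
  shows "(LINT z|lborel. indicat_real K0 z * grad2 (V h) z) \<le> 3 / 2 * S * N + e"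
proof -
  \<comment> \<open>An upper bound for the integral of V^2 over the times in [-(T + 1), 0]; the
    summand 1 makes it positive.\<close>
  let ?B = "S * (T + 1) * N + 1"
  have B: "?B > 0" using S_pos T N_nonneg by (simp add: add_nonneg_pos)
  obtain E where E: "test_function UNIV E" "\<And>z. 0 \<le> E z" "\<And>z. E z \<le> 1" "\<And>z. z \<in> K0 \<Longrightarrow> E z = 1" "\<And>z. \<bar>L E z\<bar> \<le> e / ?B"
    using exhaustion[OF K0(1), of "e / ?B"] e B by (metis divide_pos_pos)
  define \<rho> where "\<rho> s = \<sigma> (s + T + 1)" for s
  have s\<sigma>: "smooth_on UNIV \<sigma>" using step by (simp add: smooth_step_def)
  have \<rho>: "smooth_on UNIV \<rho>"
    unfolding \<rho>_def by (intro smooth_on_compose_UNIV[OF open_UNIV _ s\<sigma>] smooth_intros open_UNIV)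
  have "(\<rho> has_real_derivative deriv \<sigma> (s + T + 1) * 1) (at s)" for s
    unfolding \<rho>_def by (rule DERIV_chain2[OF smooth_on_imp_has_real_derivative[OF s\<sigma>]]) (auto intro!: derivative_eq_intros)
  then have "deriv \<rho> s = deriv \<sigma> (s + T + 1)" for s by (simp add: DERIV_imp_deriv)
  then have d\<rho>: "0 \<le> deriv \<rho> s" for s using step by (simp add: smooth_step_def)
  have \<rho>b: "0 \<le> \<rho> s" "\<rho> s \<le> 1" "s \<le> - (T + 1) \<Longrightarrow> \<rho> s = 0" "- T \<le> s \<Longrightarrow> \<rho> s = 1" for s
    using smooth_step_bounds[OF step] step by (auto simp: \<rho>_def smooth_step_def)
  let ?E = "\<lambda>z. \<rho> (snd z) * E z"
  have "test_function UNIV (\<lambda>z. E z * \<rho> (snd z))" by (intro test_function_mult E smooth_on_time \<rho>)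
  then have tE: "test_function UNIV ?E" by (simp add: mult.commute)
  have LE: "L ?E z = \<rho> (snd z) * L E z - deriv \<rho> (snd z) * E z" for z
    by (rule L_time_mult[OF \<rho> test_function_smooth[OF E(1)]])
  have sV: "smooth_on UNIV (V h)" and sP: "smooth_on UNIV (P h)" by (intro V_props P_props h)+
  have sg: "smooth_on UNIV (grad2 (V h))"
    by (intro smooth_on_sum smooth_on_power smooth_vf_lift sV open_UNIV)
  have i1: "integrable lborel (\<lambda>z. ?E z * grad2 (V h) z)"
    by (rule test_function_integrable[OF test_function_mult[OF tE sg]])
  have gnn: "0 \<le> grad2 (V h) z" for z by (intro sum_nonneg) simp
  have b1: "indicat_real K0 z * grad2 (V h) z \<le> ?E z * grad2 (V h) z" for z
    using E(2,4)[of z] \<rho>b(1,4)[of "snd z"] K0(2)[of z] gnn[of z]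
    by (intro mult_right_mono) (auto simp: indicator_def)
  have i0: "integrable lborel (\<lambda>z. indicat_real K0 z * grad2 (V h) z)"
    by (rule integrable_mult_continuous_compact[OF integrable_indicator_compact[OF K0(1)] K0(1) _ smooth_on_imp_continuous_on[OF sg]]) auto
  have "(LINT z|lborel. indicat_real K0 z * grad2 (V h) z) \<le> (LINT z|lborel. ?E z * grad2 (V h) z)"
    by (intro integral_mono i0 i1 b1)
  also have "\<dots> = (LINT z|lborel. ?E z * (P h z * V h z)) + (LINT z|lborel. L ?E z * ((V h z)\<^sup>2 / 2))"
    by (rule energy_identity[OF sV sP tE V_equation[OF h(1)]])
  also have "\<dots> \<le> 3 / 2 * S * N + e"
  proof (rule add_mono)
    have "(LINT z|lborel. ?E z * (P h z * V h z)) \<le> (LINT z|lborel. P h z * V h z)"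
    proof (rule integral_mono)
      show "integrable lborel (\<lambda>z. ?E z * (P h z * V h z))"
        by (rule test_function_integrable[OF test_function_mult[OF tE smooth_on_mult[OF open_UNIV sP sV]]])
      show "?E z * (P h z * V h z) \<le> P h z * V h z" for z
        using E(2,3)[of z] \<rho>b(1,2)[of "snd z"] P_props(2)[OF h(1), of z] V_props(2)[OF h(1), of z]
        by (intro mult_left_le_one_le mult_nonneg_nonneg) (auto intro: mult_le_one)
    qed (rule PV_bound[OF h])
    then show "(LINT z|lborel. ?E z * (P h z * V h z)) \<le> 3 / 2 * S * N" using PV_bound(2)[OF h] by simp
    have T1: "T + 1 \<ge> 0" using T by simp
    note V2 = V_L2[OF h(1) T1]
    have "(LINT z|lborel. L ?E z * ((V h z)\<^sup>2 / 2)) \<le> (LINT z|lborel. (e / ?B) * (indicat_real {- (T + 1)..0} (snd z) * (V h z)\<^sup>2))"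
    proof (rule integral_mono)
      show "integrable lborel (\<lambda>z. L ?E z * ((V h z)\<^sup>2 / 2))"
        unfolding divide_inverse
        by (intro test_function_integrable[OF test_function_mult[OF test_L[OF tE]]] smooth_intros sV open_UNIV)
      show "integrable lborel (\<lambda>z. (e / ?B) * (indicat_real {- (T + 1)..0} (snd z) * (V h z)\<^sup>2))"
        by (intro integrable_mult_right V2(1))
      show "L ?E z * ((V h z)\<^sup>2 / 2) \<le> (e / ?B) * (indicat_real {- (T + 1)..0} (snd z) * (V h z)\<^sup>2)" for z
      proof (cases "snd z \<in> {- (T + 1)..0}")
        case True
        have "L ?E z \<le> \<rho> (snd z) * L E z" unfolding LE using d\<rho>[of "snd z"] E(2)[of z] by simp
        also have "\<dots> \<le> \<rho> (snd z) * (e / ?B)"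
          using \<rho>b(1)[of "snd z"] E(5)[of z] by (intro mult_left_mono) auto
        also have "\<dots> \<le> 1 * (e / ?B)"
          using \<rho>b(2)[of "snd z"] e B by (intro mult_right_mono) auto
        finally have "L ?E z * ((V h z)\<^sup>2 / 2) \<le> (e / ?B) * ((V h z)\<^sup>2 / 2)" by (intro mult_right_mono) auto
        also have "\<dots> \<le> (e / ?B) * (V h z)\<^sup>2" using e B by (intro mult_left_mono) auto
        finally show ?thesis using True by simp
      next
        case False
        show ?thesis
        proof (cases "snd z > 0")
          case True
          then show ?thesis using V_props(3)[OF h(1), of z] delta_pos by (simp add: indicator_def)
        next
          case F: False
          \<comment> \<open>Before time -(T + 1) the factor \<rho> vanishes, and the remaining term
            of L has the good sign.\<close>
          then have "L ?E z \<le> 0" unfolding LE using False \<rho>b(3)[of "snd z"] d\<rho>[of "snd z"] E(2)[of z] by auto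
          then have "L ?E z * ((V h z)\<^sup>2 / 2) \<le> 0" by (intro mult_nonpos_nonneg) auto
          then show ?thesis using False by simp
        qed
      qed
    qed
    also have "\<dots> = (e / ?B) * (LINT z|lborel. indicat_real {- (T + 1)..0} (snd z) * (V h z)\<^sup>2)" by simp
    also have "\<dots> \<le> (e / ?B) * ?B" using V2(2) e B by (intro mult_left_mono) auto
    also have "\<dots> = e" using B by simp
    finally show "(LINT z|lborel. L ?E z * ((V h z)\<^sup>2 / 2)) \<le> e" .
  qed
  finally show ?thesis .
qed

end

subsection \<open>Approximation of the identity\<close>

lemma integrable_mult_L2:
  fixes f g :: "'m::euclidean_space \<Rightarrow> real"
  assumes [measurable]: "f \<in> borel_measurable M'" "g \<in> borel_measurable M'"
    and i: "integrable M' (\<lambda>x. (f x)\<^sup>2)" "integrable M' (\<lambda>x. (g x)\<^sup>2)" and \<kappa>: "\<kappa> > 0"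
  shows "integrable M' (\<lambda>x. f x * g x)"
    "\<bar>integral\<^sup>L M' (\<lambda>x. f x * g x)\<bar> \<le> integral\<^sup>L M' (\<lambda>x. (f x)\<^sup>2) / (2 * \<kappa>) + \<kappa> / 2 * integral\<^sup>L M' (\<lambda>x. (g x)\<^sup>2)"
proof -
  let ?b = "\<lambda>x. (f x)\<^sup>2 / (2 * \<kappa>) + \<kappa> / 2 * (g x)\<^sup>2"
  have le: "\<bar>f x * g x\<bar> \<le> ?b x" for x
  proof -
    have "0 \<le> (\<bar>f x\<bar> - \<kappa> * \<bar>g x\<bar>)\<^sup>2 / (2 * \<kappa>)" using \<kappa> by simp
    also have "\<dots> = ?b x - \<bar>f x * g x\<bar>" using \<kappa> by (simp add: power2_eq_square field_simps abs_mult)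
    finally show ?thesis by simp
  qed
  have ib: "integrable M' ?b" using i by simp
  show ii: "integrable M' (\<lambda>x. f x * g x)"
    by (rule Bochner_Integration.integrable_bound[OF ib]) (use le in \<open>auto intro!: AE_I2 order_trans[OF le]\<close>)
  have "\<bar>integral\<^sup>L M' (\<lambda>x. f x * g x)\<bar> \<le> integral\<^sup>L M' ?b"
    by (rule integral_abs_bound_integral[OF ii ib]) (rule le)
  also have "\<dots> = integral\<^sup>L M' (\<lambda>x. (f x)\<^sup>2) / (2 * \<kappa>) + \<kappa> / 2 * integral\<^sup>L M' (\<lambda>x. (g x)\<^sup>2)" using i by simp
  finally show "\<bar>integral\<^sup>L M' (\<lambda>x. f x * g x)\<bar> \<le> integral\<^sup>L M' (\<lambda>x. (f x)\<^sup>2) / (2 * \<kappa>) + \<kappa> / 2 * integral\<^sup>L M' (\<lambda>x. (g x)\<^sup>2)" .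
qed

lemma negligible_time_slice: "negligible {z :: 'a::euclidean_space \<times> real. snd z = t}"
proof -
  have "(0, 1) \<in> (Basis :: ('a \<times> real) set)" by (simp add: Basis_prod_def)
  then have "negligible {z :: 'a \<times> real. z \<bullet> (0, 1) = t}" by (rule negligible_standard_hyperplane)
  then show ?thesis by (simp add: inner_prod_def)
qed

context evolution
begin

text \<open>The transpose of the map from \<psi> to its source: pairing \<open>P h\<close> with v
  equals pairing \<psi> with these averages of v over the times between h and 2 h before z.\<close>

definition avg :: "real \<Rightarrow> ('n point \<Rightarrow> real) \<Rightarrow> 'n point \<Rightarrow> real" where
  "avg h v z = (LINT \<zeta>|lborel. (\<Gamma> z \<zeta> * deriv (ramp \<sigma> h) (snd z - snd \<zeta>)) * v \<zeta>)"

text \<open>The error made by localising the representation formula to a time strip around z. The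
  strip contains both time orders, and integrability over it comes from the representation formula
  itself.\<close>

definition remainder :: "real \<Rightarrow> ('n point \<Rightarrow> real) \<Rightarrow> 'n point \<Rightarrow> real" where
  "remainder h v z = (LINT \<zeta>|lebesgue. indicat_real {\<zeta>. \<bar>snd z - snd \<zeta>\<bar> \<le> 2 * h} \<zeta> * \<bar>\<Gamma> z \<zeta> * L v \<zeta>\<bar>)"

lemma avg_kernel_continuous:
  assumes "h > 0"
  shows "continuous_on UNIV (\<lambda>p. \<Gamma> (fst p) (snd p) * deriv (ramp \<sigma> h) (snd (fst p) - snd (snd p)))"
  by (rule smooth_on_imp_continuous_on[OF smooth_cut_kernel[OF smooth_on_deriv[OF ramp_props(1)[OF step assms]] assms
      ramp_props(7)[OF step assms]]])

lemma avg_integrable: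
  assumes "h > 0" "test_function UNIV v"
  shows "integrable lborel (\<lambda>\<zeta>. (\<Gamma> z \<zeta> * deriv (ramp \<sigma> h) (snd z - snd \<zeta>)) * v \<zeta>)"
proof -
  obtain K where K: "compact K" "\<And>z. z \<notin> K \<Longrightarrow> v z = 0" using test_functionE[OF assms(2)] by metis
  have "integrable lborel (\<lambda>\<zeta>. v \<zeta> * (\<Gamma> z \<zeta> * deriv (ramp \<sigma> h) (snd z - snd \<zeta>)))"
    using integrable_mult_continuous_compact[OF test_function_integrable[OF assms(2)] K
        continuous_on_section2[OF avg_kernel_continuous[OF assms(1)], of z]] by simp
  then show ?thesis by (simp add: mult.commute)
qed

lemma avg_add: "h > 0 \<Longrightarrow> test_function UNIV v \<Longrightarrow> test_function UNIV w \<Longrightarrow> avg h (\<lambda>z. v z + w z) z = avg h v z + avg h w z"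
  unfolding avg_def using avg_integrable[of h v z] avg_integrable[of h w z] by (simp add: distrib_left)

lemma avg_diff: "h > 0 \<Longrightarrow> test_function UNIV v \<Longrightarrow> test_function UNIV w \<Longrightarrow> avg h (\<lambda>z. v z - w z) z = avg h v z - avg h w z"
  unfolding avg_def using avg_integrable[of h v z] avg_integrable[of h w z] by (simp add: right_diff_distrib)

text \<open>The averaging kernel is non-negative with total mass one.\<close>

lemma avg_le:
  assumes h: "h > 0" and v: "test_function UNIV v" and b: "\<And>z. v z \<le> B" "0 \<le> B"
  shows "avg h v z \<le> B"
proof -
  note r = ramp_props[OF step h]
  have [measurable]: "deriv (ramp \<sigma> h) \<in> borel_measurable borel"
    by (intro borel_measurable_continuous_onI smooth_on_imp_continuous_on smooth_on_deriv r)
  let ?k = "\<lambda>\<zeta>. \<Gamma> z \<zeta> * deriv (ramp \<sigma> h) (snd z - snd \<zeta>)"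
  have k0: "0 \<le> ?k \<zeta>" for \<zeta> by (intro mult_nonneg_nonneg kernel_nonneg r)
  have km: "?k \<in> borel_measurable borel"
    using borel_measurable_continuous_onI[OF continuous_on_section2[OF avg_kernel_continuous[OF h], of z]] by simp
  have "(\<integral>\<^sup>+\<zeta>. ennreal (?k \<zeta>) \<partial>lborel) = (\<integral>\<^sup>+\<zeta>. ennreal (G z \<zeta>) * ennreal (deriv (ramp \<sigma> h) (snd z - snd \<zeta>)) \<partial>lborel)"
  proof (intro nn_integral_cong)
    fix \<zeta>
    have "?k \<zeta> = G z \<zeta> * deriv (ramp \<sigma> h) (snd z - snd \<zeta>)"
      using r(7)[of "snd z - snd \<zeta>"] h by (auto simp: G_def)
    then show "ennreal (?k \<zeta>) = ennreal (G z \<zeta>) * ennreal (deriv (ramp \<sigma> h) (snd z - snd \<zeta>))"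
      by (simp only: ennreal_mult G_nonneg r)
  qed
  also have "\<dots> = (\<integral>\<^sup>+\<tau>. (if \<tau> < snd z then ennreal (deriv (ramp \<sigma> h) (snd z - \<tau>)) else 0) \<partial>lborel)"
    by (rule G_time_integral_right) measurable
  also have "\<dots> = 1" by (rule nn_integral_ramp_deriv_right[OF step h])
  finally have m: "(\<integral>\<^sup>+\<zeta>. ennreal (?k \<zeta>) \<partial>lborel) = ennreal 1" by simp
  have ik: "integrable lborel ?k" "(LINT \<zeta>|lborel. ?k \<zeta>) \<le> 1"
    using integral_le_of_nn_integral_le[of ?k lborel 1] km k0 m by auto
  have "avg h v z \<le> (LINT \<zeta>|lborel. ?k \<zeta> * B)"
    unfolding avg_def by (intro integral_mono avg_integrable h v integrable_mult_left ik mult_left_mono b k0)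
  also have "\<dots> = (LINT \<zeta>|lborel. ?k \<zeta>) * B" by simp
  also have "\<dots> \<le> 1 * B" using ik(2) b(2) by (rule mult_right_mono)
  finally show ?thesis by simp
qed

lemma avg_ge_remainder:
  assumes h: "h > 0" and v: "test_function UNIV v" and nn: "\<And>z. 0 \<le> v z"
  shows "v z \<le> avg h v z + remainder h v z"
proof -
  note r = ramp_props[OF step h]
  \<comment> \<open>The plateau: 1 for arguments of size at most h and 0 for size at least 2 h; at
    most one of the two ramps is non-zero at any point.\<close>
  define g where "g s = 1 - ramp \<sigma> h s - ramp \<sigma> h (- s)" for s
  define c where "c \<tau> = g (snd z - \<tau>)" for \<tau>
  have sg: "smooth_on UNIV g" unfolding g_def
    by (intro smooth_on_diff smooth_on_const open_UNIV r smooth_on_compose_UNIV[OF open_UNIV _ r(1)] smooth_on_minus smooth_on_id)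
  have sc: "smooth_on UNIV c" unfolding c_def
    by (intro smooth_on_compose_UNIV[OF open_UNIV _ sg] smooth_intros open_UNIV)
  have dr: "(ramp \<sigma> h has_real_derivative deriv (ramp \<sigma> h) s) (at s)" for s
    by (rule smooth_on_imp_has_real_derivative[OF r(1)])
  have dc: "deriv c \<tau> = deriv (ramp \<sigma> h) (snd z - \<tau>) - deriv (ramp \<sigma> h) (\<tau> - snd z)" for \<tau>
  proof (rule DERIV_imp_deriv)
    have 1: "((\<lambda>\<tau>. ramp \<sigma> h (snd z - \<tau>)) has_real_derivative deriv (ramp \<sigma> h) (snd z - \<tau>) * (- 1)) (at \<tau>)"
      by (rule DERIV_chain2[OF dr]) (auto intro!: derivative_eq_intros)
    have 2: "((\<lambda>\<tau>. ramp \<sigma> h (\<tau> - snd z)) has_real_derivative deriv (ramp \<sigma> h) (\<tau> - snd z) * 1) (at \<tau>)"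
      by (rule DERIV_chain2[OF dr]) (auto intro!: derivative_eq_intros)
    have "((\<lambda>\<tau>. 1 - ramp \<sigma> h (snd z - \<tau>) - ramp \<sigma> h (\<tau> - snd z)) has_real_derivative
        0 - deriv (ramp \<sigma> h) (snd z - \<tau>) * (- 1) - deriv (ramp \<sigma> h) (\<tau> - snd z) * 1) (at \<tau>)"
      by (intro DERIV_diff DERIV_const 1 2)
    then show "(c has_real_derivative deriv (ramp \<sigma> h) (snd z - \<tau>) - deriv (ramp \<sigma> h) (\<tau> - snd z)) (at \<tau>)"
      by (simp add: c_def[abs_def] g_def)
  qed
  have cz: "c (snd z) = 1" using r(4)[of 0] h by (simp add: c_def g_def)
  have cb: "\<bar>c \<tau>\<bar> \<le> indicat_real {\<tau>. \<bar>snd z - \<tau>\<bar> \<le> 2 * h} \<tau>" for \<tau>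
  proof (cases "\<bar>snd z - \<tau>\<bar> \<le> 2 * h")
    case True
    have "ramp \<sigma> h (snd z - \<tau>) = 0 \<or> ramp \<sigma> h (- (snd z - \<tau>)) = 0"
      using r(4)[of "snd z - \<tau>"] r(4)[of "- (snd z - \<tau>)"] h by linarith
    then show ?thesis
      using True r(2,3)[of "snd z - \<tau>"] r(2,3)[of "- (snd z - \<tau>)"] unfolding c_def g_def by auto
  next
    case False
    then consider "snd z - \<tau> \<ge> 2 * h" | "- (snd z - \<tau>) \<ge> 2 * h" by linarith
    then have "c \<tau> = 0"
    proof cases
      case 1
      then show ?thesis using r(5)[of "snd z - \<tau>"] r(4)[of "- (snd z - \<tau>)"] h by (simp add: c_def g_def)
    next
      case 2
      then show ?thesis using r(4)[of "snd z - \<tau>"] r(5)[of "- (snd z - \<tau>)"] h by (simp add: c_def g_def)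
    qed
    then show ?thesis by simp
  qed
  have sv: "smooth_on UNIV v" using v by (rule test_function_smooth)
  have "test_function UNIV (\<lambda>\<zeta>. v \<zeta> * c (snd \<zeta>))" by (intro test_function_mult v smooth_on_time sc)
  then have t: "test_function UNIV (\<lambda>\<zeta>. c (snd \<zeta>) * v \<zeta>)" by (simp add: mult.commute)
  let ?F = "\<lambda>\<zeta>. \<Gamma> z \<zeta> * L (\<lambda>\<zeta>. c (snd \<zeta>) * v \<zeta>) \<zeta>"
  let ?R = "\<lambda>\<zeta>. indicat_real {\<zeta>. \<bar>snd z - snd \<zeta>\<bar> \<le> 2 * h} \<zeta> * \<bar>\<Gamma> z \<zeta> * L v \<zeta>\<bar>"
  let ?A = "\<lambda>\<zeta>. (\<Gamma> z \<zeta> * deriv (ramp \<sigma> h) (snd z - snd \<zeta>)) * v \<zeta>"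
  have hF: "has_bochner_integral lebesgue ?F (- v z)"
    using representation[OF t, of z] cz by simp
  have hv: "integrable lebesgue (\<lambda>\<zeta>. \<Gamma> z \<zeta> * L v \<zeta>)"
    using representation[OF v, of z] by (simp add: has_bochner_integral_iff)
  have iA: "integrable lebesgue ?A" "(LINT \<zeta>|lebesgue. ?A \<zeta>) = avg h v z"
    using avg_integrable[OF h v, of z] unfolding avg_def
    by (auto simp: integral_completion integrable_completion)
  have "closed {\<zeta> :: 'n point. \<bar>snd z - snd \<zeta>\<bar> \<le> 2 * h}" by (intro closed_Collect_le continuous_intros)
  then have cl: "{\<zeta> :: 'n point. \<bar>snd z - snd \<zeta>\<bar> \<le> 2 * h} \<in> sets lebesgue" by auto
  have iR: "integrable lebesgue ?R"
    using integrable_mult_indicator[OF cl, of "\<lambda>\<zeta>. \<bar>\<Gamma> z \<zeta> * L v \<zeta>\<bar>"] hv by simp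
  have "(LINT \<zeta>|lebesgue. - ?R \<zeta> - ?A \<zeta>) \<le> (LINT \<zeta>|lebesgue. ?F \<zeta>)"
  proof (rule integral_mono)
    show "integrable lebesgue (\<lambda>\<zeta>. - ?R \<zeta> - ?A \<zeta>)"
      by (intro Bochner_Integration.integrable_diff Bochner_Integration.integrable_minus iA iR)
    show "integrable lebesgue ?F" using hF by (simp add: has_bochner_integral_iff)
    fix \<zeta>
    have "?F \<zeta> = c (snd \<zeta>) * (\<Gamma> z \<zeta> * L v \<zeta>) - ?A \<zeta> + \<Gamma> z \<zeta> * deriv (ramp \<sigma> h) (snd \<zeta> - snd z) * v \<zeta>"
      unfolding L_time_mult[OF sc sv] dc by (simp add: algebra_simps)
    moreover have "0 \<le> \<Gamma> z \<zeta> * deriv (ramp \<sigma> h) (snd \<zeta> - snd z) * v \<zeta>"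
      by (intro mult_nonneg_nonneg kernel_nonneg r nn)
    moreover have "\<bar>c (snd \<zeta>) * (\<Gamma> z \<zeta> * L v \<zeta>)\<bar> \<le> ?R \<zeta>"
      using cb[of "snd \<zeta>"] unfolding abs_mult[of "c _"] by (intro mult_right_mono) (auto simp: indicator_def)
    ultimately show "- ?R \<zeta> - ?A \<zeta> \<le> ?F \<zeta>" by linarith
  qed
  moreover have "(LINT \<zeta>|lebesgue. ?F \<zeta>) = - v z" using hF by (rule has_bochner_integral_integral_eq)
  moreover have "(LINT \<zeta>|lebesgue. - ?R \<zeta> - ?A \<zeta>) = - remainder h v z - avg h v z"
    using iA iR by (simp add: remainder_def)
  ultimately show ?thesis by linarith
qed

text \<open>Dominated convergence: the strips shrink to the time slice of z, which is a null
  set.\<close>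

lemma remainder_tendsto_0:
  assumes v: "test_function UNIV v" and H: "H > 0"
  shows "(\<lambda>n. remainder (H / real (Suc n)) v z) \<longlonglongrightarrow> 0"
proof -
  have hv: "integrable lebesgue (\<lambda>\<zeta>. \<Gamma> z \<zeta> * L v \<zeta>)"
    using representation[OF v, of z] by (simp add: has_bochner_integral_iff)
  let ?A = "\<lambda>n. {\<zeta> :: 'n point. \<bar>snd z - snd \<zeta>\<bar> \<le> 2 * (H / real (Suc n))}"
  have cl: "?A n \<in> sets lebesgue" for n
  proof -
    have "closed (?A n)" by (intro closed_Collect_le continuous_intros)
    then show ?thesis by auto
  qed
  have "negligible {\<zeta> :: 'n point. snd \<zeta> = snd z}" by (rule negligible_time_slice)
  then have ae: "AE \<zeta> in (lebesgue :: 'n point measure). snd \<zeta> \<noteq> snd z"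
    using AE_not_in[of "{\<zeta> :: 'n point. snd \<zeta> = snd z}" lebesgue]
    by (simp add: negligible_iff_null_sets)
  have "(\<lambda>n. LINT \<zeta>|lebesgue. indicat_real (?A n) \<zeta> * \<bar>\<Gamma> z \<zeta> * L v \<zeta>\<bar>) \<longlonglongrightarrow> (LINT \<zeta>|(lebesgue :: 'n point measure). 0)"
  proof (rule integral_dominated_convergence[where w = "\<lambda>\<zeta>. \<bar>\<Gamma> z \<zeta> * L v \<zeta>\<bar>"])
    show "(\<lambda>\<zeta>. indicat_real (?A n) \<zeta> * \<bar>\<Gamma> z \<zeta> * L v \<zeta>\<bar>) \<in> borel_measurable lebesgue" for n
      by (intro borel_measurable_times borel_measurable_abs borel_measurable_indicator cl borel_measurable_integrable[OF hv])
    show "AE \<zeta> in lebesgue. (\<lambda>n. indicat_real (?A n) \<zeta> * \<bar>\<Gamma> z \<zeta> * L v \<zeta>\<bar>) \<longlonglongrightarrow> 0"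
      using ae
    proof eventually_elim
      case (elim \<zeta>)
      have "(\<lambda>n. 2 * (H / real (Suc n))) \<longlonglongrightarrow> 2 * 0"
        by (intro tendsto_mult tendsto_const LIMSEQ_Suc[OF lim_const_over_n])
      then have "\<forall>\<^sub>F n in sequentially. 2 * (H / real (Suc n)) < \<bar>snd z - snd \<zeta>\<bar>"
        by (rule order_tendstoD(2)) (use elim in auto)
      then have "\<forall>\<^sub>F n in sequentially. indicat_real (?A n) \<zeta> * \<bar>\<Gamma> z \<zeta> * L v \<zeta>\<bar> = 0"
        by eventually_elim auto
      then show ?case by (rule tendsto_eventually)
    qed
    show "AE \<zeta> in lebesgue. norm (indicat_real (?A n) \<zeta> * \<bar>\<Gamma> z \<zeta> * L v \<zeta>\<bar>) \<le> \<bar>\<Gamma> z \<zeta> * L v \<zeta>\<bar>" for n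
      by (intro AE_I2) (simp add: indicator_def)
  qed (use hv in auto)
  then show ?thesis by (simp add: remainder_def)
qed

text \<open>The averages of a non-negative test function dominate it in the limit because the part of
  the kernel after the pole enters with a sign; applied to \<open>B * cut \<plusminus> v\<close>, where the averages of
  \<open>B * cut\<close> are at most \<open>B\<close>, this yields convergence.\<close>

lemma avg_tendsto:
  assumes v: "test_function UNIV v" and H: "H > 0"
  shows "(\<lambda>n. avg (H / real (Suc n)) v z) \<longlonglongrightarrow> v z"
proof -
  obtain B where B: "\<And>z. \<bar>v z\<bar> \<le> B" "B \<ge> 0" using test_function_bounded[OF v] by metis
  obtain K where K: "compact K" "\<And>z. z \<notin> K \<Longrightarrow> v z = 0" using test_functionE[OF v] by metis
  have "bounded (insert z K)" using K(1) compact_imp_bounded by auto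
  then obtain cut where cut: "test_function UNIV cut" "\<And>x. 0 \<le> cut x" "\<And>x. cut x \<le> 1" "\<And>x. x \<in> insert z K \<Longrightarrow> cut x = 1"
    using smooth_step_plateau[OF step] by metis
  let ?C = "\<lambda>x. B * cut x" and ?P = "\<lambda>x. B * cut x + v x" and ?M = "\<lambda>x. B * cut x - v x"
  have tC: "test_function UNIV ?C" by (intro test_function_mult_const cut)
  have tP: "test_function UNIV ?P" by (intro test_function_add tC v)
  have tM: "test_function UNIV ?M" by (intro test_function_diff tC v)
  have bv: "\<bar>v x\<bar> \<le> B * cut x" for x
    using B(1)[of x] B(2) K(2)[of x] cut(2)[of x] cut(4)[of x] by (cases "x \<in> K") auto
  have P0: "0 \<le> ?P x" and M0: "0 \<le> ?M x" for x using bv[of x] by linarith+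
  have C1: "?C x \<le> B" for x using cut(3)[of x] B(2) by (simp add: mult_left_le)
  have Cz: "cut z = 1" using cut(4)[of z] by simp
  define h where "h n = H / real (Suc n)" for n
  have hp: "h n > 0" for n using H by (simp add: h_def)
  have "\<bar>avg (h n) v z - v z\<bar> \<le> remainder (h n) ?P z + remainder (h n) ?M z" for n
  proof -
    have c: "avg (h n) ?C z \<le> B" by (rule avg_le[OF hp tC C1 B(2)])
    have p: "?P z \<le> avg (h n) ?P z + remainder (h n) ?P z" by (rule avg_ge_remainder[OF hp tP P0])
    have m: "?M z \<le> avg (h n) ?M z + remainder (h n) ?M z" by (rule avg_ge_remainder[OF hp tM M0])
    have rp: "0 \<le> remainder (h n) ?P z" and rm: "0 \<le> remainder (h n) ?M z"
      unfolding remainder_def by (intro Bochner_Integration.integral_nonneg mult_nonneg_nonneg; simp)+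
    show ?thesis
      using c p m rp rm Cz unfolding avg_add[OF hp tC v] avg_diff[OF hp tC v] by simp
  qed
  moreover have "(\<lambda>n. remainder (h n) ?P z + remainder (h n) ?M z) \<longlonglongrightarrow> 0 + 0"
    unfolding h_def by (intro tendsto_add remainder_tendsto_0 tP tM H)
  ultimately have "(\<lambda>n. avg (h n) v z - v z) \<longlonglongrightarrow> 0"
    by (intro Lim_null_comparison[of "\<lambda>n. avg (h n) v z - v z"]) auto
  then show ?thesis by (simp add: h_def LIM_zero_iff)
qed

end

context potential
begin

text \<open>After transposition the averages converge pointwise and inherit the bound of v, so a
  multiple of \<psi> dominates.\<close>

lemma test_P_tendsto:
  assumes v: "test_function UNIV v" and H: "H > 0"
  shows "(\<lambda>n. LINT \<zeta>|lborel. P (H / real (Suc n)) \<zeta> * v \<zeta>) \<longlonglongrightarrow> (LINT z|lborel. \<psi> z * v z)"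
proof -
  define h where "h n = H / real (Suc n)" for n
  have hp: "h n > 0" for n using H by (simp add: h_def)
  obtain K1 where K1: "compact K1" "\<And>z. z \<notin> K1 \<Longrightarrow> v z = 0" using test_functionE[OF v] by metis
  obtain B where B: "\<And>z. \<bar>v z\<bar> \<le> B" "B \<ge> 0" using test_function_bounded[OF v] by metis
  have vm[measurable]: "v \<in> borel_measurable borel"
    by (intro borel_measurable_continuous_onI smooth_on_imp_continuous_on test_function_smooth[OF v])
  have eq: "(LINT \<zeta>|lborel. P (h n) \<zeta> * v \<zeta>) = (LINT z|lborel. \<psi> z * avg (h n) v z)" for n
  proof -
    note r = ramp_props[OF step hp[of n]]
    show ?thesis unfolding avg_def
      by (rule pot_swap[OF smooth_on_deriv[OF r(1)] hp r(7) r(6) test_function_integrable[OF v] K1])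
  qed
  have "(\<lambda>n. LINT z|lborel. \<psi> z * avg (h n) v z) \<longlonglongrightarrow> (LINT z|lborel. \<psi> z * v z)"
  proof (rule integral_dominated_convergence[where w = "\<lambda>z. \<psi> z * B"])
    show "(\<lambda>z. \<psi> z * avg (h n) v z) \<in> borel_measurable lborel" for n
    proof -
      have "continuous_on UNIV (\<lambda>p. \<Gamma> (snd p) (fst p) * deriv (ramp \<sigma> (h n)) (snd (snd p) - snd (fst p)))"
        using continuous_on_compose2[OF avg_kernel_continuous[OF hp, of n], of UNIV "\<lambda>p. (snd p, fst p)"]
        by (simp add: continuous_on_Pair continuous_on_fst continuous_on_snd continuous_on_id)
      then have "continuous_on UNIV (\<lambda>z. LINT \<zeta>|lborel. v \<zeta> * (\<Gamma> z \<zeta> * deriv (ramp \<sigma> (h n)) (snd z - snd \<zeta>)))"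
        using continuous_on_parametric_integral[OF test_function_integrable[OF v] K1] by force
      then have "continuous_on UNIV (avg (h n) v)" by (simp add: avg_def[abs_def] mult.commute)
      then have "avg (h n) v \<in> borel_measurable borel" by (rule borel_measurable_continuous_onI)
      then show ?thesis by simp
    qed
    show "AE z in lborel. (\<lambda>n. \<psi> z * avg (h n) v z) \<longlonglongrightarrow> \<psi> z * v z"
      unfolding h_def by (intro AE_I2 tendsto_mult tendsto_const avg_tendsto v H)
    show "AE z in lborel. norm (\<psi> z * avg (h n) v z) \<le> \<psi> z * B" for n
    proof (rule AE_I2)
      fix z
      have 1: "avg (h n) v z \<le> B" by (rule avg_le[OF hp v _ B(2)]) (use B(1) abs_le_D1 in blast)
      have "avg (h n) (\<lambda>z. - v z) z \<le> B"
        by (rule avg_le[OF hp test_function_minus[OF v] _ B(2)]) (use B(1) abs_le_D2 in blast)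
      moreover have "avg (h n) (\<lambda>z. - v z) z = - avg (h n) v z" by (simp add: avg_def)
      ultimately have "\<bar>avg (h n) v z\<bar> \<le> B" using 1 by linarith
      then show "norm (\<psi> z * avg (h n) v z) \<le> \<psi> z * B"
        using psi_bounds(1)[of z] by (simp add: abs_mult mult_left_mono)
    qed
  qed (use integrable_psi in auto)
  then show ?thesis unfolding eq[symmetric] by (simp add: h_def)
qed

text \<open>Weak convergence in L2: known against test functions, it passes to all u by density
  because the sources are bounded in norm by \<psi>.\<close>

lemma P_tendsto:
  assumes u[measurable]: "u \<in> borel_measurable borel" and u2: "integrable lborel (\<lambda>z. (u z)\<^sup>2)" and H: "H > 0"
  shows "(\<lambda>n. LINT z|lborel. u z * P (H / real (Suc n)) z) \<longlonglongrightarrow> (LINT z|lborel. u z * \<psi> z)"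
  unfolding LIMSEQ_def
proof (intro allI impI)
  fix e :: real assume e: "e > 0"
  define h where "h n = H / real (Suc n)" for n
  have hp: "h n > 0" for n using H by (simp add: h_def)
  \<comment> \<open>This weight makes \<open>\<kappa> / 2 * N\<close> at most e / 4. The total error
    is then at most e / 8 + e / 4 twice, plus less than e / 4 for the test function.\<close>
  define \<kappa> where "\<kappa> = e / (2 * (N + 1))"
  have \<kappa>: "\<kappa> > 0" using e N_nonneg by (simp add: \<kappa>_def)
  obtain v where v: "test_function UNIV v" "integrable lborel (\<lambda>z. (u z - v z)\<^sup>2)" "(LINT z|lborel. (u z - v z)\<^sup>2) < \<kappa> * (e / 4)"
    using L2_approx_test_functions[OF step u u2, unfolded L2_approx_def, rule_format, of "\<kappa> * (e / 4)"] \<kappa> e by auto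
  have [measurable]: "v \<in> borel_measurable borel"
    by (intro borel_measurable_continuous_onI smooth_on_imp_continuous_on test_function_smooth[OF v(1)])
  have [measurable]: "P (h n) \<in> borel_measurable borel" for n using measurable_P[OF hp] .
  have v2: "integrable lborel (\<lambda>z. (v z)\<^sup>2)"
    using test_function_integrable[OF test_function_mult[OF v(1) test_function_smooth[OF v(1)]]] by (simp add: power2_eq_square)
  obtain n0 where n0: "\<And>n. n \<ge> n0 \<Longrightarrow> \<bar>(LINT \<zeta>|lborel. P (h n) \<zeta> * v \<zeta>) - (LINT z|lborel. \<psi> z * v z)\<bar> < e / 4"
    using LIMSEQ_D[OF test_P_tendsto[OF v(1) H], of "e / 4"] e by (auto simp: h_def)
  have d: "\<bar>(LINT z|lborel. (u z - v z) * f z)\<bar> \<le> e / 8 + \<kappa> / 2 * N"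
    if f: "f \<in> borel_measurable lborel" "integrable lborel (\<lambda>z. (f z)\<^sup>2)" "(LINT z|lborel. (f z)\<^sup>2) \<le> N" for f
  proof -
    have "\<bar>(LINT z|lborel. (u z - v z) * f z)\<bar> \<le> (LINT z|lborel. (u z - v z)\<^sup>2) / (2 * \<kappa>) + \<kappa> / 2 * (LINT z|lborel. (f z)\<^sup>2)"
      by (rule integrable_mult_L2(2)[OF _ f(1) v(2) f(2) \<kappa>]) simp
    also have "\<dots> \<le> (\<kappa> * (e / 4)) / (2 * \<kappa>) + \<kappa> / 2 * N"
      using v(3) f(3) \<kappa> by (intro add_mono divide_right_mono mult_left_mono) auto
    finally show ?thesis using \<kappa> by simp
  qed
  have kN: "\<kappa> / 2 * N \<le> e / 4"
    using e N_nonneg by (simp add: \<kappa>_def field_simps)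
  show "\<exists>no. \<forall>n\<ge>no. dist (LINT z|lborel. u z * P (H / real (Suc n)) z) (LINT z|lborel. u z * \<psi> z) < e"
  proof (intro exI[of _ n0] allI impI)
    fix n assume n: "n \<ge> n0"
    have i: "integrable lborel (\<lambda>z. u z * P (h n) z)" "integrable lborel (\<lambda>z. v z * P (h n) z)"
      "integrable lborel (\<lambda>z. u z * \<psi> z)" "integrable lborel (\<lambda>z. v z * \<psi> z)"
      by (rule integrable_mult_L2(1)[where \<kappa> = 1]; (intro u2 v2 P_L2 hp integrable_psi2)?; simp)+
    have a: "(LINT z|lborel. u z * P (h n) z) = (LINT z|lborel. (u z - v z) * P (h n) z) + (LINT z|lborel. v z * P (h n) z)"
      using i by (simp add: left_diff_distrib)
    have b: "(LINT z|lborel. u z * \<psi> z) = (LINT z|lborel. (u z - v z) * \<psi> z) + (LINT z|lborel. v z * \<psi> z)"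
      using i by (simp add: left_diff_distrib)
    have "\<bar>(LINT z|lborel. (u z - v z) * P (h n) z)\<bar> \<le> e / 8 + \<kappa> / 2 * N"
      by (rule d) (use P_L2[OF hp] in auto)
    moreover have "\<bar>(LINT z|lborel. (u z - v z) * \<psi> z)\<bar> \<le> e / 8 + \<kappa> / 2 * N"
      by (rule d) (use integrable_psi2 in \<open>auto simp: N_def\<close>)
    moreover have "\<bar>(LINT z|lborel. v z * P (h n) z) - (LINT z|lborel. v z * \<psi> z)\<bar> < e / 4"
      using n0[OF n] by (simp add: mult.commute)
    ultimately have "\<bar>(LINT z|lborel. u z * P (h n) z) - (LINT z|lborel. u z * \<psi> z)\<bar> < e"
      unfolding a b using kN by linarith
    then show "dist (LINT z|lborel. u z * P (H / real (Suc n)) z) (LINT z|lborel. u z * \<psi> z) < e"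
      by (simp add: dist_real_def h_def)
  qed
qed

end

subsection \<open>The duality estimate\<close>

lemma lebesgue_of_lborel:
  fixes f :: "'a::euclidean_space \<Rightarrow> real"
  assumes "integrable lborel f"
  shows "integrable lebesgue f" "integral\<^sup>L lebesgue f = integral\<^sup>L lborel f"
  using assms by (auto simp: integrable_completion integral_completion)

lemma continuous_imp_lebesgue_measurable:
  fixes g :: "'a::euclidean_space \<Rightarrow> real"
  assumes "continuous_on UNIV g"
  shows "g \<in> borel_measurable lebesgue"
  using assms by (intro measurable_completion) (simp add: borel_measurable_continuous_onI)

lemma integrable_L2_mult_compact:
  fixes f g :: "'a::euclidean_space \<Rightarrow> real"
  assumes f: "f \<in> borel_measurable lebesgue" "integrable lebesgue (\<lambda>z. (f z)\<^sup>2)"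
    and g: "continuous_on UNIV g" "compact K" "\<And>z. z \<notin> K \<Longrightarrow> g z = 0"
  shows "integrable lebesgue (\<lambda>z. f z * g z)"
proof (rule integrable_mult_L2(1)[where \<kappa> = 1])
  have "integrable lborel (\<lambda>z. indicat_real K z * (g z)\<^sup>2)"
    by (rule integrable_mult_continuous_compact[OF integrable_indicator_compact[OF g(2)] g(2)])
      (auto intro!: continuous_intros g)
  moreover have "(\<lambda>z. indicat_real K z * (g z)\<^sup>2) = (\<lambda>z. (g z)\<^sup>2)"
  proof
    show "indicat_real K z * (g z)\<^sup>2 = (g z)\<^sup>2" for z using g(3)[of z] by (cases "z \<in> K") auto
  qed
  ultimately show "integrable lebesgue (\<lambda>z. (g z)\<^sup>2)" using lebesgue_of_lborel(1) by metis
qed (use f continuous_imp_lebesgue_measurable[OF g(1)] in auto)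

context potential
begin

text \<open>\<phi> V is the test function, and Kf carries it: below time -\<delta> the factor \<phi>
  vanishes outside Kf, and from there on V vanishes. Second derivatives of V are traded for the
  source and Y V by the adjoint equation; derivatives that then hit w are weak ones. s is a free
  weight in Young's inequality and e the error from the gradient bound; both are fixed by the user
  of the estimate.\<close>

theorem duality_estimate:
  fixes w YW :: "'n point \<Rightarrow> real" and XW :: "nat \<Rightarrow> 'n point \<Rightarrow> real" and a :: "nat \<Rightarrow> nat \<Rightarrow> 'n point \<Rightarrow> real"
  assumes w: "w \<in> borel_measurable lebesgue" "integrable lebesgue (\<lambda>z. (w z)\<^sup>2)" "AE z in lebesgue. 0 \<le> w z"
    and XW: "\<And>j. j \<in> {1..m0} \<Longrightarrow> XW j \<in> borel_measurable lebesgue"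
      "\<And>j. j \<in> {1..m0} \<Longrightarrow> integrable lebesgue (\<lambda>z. (XW j z)\<^sup>2)"
    and YW: "YW \<in> borel_measurable lebesgue" "integrable lebesgue (\<lambda>z. (YW z)\<^sup>2)"
    and Kf: "compact Kf" "\<And>z. z \<in> Kf \<Longrightarrow> - T \<le> snd z \<and> snd z \<le> 0" and T: "0 \<le> T"
    and weak_X: "\<And>j t. j \<in> {1..m0} \<Longrightarrow> test_function UNIV t \<Longrightarrow> (\<And>z. z \<notin> Kf \<Longrightarrow> t z = 0) \<Longrightarrow>
      (LINT z|lebesgue. w z * vf_deriv (lift X j) t z) = - (LINT z|lebesgue. XW j z * t z)"
    and weak_Y: "\<And>t. test_function UNIV t \<Longrightarrow> (\<And>z. z \<notin> Kf \<Longrightarrow> t z = 0) \<Longrightarrow>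
      (LINT z|lebesgue. w z * vf_deriv (drift X) t z) = - (LINT z|lebesgue. YW z * t z)"
    and sub: "\<And>t. test_function UNIV t \<Longrightarrow> (\<And>z. 0 \<le> t z) \<Longrightarrow> (\<And>z. z \<notin> Kf \<Longrightarrow> t z = 0) \<Longrightarrow>
      0 \<le> (LINT z|lebesgue. t z * YW z - (\<Sum>i=1..m0. \<Sum>j=1..m0. XW i z * a i j z * vf_deriv (lift X j) t z))"
    and a: "\<And>i j. i \<in> {1..m0} \<Longrightarrow> j \<in> {1..m0} \<Longrightarrow> a i j = a j i"
      "\<And>i j. i \<in> {1..m0} \<Longrightarrow> j \<in> {1..m0} \<Longrightarrow> a i j \<in> borel_measurable lebesgue"
      "\<And>z \<xi>. 0 \<le> (\<Sum>i=1..m0. \<Sum>j=1..m0. a i j z * \<xi> i * \<xi> j)"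
      "\<And>z \<xi>. (\<Sum>i=1..m0. \<Sum>j=1..m0. a i j z * \<xi> i * \<xi> j) \<le> lam * (\<Sum>i=1..m0. (\<xi> i)\<^sup>2)"
    and lam: "0 \<le> lam"
    and \<phi>: "smooth_on UNIV \<phi>" "\<And>z. 0 \<le> \<phi> z" "\<And>z. \<phi> z \<le> 1" "\<And>z. snd z < - \<delta> \<Longrightarrow> \<phi> z \<noteq> 0 \<Longrightarrow> z \<in> Kf"
    and D: "\<And>z. z \<in> Kf \<Longrightarrow> snd z < 0 \<Longrightarrow> grad2 \<phi> z \<le> D" and D0: "0 \<le> D"
    and h: "h > 0" "2 * h \<le> S" and s: "s > 0" and e: "e > 0"
  shows "(LINT z|lebesgue. w z * \<phi> z * P h z) \<le>
      (LINT z|lebesgue. w z * (V h z * ((\<Sum>j=1..m0. \<bar>vf_deriv (lift X j) (vf_deriv (lift X j) \<phi>) z\<bar>) - vf_deriv (drift X) \<phi> z)))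
      + (1 + lam) * (s / 2 * (LINT z|lebesgue. indicat_real Kf z * (\<Sum>j=1..m0. (XW j z)\<^sup>2))
          + (3 / 2 * S * N + e + D * (S * T * N)) / s)"
proof -
  let ?V = "V h" and ?Q = "P h"
  let ?X = "\<lambda>j. vf_deriv (lift X j)" and ?Y = "vf_deriv (drift X)"
  have sV: "smooth_on UNIV ?V" and sP: "smooth_on UNIV ?Q" by (intro V_props P_props h)+
  note sXV = smooth_vf_lift[OF _ sV] and sX\<phi> = smooth_vf_lift[OF _ \<phi>(1)]
  note sXXV = smooth_vf_lift[OF _ sXV] and sXX\<phi> = smooth_vf_lift[OF _ sX\<phi>]
  note sYV = smooth_vf_drift[OF sV] and sY\<phi> = smooth_vf_drift[OF \<phi>(1)]
  \<comment> \<open>V vanishes on an open set that reaches h below time -\<delta>, so its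
    derivatives vanish at time -\<delta> as well.\<close>
  have V0: "?V z = 0" "frechet_derivative ?V (at z) v = 0" if "- \<delta> \<le> snd z" for z v
  proof -
    have z0: "?V x = 0" if "x \<in> {x. - \<delta> - h < snd x}" for x
      using ramp_props[OF step h(1)] h(1) that by (intro pot_zero[of _ h]) auto
    have "open {x :: 'n point. - \<delta> - h < snd x}" by (intro open_Collect_less continuous_intros)
    then show "?V z = 0" "frechet_derivative ?V (at z) v = 0"
      using z0 that h(1) by (auto intro!: frechet_derivative_zero_outside[of "{x. - \<delta> - h < snd x}"])
  qed
  have phi0: "\<phi> z = 0" "frechet_derivative \<phi> (at z) v = 0" if "z \<notin> Kf" "snd z < - \<delta>" for z v
  proof -
    have "open ({x :: 'n point. snd x < - \<delta>} \<inter> - Kf)"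
      by (intro open_Int open_Collect_less continuous_intros open_Compl compact_imp_closed Kf)
    then show "frechet_derivative \<phi> (at z) v = 0"
      by (rule frechet_derivative_zero_outside) (use \<phi>(4) that in blast)+
    show "\<phi> z = 0" using \<phi>(4)[of z] that by blast
  qed
  have off: "\<phi> z * ?V z = 0" "\<phi> z * ?X j ?V z = 0" "?V z * ?X j \<phi> z = 0" "?V z * ?Y \<phi> z = 0" "\<phi> z * ?Q z = 0"
    if "z \<notin> Kf" for z j
    using V0[of z] phi0[OF that] P_props(3)[OF h(1), of z] by (cases "- \<delta> \<le> snd z"; simp add: vf_deriv_def)+
  \<comment> \<open>\<open>t1\<close> and \<open>t2\<close> are the two parts of X_j applied to
    \<open>t3\<close>, which is \<phi> V. The sub-solution inequality sees their sum, the
    integration by parts their difference.\<close>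
  define t1 where "t1 j z = \<phi> z * ?X j ?V z" for j z
  define t2 where "t2 j z = ?V z * ?X j \<phi> z" for j z
  define t3 where "t3 z = \<phi> z * ?V z" for z
  have t1: "test_function UNIV (t1 j)" "\<And>z. z \<notin> Kf \<Longrightarrow> t1 j z = 0" if "j \<in> {1..m0}" for j
  proof -
    show "test_function UNIV (t1 j)"
      by (rule test_functionI[OF _ Kf(1)]) (use off(2) that in \<open>auto simp: t1_def[abs_def] intro!: smooth_on_mult \<phi>(1) sXV\<close>)
  qed (use off(2) in \<open>auto simp: t1_def\<close>)
  have t2: "test_function UNIV (t2 j)" "\<And>z. z \<notin> Kf \<Longrightarrow> t2 j z = 0" if "j \<in> {1..m0}" for j
  proof -
    show "test_function UNIV (t2 j)"
      by (rule test_functionI[OF _ Kf(1)]) (use off(3) that in \<open>auto simp: t2_def[abs_def] intro!: smooth_on_mult sV sX\<phi>\<close>)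
  qed (use off(3) in \<open>auto simp: t2_def\<close>)
  have t3: "test_function UNIV t3" "\<And>z. z \<notin> Kf \<Longrightarrow> t3 z = 0" "\<And>z. 0 \<le> t3 z"
  proof -
    show "test_function UNIV t3"
      by (rule test_functionI[OF _ Kf(1)]) (use off(1) in \<open>auto simp: t3_def[abs_def] intro!: smooth_on_mult sV \<phi>(1)\<close>)
  qed (use off(1) \<phi>(2) V_props(2)[OF h(1)] in \<open>auto simp: t3_def\<close>)
  have int: "integrable lebesgue (\<lambda>z. f z * t z)" if ft: "f \<in> borel_measurable lebesgue" "integrable lebesgue (\<lambda>z. (f z)\<^sup>2)" "test_function UNIV t" for f t
  proof -
    obtain K' where "compact K'" "\<And>z. z \<notin> K' \<Longrightarrow> t z = 0" using test_functionE[OF ft(3)] by metis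
    then show ?thesis
      using integrable_L2_mult_compact[OF ft(1,2)] smooth_on_imp_continuous_on[OF test_function_smooth[OF ft(3)]] by blast
  qed
  have Xt1: "?X j (t1 j) z = \<phi> z * ?X j (?X j ?V) z + ?X j \<phi> z * ?X j ?V z" if "j \<in> {1..m0}" for j z
    unfolding t1_def[abs_def] vf_mult[OF \<phi>(1) sXV[OF that]] by simp
  have Xt2: "?X j (t2 j) z = ?V z * ?X j (?X j \<phi>) z + ?X j ?V z * ?X j \<phi> z" if "j \<in> {1..m0}" for j z
    unfolding t2_def[abs_def] vf_mult[OF sV sX\<phi>[OF that]] by simp
  have Yt3: "?Y t3 z = \<phi> z * ?Y ?V z + ?Y \<phi> z * ?V z" for z
    unfolding t3_def[abs_def] vf_mult[OF \<phi>(1) sV] by simp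
  have Xt3: "?X j t3 z = t1 j z + t2 j z" for j z
    unfolding t3_def[abs_def] vf_mult[OF \<phi>(1) sV] by (simp add: t1_def t2_def)
  \<comment> \<open>\<open>?q\<close> is what the integration by parts produces, \<open>?q'\<close>
    is the form occurring in I1 and C2; pointwise -\<open>?q\<close> \<le> \<open>?q'\<close>, which
    suffices because w V \<ge> 0.\<close>
  let ?q = "\<lambda>z. (\<Sum>j=1..m0. ?X j (?X j \<phi>) z) + ?Y \<phi> z"
  let ?q' = "\<lambda>z. (\<Sum>j=1..m0. \<bar>?X j (?X j \<phi>) z\<bar>) - ?Y \<phi> z"
  have XX0: "?V z * ?X j (?X j \<phi>) z = 0" if "z \<notin> Kf" "j \<in> {1..m0}" for z j
  proof (cases "- \<delta> \<le> snd z")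
    case False
    have "open ({x :: 'n point. snd x < - \<delta>} \<inter> - Kf)"
      by (intro open_Int open_Collect_less continuous_intros open_Compl compact_imp_closed Kf)
    then have "frechet_derivative (?X j \<phi>) (at z) v = 0" for v
      by (rule frechet_derivative_zero_outside) (use False that phi0 in \<open>auto simp: vf_deriv_def\<close>)
    then show ?thesis by (simp add: vf_deriv_def)
  qed (use V0 in simp)
  have cq: "continuous_on UNIV (\<lambda>z. ?V z * ?q z)" "continuous_on UNIV (\<lambda>z. ?V z * ?q' z)"
    by (intro continuous_on_mult continuous_on_add continuous_on_diff continuous_on_sum continuous_on_rabs
        smooth_on_imp_continuous_on[OF sV] smooth_on_imp_continuous_on[OF sXX\<phi>] smooth_on_imp_continuous_on[OF sY\<phi>]; assumption)+
  have q0: "?V z * ?q z = 0" "?V z * ?q' z = 0" if "z \<notin> Kf" for z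
  proof -
    have 1: "\<forall>j\<in>{1..m0}. ?V z = 0 \<or> ?X j (?X j \<phi>) z = 0" using XX0[OF that] by auto
    have 2: "?V z = 0 \<or> ?Y \<phi> z = 0" using off(4)[OF that] by auto
    show "?V z * ?q z = 0" "?V z * ?q' z = 0" using 1 2 by (cases "?V z = 0"; simp)+
  qed
  have iq: "integrable lebesgue (\<lambda>z. w z * (?V z * ?q z))" "integrable lebesgue (\<lambda>z. w z * (?V z * ?q' z))"
    by (rule integrable_L2_mult_compact[OF w(1,2) cq(1) Kf(1) q0(1)], assumption)
      (rule integrable_L2_mult_compact[OF w(1,2) cq(2) Kf(1) q0(2)], assumption)
  have i1: "integrable lebesgue (\<lambda>z. w z * ?X j (t1 j) z)" "integrable lebesgue (\<lambda>z. w z * ?X j (t2 j) z)"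
    if "j \<in> {1..m0}" for j
    using that by (auto intro!: int w test_vf_lift t1 t2)
  have i2: "integrable lebesgue (\<lambda>z. w z * ?Y t3 z)" by (intro int w test_vf_drift t3)
  have i3: "integrable lebesgue (\<lambda>z. XW j z * t1 j z)" "integrable lebesgue (\<lambda>z. XW j z * t2 j z)"
    if "j \<in> {1..m0}" for j
    using that by (auto intro!: int XW t1 t2)
  have i4: "integrable lebesgue (\<lambda>z. YW z * t3 z)" by (intro int YW t3)
  let ?J = "\<lambda>z. \<Sum>j=1..m0. w z * ?X j (t2 j) z - w z * ?X j (t1 j) z"
  \<comment> \<open>The pointwise identity behind the estimate: the sum of the \<phi> X_j^2 V is
    replaced by \<phi> (Y V - P), and what remains is arranged as derivatives of compactly supported
    functions plus a term without derivatives of V.\<close>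
  have pw: "w z * \<phi> z * ?Q z = w z * ?Y t3 z + ?J z - w z * (?V z * ?q z)" for z
  proof -
    have "?J z = w z * (?V z * (\<Sum>j=1..m0. ?X j (?X j \<phi>) z)) - w z * (\<phi> z * (\<Sum>j=1..m0. ?X j (?X j ?V) z))"
      unfolding sum_distrib_left sum_subtractf[symmetric]
      by (intro sum.cong refl) (simp add: Xt1 Xt2 algebra_simps)
    also have "(\<Sum>j=1..m0. ?X j (?X j ?V) z) = ?Y ?V z - ?Q z" using V_equation[OF h(1), of z] by simp
    finally have J: "?J z = w z * (?V z * (\<Sum>j=1..m0. ?X j (?X j \<phi>) z)) - w z * (\<phi> z * (?Y ?V z - ?Q z))" .
    show ?thesis unfolding J Yt3 by (simp add: algebra_simps)
  qed
  have iJ: "integrable lebesgue ?J" by (intro Bochner_Integration.integrable_sum Bochner_Integration.integrable_diff i1)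
  let ?H = "\<lambda>z. \<Sum>j=1..m0. XW j z * (t1 j z - t2 j z)"
  have iH: "integrable lebesgue ?H"
    unfolding right_diff_distrib by (intro Bochner_Integration.integrable_sum Bochner_Integration.integrable_diff i3)
  have "(LINT z|lebesgue. ?J z) = (\<Sum>j=1..m0. (LINT z|lebesgue. w z * ?X j (t2 j) z) - (LINT z|lebesgue. w z * ?X j (t1 j) z))"
    by (subst Bochner_Integration.integral_sum)
      (auto intro!: Bochner_Integration.integrable_diff i1 sum.cong Bochner_Integration.integral_diff)
  also have "\<dots> = (\<Sum>j=1..m0. (LINT z|lebesgue. XW j z * t1 j z) - (LINT z|lebesgue. XW j z * t2 j z))"
    by (intro sum.cong refl) (simp add: weak_X t1 t2)
  also have "\<dots> = (LINT z|lebesgue. ?H z)"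
    unfolding right_diff_distrib
    by (subst Bochner_Integration.integral_sum)
      (auto intro!: Bochner_Integration.integrable_diff i3 sum.cong Bochner_Integration.integral_diff[symmetric])
  finally have JH: "(LINT z|lebesgue. ?J z) = (LINT z|lebesgue. ?H z)" .
  let ?A = "\<lambda>z. \<Sum>i=1..m0. \<Sum>j=1..m0. XW i z * a i j z * (t1 j z + t2 j z)"
  let ?n = "\<lambda>z. \<Sum>j=1..m0. (XW j z)\<^sup>2"
  have nn: "0 \<le> ?n z" for z by (intro sum_nonneg) simp
  let ?b = "\<lambda>z. s / 2 * (indicat_real Kf z * ?n z)
      + (indicat_real Kf z * grad2 ?V z + D * (indicat_real {- T..0} (snd z) * (?V z)\<^sup>2)) / s"
  have q2: "(\<Sum>j=1..m0. (t1 j z + c * t2 j z)\<^sup>2) \<le> 2 * (indicat_real Kf z * grad2 ?V z + D * (indicat_real {- T..0} (snd z) * (?V z)\<^sup>2))"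
    \<comment> \<open>c = -1 serves the term from the integration by parts, c = 1 the elliptic
      form.\<close>
    if c: "c = 1 \<or> c = - 1" and z: "z \<in> Kf" for c z
  proof (cases "snd z < 0")
    case True
    have "(\<Sum>j=1..m0. (t1 j z + c * t2 j z)\<^sup>2) \<le> (\<Sum>j=1..m0. 2 * (?X j ?V z)\<^sup>2 + 2 * ((?V z)\<^sup>2 * (?X j \<phi> z)\<^sup>2))"
    proof (rule sum_mono)
      fix j
      have "0 \<le> (t1 j z - c * t2 j z)\<^sup>2" by simp
      then have "(t1 j z + c * t2 j z)\<^sup>2 \<le> 2 * (t1 j z)\<^sup>2 + 2 * (t2 j z)\<^sup>2"
        using c by (auto simp: power2_eq_square algebra_simps)
      moreover have "(t1 j z)\<^sup>2 \<le> (?X j ?V z)\<^sup>2"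
        using \<phi>(2,3)[of z] by (simp add: t1_def power_mult_distrib mult_left_le_one_le power_le_one)
      ultimately show "(t1 j z + c * t2 j z)\<^sup>2 \<le> 2 * (?X j ?V z)\<^sup>2 + 2 * ((?V z)\<^sup>2 * (?X j \<phi> z)\<^sup>2)"
        by (simp add: t2_def power_mult_distrib)
    qed
    also have "\<dots> = 2 * (grad2 ?V z + (?V z)\<^sup>2 * grad2 \<phi> z)"
      by (simp add: sum.distrib sum_distrib_left)
    also have "\<dots> \<le> 2 * (grad2 ?V z + (?V z)\<^sup>2 * D)"
      using D[OF z True] by (simp add: mult_left_mono)
    finally show ?thesis using z Kf(2)[OF z] by (simp add: mult.commute)
  next
    case False
    then have "?V z = 0" "t1 j z = 0" "t2 j z = 0" for j
      using V0[of z] delta_pos by (auto simp: t1_def t2_def vf_deriv_def)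
    moreover have "0 \<le> grad2 ?V z" by (intro sum_nonneg) simp
    ultimately show ?thesis using z by simp
  qed
  have bound: "?H z + \<bar>?A z\<bar> \<le> (1 + lam) * ?b z" "\<bar>?A z\<bar> \<le> lam * ?b z" for z
  proof -
    have Y1: "?H z \<le> (s * ?n z + (\<Sum>j=1..m0. (t1 j z - t2 j z)\<^sup>2) / s) / 2" by (rule sum_Young[OF s])
    have Y2: "\<bar>?A z\<bar> \<le> lam * (s * ?n z + (\<Sum>j=1..m0. (t1 j z + t2 j z)\<^sup>2) / s) / 2"
      by (rule elliptic_form_Young[OF _ a(3,4) s lam]) (use a(1) in auto)
    show "?H z + \<bar>?A z\<bar> \<le> (1 + lam) * ?b z" "\<bar>?A z\<bar> \<le> lam * ?b z"
    proof (atomize (full), cases "z \<in> Kf")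
      case True
      have p: "(s * ?n z + (\<Sum>j=1..m0. (t1 j z + c * t2 j z)\<^sup>2) / s) / 2 \<le> ?b z" if "c = 1 \<or> c = - 1" for c
      proof -
        have "(\<Sum>j=1..m0. (t1 j z + c * t2 j z)\<^sup>2) / s \<le> 2 * (indicat_real Kf z * grad2 ?V z + D * (indicat_real {- T..0} (snd z) * (?V z)\<^sup>2)) / s"
          using q2[OF that True] s by (intro divide_right_mono) auto
        then show ?thesis using True by (simp add: add_divide_distrib)
      qed
      have e: "t1 j z + - 1 * t2 j z = t1 j z - t2 j z" "t1 j z + 1 * t2 j z = t1 j z + t2 j z" for j by simp_all
      have H: "?H z \<le> ?b z"
        using Y1 p[OF disjI2[OF refl]] unfolding e by (rule order_trans)
      have "lam * ((s * ?n z + (\<Sum>j=1..m0. (t1 j z + t2 j z)\<^sup>2) / s) / 2) \<le> lam * ?b z"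
        using p[OF disjI1[OF refl]] lam unfolding e by (rule mult_left_mono)
      then have A: "\<bar>?A z\<bar> \<le> lam * ?b z"
        using order_trans[OF Y2] unfolding times_divide_eq_right by blast
      show "?H z + \<bar>?A z\<bar> \<le> (1 + lam) * ?b z \<and> \<bar>?A z\<bar> \<le> lam * ?b z"
        using add_mono[OF H A] A unfolding distrib_right[of 1 lam] mult_1_left by (rule conjI)
    next
      case False
      have H0: "?H z = 0" using t1(2) t2(2) False by (intro sum.neutral) auto
      have A0: "?A z = 0" using t1(2) t2(2) False by (intro sum.neutral ballI) auto
      have "0 \<le> D * (indicat_real {- T..0} (snd z) * (?V z)\<^sup>2)"
        using D0 by (auto simp: indicator_def)
      then have "0 \<le> ?b z" using False s by simp
      then show "?H z + \<bar>?A z\<bar> \<le> (1 + lam) * ?b z \<and> \<bar>?A z\<bar> \<le> lam * ?b z"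
        unfolding H0 A0 using lam by (auto intro!: mult_nonneg_nonneg)
    qed
  qed
  have sg: "continuous_on UNIV (grad2 ?V)"
    by (intro smooth_on_imp_continuous_on smooth_on_sum smooth_on_power sXV open_UNIV)
  have ig: "integrable lborel (\<lambda>z. indicat_real Kf z * grad2 ?V z)"
    by (rule integrable_mult_continuous_compact[OF integrable_indicator_compact[OF Kf(1)] Kf(1) _ sg]) auto
  note V2 = V_L2[OF h(1) T]
  have Kl: "Kf \<in> sets lebesgue" using Kf(1) by (simp add: compact_imp_closed)
  have inn: "integrable lebesgue (\<lambda>z. indicat_real Kf z * ?n z)"
  proof -
    have "integrable lebesgue ?n" by (intro Bochner_Integration.integrable_sum XW(2))
    from integrable_mult_indicator[OF Kl this] show ?thesis by simp
  qed
  have ib: "integrable lebesgue ?b"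
    by (intro Bochner_Integration.integrable_add integrable_mult_right integrable_divide inn lebesgue_of_lborel ig V2(1))
  have Am: "?A \<in> borel_measurable lebesgue"
    by (intro borel_measurable_sum borel_measurable_times borel_measurable_add XW a
        continuous_imp_lebesgue_measurable smooth_on_imp_continuous_on test_function_smooth[OF t1(1)] test_function_smooth[OF t2(1)])
  have iA: "integrable lebesgue ?A"
  proof (rule Bochner_Integration.integrable_bound[OF _ Am])
    show "integrable lebesgue (\<lambda>z. lam * ?b z)" by (intro integrable_mult_right ib)
    show "AE z in lebesgue. norm (?A z) \<le> norm (lam * ?b z)"
      unfolding real_norm_def by (rule AE_I2, rule order_trans[OF bound(2) abs_ge_self])
  qed
  have "0 \<le> (LINT z|lebesgue. t3 z * YW z - (\<Sum>i=1..m0. \<Sum>j=1..m0. XW i z * a i j z * ?X j t3 z))"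
    by (rule sub[OF t3(1,3,2)])
  also have "\<dots> = (LINT z|lebesgue. YW z * t3 z) - (LINT z|lebesgue. ?A z)"
    unfolding Xt3 using i4 iA by (simp add: mult.commute)
  finally have sub3: "(LINT z|lebesgue. ?A z) \<le> (LINT z|lebesgue. YW z * t3 z)" by simp
  have "(LINT z|lebesgue. w z * \<phi> z * ?Q z) = (LINT z|lebesgue. w z * ?Y t3 z) + (LINT z|lebesgue. ?J z) - (LINT z|lebesgue. w z * (?V z * ?q z))"
    unfolding pw using i2 iJ iq(1) by simp
  \<comment> \<open>The weak derivative along Y turns the first integral into minus that of
    \<open>YW z * t3 z\<close>, which the sub-solution inequality bounds by minus the elliptic
    form.\<close>
  also have "\<dots> \<le> (LINT z|lebesgue. ?H z) - (LINT z|lebesgue. ?A z) - (LINT z|lebesgue. w z * (?V z * ?q z))"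
    using JH weak_Y[OF t3(1) t3(2)] sub3 by linarith
  also have "\<dots> = (LINT z|lebesgue. ?H z - ?A z) + (LINT z|lebesgue. - (w z * (?V z * ?q z)))"
    using iH iA by simp
  also have "\<dots> \<le> (LINT z|lebesgue. (1 + lam) * ?b z) + (LINT z|lebesgue. w z * (?V z * ?q' z))"
  proof (rule add_mono)
    show "(LINT z|lebesgue. ?H z - ?A z) \<le> (LINT z|lebesgue. (1 + lam) * ?b z)"
    proof (rule integral_mono)
      show "?H z - ?A z \<le> (1 + lam) * ?b z" for z using bound(1)[of z] abs_ge_minus_self[of "?A z"] by linarith
    qed (intro Bochner_Integration.integrable_diff iH iA integrable_mult_right ib)+
    show "(LINT z|lebesgue. - (w z * (?V z * ?q z))) \<le> (LINT z|lebesgue. w z * (?V z * ?q' z))"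
    proof (rule integral_mono_AE)
      show "AE z in lebesgue. - (w z * (?V z * ?q z)) \<le> w z * (?V z * ?q' z)"
        using w(3)
      proof eventually_elim
        case (elim z)
        have "- (\<Sum>j=1..m0. ?X j (?X j \<phi>) z) \<le> (\<Sum>j=1..m0. \<bar>?X j (?X j \<phi>) z\<bar>)"
          unfolding sum_negf[symmetric] by (intro sum_mono) simp
        then have "- ?q z \<le> ?q' z" by simp
        then have "(w z * ?V z) * (- ?q z) \<le> (w z * ?V z) * ?q' z"
          using elim V_props(2)[OF h(1), of z] by (intro mult_left_mono mult_nonneg_nonneg)
        then show ?case by (simp only: mult.assoc mult_minus_right)
      qed
    qed (use iq in auto)
  qed
  also have "(LINT z|lebesgue. (1 + lam) * ?b z) = (1 + lam) * (s / 2 * (LINT z|lebesgue. indicat_real Kf z * ?n z)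
      + ((LINT z|lborel. indicat_real Kf z * grad2 ?V z) + D * (LINT z|lborel. indicat_real {- T..0} (snd z) * (?V z)\<^sup>2)) / s)"
  proof -
    note l = lebesgue_of_lborel(1)[OF ig] lebesgue_of_lborel(1)[OF V2(1)]
    have "(LINT z|lebesgue. ?b z) = (LINT z|lebesgue. s / 2 * (indicat_real Kf z * ?n z))
      + (LINT z|lebesgue. (indicat_real Kf z * grad2 ?V z + D * (indicat_real {- T..0} (snd z) * (?V z)\<^sup>2)) / s)"
      by (intro Bochner_Integration.integral_add integrable_mult_right Bochner_Integration.integrable_add integrable_divide inn l)
    also have "(LINT z|lebesgue. (indicat_real Kf z * grad2 ?V z + D * (indicat_real {- T..0} (snd z) * (?V z)\<^sup>2)) / s)
      = ((LINT z|lebesgue. indicat_real Kf z * grad2 ?V z) + D * (LINT z|lebesgue. indicat_real {- T..0} (snd z) * (?V z)\<^sup>2)) / s"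
      using Bochner_Integration.integral_add[OF l(1) integrable_mult_right[OF l(2), of D]] by simp
    finally show ?thesis
      by (simp only: integral_mult_right_zero lebesgue_of_lborel(2)[OF ig] lebesgue_of_lborel(2)[OF V2(1)])
  qed
  also have "\<dots> \<le> (1 + lam) * (s / 2 * (LINT z|lebesgue. indicat_real Kf z * ?n z) + (3 / 2 * S * N + e + D * (S * T * N)) / s)"
    using gradient_bound[OF h T Kf(1) _ e] Kf(2) V2(2) s lam D0
    by (intro mult_left_mono add_left_mono divide_right_mono add_mono) auto
  finally show ?thesis by simp
qed

end

subsection \<open>Homogeneous groups and polynomial coefficients\<close>

text \<open>A monomial of weighted degree d is at most R^d on the box, and there are at most (Q +
  1)^N of them, since all weights are at least 1 and no exponent exceeds d \<le> Q.\<close>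

lemma bounded_hom_poly_bound:
  fixes p :: "'n::finite space \<Rightarrow> real"
  assumes p: "bounded_hom_poly \<alpha> lam d p" and \<alpha>: "\<And>i. 1 \<le> \<alpha> i" and d: "d \<le> Q"
    and R: "0 \<le> R" "\<And>i. \<bar>x $ i\<bar> \<le> R ^ \<alpha> i" and lam: "0 \<le> lam"
  shows "\<bar>p x\<bar> \<le> lam * real (Q + 1) ^ CARD('n) * R ^ d"
proof -
  let ?B = "{\<beta>. (\<Sum>i\<in>UNIV. \<alpha> i * \<beta> i) = d}"
  obtain c where c: "\<And>\<beta>. \<bar>c \<beta>\<bar> \<le> lam" "\<And>x. p x = (\<Sum>\<beta>\<in>?B. c \<beta> * (\<Prod>i\<in>UNIV. (x $ i) ^ \<beta> i))"
    using p unfolding bounded_hom_poly_def by auto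
  have sub: "?B \<subseteq> PiE UNIV (\<lambda>_::'n. {..Q})"
  proof
    fix \<beta> :: "'n \<Rightarrow> nat" assume "\<beta> \<in> ?B"
    then have s: "(\<Sum>i\<in>UNIV. \<alpha> i * \<beta> i) = d" by simp
    have "\<beta> i \<le> Q" for i
    proof -
      have "\<beta> i \<le> \<alpha> i * \<beta> i" using \<alpha>[of i] by simp
      also have "\<dots> \<le> (\<Sum>i\<in>UNIV. \<alpha> i * \<beta> i)" by (rule member_le_sum) auto
      finally show ?thesis using s d by simp
    qed
    then show "\<beta> \<in> PiE UNIV (\<lambda>_::'n. {..Q})" by auto
  qed
  have "finite (PiE UNIV (\<lambda>_::'n. {..Q}))" by (intro finite_PiE) auto
  then have "card ?B \<le> card (PiE UNIV (\<lambda>_::'n. {..Q}))" using sub by (rule card_mono)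
  also have "\<dots> = (Q + 1) ^ CARD('n)" by (subst card_PiE) auto
  finally have card: "card ?B \<le> (Q + 1) ^ CARD('n)" .
  have "\<bar>p x\<bar> \<le> (\<Sum>\<beta>\<in>?B. \<bar>c \<beta> * (\<Prod>i\<in>UNIV. (x $ i) ^ \<beta> i)\<bar>)" unfolding c(2) by (rule sum_abs)
  also have "\<dots> \<le> (\<Sum>\<beta>\<in>?B. lam * R ^ d)"
  proof (rule sum_mono)
    fix \<beta> assume b: "\<beta> \<in> ?B"
    have "\<bar>\<Prod>i\<in>UNIV. (x $ i) ^ \<beta> i\<bar> = (\<Prod>i\<in>UNIV. \<bar>x $ i\<bar> ^ \<beta> i)" by (simp add: abs_prod power_abs)
    also have "\<dots> \<le> (\<Prod>i\<in>UNIV. (R ^ \<alpha> i) ^ \<beta> i)"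
      by (intro prod_mono conjI power_mono R) auto
    also have "\<dots> = R ^ (\<Sum>i\<in>UNIV. \<alpha> i * \<beta> i)" by (simp add: power_sum power_mult)
    finally show "\<bar>c \<beta> * (\<Prod>i\<in>UNIV. (x $ i) ^ \<beta> i)\<bar> \<le> lam * R ^ d"
      using b c(1)[of \<beta>] lam unfolding abs_mult by (intro mult_mono) auto
  qed
  also have "\<dots> = real (card ?B) * (lam * R ^ d)" by simp
  also have "\<dots> \<le> real ((Q + 1) ^ CARD('n)) * (lam * R ^ d)"
    using card lam R(1) by (intro mult_right_mono) (auto simp del: of_nat_power)
  finally show ?thesis by (simp add: mult_ac)
qed

text \<open>A coordinate of weight larger than d cannot occur in a polynomial of weighted degree
  d.\<close>

lemma bounded_hom_poly_indep:
  fixes p :: "'n::finite space \<Rightarrow> real"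
  assumes p: "bounded_hom_poly \<alpha> lam d p" and d: "d < \<alpha> i"
  shows "p (x + s *\<^sub>R axis i 1) = p x"
proof -
  obtain c where c: "\<And>x. p x = (\<Sum>\<beta> | (\<Sum>i\<in>UNIV. \<alpha> i * \<beta> i) = d. c \<beta> * (\<Prod>i\<in>UNIV. (x $ i) ^ \<beta> i))"
    using p unfolding bounded_hom_poly_def by auto
  show ?thesis
    unfolding c
  proof (intro sum.cong refl arg_cong2[where f = "(*)"] prod.cong)
    fix \<beta> k assume "\<beta> \<in> {\<beta>. (\<Sum>i\<in>UNIV. \<alpha> i * \<beta> i) = d}"
    then have s: "(\<Sum>i\<in>UNIV. \<alpha> i * \<beta> i) = d" by simp
    have "\<alpha> i * \<beta> i \<le> (\<Sum>i\<in>UNIV. \<alpha> i * \<beta> i)" by (rule member_le_sum) auto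
    then have lt: "\<alpha> i * \<beta> i < \<alpha> i" using s d by linarith
    have "\<beta> i = 0"
    proof (rule ccontr)
      assume "\<beta> i \<noteq> 0"
      then have "\<alpha> i * 1 \<le> \<alpha> i * \<beta> i" by (intro mult_le_mono) auto
      then show False using lt by linarith
    qed
    then show "((x + s *\<^sub>R axis i 1) $ k) ^ \<beta> k = (x $ k) ^ \<beta> k"
      by (cases "k = i") (auto simp: axis_def)
  qed
qed

text \<open>The diagonal entries of the derivative differentiate the i-th component along the i-th
  axis, where it is constant. The constant last component c covers the lifted fields (c = 0) and the
  drift (c = -1).\<close>

lemma divergence_zero:
  fixes W :: "'n::finite space \<Rightarrow> 'n space"
  assumes sm: "smooth_on UNIV W" and ind: "\<And>i x s. W (x + s *\<^sub>R axis i 1) $ i = W x $ i"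
  shows "divergence (\<lambda>z::'n point. (W (fst z), c)) z = 0"
proof -
  let ?F = "\<lambda>z::'n point. (W (fst z), c)"
  have "smooth_on UNIV ?F"
    by (intro smooth_intros open_UNIV smooth_on_compose_UNIV[OF open_UNIV smooth_on_fst[OF open_UNIV smooth_on_id[OF open_UNIV]] sm])
  then have dF: "(?F has_derivative frechet_derivative ?F (at z)) (at z)"
    by (rule smooth_on_imp_has_derivative) simp
  have "frechet_derivative ?F (at z) b \<bullet> b = 0" if b: "b \<in> Basis" for b
  proof -
    have "((\<lambda>s. z + s *\<^sub>R b) has_derivative (\<lambda>s. s *\<^sub>R b)) (at 0)" by (auto intro!: derivative_eq_intros)
    from has_derivative_compose[OF this, of ?F "frechet_derivative ?F (at z)"] dF
    have "((\<lambda>s. ?F (z + s *\<^sub>R b)) has_derivative (\<lambda>s. frechet_derivative ?F (at z) (s *\<^sub>R b))) (at 0)" by simp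
    then have "((\<lambda>s. ?F (z + s *\<^sub>R b) \<bullet> b) has_derivative (\<lambda>s. frechet_derivative ?F (at z) (s *\<^sub>R b) \<bullet> b)) (at 0)"
      by (rule has_derivative_inner_left)
    moreover have const: "?F (z + s *\<^sub>R b) \<bullet> b = ?F z \<bullet> b" for s
    proof -
      consider i where "b = (axis i 1, 0)" | "b = (0, 1)"
        using b by (auto simp: Basis_prod_def Basis_vec_def)
      then show ?thesis
      proof cases
        case 1
        then show ?thesis using ind[of "fst z" s i] by (simp add: inner_prod_def inner_axis)
      qed (simp add: inner_prod_def)
    qed
    ultimately have "((\<lambda>s::real. ?F z \<bullet> b) has_derivative (\<lambda>s. frechet_derivative ?F (at z) (s *\<^sub>R b) \<bullet> b)) (at 0)" by simp
    then have "(\<lambda>s::real. frechet_derivative ?F (at z) (s *\<^sub>R b) \<bullet> b) = (\<lambda>s. 0)"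
      using has_derivative_unique[OF _ has_derivative_const] by blast
    from fun_cong[OF this, of 1] show ?thesis by simp
  qed
  then show ?thesis by (simp add: divergence_def)
qed

lemma coefficient_structure_divergence:
  fixes X :: "nat \<Rightarrow> 'n space \<Rightarrow> 'n::{finite,linorder} space"
  assumes c: "coefficient_structure m0 lam \<alpha> X" and sm: "\<And>j. j \<le> m0 \<Longrightarrow> smooth_on UNIV (X j)" and \<alpha>: "\<And>i. 1 \<le> \<alpha> i"
  shows "j \<in> {1..m0} \<Longrightarrow> divergence (lift X j) z = 0" "divergence (drift X) z = 0"
proof -
  \<comment> \<open>Truncated subtraction is harmless here: since the weight is at least 1, both
    differences are strictly smaller, even when the weight is 1 and the second one is cut to
    0.\<close>
  have a1: "\<alpha> i - 1 < \<alpha> i" "\<alpha> i - 2 < \<alpha> i" for i using \<alpha>[of i] by auto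
  show "divergence (lift X j) z = 0" if j: "j \<in> {1..m0}"
    unfolding lift_def[abs_def]
  proof (rule divergence_zero)
    show "X j (x + s *\<^sub>R axis i 1) $ i = X j x $ i" for i x s
    proof (cases "pos i \<le> m0")
      case True
      then obtain k where "\<And>x. X j x $ i = k" using c j unfolding coefficient_structure_def by metis
      then show ?thesis by simp
    next
      case False
      then have "bounded_hom_poly \<alpha> lam (\<alpha> i - 1) (\<lambda>x. X j x $ i)"
        using c j unfolding coefficient_structure_def by auto
      from bounded_hom_poly_indep[OF this a1(1)] show ?thesis .
    qed
  qed (use sm j in auto)
  show "divergence (drift X) z = 0"
    unfolding drift_def[abs_def]
  proof (rule divergence_zero)
    show "X 0 (x + s *\<^sub>R axis i 1) $ i = X 0 x $ i" for i x s
    proof (cases "pos i \<le> m0")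
      case True
      then show ?thesis using c unfolding coefficient_structure_def by auto
    next
      case False
      then have "bounded_hom_poly \<alpha> lam (\<alpha> i - 2) (\<lambda>x. X 0 x $ i)"
        using c unfolding coefficient_structure_def by auto
      from bounded_hom_poly_indep[OF this a1(2)] show ?thesis .
    qed
  qed (use sm in auto)
qed

lemma smooth_on_vec_lambda:
  fixes f :: "'a::real_normed_vector \<Rightarrow> 'n::finite \<Rightarrow> real"
  assumes "\<And>i. smooth_on UNIV (\<lambda>x. f x i)"
  shows "smooth_on UNIV (\<lambda>x. \<chi> i. f x i)"
proof -
  have "(\<lambda>x. \<chi> i. f x i) = (\<lambda>x. \<Sum>i\<in>UNIV. f x i *\<^sub>R axis i (1::real))"
    by (auto simp: vec_eq_iff axis_def if_distrib[of "\<lambda>c. _ * c"] cong: if_cong)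
  moreover have "smooth_on UNIV (\<lambda>x. \<Sum>i\<in>UNIV. f x i *\<^sub>R axis i (1::real))"
    by (intro smooth_on_sum smooth_on_scaleR smooth_on_const assms open_UNIV)
  ultimately show ?thesis by simp
qed

lemma smooth_dil: "smooth_on UNIV (dil \<alpha> \<mu> :: 'n::finite point \<Rightarrow> 'n point)"
  unfolding dil_def[abs_def]
  by (intro smooth_on_Pair smooth_on_vec_lambda smooth_on_mult smooth_on_const smooth_on_nth smooth_on_fst
      smooth_on_snd smooth_on_id open_UNIV)

lemma dil_inverse: "\<mu> \<noteq> 0 \<Longrightarrow> dil \<alpha> (1 / \<mu>) (dil \<alpha> \<mu> z) = z"
  by (cases z) (simp add: dil_def vec_eq_iff power_one_over)

lemma norm_dil_le:
  fixes z :: "'n::finite point"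
  assumes "0 \<le> \<mu>" "\<mu> \<le> 1" "\<And>i. 1 \<le> \<alpha> i"
  shows "norm (dil \<alpha> \<mu> z) \<le> \<mu> * norm z"
proof -
  have le: "\<mu> ^ k \<le> \<mu>" if "1 \<le> k" for k using power_decreasing[OF that assms(1,2)] by simp
  have "norm (\<chi> i. \<mu> ^ \<alpha> i * fst z $ i) \<le> norm (\<mu> *\<^sub>R fst z)"
    using le[OF assms(3)] assms(1) by (intro norm_le_componentwise_cart) (simp add: abs_mult mult_right_mono)
  then have 1: "norm (\<chi> i. \<mu> ^ \<alpha> i * fst z $ i) \<le> \<mu> * norm (fst z)" using assms(1) by simp
  have 2: "norm (\<mu>\<^sup>2 * snd z) \<le> \<mu> * norm (snd z)" using le[of 2] assms(1) by (simp add: abs_mult mult_right_mono)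
  have "(norm (dil \<alpha> \<mu> z))\<^sup>2 = (norm (\<chi> i. \<mu> ^ \<alpha> i * fst z $ i))\<^sup>2 + (norm (\<mu>\<^sup>2 * snd z))\<^sup>2"
    by (simp add: dil_def norm_prod_def)
  also have "\<dots> \<le> (\<mu> * norm (fst z))\<^sup>2 + (\<mu> * norm (snd z))\<^sup>2"
    by (intro add_mono power_mono 1 2) auto
  also have "\<dots> = (\<mu> * norm z)\<^sup>2" by (simp add: norm_prod_def power_mult_distrib distrib_left)
  finally show ?thesis using assms(1) by (simp add: power2_le_iff_abs_le)
qed

lemma L1_op_dil:
  fixes X :: "nat \<Rightarrow> 'n space \<Rightarrow> 'n::finite space"
  assumes hX: "\<And>j. j \<in> {1..m0} \<Longrightarrow> homogeneous_vf \<alpha> 1 (lift X j)" and hY: "homogeneous_vf \<alpha> 2 (drift X)"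
    and sm: "\<And>j. j \<in> {1..m0} \<Longrightarrow> smooth_on UNIV (lift X j)" and f: "smooth_on UNIV f" and \<mu>: "\<mu> > 0"
  shows "L1_op m0 X (f \<circ> dil \<alpha> \<mu>) z = \<mu>\<^sup>2 * L1_op m0 X f (dil \<alpha> \<mu> z)"
proof -
  have 1: "vf_deriv (lift X j) (g \<circ> dil \<alpha> \<mu>) = (\<lambda>z. \<mu> * vf_deriv (lift X j) g (dil \<alpha> \<mu> z))"
    if "j \<in> {1..m0}" "smooth_on UNIV g" for j g
    using hX[OF that(1)] that(2) \<mu> unfolding homogeneous_vf_def by simp
  have 2: "vf_deriv (lift X j) (vf_deriv (lift X j) (f \<circ> dil \<alpha> \<mu>)) z
      = \<mu>\<^sup>2 * vf_deriv (lift X j) (vf_deriv (lift X j) f) (dil \<alpha> \<mu> z)" if j: "j \<in> {1..m0}" for j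
  proof -
    have sg: "smooth_on UNIV (vf_deriv (lift X j) f)" by (intro smooth_on_vf_deriv sm j f open_UNIV)
    have "vf_deriv (lift X j) (f \<circ> dil \<alpha> \<mu>) = (\<lambda>z. \<mu> * (vf_deriv (lift X j) f \<circ> dil \<alpha> \<mu>) z)"
      using 1[OF j f] by simp
    moreover have "smooth_on UNIV (vf_deriv (lift X j) f \<circ> dil \<alpha> \<mu>)"
      unfolding o_def by (rule smooth_on_compose_UNIV[OF open_UNIV smooth_dil sg])
    ultimately have "vf_deriv (lift X j) (vf_deriv (lift X j) (f \<circ> dil \<alpha> \<mu>)) z
        = \<mu> * vf_deriv (lift X j) (vf_deriv (lift X j) f \<circ> dil \<alpha> \<mu>) z"
      using vf_cmult[of "vf_deriv (lift X j) f \<circ> dil \<alpha> \<mu>" "lift X j" \<mu>] by metis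
    then show ?thesis unfolding 1[OF j sg] by (simp add: power2_eq_square)
  qed
  have 3: "vf_deriv (drift X) (f \<circ> dil \<alpha> \<mu>) z = \<mu>\<^sup>2 * vf_deriv (drift X) f (dil \<alpha> \<mu> z)"
    using hY f \<mu> unfolding homogeneous_vf_def by simp
  have "(\<Sum>j=1..m0. vf_deriv (lift X j) (vf_deriv (lift X j) (f \<circ> dil \<alpha> \<mu>)) z)
      = \<mu>\<^sup>2 * (\<Sum>j=1..m0. vf_deriv (lift X j) (vf_deriv (lift X j) f) (dil \<alpha> \<mu> z))"
    unfolding sum_distrib_left by (intro sum.cong refl 2)
  then show ?thesis unfolding L1_op_def 3 by (simp add: distrib_left)
qed

text \<open>A fixed bump is stretched by composing it with the dilation of small factor \<mu>. L is
  homogeneous of degree two, so L of the stretched bump is \<mu>^2 times a bounded function.\<close>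

lemma dilated_exhaustion:
  fixes X :: "nat \<Rightarrow> 'n space \<Rightarrow> 'n::finite space"
  assumes step: "smooth_step \<sigma>" and \<alpha>: "\<And>i. 1 \<le> \<alpha> i"
    and hX: "\<And>j. j \<in> {1..m0} \<Longrightarrow> homogeneous_vf \<alpha> 1 (lift X j)" and hY: "homogeneous_vf \<alpha> 2 (drift X)"
    and sm: "\<And>j. j \<in> {1..m0} \<Longrightarrow> smooth_on UNIV (lift X j)" "smooth_on UNIV (drift X)"
    and K: "compact K" and e: "0 < e"
  shows "\<exists>E. test_function UNIV E \<and> (\<forall>z. 0 \<le> E z \<and> E z \<le> 1) \<and> (\<forall>z\<in>K. E z = 1) \<and> (\<forall>z. \<bar>L1_op m0 X E z\<bar> \<le> e)"
proof -
  let ?f = "bump \<sigma> (0 :: 'n point) 1"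
  have tf: "test_function UNIV ?f" using bump_props(1)[OF step, of 1 0] by simp
  have sf: "smooth_on UNIV ?f" using tf by (rule test_function_smooth)
  have "test_function UNIV (L1_op m0 X ?f)"
    unfolding L1_op_def by (intro test_function_add test_function_sum test_function_vf_deriv sm tf)
  then obtain B where B: "\<And>z. \<bar>L1_op m0 X ?f z\<bar> \<le> B" "B \<ge> 0" using test_function_bounded by metis
  obtain R where R: "R > 0" "\<And>z. z \<in> K \<Longrightarrow> norm z \<le> R" using compact_imp_bounded[OF K] bounded_pos by metis
  \<comment> \<open>The bounds make the dilation a contraction, let the plateau cover K, and push L
    below e.\<close>
  define \<mu> where "\<mu> = min 1 (min (1 / R) (e / (B + 1)))"
  have "\<mu> \<le> 1 / R" "\<mu> \<le> e / (B + 1)" by (auto simp: \<mu>_def)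
  then have \<mu>: "\<mu> > 0" "\<mu> \<le> 1" "\<mu> * R \<le> 1" "\<mu> * (B + 1) \<le> e"
    using R(1) e B(2) by (auto simp: \<mu>_def pos_le_divide_eq)
  have \<mu>B: "\<mu>\<^sup>2 * B \<le> e"
  proof -
    have "\<mu>\<^sup>2 * B \<le> \<mu> * (B + 1)"
      using \<mu>(1,2) B(2) unfolding power2_eq_square by (intro mult_mono) (auto simp: mult_left_le)
    then show ?thesis using \<mu>(4) by simp
  qed
  let ?E = "?f \<circ> dil \<alpha> \<mu>"
  have "test_function UNIV ?E"
  proof (rule test_functionI[where K = "dil \<alpha> (1 / \<mu>) ` cball 0 2"])
    show "smooth_on UNIV ?E" unfolding o_def by (rule smooth_on_compose_UNIV[OF open_UNIV smooth_dil sf])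
    show "compact (dil \<alpha> (1 / \<mu>) ` cball (0 :: 'n point) 2)"
      using smooth_on_imp_continuous_on[OF smooth_dil] by (intro compact_continuous_image) (auto intro: continuous_on_subset)
    show "z \<in> dil \<alpha> (1 / \<mu>) ` cball 0 2" if "?E z \<noteq> 0" for z
    proof -
      have "norm (dil \<alpha> \<mu> z) \<le> 2" using that bump_props(5)[OF step, of 1 "dil \<alpha> \<mu> z" 0] by force
      then show ?thesis using dil_inverse[of \<mu> \<alpha> z] \<mu>(1) by (intro image_eqI[of _ _ "dil \<alpha> \<mu> z"]) auto
    qed
  qed auto
  moreover have "0 \<le> ?E z \<and> ?E z \<le> 1" for z
    using bump_props(2,3)[OF step zero_less_one, where c = "0 :: 'n point" and z = "dil \<alpha> \<mu> z"] by simp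
  moreover have "?E z = 1" if "z \<in> K" for z
  proof -
    have "norm (dil \<alpha> \<mu> z) \<le> \<mu> * norm z" by (rule norm_dil_le[OF _ \<mu>(2) \<alpha>]) (use \<mu> in auto)
    also have "\<dots> \<le> \<mu> * R" using R(2)[OF that] \<mu>(1) by (intro mult_left_mono) auto
    finally show ?thesis using bump_props(4)[OF step, of 1 "dil \<alpha> \<mu> z" 0] \<mu>(3) by simp
  qed
  moreover have "\<bar>L1_op m0 X ?E z\<bar> \<le> e" for z
  proof -
    have "L1_op m0 X ?E z = \<mu>\<^sup>2 * L1_op m0 X ?f (dil \<alpha> \<mu> z)" by (rule L1_op_dil[OF hX hY sm(1) sf \<mu>(1)])
    then have "\<bar>L1_op m0 X ?E z\<bar> \<le> \<mu>\<^sup>2 * B" using B(1)[of "dil \<alpha> \<mu> z"] by (simp add: abs_mult mult_left_mono)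
    then show ?thesis using \<mu>B by linarith
  qed
  ultimately show ?thesis by blast
qed

text \<open>By invariance the kernel is \<Gamma>(., 0) composed with a smooth map of both points,
  and this map misses 0 off the diagonal once the neutral element is 0. The dilate of the neutral
  element is idempotent, hence equal to it, and only 0 is fixed by the dilation with factor
  2.\<close>

lemma homogeneous_group_kernel_smooth:
  fixes op :: "'n::{finite,linorder} point \<Rightarrow> 'n point \<Rightarrow> 'n point"
  assumes g: "homogeneous_Lie_group op e iv \<alpha>" and s: "smooth_on (- {0}) (\<lambda>z. \<Gamma> z 0)"
    and inv: "\<And>z \<zeta>. \<Gamma> z \<zeta> = \<Gamma> (op (iv \<zeta>) z) (0 :: 'n point)"
  shows "smooth_on {p. fst p \<noteq> snd p} (\<lambda>p. \<Gamma> (fst p) (snd p) :: real)"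
proof -
  have gr: "group op e iv" and sop: "smooth_on UNIV (\<lambda>p. op (fst p) (snd p))" and siv: "smooth_on UNIV iv"
    and \<alpha>: "\<And>i. 1 \<le> \<alpha> i" and dl: "\<And>\<mu> z \<zeta>. \<mu> > 0 \<Longrightarrow> dil \<alpha> \<mu> (op z \<zeta>) = op (dil \<alpha> \<mu> z) (dil \<alpha> \<mu> \<zeta>)"
    using g unfolding homogeneous_Lie_group_def by auto
  interpret group op e iv by (rule gr)
  have "op (dil \<alpha> 2 e) (dil \<alpha> 2 e) = op (dil \<alpha> 2 e) e" using dl[of 2 e e] by simp
  then have de: "dil \<alpha> 2 e = e" using left_cancel by blast
  have "fst e $ i = 0" for i
  proof -
    have "2 ^ \<alpha> i * fst e $ i = fst e $ i" using arg_cong[OF de, of "\<lambda>z. fst z $ i"] by (simp add: dil_def)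
    moreover have "(2::real) ^ \<alpha> i > 1" using \<alpha>[of i] by (simp add: one_less_power)
    ultimately show ?thesis by auto
  qed
  moreover have "snd e = 0" using arg_cong[OF de, of snd] by (simp add: dil_def)
  ultimately have e0: "e = 0" by (simp add: prod_eq_iff vec_eq_iff)
  let ?A = "{p :: 'n point \<times> 'n point. fst p \<noteq> snd p}"
  have op: "open ?A" by (intro open_Collect_neq continuous_intros)
  have "smooth_on UNIV (\<lambda>p :: 'n point \<times> 'n point. (iv (snd p), fst p))"
    by (intro smooth_on_Pair smooth_on_fst smooth_on_id open_UNIV
        smooth_on_compose_UNIV[OF open_UNIV smooth_on_snd[OF open_UNIV smooth_on_id[OF open_UNIV]] siv])
  from smooth_on_compose_UNIV[OF open_UNIV this sop]
  have "smooth_on UNIV (\<lambda>p :: 'n point \<times> 'n point. op (iv (snd p)) (fst p))" by simp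
  then have sf: "smooth_on ?A (\<lambda>p. op (iv (snd p)) (fst p))" by (rule smooth_on_subset) auto
  have "smooth_on ?A (\<lambda>p. \<Gamma> (op (iv (snd p)) (fst p)) 0)"
  proof (rule smooth_on_compose[OF op _ sf s])
    show "(\<lambda>p. op (iv (snd p)) (fst p)) ` ?A \<subseteq> - {0}"
    proof clarsimp
      fix x t y u assume "op (iv (y, u)) (x, t) = 0" and n: "x = y \<longrightarrow> t \<noteq> u"
      then have "op (y, u) (op (iv (y, u)) (x, t)) = op (y, u) e" by (simp add: e0)
      then have "(x, t) = (y, u)" by (simp add: assoc[symmetric])
      then show False using n by simp
    qed
  qed auto
  then show ?thesis by (subst smooth_on_cong[OF op, of _ "\<lambda>p. \<Gamma> (op (iv (snd p)) (fst p)) 0"]) (auto intro: inv)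
qed

subsection \<open>The cut-off function\<close>

text \<open>A zero of a non-negative function is a minimum.\<close>

lemma frechet_zero_at_nonneg_zero:
  fixes f :: "'a::euclidean_space \<Rightarrow> real"
  assumes "f differentiable (at z)" "f z = 0" "\<And>x. 0 \<le> f x"
  shows "vf_deriv Z f z = 0"
  using differential_zero_maxmin[of z UNIV f "frechet_derivative f (at z)"] assms
  unfolding frechet_derivative_works vf_deriv_def by (auto simp: fun_eq_iff)

text \<open>The conditions on \<theta> serve different ends: \<open>root Q \<theta> < 1 / 2\<close>
  bounds the derivative of the profile by 4 / r, while the last two place the small cylinder inside
  the region where the cut-off equals 1.\<close>

locale cutoff =
  fixes m0 Q :: nat and \<alpha> :: "'n::{finite,linorder} \<Rightarrow> nat" and X :: "nat \<Rightarrow> 'n space \<Rightarrow> 'n space"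
    and C1 r \<theta> K lam lam' :: real and h :: "real \<Rightarrow> real"
  assumes r: "0 < r" "r < \<theta>" and theta: "\<theta> < 1" "root Q \<theta> < 1 / 2" "lam' * \<theta> \<le> 1" "(real CARD('n) + C1) * \<theta> \<le> 1"
    and C1: "1 < C1" and lam: "0 \<le> lam" and lam': "1 < lam'"
    and alpha: "\<And>i. 1 \<le> \<alpha> i" and Q: "Q = (\<Sum>i\<in>UNIV. \<alpha> i)"
    and coeff: "coefficient_structure m0 lam \<alpha> X"
    and adm: "admissible_C1 m0 \<alpha> Q X C1 r \<theta>"
    and profile: "cutoff_profile Q K r \<theta> h"
begin

lemma theta_pos: "0 < \<theta>" using r by simp

lemma alpha_le_Q: "\<alpha> i \<le> Q" unfolding Q by (rule member_le_sum) auto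

lemma Q_pos: "0 < Q" using alpha[of undefined] alpha_le_Q[of undefined] by linarith

lemma h_smooth: "smooth_on UNIV h"
  and h_one: "s \<le> root Q \<theta> * r \<Longrightarrow> h s = 1"
  and h_zero: "r < s \<Longrightarrow> h s = 0"
  and h_deriv: "deriv h s \<le> 0" "- deriv h s \<le> 2 / ((1 - root Q \<theta>) * r)"
  using profile by (auto simp: cutoff_profile_def)

lemma root_theta: "0 < root Q \<theta>" "root Q \<theta> ^ Q = \<theta>" "\<theta> \<le> root Q \<theta>"
proof -
  show p: "0 < root Q \<theta>" "root Q \<theta> ^ Q = \<theta>" using theta_pos Q_pos by auto
  have "root Q \<theta> ^ Q \<le> root Q \<theta> ^ 1"
    using p(1) theta(1,2) Q_pos by (intro power_decreasing) auto
  then show "\<theta> \<le> root Q \<theta>" using p(2) by simp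
qed

lemma h_DERIV: "(h has_real_derivative deriv h s) (at s)"
  by (rule smooth_on_imp_has_real_derivative[OF h_smooth])

lemma h_antimono: "a \<le> b \<Longrightarrow> h b \<le> h a"
  using h_DERIV h_deriv(1) by (intro DERIV_nonpos_imp_nonincreasing[of a b h]) auto

lemma h_bounds: "0 \<le> h s" "h s \<le> 1"
  using h_antimono[of s "max s (r + 1)"] h_zero[of "max s (r + 1)"]
    h_antimono[of "min s (root Q \<theta> * r)" s] h_one[of "min s (root Q \<theta> * r)"] by auto

lemma step: "smooth_step (\<lambda>s. 1 - h (root Q \<theta> * r + s * (r + 1 - root Q \<theta> * r)))"
proof (rule smooth_step_of_cutoff)
  have "root Q \<theta> * r < 1 * r" using theta(2) r by (intro mult_strict_right_mono) auto
  then show "root Q \<theta> * r < r + 1" by simp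
qed (use h_smooth h_one h_zero h_deriv in auto)

lemma h_deriv_abs: "\<bar>deriv h s\<bar> \<le> 4 / r"
proof -
  have "1 / 2 * r \<le> (1 - root Q \<theta>) * r" using theta(2) r by (intro mult_right_mono) auto
  then have "2 / ((1 - root Q \<theta>) * r) \<le> 2 / (1 / 2 * r)" using r by (intro divide_left_mono) auto
  then show ?thesis using h_deriv[of s] by simp
qed

lemma h_deriv_zero: "s < root Q \<theta> * r \<Longrightarrow> deriv h s = 0"
proof (rule DERIV_imp_deriv)
  assume s: "s < root Q \<theta> * r"
  show "(h has_real_derivative 0) (at s)"
    by (rule has_field_derivative_transform_within_open[where f = "\<lambda>s. 1" and S = "{..<root Q \<theta> * r}"])
      (use s h_one in auto)
qed

abbreviation "\<phi> \<equiv> cutoff_phi m0 \<alpha> Q C1 r \<theta> h"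

text \<open>In the rescaled coordinates \<open>(\<theta>/r)^\<alpha>\<^sub>j x\<^sub>j\<close> the factor \<open>r^Q\<close> can be pulled out of the root.\<close>

definition p :: "'n point \<Rightarrow> real" where
  "p z = (\<Sum>j | m0 < pos j. ((\<theta> / r) ^ \<alpha> j * fst z $ j)\<^sup>2) + (- C1 / r\<^sup>2) * snd z"

definition q :: "'n point \<Rightarrow> real" where
  "q z = (\<Sum>i | pos i \<le> m0. (fst z $ i)\<^sup>2)"

text \<open>\<open>A\<close> and \<open>B\<close> are the factors phi_0 and phi_1 of the cut-off.
  Both are the profile composed with a root of a polynomial, so their smoothness has a common
  proof.\<close>

definition A :: "'n point \<Rightarrow> real" where "A z = h (r * root Q (p z))"
definition B :: "'n point \<Rightarrow> real" where "B z = h (\<theta> * root 2 (q z))"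

lemma r_powi: "r powi (int Q - 2) = r ^ Q / r\<^sup>2" "r powi (2 * int k - int Q) = (r ^ k)\<^sup>2 / r ^ Q"
  "r powi (int Q - 2 * int k) = r ^ Q / (r ^ k)\<^sup>2"
proof -
  have r0: "r \<noteq> 0" using r by simp
  have k: "r powi (2 * int k) = (r ^ k)\<^sup>2" for k
  proof -
    have "r powi (2 * int k) = r powi int (2 * k)" by simp
    also have "\<dots> = r ^ (2 * k)" by (rule power_int_of_nat)
    finally show ?thesis by (simp add: power_mult mult.commute[of 2])
  qed
  show "r powi (int Q - 2) = r ^ Q / r\<^sup>2" using r0 by (simp add: power_int_diff)
  show "r powi (2 * int k - int Q) = (r ^ k)\<^sup>2 / r ^ Q" using r0 by (simp add: power_int_diff k)
  show "r powi (int Q - 2 * int k) = r ^ Q / (r ^ k)\<^sup>2" using r0 by (simp add: power_int_diff k)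
qed

lemma phi_eq: "\<phi> z = A z * B z"
proof -
  have "(\<Sum>j | m0 < pos j. \<theta> ^ (2 * \<alpha> j) * (fst z $ j)\<^sup>2 / r powi (2 * int (\<alpha> j) - int Q)) - C1 * snd z * r powi (int Q - 2)
      = r ^ Q * p z"
    unfolding r_powi p_def distrib_left sum_distrib_left using r
    by (simp add: power_mult_distrib power_divide power_mult[symmetric] mult.commute field_simps)
  moreover have "root Q (r ^ Q * p z) = r * root Q (p z)"
    using r Q_pos by (simp add: real_root_mult real_root_power_cancel)
  ultimately show ?thesis
    by (simp add: cutoff_phi_def A_def B_def front_norm_def q_def sqrt_def)
qed

lemma smooth_p: "smooth_on UNIV p" and smooth_q: "smooth_on UNIV q"
  unfolding p_def[abs_def] q_def[abs_def]
  by (intro smooth_on_add smooth_on_sum smooth_on_power smooth_on_mult smooth_on_const smooth_on_nth smooth_on_fst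
      smooth_on_snd smooth_on_id open_UNIV)+

lemma smooth_A: "smooth_on UNIV A" and smooth_B: "smooth_on UNIV B"
proof -
  have c: "0 < root Q \<theta> * r" using root_theta r by simp
  show "smooth_on UNIV A"
    unfolding A_def[abs_def]
    by (rule smooth_on_compose_UNIV[OF open_UNIV smooth_p smooth_on_flat_root[OF Q_pos c r(1) h_smooth h_one]])
  show "smooth_on UNIV B"
    unfolding B_def[abs_def]
    by (rule smooth_on_compose_UNIV[OF open_UNIV smooth_q smooth_on_flat_root[OF _ c theta_pos h_smooth h_one]]) auto
qed

lemma phi_fun: "\<phi> = (\<lambda>z. A z * B z)" by (rule ext) (rule phi_eq)

lemma smooth_phi: "smooth_on UNIV \<phi>"
  unfolding phi_fun by (intro smooth_on_mult smooth_A smooth_B open_UNIV)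

lemma AB_bounds: "0 \<le> A z" "A z \<le> 1" "0 \<le> B z" "B z \<le> 1"
  by (auto simp: A_def B_def h_bounds)

lemma phi_bounds: "0 \<le> \<phi> z" "\<phi> z \<le> 1"
  unfolding phi_eq using AB_bounds[of z] by (auto intro: mult_le_one)

lemma p_time: "(- C1 / r\<^sup>2) * snd z \<le> p z"
  unfolding p_def using sum_nonneg[of "{j. m0 < pos j}" "\<lambda>j. ((\<theta> / r) ^ \<alpha> j * fst z $ j)\<^sup>2"] by simp

lemma p_pos: "snd z < 0 \<Longrightarrow> 0 < p z"
proof -
  assume "snd z < 0"
  then have "0 < (- C1 / r\<^sup>2) * snd z" using C1 r by (intro mult_neg_neg) auto
  then show ?thesis using p_time[of z] by linarith
qed

lemma rescale: "\<bar>x\<bar> \<le> (r / \<theta>) ^ k \<longleftrightarrow> \<bar>(\<theta> / r) ^ k * x\<bar> \<le> 1"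
  using r theta_pos by (simp add: abs_mult power_divide divide_simps mult.commute)

text \<open>For t < 0 both parts of p are non-negative, so p \<le> 1 bounds every rescaled
  coordinate and the time separately; C1 > 1 turns the latter bound into -t \<le> r^2.\<close>

lemma phi_support:
  assumes t: "snd z < 0" and nz: "\<phi> z \<noteq> 0"
  shows "z \<in> bigbox m0 \<alpha> r \<theta>"
proof -
  have "A z \<noteq> 0" "B z \<noteq> 0" using nz by (auto simp: phi_eq)
  then have a: "r * root Q (p z) \<le> r" and b: "\<theta> * root 2 (q z) \<le> r"
    using h_zero by (force simp: A_def B_def not_le[symmetric])+
  have "root Q (p z) \<le> 1" using a r by simp
  then have p1: "p z \<le> 1" using Q_pos by simp
  have "(- C1 / r\<^sup>2) * snd z \<le> 1" using p_time[of z] p1 by linarith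
  then have "C1 * (- snd z) \<le> r\<^sup>2" using r by (simp add: field_simps)
  moreover have "1 * (- snd z) \<le> C1 * (- snd z)" using C1 t by (intro mult_right_mono) auto
  ultimately have time: "- r\<^sup>2 \<le> snd z" by linarith
  have "\<bar>fst z $ j\<bar> \<le> (r / \<theta>) ^ \<alpha> j" if j: "m0 < pos j" for j
  proof -
    have "((\<theta> / r) ^ \<alpha> j * fst z $ j)\<^sup>2 \<le> (\<Sum>j | m0 < pos j. ((\<theta> / r) ^ \<alpha> j * fst z $ j)\<^sup>2)"
      using j by (intro member_le_sum) auto
    also have "\<dots> \<le> 1"
    proof -
      have "0 \<le> (- C1 / r\<^sup>2) * snd z" using C1 t by (intro mult_nonpos_nonpos) auto
      then show ?thesis using p1 unfolding p_def by linarith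
    qed
    finally show ?thesis unfolding rescale by (simp add: abs_square_le_1)
  qed
  moreover have "front_norm m0 (fst z) \<le> r / \<theta>"
    using b theta_pos by (simp add: front_norm_def q_def sqrt_def field_simps)
  ultimately show ?thesis using time t by (cases z) (auto simp: bigbox_def)
qed

text \<open>On the small cylinder the rescaled coordinates are at most a power of lam' \<theta>^2,
  hence at most \<theta>. So p is at most (N + C1) \<theta>^2 \<le> \<theta>, and the argument of
  the profile stays below its threshold \<open>root Q \<theta> * r\<close>.\<close>

lemma phi_one:
  assumes "z \<in> cyl m0 \<alpha> lam' (\<theta> * r)"
  shows "\<phi> z = 1"
proof -
  have t: "- (\<theta> * r)\<^sup>2 \<le> snd z" and f: "front_norm m0 (fst z) \<le> \<theta> * r"
    and x: "\<And>j. m0 < pos j \<Longrightarrow> \<bar>fst z $ j\<bar> \<le> (lam' * (\<theta> * r)) ^ \<alpha> j"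
    using assms by (auto simp: cyl_def)
  have th2: "lam' * \<theta> * \<theta> \<le> \<theta>" using theta(3) theta_pos by simp
  have th1: "lam' * \<theta> * \<theta> \<le> 1" using th2 theta(1) by linarith
  have y: "((\<theta> / r) ^ \<alpha> j * fst z $ j)\<^sup>2 \<le> \<theta>\<^sup>2" if j: "m0 < pos j" for j
  proof -
    have "\<bar>(\<theta> / r) ^ \<alpha> j * fst z $ j\<bar> \<le> (\<theta> / r) ^ \<alpha> j * (lam' * (\<theta> * r)) ^ \<alpha> j"
      using x[OF j] r theta_pos by (simp add: abs_mult mult_left_mono)
    also have "\<dots> = (lam' * \<theta> * \<theta>) ^ \<alpha> j"
      using r by (simp add: power_mult_distrib[symmetric] mult_ac)
    also have "\<dots> \<le> (lam' * \<theta> * \<theta>) ^ 1"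
      using alpha[of j] th1 theta_pos lam' by (intro power_decreasing) auto
    also have "\<dots> \<le> \<theta>" using th2 by simp
    finally show ?thesis using theta_pos by (simp add: abs_le_square_iff[symmetric])
  qed
  have "(\<Sum>j | m0 < pos j. ((\<theta> / r) ^ \<alpha> j * fst z $ j)\<^sup>2) \<le> real (card {j :: 'n. m0 < pos j}) * \<theta>\<^sup>2"
    using sum_bounded_above[of "{j. m0 < pos j}" "\<lambda>j. ((\<theta> / r) ^ \<alpha> j * fst z $ j)\<^sup>2" "\<theta>\<^sup>2"] y by simp
  also have "\<dots> \<le> real CARD('n) * \<theta>\<^sup>2" by (intro mult_right_mono) (auto intro: card_mono)
  finally have 1: "(\<Sum>j | m0 < pos j. ((\<theta> / r) ^ \<alpha> j * fst z $ j)\<^sup>2) \<le> real CARD('n) * \<theta>\<^sup>2" .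
  have "(- C1 / r\<^sup>2) * snd z = C1 / r\<^sup>2 * (- snd z)" by simp
  also have "\<dots> \<le> C1 / r\<^sup>2 * (\<theta> * r)\<^sup>2" using t C1 by (intro mult_left_mono) auto
  also have "\<dots> = C1 * \<theta>\<^sup>2" using r by (simp add: power_mult_distrib)
  finally have "p z \<le> (real CARD('n) + C1) * \<theta> * \<theta>"
    using 1 by (simp add: p_def distrib_right power2_eq_square)
  also have "\<dots> \<le> 1 * \<theta>" using theta(4) theta_pos by (intro mult_right_mono) auto
  finally have "root Q (p z) \<le> root Q \<theta>" using Q_pos by simp
  then have "A z = 1" unfolding A_def using r by (intro h_one) (simp add: mult.commute mult_right_mono)
  moreover have "B z = 1"
    unfolding B_def
  proof (rule h_one)
    have "\<theta> * root 2 (q z) \<le> \<theta> * (\<theta> * r)"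
      using f theta_pos by (intro mult_left_mono) (auto simp: front_norm_def q_def sqrt_def)
    also have "\<dots> \<le> 1 * (\<theta> * r)" using theta(1) r theta_pos by (intro mult_right_mono) auto
    also have "\<dots> \<le> root Q \<theta> * r" using root_theta(3) r by (simp add: mult_right_mono)
    finally show "\<theta> * root 2 (q z) \<le> root Q \<theta> * r" .
  qed
  ultimately show ?thesis by (simp add: phi_eq)
qed

lemma vf_coord: "vf_deriv Z (\<lambda>z. fst z $ i) z = fst (Z z) $ i" for Z :: "'n point \<Rightarrow> 'n point"
proof -
  have "bounded_linear (\<lambda>z :: 'n point. fst z $ i)"
    using bounded_linear_compose[OF bounded_linear_vec_nth bounded_linear_fst] .
  from vf_deriv_eq[OF bounded_linear_imp_has_derivative[OF this]] show ?thesis .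
qed

lemma vf_coord_sq: "vf_deriv Z (\<lambda>z. (c * fst z $ i)\<^sup>2) z = 2 * c\<^sup>2 * fst z $ i * fst (Z z) $ i" for Z :: "'n point \<Rightarrow> 'n point"
proof -
  have s: "smooth_on UNIV (\<lambda>z :: 'n point. fst z $ i)" by (intro smooth_on_nth smooth_on_fst smooth_on_id open_UNIV)
  have "vf_deriv Z (\<lambda>z. (c * fst z $ i)\<^sup>2) z = vf_deriv Z (\<lambda>z. c\<^sup>2 * (fst z $ i * fst z $ i)) z"
    by (simp add: power2_eq_square mult_ac)
  also have "\<dots> = 2 * c\<^sup>2 * fst z $ i * fst (Z z) $ i"
    unfolding vf_cmult[OF smooth_on_mult[OF open_UNIV s s]] vf_mult[OF s s] by (simp add: vf_coord)
  finally show ?thesis .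
qed

lemma vf_p: "vf_deriv Z p z = (\<Sum>j | m0 < pos j. 2 * ((\<theta> / r) ^ \<alpha> j)\<^sup>2 * fst z $ j * fst (Z z) $ j) + (- C1 / r\<^sup>2) * snd (Z z)"
proof -
  have s: "smooth_on UNIV (\<lambda>z :: 'n point. ((\<theta> / r) ^ \<alpha> j * fst z $ j)\<^sup>2)" for j
    by (intro smooth_on_power smooth_on_mult smooth_on_const smooth_on_nth smooth_on_fst smooth_on_id open_UNIV)
  have s2: "smooth_on UNIV (\<lambda>z :: 'n point. snd z)" by (intro smooth_on_snd smooth_on_id open_UNIV)
  have t: "vf_deriv Z (\<lambda>z. snd z) z = snd (Z z)"
    by (rule vf_deriv_eq[OF bounded_linear_imp_has_derivative[OF bounded_linear_snd]])
  have "vf_deriv Z p z = vf_deriv Z (\<lambda>z. \<Sum>j | m0 < pos j. ((\<theta> / r) ^ \<alpha> j * fst z $ j)\<^sup>2) z + vf_deriv Z (\<lambda>z. (- C1 / r\<^sup>2) * snd z) z"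
    unfolding p_def[abs_def]
    by (intro vf_deriv_add smooth_differentiable smooth_on_sum s open_UNIV smooth_on_mult smooth_on_const s2)
  also have "vf_deriv Z (\<lambda>z. \<Sum>j | m0 < pos j. ((\<theta> / r) ^ \<alpha> j * fst z $ j)\<^sup>2) z
      = (\<Sum>j | m0 < pos j. vf_deriv Z (\<lambda>z. ((\<theta> / r) ^ \<alpha> j * fst z $ j)\<^sup>2) z)"
    by (intro vf_deriv_sum smooth_differentiable s)
  also have "vf_deriv Z (\<lambda>z. (- C1 / r\<^sup>2) * snd z) z = (- C1 / r\<^sup>2) * snd (Z z)"
    unfolding vf_cmult[OF s2] t ..
  finally show ?thesis by (simp only: vf_coord_sq)
qed

lemma vf_q: "vf_deriv Z q z = (\<Sum>i | pos i \<le> m0. 2 * fst z $ i * fst (Z z) $ i)"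
proof -
  have s: "smooth_on UNIV (\<lambda>z :: 'n point. (fst z $ j)\<^sup>2)" for j
    by (intro smooth_on_power smooth_on_nth smooth_on_fst smooth_on_id open_UNIV)
  have "vf_deriv Z q z = (\<Sum>i | pos i \<le> m0. vf_deriv Z (\<lambda>z. (fst z $ i)\<^sup>2) z)"
    unfolding q_def[abs_def] by (intro vf_deriv_sum smooth_differentiable s)
  then show ?thesis using vf_coord_sq[of Z 1] by simp
qed

lemma vf_A:
  assumes "snd z < 0"
  shows "vf_deriv Z A z = deriv h (r * root Q (p z)) * (r * inverse (real Q * root Q (p z) ^ (Q - 1))) * vf_deriv Z p z"
  unfolding A_def[abs_def]
proof (rule vf_deriv_compose[of p z "\<lambda>s. h (r * root Q s)", OF smooth_differentiable[OF smooth_p]])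
  have "((\<lambda>s. r * root Q s) has_real_derivative r * inverse (real Q * root Q (p z) ^ (Q - 1))) (at (p z))"
    using DERIV_cmult[OF DERIV_real_root[OF Q_pos p_pos[OF assms]], of r] by simp
  then show "((\<lambda>s. h (r * root Q s)) has_real_derivative
      deriv h (r * root Q (p z)) * (r * inverse (real Q * root Q (p z) ^ (Q - 1)))) (at (p z))"
    by (rule DERIV_chain2[OF h_DERIV])
qed

lemma vf_B:
  assumes "0 < q z"
  shows "vf_deriv Z B z = deriv h (\<theta> * root 2 (q z)) * (\<theta> * inverse (2 * root 2 (q z))) * vf_deriv Z q z"
  unfolding B_def[abs_def]
proof (rule vf_deriv_compose[of q z "\<lambda>s. h (\<theta> * root 2 s)", OF smooth_differentiable[OF smooth_q]])
  have "((\<lambda>s. \<theta> * root 2 s) has_real_derivative \<theta> * inverse (2 * root 2 (q z))) (at (q z))"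
    using DERIV_cmult[OF DERIV_real_root[of 2, OF _ assms], of \<theta>] by simp
  then show "((\<lambda>s. h (\<theta> * root 2 s)) has_real_derivative
      deriv h (\<theta> * root 2 (q z)) * (\<theta> * inverse (2 * root 2 (q z)))) (at (q z))"
    by (rule DERIV_chain2[OF h_DERIV])
qed

lemma q_nonneg: "0 \<le> q z" unfolding q_def by (intro sum_nonneg) simp

lemma vf_B_q_zero:
  assumes "q z = 0"
  shows "vf_deriv Z B z = 0"
proof -
  have B1: "B z = 1" using assms root_theta r by (auto simp: B_def intro!: h_one)
  have s: "smooth_on UNIV (\<lambda>z. 1 - B z)" by (intro smooth_on_diff smooth_on_const smooth_B open_UNIV)
  have "vf_deriv Z (\<lambda>z. 1 - B z) z = 0"
    by (rule frechet_zero_at_nonneg_zero) (use s B1 AB_bounds in \<open>auto intro: smooth_differentiable\<close>)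
  then show ?thesis using vf_diff[OF smooth_on_const smooth_B, of Z 1] by simp
qed

lemma vf_phi: "vf_deriv Z \<phi> z = A z * vf_deriv Z B z + vf_deriv Z A z * B z"
  unfolding phi_fun vf_mult[OF smooth_A smooth_B] by simp

text \<open>The defining inequality of C1 makes Y p non-negative on the box, the profile decreases,
  and Y does not differentiate in the first m0 coordinates. Where \<phi> = 0 it has a minimum, so
  its derivative vanishes there.\<close>

lemma drift_phi_nonpos:
  assumes t: "snd z < 0"
  shows "vf_deriv (drift X) \<phi> z \<le> 0"
proof (cases "\<phi> z = 0")
  case True
  then show ?thesis
    using frechet_zero_at_nonneg_zero[OF smooth_differentiable[OF smooth_phi] _ phi_bounds(1)] by simp
next
  case False
  have bb: "z \<in> bigbox m0 \<alpha> r \<theta>" by (rule phi_support[OF t False])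
  let ?S = "\<Sum>j | m0 < pos j. 2 * ((\<theta> / r) ^ \<alpha> j)\<^sup>2 * fst z $ j * X 0 (fst z) $ j"
  have "\<bar>\<Sum>j | m0 < pos j. 2 * \<theta> ^ (2 * \<alpha> j) * X 0 (fst z) $ j * fst z $ j * r powi (int Q - 2 * int (\<alpha> j))\<bar>
      \<le> C1 * r powi (int Q - 2)"
    using adm bb unfolding admissible_C1_def by (cases z) auto
  also have "(\<Sum>j | m0 < pos j. 2 * \<theta> ^ (2 * \<alpha> j) * X 0 (fst z) $ j * fst z $ j * r powi (int Q - 2 * int (\<alpha> j))) = r ^ Q * ?S"
    unfolding sum_distrib_left r_powi using r
    by (intro sum.cong refl) (simp add: power_divide power_mult field_simps power2_eq_square)
  finally have "r ^ Q * \<bar>?S\<bar> \<le> r ^ Q * (C1 / r\<^sup>2)"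
    using r by (simp add: abs_mult r_powi mult_ac)
  then have "\<bar>?S\<bar> \<le> C1 / r\<^sup>2" by (rule mult_left_le_imp_le) (use r in simp)
  then have "0 \<le> vf_deriv (drift X) p z" unfolding vf_p by (simp add: drift_def abs_le_iff)
  moreover have "0 \<le> root Q (p z)" using p_pos[OF t] Q_pos by simp
  ultimately have "vf_deriv (drift X) A z \<le> 0"
    unfolding vf_A[OF t] using h_deriv(1) r by (intro mult_nonpos_nonneg mult_nonneg_nonneg) auto
  moreover have "vf_deriv (drift X) B z = 0"
  proof (cases "q z = 0")
    case True
    then show ?thesis by (rule vf_B_q_zero)
  next
    case False
    have "vf_deriv (drift X) q z = 0"
      unfolding vf_q using coeff by (intro sum.neutral) (auto simp: drift_def coefficient_structure_def)
    moreover have "0 < q z" using False q_nonneg[of z] by simp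
    ultimately show ?thesis by (simp add: vf_B)
  qed
  ultimately show ?thesis
    unfolding vf_phi using AB_bounds[of z] by (simp add: mult_nonpos_nonneg)
qed

text \<open>Bound for r times the derivatives of \<phi> along the fields X_j: the first summand
  stems from \<open>B\<close>, the second from \<open>A\<close>. The factor 4 is the bound for r
  times the derivative of the profile.\<close>

definition "M = 4 * real CARD('n) * lam + 8 * real CARD('n) * (lam * real (Q + 1) ^ CARD('n))"

text \<open>Differentiating p gains \<theta> / r, while the derivative of the Q-th root costs at
  most \<theta>^(-(Q-1)/Q), because the derivative of the profile vanishes where p < \<theta>. The
  product is \<theta>^(1/Q) / r, so the bound does not deteriorate as \<theta> becomes
  small.\<close>

lemma lift_phi_bound:
  assumes j: "j \<in> {1..m0}" and t: "snd z < 0" and bb: "z \<in> bigbox m0 \<alpha> r \<theta>"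
  shows "\<bar>vf_deriv (lift X j) \<phi> z\<bar> \<le> M / r"
proof -
  let ?c = "lam * real (Q + 1) ^ CARD('n)"
  have gen: "\<bar>a * b * c\<bar> = \<bar>a\<bar> * b * \<bar>c\<bar>" if "0 \<le> b" for a b c :: real
    using that by (simp add: abs_mult)
  have gen2: "a * b * inverse b = a" if "0 < b" for a b :: real using that by simp
  have fr: "front_norm m0 (fst z) \<le> r / \<theta>" and xb: "\<And>i. m0 < pos i \<Longrightarrow> \<bar>fst z $ i\<bar> \<le> (r / \<theta>) ^ \<alpha> i"
    using bb by (auto simp: bigbox_def)
  have qi: "\<bar>fst z $ i\<bar> \<le> root 2 (q z)" if "pos i \<le> m0" for i
  proof -
    have "(fst z $ i)\<^sup>2 \<le> q z" unfolding q_def using that by (intro member_le_sum) auto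
    then show ?thesis using real_sqrt_le_mono by (fastforce simp: sqrt_def[symmetric])
  qed
  have xa: "\<bar>fst z $ i\<bar> \<le> (r / \<theta>) ^ \<alpha> i" for i
  proof (cases "pos i \<le> m0")
    case True
    then have "\<alpha> i = 1" using coeff by (auto simp: coefficient_structure_def)
    then show ?thesis using qi[OF True] fr by (simp add: front_norm_def q_def sqrt_def)
  qed (use xb in auto)
  have Xb: "(\<theta> / r) ^ \<alpha> i * \<bar>X j (fst z) $ i\<bar> \<le> ?c * (\<theta> / r)" if i: "m0 < pos i" for i
  proof -
    have "bounded_hom_poly \<alpha> lam (\<alpha> i - 1) (\<lambda>x. X j x $ i)"
      using coeff j i by (auto simp: coefficient_structure_def)
    then have "\<bar>X j (fst z) $ i\<bar> \<le> ?c * (r / \<theta>) ^ (\<alpha> i - 1)"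
      by (rule bounded_hom_poly_bound[OF _ alpha]) (use alpha_le_Q[of i] xa r theta_pos lam in auto)
    then have "(\<theta> / r) ^ \<alpha> i * \<bar>X j (fst z) $ i\<bar> \<le> (\<theta> / r) ^ \<alpha> i * (?c * (r / \<theta>) ^ (\<alpha> i - 1))"
      using r theta_pos by (intro mult_left_mono) auto
    also have "\<dots> = ?c * (\<theta> / r) * ((\<theta> / r) * (r / \<theta>)) ^ (\<alpha> i - 1)"
    proof -
      have e: "(\<theta> / r) ^ \<alpha> i = (\<theta> / r) * (\<theta> / r) ^ (\<alpha> i - 1)"
        using alpha[of i] by (cases "\<alpha> i") auto
      show ?thesis unfolding e power_mult_distrib by (simp only: mult_ac)
    qed
    also have "\<dots> = ?c * (\<theta> / r)" using r theta_pos by simp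
    finally show ?thesis .
  qed
  have c0: "0 \<le> ?c" using lam by simp
  have "\<bar>vf_deriv (lift X j) p z\<bar> \<le> (\<Sum>i | m0 < pos i. \<bar>2 * ((\<theta> / r) ^ \<alpha> i)\<^sup>2 * fst z $ i * X j (fst z) $ i\<bar>)"
    unfolding vf_p by (simp add: lift_def)
  also have "\<dots> \<le> (\<Sum>i | m0 < pos (i :: 'n). 2 * (?c * (\<theta> / r)))"
  proof (rule sum_mono)
    fix i :: 'n assume "i \<in> {i. m0 < pos i}"
    then have i: "m0 < pos i" by simp
    have "\<bar>2 * ((\<theta> / r) ^ \<alpha> i)\<^sup>2 * fst z $ i * X j (fst z) $ i\<bar>
        = 2 * (\<bar>(\<theta> / r) ^ \<alpha> i * fst z $ i\<bar> * ((\<theta> / r) ^ \<alpha> i * \<bar>X j (fst z) $ i\<bar>))"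
      using r theta_pos by (simp add: abs_mult power2_eq_square)
    also have "\<dots> \<le> 2 * (1 * (?c * (\<theta> / r)))"
    proof (rule mult_left_mono)
      show "\<bar>(\<theta> / r) ^ \<alpha> i * fst z $ i\<bar> * ((\<theta> / r) ^ \<alpha> i * \<bar>X j (fst z) $ i\<bar>) \<le> 1 * (?c * (\<theta> / r))"
        using xa[of i, unfolded rescale] Xb[OF i] by (rule mult_mono) (use r theta_pos in auto)
    qed simp
    finally show "\<bar>2 * ((\<theta> / r) ^ \<alpha> i)\<^sup>2 * fst z $ i * X j (fst z) $ i\<bar> \<le> 2 * (?c * (\<theta> / r))" by simp
  qed
  also have "\<dots> = real (card {i :: 'n. m0 < pos i}) * (2 * (?c * (\<theta> / r)))" by simp
  also have "\<dots> \<le> real CARD('n) * (2 * (?c * (\<theta> / r)))"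
    using c0 r theta_pos by (intro mult_right_mono) (auto intro: card_mono)
  finally have vp: "\<bar>vf_deriv (lift X j) p z\<bar> \<le> real CARD('n) * (2 * (?c * (\<theta> / r)))" .
  have vA: "\<bar>vf_deriv (lift X j) A z\<bar> \<le> 8 * real CARD('n) * ?c / r"
  proof (cases "root Q (p z) < root Q \<theta>")
    case True
    then have "r * root Q (p z) < root Q \<theta> * r" using r by (simp add: mult.commute)
    then have "deriv h (r * root Q (p z)) = 0" by (rule h_deriv_zero)
    then show ?thesis unfolding vf_A[OF t] using c0 r by simp
  next
    case False
    have rp: "root Q \<theta> ^ (Q - 1) \<le> root Q (p z) ^ (Q - 1)" using False root_theta(1) by (intro power_mono) auto
    have rt: "0 < root Q \<theta> ^ (Q - 1)" using root_theta(1) by simp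
    have "root Q \<theta> ^ (Q - 1) \<le> real Q * root Q (p z) ^ (Q - 1)"
      using rp rt Q_pos by (smt (verit) mult_left_le_imp_le mult_le_cancel_right1 of_nat_1 of_nat_mono Suc_leI One_nat_def)
    then have inv: "inverse (real Q * root Q (p z) ^ (Q - 1)) \<le> inverse (root Q \<theta> ^ (Q - 1))"
      using rt by (rule le_imp_inverse_le)
    have inv0: "0 \<le> inverse (real Q * root Q (p z) ^ (Q - 1))" using p_pos[OF t] Q_pos by simp
    have "\<bar>vf_deriv (lift X j) A z\<bar>
        = \<bar>deriv h (r * root Q (p z))\<bar> * (r * inverse (real Q * root Q (p z) ^ (Q - 1))) * \<bar>vf_deriv (lift X j) p z\<bar>"
      unfolding vf_A[OF t] using inv0 r by (intro gen mult_nonneg_nonneg) auto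
    also have "\<dots> \<le> 4 / r * (r * inverse (root Q \<theta> ^ (Q - 1))) * (real CARD('n) * (2 * (?c * (\<theta> / r))))"
      using h_deriv_abs inv inv0 vp r rt by (intro mult_mono mult_nonneg_nonneg) auto
    also have "\<dots> = 8 * real CARD('n) * ?c / r * (\<theta> * inverse (root Q \<theta> ^ (Q - 1)))"
      using r by (simp add: field_simps)
    also have "\<theta> * inverse (root Q \<theta> ^ (Q - 1)) = root Q \<theta>"
    proof -
      have e: "root Q \<theta> * root Q \<theta> ^ (Q - 1) = \<theta>" using root_theta(2) Q_pos by (metis power_eq_if not_gr_zero)
      have "\<theta> * inverse (root Q \<theta> ^ (Q - 1)) = root Q \<theta> * root Q \<theta> ^ (Q - 1) * inverse (root Q \<theta> ^ (Q - 1))"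
        by (simp only: e)
      also have "\<dots> = root Q \<theta>" by (rule gen2[OF rt])
      finally show ?thesis .
    qed
    also have "8 * real CARD('n) * ?c / r * root Q \<theta> \<le> 8 * real CARD('n) * ?c / r * 1"
      using theta(2) c0 r by (intro mult_left_mono) auto
    finally show ?thesis by simp
  qed
  have vB: "\<bar>vf_deriv (lift X j) B z\<bar> \<le> 4 * real CARD('n) * lam / r"
  proof (cases "q z = 0")
    case True
    then show ?thesis using vf_B_q_zero lam r by simp
  next
    case False
    then have qp: "0 < q z" using q_nonneg[of z] by simp
    then have rq: "0 < root 2 (q z)" by simp
    have "\<bar>vf_deriv (lift X j) q z\<bar> \<le> (\<Sum>i | pos i \<le> m0. \<bar>2 * fst z $ i * X j (fst z) $ i\<bar>)"
      unfolding vf_q by (simp add: lift_def)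
    also have "\<dots> \<le> (\<Sum>i | pos (i :: 'n) \<le> m0. 2 * (root 2 (q z) * lam))"
    proof (rule sum_mono)
      fix i :: 'n assume "i \<in> {i. pos i \<le> m0}"
      then have i: "pos i \<le> m0" by simp
      obtain c where c: "\<bar>c\<bar> \<le> lam" "\<And>x. X j x $ i = c"
        using coeff j i unfolding coefficient_structure_def by metis
      then have "\<bar>X j (fst z) $ i\<bar> \<le> lam" by simp
      then have "\<bar>fst z $ i\<bar> * \<bar>X j (fst z) $ i\<bar> \<le> root 2 (q z) * lam"
        using qi[OF i] rq by (intro mult_mono) auto
      then show "\<bar>2 * fst z $ i * X j (fst z) $ i\<bar> \<le> 2 * (root 2 (q z) * lam)" by (simp add: abs_mult)
    qed
    also have "\<dots> = real (card {i :: 'n. pos i \<le> m0}) * (2 * (root 2 (q z) * lam))" by simp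
    also have "\<dots> \<le> real CARD('n) * (2 * (root 2 (q z) * lam))"
      using rq lam by (intro mult_right_mono) (auto intro: card_mono)
    finally have vq: "\<bar>vf_deriv (lift X j) q z\<bar> \<le> real CARD('n) * (2 * (root 2 (q z) * lam))" .
    have "\<bar>vf_deriv (lift X j) B z\<bar>
        = \<bar>deriv h (\<theta> * root 2 (q z))\<bar> * (\<theta> * inverse (2 * root 2 (q z))) * \<bar>vf_deriv (lift X j) q z\<bar>"
      unfolding vf_B[OF qp] using theta_pos rq by (intro gen mult_nonneg_nonneg) auto
    also have "\<dots> \<le> 4 / r * (\<theta> * inverse (2 * root 2 (q z))) * (real CARD('n) * (2 * (root 2 (q z) * lam)))"
      using h_deriv_abs vq r rq theta_pos by (intro mult_mono mult_nonneg_nonneg) auto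
    also have "\<dots> = 4 * real CARD('n) * lam / r * \<theta>" using rq by (simp add: field_simps)
    also have "\<dots> \<le> 4 * real CARD('n) * lam / r * 1"
      using theta(1) lam r by (intro mult_left_mono) auto
    finally show ?thesis by simp
  qed
  have "\<bar>vf_deriv (lift X j) \<phi> z\<bar> \<le> \<bar>A z * vf_deriv (lift X j) B z\<bar> + \<bar>vf_deriv (lift X j) A z * B z\<bar>"
    unfolding vf_phi by (rule abs_triangle_ineq)
  also have "\<dots> \<le> 1 * \<bar>vf_deriv (lift X j) B z\<bar> + \<bar>vf_deriv (lift X j) A z\<bar> * 1"
    unfolding abs_mult using AB_bounds[of z] by (intro add_mono mult_mono) auto
  also have "\<dots> \<le> 4 * real CARD('n) * lam / r + 8 * real CARD('n) * ?c / r" using vA vB by simp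
  also have "\<dots> = M / r" by (simp add: M_def add_divide_distrib mult.assoc)
  finally show ?thesis .
qed

lemma grad2_phi_bound:
  assumes "snd z < 0" "z \<in> bigbox m0 \<alpha> r \<theta>"
  shows "(\<Sum>j=1..m0. (vf_deriv (lift X j) \<phi> z)\<^sup>2) \<le> real m0 * M\<^sup>2 / r\<^sup>2"
proof -
  have "(\<Sum>j=1..m0. (vf_deriv (lift X j) \<phi> z)\<^sup>2) \<le> (\<Sum>j=1..m0. (M / r)\<^sup>2)"
    using lift_phi_bound[OF _ assms] by (intro sum_mono) (metis abs_ge_zero power2_abs power_mono)
  then show ?thesis by (simp add: power_divide)
qed

end

subsection \<open>The estimate at a fixed level\<close>

lemma borel_version:
  fixes f :: "'a::euclidean_space \<Rightarrow> real"
  assumes "f \<in> borel_measurable lebesgue"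
  obtains f' where "f' \<in> borel_measurable borel" "AE z in lebesgue. f z = f' z"
proof -
  obtain f' where "f' \<in> borel_measurable lborel" "AE z in lborel. f z = f' z"
    using completion_ex_borel_measurable_real[OF assms] by auto
  then show ?thesis using that[of f'] AE_completion by auto
qed

context potential
begin

lemma V_le: "0 < h \<Longrightarrow> ennreal (V h \<zeta>) \<le> (\<integral>\<^sup>+z. ennreal (G z \<zeta>) * ennreal (\<psi> z) \<partial>lborel)"
proof -
  assume h: "0 < h"
  note r = ramp_props[OF step h]
  have "ennreal (V h \<zeta>) = (\<integral>\<^sup>+z. ennreal (G z \<zeta>) * ennreal (ramp \<sigma> h (snd z - snd \<zeta>)) * ennreal (\<psi> z) \<partial>lborel)"
    by (rule pot_nn[OF r(1) h r(4) r(2)])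
  also have "\<dots> \<le> (\<integral>\<^sup>+z. ennreal (G z \<zeta>) * 1 * ennreal (\<psi> z) \<partial>lborel)"
    using r(3) by (intro nn_integral_mono mult_right_mono mult_left_mono) auto
  finally show ?thesis by simp
qed

text \<open>The limit h \<rightarrow> 0 of the duality estimate. f is a Borel majorant of w times
  the derivative terms of \<phi> in I1 and C2, so that Fubini applies to Borel functions; \<iota>
  stands for I0, and \<open>level\<close> says that \<psi> is at most w - \<iota> wherever it is
  non-zero.\<close>

theorem level_estimate:
  fixes w YW :: "'n point \<Rightarrow> real" and XW :: "nat \<Rightarrow> 'n point \<Rightarrow> real" and a :: "nat \<Rightarrow> nat \<Rightarrow> 'n point \<Rightarrow> real"
    and f :: "'n point \<Rightarrow> ennreal"
  assumes w: "w \<in> borel_measurable lebesgue" "integrable lebesgue (\<lambda>z. (w z)\<^sup>2)" "AE z in lebesgue. 0 \<le> w z"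
    and XW: "\<And>j. j \<in> {1..m0} \<Longrightarrow> XW j \<in> borel_measurable lebesgue"
      "\<And>j. j \<in> {1..m0} \<Longrightarrow> integrable lebesgue (\<lambda>z. (XW j z)\<^sup>2)"
    and YW: "YW \<in> borel_measurable lebesgue" "integrable lebesgue (\<lambda>z. (YW z)\<^sup>2)"
    and Kf: "compact Kf" "\<And>z. z \<in> Kf \<Longrightarrow> - T \<le> snd z \<and> snd z \<le> 0" and T: "0 \<le> T"
    and weak_X: "\<And>j t. j \<in> {1..m0} \<Longrightarrow> test_function UNIV t \<Longrightarrow> (\<And>z. z \<notin> Kf \<Longrightarrow> t z = 0) \<Longrightarrow>
      (LINT z|lebesgue. w z * vf_deriv (lift X j) t z) = - (LINT z|lebesgue. XW j z * t z)"
    and weak_Y: "\<And>t. test_function UNIV t \<Longrightarrow> (\<And>z. z \<notin> Kf \<Longrightarrow> t z = 0) \<Longrightarrow>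
      (LINT z|lebesgue. w z * vf_deriv (drift X) t z) = - (LINT z|lebesgue. YW z * t z)"
    and sub: "\<And>t. test_function UNIV t \<Longrightarrow> (\<And>z. 0 \<le> t z) \<Longrightarrow> (\<And>z. z \<notin> Kf \<Longrightarrow> t z = 0) \<Longrightarrow>
      0 \<le> (LINT z|lebesgue. t z * YW z - (\<Sum>i=1..m0. \<Sum>j=1..m0. XW i z * a i j z * vf_deriv (lift X j) t z))"
    and a: "\<And>i j. i \<in> {1..m0} \<Longrightarrow> j \<in> {1..m0} \<Longrightarrow> a i j = a j i"
      "\<And>i j. i \<in> {1..m0} \<Longrightarrow> j \<in> {1..m0} \<Longrightarrow> a i j \<in> borel_measurable lebesgue"
      "\<And>z \<xi>. 0 \<le> (\<Sum>i=1..m0. \<Sum>j=1..m0. a i j z * \<xi> i * \<xi> j)"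
      "\<And>z \<xi>. (\<Sum>i=1..m0. \<Sum>j=1..m0. a i j z * \<xi> i * \<xi> j) \<le> lam * (\<Sum>i=1..m0. (\<xi> i)\<^sup>2)"
    and lam: "0 \<le> lam"
    and \<phi>: "smooth_on UNIV \<phi>" "\<And>z. 0 \<le> \<phi> z" "\<And>z. \<phi> z \<le> 1" "\<And>z. snd z < - \<delta> \<Longrightarrow> \<phi> z \<noteq> 0 \<Longrightarrow> z \<in> Kf"
      "\<And>z. snd z < 0 \<Longrightarrow> vf_deriv (drift X) \<phi> z \<le> 0" "\<And>z. \<psi> z \<noteq> 0 \<Longrightarrow> \<phi> z = 1"
    and D: "\<And>z. z \<in> Kf \<Longrightarrow> snd z < 0 \<Longrightarrow> grad2 \<phi> z \<le> D" and D0: "0 \<le> D"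
    and f[measurable]: "f \<in> borel_measurable borel"
    and f_ge: "AE z in lebesgue. z \<in> Kf \<longrightarrow>
      ennreal (w z * ((\<Sum>j=1..m0. \<bar>vf_deriv (lift X j) (vf_deriv (lift X j) \<phi>) z\<bar>) - vf_deriv (drift X) \<phi> z)) \<le> f z"
    and w_off: "\<And>z. z \<notin> Kf \<Longrightarrow> w z = 0"
    and \<iota>: "0 \<le> \<iota>" "\<And>z. \<psi> z \<noteq> 0 \<Longrightarrow> (\<integral>\<^sup>+\<zeta>. ennreal (G z \<zeta>) * f \<zeta> \<partial>lborel) \<le> ennreal \<iota>"
    and level: "AE z in lebesgue. (\<psi> z)\<^sup>2 \<le> (w z - \<iota>) * \<psi> z"
  shows "N \<le> 2 * (1 + lam)\<^sup>2 * (2 + D * T) * S * (LINT z|lebesgue. indicat_real Kf z * (\<Sum>j=1..m0. (XW j z)\<^sup>2))"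
proof (cases "N = 0")
  case True
  have "0 \<le> (LINT z|lebesgue. indicat_real Kf z * (\<Sum>j=1..m0. (XW j z)\<^sup>2))"
    by (intro Bochner_Integration.integral_nonneg mult_nonneg_nonneg sum_nonneg) auto
  then show ?thesis using True lam D0 T S_pos by simp
next
  case False
  then have Np: "N > 0" using N_nonneg by simp
  let ?Gw = "LINT z|lebesgue. indicat_real Kf z * (\<Sum>j=1..m0. (XW j z)\<^sup>2)"
  let ?q' = "\<lambda>z. (\<Sum>j=1..m0. \<bar>vf_deriv (lift X j) (vf_deriv (lift X j) \<phi>) z\<bar>) - vf_deriv (drift X) \<phi> z"
  define c where "c = 2 + D * T"
  define B where "B = 1 + lam"
  have cB: "c > 0" "B > 0" using D0 T lam by (auto simp: c_def B_def add_pos_nonneg)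
  \<comment> \<open>Chosen so that the part of the error proportional to N becomes exactly N / 2 and
    can be absorbed on the left.\<close>
  define s where "s = 2 * B * c * S"
  have s: "s > 0" using cB S_pos by (simp add: s_def)
  define h where "h n = (S / 2) / real (Suc n)" for n
  have h: "h n > 0" "2 * h n \<le> S" for n using S_pos by (auto simp: h_def field_simps)
  have V_bound: "(LINT z|lebesgue. w z * (V (h n) z * ?q' z)) \<le> \<iota> * (LINT z|lborel. \<psi> z)" for n
  proof -
    have le: "AE z in lebesgue. ennreal (w z * (V (h n) z * ?q' z)) \<le> f z * ennreal (V (h n) z)"
      using f_ge w(3)
    proof eventually_elim
      case (elim z)
      show ?case
      proof (cases "z \<in> Kf")
        case True
        have "ennreal (w z * (V (h n) z * ?q' z)) = ennreal ((w z * ?q' z) * V (h n) z)" by (simp add: mult_ac)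
        also have "\<dots> = ennreal (w z * ?q' z) * ennreal (V (h n) z)"
          using V_props(2)[OF h(1)] by (rule ennreal_mult'')
        also have "\<dots> \<le> f z * ennreal (V (h n) z)" using elim True by (intro mult_right_mono) auto
        finally show ?thesis .
      qed (simp add: w_off)
    qed
    have nn: "AE z in lebesgue. 0 \<le> w z * (V (h n) z * ?q' z)"
      using w(3)
    proof eventually_elim
      case (elim z)
      show ?case
      proof (cases "snd z < 0")
        case True
        have "0 \<le> (\<Sum>j=1..m0. \<bar>vf_deriv (lift X j) (vf_deriv (lift X j) \<phi>) z\<bar>)" by (intro sum_nonneg) simp
        then have "0 \<le> ?q' z" using \<phi>(5)[OF True] by linarith
        then show ?thesis using elim V_props(2)[OF h(1)] by (intro mult_nonneg_nonneg)
      next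
        case False
        then show ?thesis using V_props(3)[OF h(1), of z] delta_pos by simp
      qed
    qed
    have "ennreal (LINT z|lebesgue. w z * (V (h n) z * ?q' z)) \<le> (\<integral>\<^sup>+z. ennreal (w z * (V (h n) z * ?q' z)) \<partial>lebesgue)"
    proof (cases "integrable lebesgue (\<lambda>z. w z * (V (h n) z * ?q' z))")
      case True
      then show ?thesis using nn_integral_eq_integral[OF True nn] by simp
    qed (simp add: not_integrable_integral_eq)
    also have "\<dots> \<le> (\<integral>\<^sup>+z. f z * ennreal (V (h n) z) \<partial>lebesgue)" by (rule nn_integral_mono_AE[OF le])
    also have "\<dots> = (\<integral>\<^sup>+z. f z * ennreal (V (h n) z) \<partial>lborel)" by (rule nn_integral_completion)
    also have "\<dots> \<le> (\<integral>\<^sup>+\<zeta>. f \<zeta> * (\<integral>\<^sup>+z. ennreal (G z \<zeta>) * ennreal (\<psi> z) \<partial>lborel) \<partial>lborel)"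
      by (intro nn_integral_mono mult_left_mono V_le h) auto
    also have "\<dots> = (\<integral>\<^sup>+\<zeta>. (\<integral>\<^sup>+z. f \<zeta> * (ennreal (G z \<zeta>) * ennreal (\<psi> z)) \<partial>lborel) \<partial>lborel)"
      by (intro nn_integral_cong nn_integral_cmult[symmetric]) measurable
    \<comment> \<open>After the exchange of integrals the inner one is the forward integral of f
      against the kernel at z, at most \<iota> wherever \<psi> is non-zero.\<close>
    also have "\<dots> = (\<integral>\<^sup>+z. (\<integral>\<^sup>+\<zeta>. f \<zeta> * (ennreal (G z \<zeta>) * ennreal (\<psi> z)) \<partial>lborel) \<partial>lborel)"
      by (rule lborel_pair.Fubini') measurable
    also have "\<dots> \<le> (\<integral>\<^sup>+z. ennreal \<iota> * ennreal (\<psi> z) \<partial>lborel)"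
    proof (rule nn_integral_mono)
      fix z
      have "(\<integral>\<^sup>+\<zeta>. f \<zeta> * (ennreal (G z \<zeta>) * ennreal (\<psi> z)) \<partial>lborel) = (\<integral>\<^sup>+\<zeta>. (ennreal (G z \<zeta>) * f \<zeta>) * ennreal (\<psi> z) \<partial>lborel)"
        by (simp add: mult_ac)
      also have "\<dots> = (\<integral>\<^sup>+\<zeta>. ennreal (G z \<zeta>) * f \<zeta> \<partial>lborel) * ennreal (\<psi> z)"
        by (rule nn_integral_multc) measurable
      also have "\<dots> \<le> ennreal \<iota> * ennreal (\<psi> z)"
        using \<iota>(2)[of z] by (cases "\<psi> z = 0") (auto intro: mult_right_mono)
      finally show "(\<integral>\<^sup>+\<zeta>. f \<zeta> * (ennreal (G z \<zeta>) * ennreal (\<psi> z)) \<partial>lborel) \<le> ennreal \<iota> * ennreal (\<psi> z)" .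
    qed
    also have "\<dots> = ennreal \<iota> * (\<integral>\<^sup>+z. ennreal (\<psi> z) \<partial>lborel)" by (rule nn_integral_cmult) measurable
    also have "\<dots> = ennreal (\<iota> * (LINT z|lborel. \<psi> z))"
      using nn_integral_eq_integral[OF integrable_psi] psi_bounds(1) \<iota>(1) by (simp add: ennreal_mult')
    finally show ?thesis
      using \<iota>(1) psi_bounds(1) by (subst (asm) ennreal_le_iff) (auto intro!: mult_nonneg_nonneg Bochner_Integration.integral_nonneg)
  qed
  obtain w' where w'[measurable]: "w' \<in> borel_measurable borel" and ww': "AE z in lebesgue. w z = w' z"
    using borel_version[OF w(1)] by metis
  have [measurable]: "\<phi> \<in> borel_measurable borel"
    by (intro borel_measurable_continuous_onI smooth_on_imp_continuous_on \<phi>)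
  have w'2: "integrable lborel (\<lambda>z. (w' z)\<^sup>2)"
  proof -
    have "integrable lebesgue (\<lambda>z. (w' z)\<^sup>2)"
    proof (subst integrable_cong_AE[where g = "\<lambda>z. (w z)\<^sup>2"])
      show "AE z in lebesgue. (w' z)\<^sup>2 = (w z)\<^sup>2" using ww' by eventually_elim simp
    qed (use w measurable_completion[of w' lborel borel] in auto)
    then show ?thesis by (subst (asm) integrable_completion) auto
  qed
  let ?u = "\<lambda>z. w' z * \<phi> z"
  have u2: "integrable lborel (\<lambda>z. (?u z)\<^sup>2)"
  proof (rule Bochner_Integration.integrable_bound[OF w'2])
    show "AE z in lborel. norm ((?u z)\<^sup>2) \<le> norm ((w' z)\<^sup>2)"
      using \<phi>(2,3) by (intro AE_I2) (simp add: power_mult_distrib mult_left_le power_le_one)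
  qed measurable
  have conv: "(LINT z|lborel. ?u z * g z) = (LINT z|lebesgue. w z * \<phi> z * g z)" if [measurable]: "g \<in> borel_measurable borel" for g
  proof -
    have "(LINT z|lborel. ?u z * g z) = (LINT z|lebesgue. ?u z * g z)" by (subst integral_completion) auto
    also have "\<dots> = (LINT z|lebesgue. w z * \<phi> z * g z)"
    proof (rule integral_cong_AE)
      show "(\<lambda>z. ?u z * g z) \<in> borel_measurable lebesgue" by (intro measurable_completion) measurable
      have "\<phi> \<in> borel_measurable lebesgue" "g \<in> borel_measurable lebesgue" by (intro measurable_completion; measurable)+
      then show "(\<lambda>z. w z * \<phi> z * g z) \<in> borel_measurable lebesgue" using w(1) by (intro borel_measurable_times)
      show "AE z in lebesgue. ?u z * g z = w z * \<phi> z * g z" using ww' by eventually_elim simp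
    qed
    finally show ?thesis .
  qed
  \<comment> \<open>Half of S N completes the energy bound 3 / 2 S N to 2 S N, the 2 in c.\<close>
  define e where "e = S * N / 2"
  have e: "e > 0" using S_pos Np by (simp add: e_def)
  define R where "R = B * (s / 2 * ?Gw + (3 / 2 * S * N + e + D * (S * T * N)) / s)"
  have bound: "(LINT z|lborel. ?u z * P (h n) z) \<le> \<iota> * (LINT z|lborel. \<psi> z) + R" for n
  proof -
    have "(LINT z|lborel. ?u z * P (h n) z) = (LINT z|lebesgue. w z * \<phi> z * P (h n) z)"
      by (rule conv[OF measurable_P[OF h(1)]])
    also have "\<dots> \<le> (LINT z|lebesgue. w z * (V (h n) z * ?q' z)) + R"
      unfolding R_def B_def
      by (rule duality_estimate[OF w XW YW Kf T weak_X weak_Y sub a lam \<phi>(1,2,3,4) D D0 h s e])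
    finally show ?thesis using V_bound[of n] by linarith
  qed
  have "(\<lambda>n. LINT z|lborel. ?u z * P (h n) z) \<longlonglongrightarrow> (LINT z|lborel. ?u z * \<psi> z)"
    unfolding h_def using S_pos by (intro P_tendsto u2) measurable
  then have lim: "(LINT z|lborel. ?u z * \<psi> z) \<le> \<iota> * (LINT z|lborel. \<psi> z) + R"
    by (rule LIMSEQ_le_const2) (use bound in auto)
  have iu: "integrable lborel (\<lambda>z. ?u z * \<psi> z)"
    by (rule integrable_mult_L2(1)[where \<kappa> = 1]) (use u2 integrable_psi2 in auto)
  have "N = (LINT z|lborel. (\<psi> z)\<^sup>2)" by (simp add: N_def)
  also have "\<dots> \<le> (LINT z|lborel. ?u z * \<psi> z - \<iota> * \<psi> z)"
  proof (rule integral_mono_AE)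
    have "AE z in lebesgue. (\<psi> z)\<^sup>2 \<le> ?u z * \<psi> z - \<iota> * \<psi> z"
      using level ww'
    proof eventually_elim
      case (elim z)
      then show ?case using \<phi>(6)[of z] by (cases "\<psi> z = 0") (auto simp: left_diff_distrib)
    qed
    then show "AE z in lborel. (\<psi> z)\<^sup>2 \<le> ?u z * \<psi> z - \<iota> * \<psi> z" by (subst (asm) AE_completion_iff) auto
  qed (use integrable_psi2 iu integrable_psi in auto)
  also have "\<dots> = (LINT z|lborel. ?u z * \<psi> z) - \<iota> * (LINT z|lborel. \<psi> z)"
    using iu integrable_psi by simp
  finally have NR: "N \<le> R" using lim by linarith
  have "(3 / 2 * S * N + e + D * (S * T * N)) / s = N / (2 * B)"
  proof -
    have "3 / 2 * S * N + e + D * (S * T * N) = c * S * N" by (simp add: e_def c_def algebra_simps)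
    then show ?thesis using cB S_pos by (simp add: s_def field_simps)
  qed
  then have "R = B * (s / 2) * ?Gw + N / 2" using cB by (simp add: R_def distrib_left)
  then have "N \<le> 2 * (B * (s / 2) * ?Gw)" using NR by linarith
  also have "\<dots> = 2 * B\<^sup>2 * c * S * ?Gw" by (simp add: s_def power2_eq_square)
  finally show ?thesis by (simp add: B_def c_def)
qed

end

subsection \<open>Cylinders\<close>

lemma continuous_front_norm: "continuous_on UNIV (\<lambda>z :: 'n::{finite,linorder} point. front_norm m0 (fst z))"
  unfolding front_norm_def by (intro continuous_intros)

lemma coord_le_front_norm: "pos i \<le> m0 \<Longrightarrow> \<bar>x $ i\<bar> \<le> front_norm m0 x"
proof -
  assume "pos i \<le> m0"
  then have "(x $ i)\<^sup>2 \<le> (\<Sum>i | pos i \<le> m0. (x $ i)\<^sup>2)" by (intro member_le_sum) auto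
  then have "sqrt ((x $ i)\<^sup>2) \<le> front_norm m0 x" unfolding front_norm_def by (rule real_sqrt_le_mono)
  then show ?thesis by simp
qed

text \<open>With \<delta> = 0 and the slice t = 0 removed this is a cylinder; with \<delta> > 0 it
  is a compact set away from t = 0 on which the weak formulation can be localised.\<close>

definition box_set :: "nat \<Rightarrow> ('n \<Rightarrow> nat) \<Rightarrow> real \<Rightarrow> real \<Rightarrow> real \<Rightarrow> real \<Rightarrow> 'n::{finite,linorder} point set" where
  "box_set m0 \<alpha> T \<delta> R R' = {z. - T \<le> snd z \<and> snd z \<le> - \<delta> \<and> front_norm m0 (fst z) \<le> R \<and>
     (\<forall>j. m0 < pos j \<longrightarrow> \<bar>fst z $ j\<bar> \<le> R' ^ \<alpha> j)}"

lemma compact_box_set: "compact (box_set m0 \<alpha> T \<delta> R R' :: 'n::{finite,linorder} point set)"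
proof -
  have "closed (box_set m0 \<alpha> T \<delta> R R' :: 'n point set)"
    unfolding box_set_def
    by (intro closed_Collect_conj closed_Collect_all closed_Collect_imp closed_Collect_le open_Collect_const
        continuous_intros continuous_front_norm)
  moreover have "bounded (box_set m0 \<alpha> T \<delta> R R' :: 'n point set)"
  proof (rule boundedI)
    fix z :: "'n point" assume z: "z \<in> box_set m0 \<alpha> T \<delta> R R'"
    have c: "\<bar>fst z $ i\<bar> \<le> \<bar>R\<bar> + \<bar>R' ^ \<alpha> i\<bar>" for i
    proof (cases "pos i \<le> m0")
      case True
      then show ?thesis using coord_le_front_norm[OF True, of "fst z"] z by (force simp: box_set_def)
    next
      case False
      then have "\<bar>fst z $ i\<bar> \<le> R' ^ \<alpha> i" using z by (simp add: box_set_def)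
      then show ?thesis by linarith
    qed
    have "norm z \<le> norm (fst z) + norm (snd z)" by (metis norm_Pair_le prod.collapse)
    also have "norm (fst z) \<le> (\<Sum>i\<in>UNIV. \<bar>fst z $ i\<bar>)" by (rule norm_le_l1_cart)
    also have "\<dots> \<le> (\<Sum>i\<in>UNIV. \<bar>R\<bar> + \<bar>R' ^ \<alpha> i\<bar>)" by (intro sum_mono c)
    also have "norm (snd z) \<le> \<bar>T\<bar> + \<bar>\<delta>\<bar>" using z by (auto simp: box_set_def)
    finally show "norm z \<le> (\<Sum>i\<in>UNIV. \<bar>R\<bar> + \<bar>R' ^ \<alpha> i\<bar>) + (\<bar>T\<bar> + \<bar>\<delta>\<bar>)" by simp
  qed
  ultimately show ?thesis by (simp add: compact_eq_bounded_closed)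
qed

lemma cyl_eq_box_set: "cyl m0 \<alpha> lam' \<rho> = box_set m0 \<alpha> (\<rho>\<^sup>2) 0 \<rho> (lam' * \<rho>) \<inter> {z. snd z < 0}"
  by (auto simp: cyl_def box_set_def)

lemma cyl_borel: "(cyl m0 \<alpha> lam' \<rho> :: 'n::{finite,linorder} point set) \<in> sets borel"
proof -
  have "open {z :: 'n point. snd z < 0}" by (intro open_Collect_less continuous_intros)
  then show ?thesis
    unfolding cyl_eq_box_set
    by (intro sets.Int borel_closed[OF compact_imp_closed[OF compact_box_set]] borel_open)
qed

lemma cyl_subset_interior:
  fixes \<alpha> :: "'n::{finite,linorder} \<Rightarrow> nat"
  assumes "0 < \<rho>" "\<rho> < 1" "0 < lam'" "\<And>i. 1 \<le> \<alpha> i"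
  shows "cyl m0 \<alpha> lam' \<rho> \<subseteq> interior (cyl m0 \<alpha> lam' 1)"
proof -
  let ?U = "{z :: 'n point. - 1 < snd z \<and> snd z < 0 \<and> front_norm m0 (fst z) < 1} \<inter>
     (\<Inter>j\<in>{j. m0 < pos j}. {z. \<bar>fst z $ j\<bar> < lam' ^ \<alpha> j})"
  have op: "open ?U"
    by (intro open_Int open_INT ballI open_Collect_conj open_Collect_less continuous_intros continuous_front_norm) auto
  have sub: "?U \<subseteq> cyl m0 \<alpha> lam' 1" by (force simp: cyl_def)
  have "cyl m0 \<alpha> lam' \<rho> \<subseteq> ?U"
  proof
    fix z assume z: "z \<in> cyl m0 \<alpha> lam' \<rho>"
    have c: "- \<rho>\<^sup>2 \<le> snd z" "snd z < 0" "front_norm m0 (fst z) \<le> \<rho>"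
      "\<And>j. m0 < pos j \<Longrightarrow> \<bar>fst z $ j\<bar> \<le> (lam' * \<rho>) ^ \<alpha> j"
      using z by (auto simp: cyl_def)
    have "\<rho>\<^sup>2 < 1" using assms by (simp add: abs_square_less_1)
    then have "- 1 < snd z" "front_norm m0 (fst z) < 1" using c assms(2) by linarith+
    moreover have "\<bar>fst z $ j\<bar> < lam' ^ \<alpha> j" if "m0 < pos j" for j
    proof -
      have "(lam' * \<rho>) ^ \<alpha> j < lam' ^ \<alpha> j"
        using assms(1-3) assms(4)[of j] by (intro power_strict_mono) auto
      then show ?thesis using c(4)[OF that] by linarith
    qed
    ultimately show "z \<in> ?U" using c(2) by simp
  qed
  then show ?thesis using interior_maximal[OF sub op] by (rule subset_trans)
qed

subsection \<open>Localisation of the weak formulation\<close>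

text \<open>Extension by zero from a compact set turns local square integrability into global one,
  matching the abstract estimate, which is stated on the whole space.\<close>

lemma L2_loc_truncate:
  fixes f :: "'a::euclidean_space \<Rightarrow> real"
  assumes f: "L2_loc \<Omega> f" and \<Omega>: "open \<Omega>" and K: "compact K" "K \<subseteq> \<Omega>"
  shows "(\<lambda>z. indicat_real K z * f z) \<in> borel_measurable lebesgue"
    "integrable lebesgue (\<lambda>z. (indicat_real K z * f z)\<^sup>2)"
proof -
  have O: "\<Omega> \<in> sets lebesgue" and Kl: "K \<in> sets lebesgue" using \<Omega> K by (auto simp: compact_imp_closed)
  have "(\<lambda>z. indicat_real \<Omega> z *\<^sub>R f z) \<in> borel_measurable lebesgue"
    using f O by (subst borel_measurable_restrict_space_iff[symmetric]) (auto simp: L2_loc_def)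
  then have "(\<lambda>z. indicat_real K z * (indicat_real \<Omega> z *\<^sub>R f z)) \<in> borel_measurable lebesgue"
    using Kl by (intro borel_measurable_times borel_measurable_indicator)
  moreover have "(\<lambda>z. indicat_real K z * (indicat_real \<Omega> z *\<^sub>R f z)) = (\<lambda>z. indicat_real K z * f z)"
  proof
    show "indicat_real K z * (indicat_real \<Omega> z *\<^sub>R f z) = indicat_real K z * f z" for z
      using K(2) by (cases "z \<in> K") (auto simp: subset_iff)
  qed
  ultimately show "(\<lambda>z. indicat_real K z * f z) \<in> borel_measurable lebesgue" by simp
  have "integrable lebesgue (\<lambda>z. indicat_real K z *\<^sub>R (f z)\<^sup>2)"
    using f K by (auto simp: L2_loc_def set_integrable_def)
  moreover have "(\<lambda>z. indicat_real K z *\<^sub>R (f z)\<^sup>2) = (\<lambda>z. (indicat_real K z * f z)\<^sup>2)"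
    by (auto simp: indicator_def)
  ultimately show "integrable lebesgue (\<lambda>z. (indicat_real K z * f z)\<^sup>2)" by simp
qed

lemma vf_deriv_zero_outside:
  assumes "compact K" "\<And>z. z \<notin> K \<Longrightarrow> t z = 0" "z \<notin> K"
  shows "vf_deriv Z t z = 0"
  unfolding vf_deriv_def
  by (rule frechet_derivative_zero_outside[of "- K"]) (use assms in \<open>auto simp: open_Compl compact_imp_closed\<close>)

lemma test_function_restrict:
  "test_function UNIV t \<Longrightarrow> compact K \<Longrightarrow> (\<And>z. z \<notin> K \<Longrightarrow> t z = 0) \<Longrightarrow> K \<subseteq> \<Omega> \<Longrightarrow> test_function \<Omega> t"
  by (rule test_functionI[where K = K]) (auto intro: test_function_smooth)

text \<open>For a divergence-free field the formal adjoint is -Z, and a test function supported in K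
  only sees the values on K.\<close>

lemma weak_vf_deriv_truncate:
  fixes Z :: "'a::euclidean_space \<Rightarrow> 'a"
  assumes weak: "weak_vf_deriv \<Omega> Z w g" and K: "compact K" "K \<subseteq> \<Omega>"
    and Z: "smooth_on UNIV Z" "\<And>z. divergence Z z = 0"
    and t: "test_function UNIV t" "\<And>z. z \<notin> K \<Longrightarrow> t z = 0"
  shows "(LINT z|lebesgue. (indicat_real K z * w z) * vf_deriv Z t z) = - (LINT z|lebesgue. (indicat_real K z * g z) * t z)"
proof -
  have t': "test_function \<Omega> t" by (rule test_function_restrict[OF t(1) K(1) t(2) K(2)])
  have d: "divergence (\<lambda>y. t y *\<^sub>R Z y) z = vf_deriv Z t z" for z
    using divergence_scaleR[OF smooth_differentiable[OF test_function_smooth[OF t(1)]] smooth_differentiable[OF Z(1)], of z] Z(2)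
    by simp
  have "(LINT z:\<Omega>|lebesgue. w z * (- divergence (\<lambda>y. t y *\<^sub>R Z y) z)) = (LINT z:\<Omega>|lebesgue. g z * t z)"
    using weak t' by (simp add: weak_vf_deriv_def)
  then have "(LINT z|lebesgue. indicat_real \<Omega> z *\<^sub>R (w z * (- divergence (\<lambda>y. t y *\<^sub>R Z y) z)))
      = (LINT z|lebesgue. indicat_real \<Omega> z *\<^sub>R (g z * t z))"
    by (simp only: set_lebesgue_integral_def)
  moreover have "indicat_real \<Omega> z *\<^sub>R (w z * (- divergence (\<lambda>y. t y *\<^sub>R Z y) z)) = - ((indicat_real K z * w z) * vf_deriv Z t z)" for z
    using vf_deriv_zero_outside[OF K(1) t(2), where z = z and Z = Z] K(2) unfolding d by (cases "z \<in> K") auto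
  moreover have "indicat_real \<Omega> z *\<^sub>R (g z * t z) = (indicat_real K z * g z) * t z" for z
    using t(2)[of z] K(2) by (cases "z \<in> K") auto
  ultimately have "(LINT z|lebesgue. - ((indicat_real K z * w z) * vf_deriv Z t z)) = (LINT z|lebesgue. (indicat_real K z * g z) * t z)"
    by (simp only:)
  then show ?thesis by simp
qed

section \<open>The estimate for the given cut-off function and cylinders\<close>

context cutoff
begin

text \<open>The abstract estimate is applied to truncations of the positive part of w - I0, with
  bounds independent of the truncation, and Fatou's lemma removes it. The product D T of the
  gradient bound for \<phi> and the time depth r^2 equals m0 M^2, free of r and \<theta>.\<close>

theorem oscillation_estimate:
  fixes op :: "'n point \<Rightarrow> 'n point \<Rightarrow> 'n point"
  assumes A1: "assumption_A1 m0 lam a X" and A2: "assumption_A2 m0 X op e iv \<alpha>"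
    and fund: "fundamental_solution m0 X op iv \<alpha> Q \<Gamma>"
    and ws: "weak_subsolution m0 a X (interior (cyl m0 \<alpha> lam' 1)) w Xw Yw"
    and wn: "AE z in lebesgue. z \<in> interior (cyl m0 \<alpha> lam' 1) \<longrightarrow> 0 \<le> w z"
  defines "I0 \<equiv> (SUP z\<in>cyl m0 \<alpha> lam' (\<theta> * r). I1_term X \<Gamma> (cyl m0 \<alpha> lam' (r / \<theta>)) w \<phi> z
    + C2_term m0 X \<Gamma> (cyl m0 \<alpha> lam' (r / \<theta>)) w \<phi> z)"
  shows "(\<integral>\<^sup>+z\<in>cyl m0 \<alpha> lam' (\<theta> * r). (e2ennreal (max 0 (ereal (w z) - I0)))\<^sup>2 \<partial>lebesgue)
    \<le> ennreal (2 * (1 + lam)\<^sup>2 * (2 + real m0 * M\<^sup>2) * \<theta>\<^sup>2 * r\<^sup>2) *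
      (\<integral>\<^sup>+z\<in>cyl m0 \<alpha> lam' (r / \<theta>). ennreal (\<Sum>j=1..m0. (Xw j z)\<^sup>2) \<partial>lebesgue)"
proof -
  let ?\<sigma> = "\<lambda>s. 1 - h (root Q \<theta> * r + s * (r + 1 - root Q \<theta> * r))"
  have gr: "homogeneous_Lie_group op e iv \<alpha>" and hX: "\<And>j. j \<in> {1..m0} \<Longrightarrow> homogeneous_vf \<alpha> 1 (lift X j)"
    and hY: "homogeneous_vf \<alpha> 2 (drift X)"
    using A2 by (auto simp: assumption_A2_def)
  have smX: "\<And>j. j \<le> m0 \<Longrightarrow> smooth_on UNIV (X j)" using A1 by (auto simp: assumption_A1_def)
  have sl: "smooth_on UNIV (lift X j)" if "j \<in> {1..m0}" for j
    by (rule smooth_on_lift[OF smX]) (use that in simp)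
  have sd: "smooth_on UNIV (drift X)" by (rule smooth_on_drift) (rule smX[OF le0])
  note div = coefficient_structure_divergence[OF coeff smX alpha]
  have F: "\<And>\<zeta>. smooth_on (- {\<zeta>}) (\<lambda>z. \<Gamma> z \<zeta>)" "\<And>z \<zeta>. \<Gamma> z \<zeta> = \<Gamma> (op (iv \<zeta>) z) 0"
    using fund unfolding fundamental_solution_def by blast+
  interpret evolution m0 X \<Gamma> ?\<sigma>
  proof
    show "smooth_step ?\<sigma>" by (rule step)
    show "smooth_on {p. fst p \<noteq> snd p} (\<lambda>p. \<Gamma> (fst p) (snd p))"
      by (rule homogeneous_group_kernel_smooth[where \<Gamma> = \<Gamma>, OF gr F(1)[of 0] F(2)])
    show "\<exists>E. test_function UNIV E \<and> (\<forall>z. 0 \<le> E z \<and> E z \<le> 1) \<and> (\<forall>z\<in>K. E z = 1) \<and> (\<forall>z. \<bar>L1_op m0 X E z\<bar> \<le> e)"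
      if "compact K" "0 < e" for K e
      by (rule dilated_exhaustion[OF step alpha hX hY sl sd that])
  qed (use smX div fund in \<open>auto simp: fundamental_solution_def\<close>)
  define \<Omega> where "\<Omega> = interior (cyl m0 \<alpha> lam' 1)"
  define \<rho> where "\<rho> = r / \<theta>"
  define Cr where "Cr = cyl m0 \<alpha> lam' \<rho>"
  define Cs where "Cs = cyl m0 \<alpha> lam' (\<theta> * r)"
  define Y\<phi> where "Y\<phi> = vf_deriv (drift X) \<phi>"
  define XX\<phi> where "XX\<phi> z = (\<Sum>j=1..m0. \<bar>vf_deriv (lift X j) (vf_deriv (lift X j) \<phi>) z\<bar>)" for z
  have \<rho>: "0 < \<rho>" "\<rho> < 1" "r \<le> \<rho>"
    using r theta_pos theta(1) by (auto simp: \<rho>_def field_simps mult_left_le)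
  have op\<Omega>: "open \<Omega>" by (simp add: \<Omega>_def)
  have Cr\<Omega>: "Cr \<subseteq> \<Omega>" unfolding Cr_def \<Omega>_def using \<rho> lam' alpha by (intro cyl_subset_interior) auto
  have Cr_time: "snd z < 0" if "z \<in> Cr" for z using that by (auto simp: Cr_def cyl_def)
  have Cs_time: "snd z < 0" "- (\<theta> * r)\<^sup>2 \<le> snd z" if "z \<in> Cs" for z using that by (auto simp: Cs_def cyl_def)
  have Cs_phi: "\<phi> z = 1" if "z \<in> Cs" for z using that unfolding Cs_def by (rule phi_one)
  have Cs_borel[measurable]: "Cs \<in> sets borel" unfolding Cs_def by (rule cyl_borel)
  have Y0: "Y\<phi> z \<le> 0" if "snd z < 0" for z using drift_phi_nonpos[OF that] by (simp add: Y\<phi>_def)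
  have XX0: "0 \<le> XX\<phi> z" for z unfolding XX\<phi>_def by (intro sum_nonneg) simp
  have wn': "AE z in lebesgue. z \<in> \<Omega> \<longrightarrow> 0 \<le> w z" using wn by (simp add: \<Omega>_def)
  have cY: "continuous_on UNIV Y\<phi>" unfolding Y\<phi>_def by (intro smooth_on_imp_continuous_on smooth_vf_drift smooth_phi)
  have cXX: "continuous_on UNIV XX\<phi>" unfolding XX\<phi>_def[abs_def]
    by (intro continuous_on_sum continuous_on_rabs smooth_on_imp_continuous_on smooth_vf_lift smooth_phi)
  have [measurable]: "Y\<phi> \<in> borel_measurable borel" "XX\<phi> \<in> borel_measurable borel"
    using cY cXX by (auto intro: borel_measurable_continuous_onI)
  define a1 where "a1 z = (\<integral>\<^sup>+\<zeta>\<in>Cr. ennreal (- \<Gamma> z \<zeta> * w \<zeta> * Y\<phi> \<zeta>) \<partial>lebesgue)" for z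
  define a2 where "a2 z = (\<integral>\<^sup>+\<zeta>\<in>Cr. ennreal (\<Sum>j=1..m0. \<bar>vf_deriv (lift X j) (vf_deriv (lift X j) \<phi>) \<zeta>\<bar> * \<Gamma> z \<zeta> * w \<zeta>) \<partial>lebesgue)" for z
  \<comment> \<open>Almost everywhere on the cylinder w \<ge> 0 and Y \<phi> \<le> 0, so the
    integrand has no negative part and the extended integral is a genuine integral in
    [0, \<infinity>]. For C2 the sign of w alone suffices.\<close>
  have I1: "I1_term X \<Gamma> Cr w \<phi> z = enn2ereal (a1 z)" for z
  proof -
    have "(\<integral>\<^sup>+\<zeta>\<in>Cr. ennreal (- (- \<Gamma> z \<zeta> * w \<zeta> * Y\<phi> \<zeta>)) \<partial>lebesgue) = (\<integral>\<^sup>+(\<zeta> :: 'n point). 0 \<partial>lebesgue)"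
    proof (rule nn_integral_cong_AE)
      show "AE \<zeta> in lebesgue. ennreal (- (- \<Gamma> z \<zeta> * w \<zeta> * Y\<phi> \<zeta>)) * indicator Cr \<zeta> = 0"
        using wn'
      proof eventually_elim
        case (elim \<zeta>)
        show ?case
        proof (cases "\<zeta> \<in> Cr")
          case True
          then have "\<Gamma> z \<zeta> * w \<zeta> * Y\<phi> \<zeta> \<le> 0"
            using elim Cr\<Omega> Y0[OF Cr_time] kernel_nonneg by (intro mult_nonneg_nonpos mult_nonneg_nonneg) auto
          then show ?thesis by (simp add: ennreal_neg)
        qed simp
      qed
    qed
    then show ?thesis by (simp add: I1_term_def ext_integral_def a1_def Y\<phi>_def zero_ennreal.rep_eq)
  qed
  have C2: "C2_term m0 X \<Gamma> Cr w \<phi> z = enn2ereal (a2 z)" for z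
  proof -
    have "(\<integral>\<^sup>+\<zeta>\<in>Cr. ennreal (- (\<Sum>j=1..m0. \<bar>vf_deriv (lift X j) (vf_deriv (lift X j) \<phi>) \<zeta>\<bar> * \<Gamma> z \<zeta> * w \<zeta>)) \<partial>lebesgue)
        = (\<integral>\<^sup>+(\<zeta> :: 'n point). 0 \<partial>lebesgue)"
    proof (rule nn_integral_cong_AE)
      show "AE \<zeta> in lebesgue. ennreal (- (\<Sum>j=1..m0. \<bar>vf_deriv (lift X j) (vf_deriv (lift X j) \<phi>) \<zeta>\<bar> * \<Gamma> z \<zeta> * w \<zeta>)) * indicator Cr \<zeta> = 0"
        using wn'
      proof eventually_elim
        case (elim \<zeta>)
        show ?case
        proof (cases "\<zeta> \<in> Cr")
          case True
          then have "0 \<le> (\<Sum>j=1..m0. \<bar>vf_deriv (lift X j) (vf_deriv (lift X j) \<phi>) \<zeta>\<bar> * \<Gamma> z \<zeta> * w \<zeta>)"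
            using elim Cr\<Omega> kernel_nonneg by (intro sum_nonneg mult_nonneg_nonneg) auto
          then show ?thesis by (simp add: ennreal_neg)
        qed simp
      qed
    qed
    then show ?thesis by (simp add: C2_term_def ext_integral_def a2_def zero_ennreal.rep_eq)
  qed
  have I0: "I0 = (SUP z\<in>Cs. enn2ereal (a1 z + a2 z))"
    unfolding I0_def Cs_def[symmetric] \<rho>_def[symmetric] Cr_def[symmetric] I1 C2 by (simp add: plus_ennreal.rep_eq)
  define RH where "RH = (\<integral>\<^sup>+z\<in>Cr. ennreal (\<Sum>j=1..m0. (Xw j z)\<^sup>2) \<partial>lebesgue)"
  define B where "B = 2 * (1 + lam)\<^sup>2 * (2 + real m0 * M\<^sup>2) * \<theta>\<^sup>2 * r\<^sup>2"
  have B0: "0 \<le> B" using lam by (simp add: B_def)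
  have "(\<integral>\<^sup>+z\<in>Cs. (e2ennreal (max 0 (ereal (w z) - I0)))\<^sup>2 \<partial>lebesgue) \<le> ennreal B * RH"
  \<comment> \<open>In both exceptional cases the integrand on the left vanishes; otherwise I0 is a
    real number, non-negative because its terms are.\<close>
  proof (cases "Cs = {} \<or> I0 = \<infinity>")
    case True
    then have "(e2ennreal (max 0 (ereal (w z) - I0)))\<^sup>2 * indicator Cs z = 0" for z
      by (auto simp: zero_ennreal_def[symmetric])
    then show ?thesis by (simp only: nn_integral_const mult_zero_left zero_le)
  next
    case False
    then obtain z0 where z0: "z0 \<in> Cs" by auto
    have "0 \<le> enn2ereal (a1 z0 + a2 z0)" by simp
    also have "\<dots> \<le> I0" unfolding I0 using z0 by (rule SUP_upper)
    finally obtain \<iota> where \<iota>: "I0 = ereal \<iota>" "0 \<le> \<iota>" using False by (cases I0) auto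
    have a12: "a1 z + a2 z \<le> ennreal \<iota>" if "z \<in> Cs" for z
    proof -
      have "enn2ereal (a1 z + a2 z) \<le> ereal \<iota>" using that \<iota>(1) unfolding I0 by (metis SUP_upper)
      then show ?thesis using \<iota>(2) by (simp add: less_eq_ennreal.rep_eq enn2ereal_ennreal)
    qed
    have w\<Omega>: "(\<lambda>z. indicat_real \<Omega> z *\<^sub>R w z) \<in> borel_measurable lebesgue"
      using ws op\<Omega> by (subst borel_measurable_restrict_space_iff[symmetric]) (auto simp: weak_subsolution_def L2_loc_def \<Omega>_def)
    obtain w' where w'[measurable]: "w' \<in> borel_measurable borel" and "AE z in lebesgue. indicat_real \<Omega> z *\<^sub>R w z = w' z"
      using borel_version[OF w\<Omega>] by metis
    then have ww': "AE z in lebesgue. z \<in> \<Omega> \<longrightarrow> w z = w' z \<and> 0 \<le> w z"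
      using wn' by eventually_elim auto
    \<comment> \<open>Cut at height n to be bounded, and at time -1/(n + 1) to stay away from the
      top of the cylinder.\<close>
    define \<psi> where "\<psi> n z = indicat_real (Cs \<inter> {z. snd z \<le> - (1 / real (Suc n))}) z * min (real n) (max 0 (w' z - \<iota>))" for n :: nat and z
    have level: "(\<integral>\<^sup>+z. ennreal ((\<psi> n z)\<^sup>2) \<partial>lborel) \<le> ennreal B * RH" for n
    proof -
      define \<delta> where "\<delta> = 1 / real (Suc n)"
      have \<delta>: "\<delta> > 0" by (simp add: \<delta>_def)
      \<comment> \<open>The radius is \<rho> without the factor lam' and the depth is r^2, as in the
        box of the cut-off, where the gradient bound for \<phi> holds; lam' > 1 and r \<le> \<rho>
        still place K inside the large cylinder.\<close>
      define K where "K = (box_set m0 \<alpha> (r\<^sup>2) \<delta> \<rho> \<rho> :: 'n point set)"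
      have K: "compact K" unfolding K_def by (rule compact_box_set)
      have K_time: "- r\<^sup>2 \<le> snd z" "snd z \<le> - \<delta>" "snd z < 0" if "z \<in> K" for z
        using that \<delta> by (auto simp: K_def box_set_def)
      have KCr: "K \<subseteq> Cr"
      proof
        fix z assume z: "z \<in> K"
        have "r\<^sup>2 \<le> \<rho>\<^sup>2" using \<rho>(3) r by (intro power_mono) auto
        then have "- \<rho>\<^sup>2 \<le> snd z" using K_time(1)[OF z] by linarith
        moreover have "\<bar>fst z $ j\<bar> \<le> (lam' * \<rho>) ^ \<alpha> j" if "m0 < pos j" for j
        proof -
          have "\<bar>fst z $ j\<bar> \<le> \<rho> ^ \<alpha> j" using z that by (auto simp: K_def box_set_def)
          also have "\<dots> \<le> (lam' * \<rho>) ^ \<alpha> j" using \<rho>(1) lam' by (intro power_mono) auto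
          finally show ?thesis .
        qed
        ultimately show "z \<in> Cr" using z K_time(3)[OF z] by (cases z) (auto simp: Cr_def cyl_def K_def box_set_def)
      qed
      then have K\<Omega>: "K \<subseteq> \<Omega>" using Cr\<Omega> by auto
      have K_bb: "z \<in> bigbox m0 \<alpha> r \<theta>" if "z \<in> K" for z
        using that K_time(3)[OF that] by (cases z) (auto simp: K_def box_set_def bigbox_def \<rho>_def)
      have phi_K: "z \<in> K" if "snd z \<le> - \<delta>" "\<phi> z \<noteq> 0" for z
      proof -
        have "z \<in> bigbox m0 \<alpha> r \<theta>" by (rule phi_support) (use that \<delta> in auto)
        then show ?thesis using that(1) by (cases z) (auto simp: K_def box_set_def bigbox_def \<rho>_def)
      qed
      have \<psi>nz: "z \<in> Cs" "snd z \<le> - \<delta>" "0 < w' z - \<iota>" "z \<in> K" if "\<psi> n z \<noteq> 0" for z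
      proof -
        show 1: "z \<in> Cs" "snd z \<le> - \<delta>" "0 < w' z - \<iota>"
          using that by (auto simp: \<psi>_def \<delta>_def indicator_def min_def max_def split: if_splits)
        show "z \<in> K" using 1(2) Cs_phi[OF 1(1)] by (intro phi_K) auto
      qed
      have [measurable]: "{z :: 'n point. snd z \<le> - \<delta>} \<in> sets borel"
        by (intro borel_closed closed_Collect_le continuous_intros)
      have \<psi>m: "\<psi> n \<in> borel_measurable borel" unfolding \<psi>_def[abs_def] \<delta>_def[symmetric] by measurable
      interpret potential m0 X \<Gamma> ?\<sigma> "\<psi> n" K "real n" "(\<theta> * r)\<^sup>2" \<delta>
      proof
        show "\<psi> n z = 0" if "z \<notin> K" for z using \<psi>nz(4)[of z] that by auto
        show "- (\<theta> * r)\<^sup>2 \<le> snd z \<and> snd z \<le> - \<delta>" if "\<psi> n z \<noteq> 0" for z using \<psi>nz[OF that] Cs_time by auto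
        show "0 \<le> \<psi> n z" "\<psi> n z \<le> real n" for z by (auto simp: \<psi>_def indicator_def)
        show "0 < (\<theta> * r)\<^sup>2" using r theta_pos by simp
      qed (use \<psi>m K \<delta> in auto)
      define wK where "wK z = indicat_real K z * w z" for z
      define XK where "XK j z = indicat_real K z * Xw j z" for j z
      define YK where "YK z = indicat_real K z * Yw z" for z
      have L2: "L2_loc \<Omega> w" "\<And>j. j \<in> {1..m0} \<Longrightarrow> L2_loc \<Omega> (Xw j)" "L2_loc \<Omega> Yw"
        and weak: "\<And>j. j \<in> {1..m0} \<Longrightarrow> weak_vf_deriv \<Omega> (lift X j) w (Xw j)" "weak_vf_deriv \<Omega> (drift X) w Yw"
        and subs: "\<And>\<phi>. test_function \<Omega> \<phi> \<Longrightarrow> (\<And>z. 0 \<le> \<phi> z) \<Longrightarrow> 0 \<le> (LINT z:\<Omega>|lebesgue. \<phi> z * Yw z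
               - (\<Sum>i=1..m0. \<Sum>j=1..m0. Xw i z * a i j z * vf_deriv (lift X j) \<phi> z))"
        using ws unfolding weak_subsolution_def \<Omega>_def by auto
      \<comment> \<open>The two summands are the integrands of I1 and C2 with the kernel removed,
        for a Borel representative w' of w.\<close>
      define f where "f \<zeta> = ennreal (w' \<zeta> * (- Y\<phi> \<zeta>)) * indicator K \<zeta> + ennreal (w' \<zeta> * XX\<phi> \<zeta>) * indicator K \<zeta>" for \<zeta>
      have Kb[measurable]: "K \<in> sets borel" using K by (simp add: compact_imp_closed)
      let ?Gw = "LINT z|lebesgue. indicat_real K z * (\<Sum>j=1..m0. (XK j z)\<^sup>2)"
      have "N \<le> 2 * (1 + lam)\<^sup>2 * (2 + (real m0 * M\<^sup>2 / r\<^sup>2) * r\<^sup>2) * (\<theta> * r)\<^sup>2 * ?Gw"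
      proof (rule level_estimate[where w = wK and YW = YK and a = a and \<phi> = \<phi> and f = f and \<iota> = \<iota>])
        show "wK \<in> borel_measurable lebesgue" "integrable lebesgue (\<lambda>z. (wK z)\<^sup>2)"
          unfolding wK_def[abs_def] by (rule L2_loc_truncate[OF L2(1) op\<Omega> K K\<Omega>])+
        show "XK j \<in> borel_measurable lebesgue" "integrable lebesgue (\<lambda>z. (XK j z)\<^sup>2)" if "j \<in> {1..m0}" for j
          unfolding XK_def[abs_def] by (rule L2_loc_truncate[OF L2(2)[OF that] op\<Omega> K K\<Omega>])+
        show "YK \<in> borel_measurable lebesgue" "integrable lebesgue (\<lambda>z. (YK z)\<^sup>2)"
          unfolding YK_def[abs_def] by (rule L2_loc_truncate[OF L2(3) op\<Omega> K K\<Omega>])+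
        show "AE z in lebesgue. 0 \<le> wK z" by (rule eventually_mono[OF wn']) (use K\<Omega> in \<open>auto simp: wK_def indicator_def\<close>)
        show "- r\<^sup>2 \<le> snd z \<and> snd z \<le> 0" if "z \<in> K" for z using K_time[OF that] by auto
        show "(LINT z|lebesgue. wK z * vf_deriv (lift X j) t z) = - (LINT z|lebesgue. XK j z * t z)"
          if "j \<in> {1..m0}" "test_function UNIV t" "\<And>z. z \<notin> K \<Longrightarrow> t z = 0" for j t
          unfolding wK_def XK_def
          by (rule weak_vf_deriv_truncate[OF weak(1)[OF that(1)] K K\<Omega> smooth_lift[OF that(1)] div_lift[OF that(1)] that(2,3)])
        show "(LINT z|lebesgue. wK z * vf_deriv (drift X) t z) = - (LINT z|lebesgue. YK z * t z)"
          if "test_function UNIV t" "\<And>z. z \<notin> K \<Longrightarrow> t z = 0" for t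
          unfolding wK_def YK_def
          by (rule weak_vf_deriv_truncate[OF weak(2) K K\<Omega> smooth_drift div_drift that])
        show "0 \<le> (LINT z|lebesgue. t z * YK z - (\<Sum>i=1..m0. \<Sum>j=1..m0. XK i z * a i j z * vf_deriv (lift X j) t z))"
          if t: "test_function UNIV t" "\<And>z. 0 \<le> t z" "\<And>z. z \<notin> K \<Longrightarrow> t z = 0" for t
        proof -
          have "0 \<le> (LINT z:\<Omega>|lebesgue. t z * Yw z - (\<Sum>i=1..m0. \<Sum>j=1..m0. Xw i z * a i j z * vf_deriv (lift X j) t z))"
            by (rule subs[OF test_function_restrict[OF t(1) K t(3) K\<Omega>] t(2)])
          moreover have "indicat_real \<Omega> z *\<^sub>R (t z * Yw z - (\<Sum>i=1..m0. \<Sum>j=1..m0. Xw i z * a i j z * vf_deriv (lift X j) t z))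
              = t z * YK z - (\<Sum>i=1..m0. \<Sum>j=1..m0. XK i z * a i j z * vf_deriv (lift X j) t z)" for z
          proof (cases "z \<in> K")
            case True
            then show ?thesis using K\<Omega> by (auto simp: YK_def XK_def)
          next
            case False
            then show ?thesis using t(3)[of z] vf_deriv_zero_outside[OF K t(3), where z = z] by simp
          qed
          ultimately show ?thesis by (simp add: set_lebesgue_integral_def)
        qed
        show "a i j = a j i" "a i j \<in> borel_measurable lebesgue" if "i \<in> {1..m0}" "j \<in> {1..m0}" for i j
          using A1 that by (auto simp: assumption_A1_def)
        show "0 \<le> (\<Sum>i=1..m0. \<Sum>j=1..m0. a i j z * \<xi> i * \<xi> j)" for z \<xi>
        proof -
          have "0 \<le> 1 / lam * (\<Sum>i=1..m0. (\<xi> i)\<^sup>2)" using lam by (intro mult_nonneg_nonneg sum_nonneg) auto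
          also have "\<dots> \<le> (\<Sum>i=1..m0. \<Sum>j=1..m0. a i j z * \<xi> i * \<xi> j)" using A1 unfolding assumption_A1_def by blast
          finally show ?thesis .
        qed
        show "(\<Sum>i=1..m0. \<Sum>j=1..m0. a i j z * \<xi> i * \<xi> j) \<le> lam * (\<Sum>i=1..m0. (\<xi> i)\<^sup>2)" for z \<xi>
          using A1 unfolding assumption_A1_def by blast
        show "smooth_on UNIV \<phi>" "\<And>z. 0 \<le> \<phi> z" "\<And>z. \<phi> z \<le> 1" by (rule smooth_phi phi_bounds)+
        show "z \<in> K" if "snd z < - \<delta>" "\<phi> z \<noteq> 0" for z using that by (intro phi_K) auto
        show "vf_deriv (drift X) \<phi> z \<le> 0" if "snd z < 0" for z by (rule drift_phi_nonpos[OF that])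
        show "\<phi> z = 1" if "\<psi> n z \<noteq> 0" for z using \<psi>nz[OF that] Cs_phi by auto
        show "grad2 \<phi> z \<le> real m0 * M\<^sup>2 / r\<^sup>2" if "z \<in> K" "snd z < 0" for z
          by (rule grad2_phi_bound[OF that(2) K_bb[OF that(1)]])
        show "f \<in> borel_measurable borel" unfolding f_def[abs_def] by measurable
        show "AE z in lebesgue. z \<in> K \<longrightarrow> ennreal (wK z *
            ((\<Sum>j=1..m0. \<bar>vf_deriv (lift X j) (vf_deriv (lift X j) \<phi>) z\<bar>) - vf_deriv (drift X) \<phi> z)) \<le> f z"
          using ww'
        proof eventually_elim
          case (elim z)
          show ?case
          proof
            assume z: "z \<in> K"
            then have e: "w z = w' z" "0 \<le> w' z" using elim K\<Omega> by auto
            have "wK z * (XX\<phi> z - Y\<phi> z) = w' z * (- Y\<phi> z) + w' z * XX\<phi> z"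
              using z by (simp add: wK_def e(1) algebra_simps)
            moreover have "0 \<le> w' z * (- Y\<phi> z)" "0 \<le> w' z * XX\<phi> z"
              using e(2) Y0[OF K_time(3)[OF z]] XX0 by (intro mult_nonneg_nonneg; simp)+
            ultimately have "ennreal (wK z * (XX\<phi> z - Y\<phi> z)) = ennreal (w' z * (- Y\<phi> z)) + ennreal (w' z * XX\<phi> z)"
              by (simp only: ennreal_plus)
            also have "\<dots> = f z" using z by (simp add: f_def)
            finally show "ennreal (wK z *
                ((\<Sum>j=1..m0. \<bar>vf_deriv (lift X j) (vf_deriv (lift X j) \<phi>) z\<bar>) - vf_deriv (drift X) \<phi> z)) \<le> f z"
              by (simp only: XX\<phi>_def Y\<phi>_def order_refl)
          qed
        qed
        show "wK z = 0" if "z \<notin> K" for z using that by (simp add: wK_def)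
        show "(\<integral>\<^sup>+\<zeta>. ennreal (G z \<zeta>) * f \<zeta> \<partial>lborel) \<le> ennreal \<iota>" if "\<psi> n z \<noteq> 0" for z
        proof -
          \<comment> \<open>G discards a non-negative part of \<Gamma>, so the integral against G is
            at most I1 + C2, whatever the kernel does in the wrong time order.\<close>
          have G\<Gamma>: "G z \<zeta> \<le> \<Gamma> z \<zeta>" for \<zeta> by (simp add: G_def kernel_nonneg)
          have "(\<integral>\<^sup>+\<zeta>. ennreal (G z \<zeta>) * f \<zeta> \<partial>lborel)
              = (\<integral>\<^sup>+\<zeta>. ennreal (G z \<zeta>) * (ennreal (w' \<zeta> * (- Y\<phi> \<zeta>)) * indicator K \<zeta>) \<partial>lborel)
                + (\<integral>\<^sup>+\<zeta>. ennreal (G z \<zeta>) * (ennreal (w' \<zeta> * XX\<phi> \<zeta>) * indicator K \<zeta>) \<partial>lborel)"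
            unfolding f_def distrib_left by (rule nn_integral_add) measurable
          also have "\<dots> \<le> a1 z + a2 z"
          proof (rule add_mono)
            have "(\<integral>\<^sup>+\<zeta>. ennreal (G z \<zeta>) * (ennreal (w' \<zeta> * (- Y\<phi> \<zeta>)) * indicator K \<zeta>) \<partial>lborel)
                = (\<integral>\<^sup>+\<zeta>. ennreal (G z \<zeta>) * (ennreal (w' \<zeta> * (- Y\<phi> \<zeta>)) * indicator K \<zeta>) \<partial>lebesgue)"
              by (rule nn_integral_completion[symmetric])
            also have "\<dots> \<le> a1 z"
              unfolding a1_def
            proof (rule nn_integral_mono_AE)
              show "AE \<zeta> in lebesgue. ennreal (G z \<zeta>) * (ennreal (w' \<zeta> * (- Y\<phi> \<zeta>)) * indicator K \<zeta>)
                  \<le> ennreal (- \<Gamma> z \<zeta> * w \<zeta> * Y\<phi> \<zeta>) * indicator Cr \<zeta>"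
                using ww'
              proof eventually_elim
                case (elim \<zeta>)
                show ?case
                proof (cases "\<zeta> \<in> K")
                  case True
                  then have e: "w \<zeta> = w' \<zeta>" "0 \<le> w' \<zeta>" using elim K\<Omega> by auto
                  have nn: "0 \<le> w' \<zeta> * (- Y\<phi> \<zeta>)" using e(2) Y0[OF K_time(3)[OF True]] by (intro mult_nonneg_nonneg) auto
                  have "ennreal (G z \<zeta>) * ennreal (w' \<zeta> * (- Y\<phi> \<zeta>)) = ennreal (G z \<zeta> * (w' \<zeta> * (- Y\<phi> \<zeta>)))"
                    by (rule ennreal_mult[OF G_nonneg nn, symmetric])
                  also have "\<dots> \<le> ennreal (\<Gamma> z \<zeta> * (w' \<zeta> * (- Y\<phi> \<zeta>)))"
                    by (intro ennreal_leI mult_right_mono G\<Gamma> nn)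
                  also have "\<Gamma> z \<zeta> * (w' \<zeta> * (- Y\<phi> \<zeta>)) = - \<Gamma> z \<zeta> * w \<zeta> * Y\<phi> \<zeta>" by (simp add: e(1))
                  finally show ?thesis using True subsetD[OF KCr True] by simp
                qed simp
              qed
            qed
            finally show "(\<integral>\<^sup>+\<zeta>. ennreal (G z \<zeta>) * (ennreal (w' \<zeta> * (- Y\<phi> \<zeta>)) * indicator K \<zeta>) \<partial>lborel) \<le> a1 z" .
            have "(\<integral>\<^sup>+\<zeta>. ennreal (G z \<zeta>) * (ennreal (w' \<zeta> * XX\<phi> \<zeta>) * indicator K \<zeta>) \<partial>lborel)
                = (\<integral>\<^sup>+\<zeta>. ennreal (G z \<zeta>) * (ennreal (w' \<zeta> * XX\<phi> \<zeta>) * indicator K \<zeta>) \<partial>lebesgue)"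
              by (rule nn_integral_completion[symmetric])
            also have "\<dots> \<le> a2 z"
              unfolding a2_def
            proof (rule nn_integral_mono_AE)
              show "AE \<zeta> in lebesgue. ennreal (G z \<zeta>) * (ennreal (w' \<zeta> * XX\<phi> \<zeta>) * indicator K \<zeta>)
                  \<le> ennreal (\<Sum>j=1..m0. \<bar>vf_deriv (lift X j) (vf_deriv (lift X j) \<phi>) \<zeta>\<bar> * \<Gamma> z \<zeta> * w \<zeta>) * indicator Cr \<zeta>"
                using ww'
              proof eventually_elim
                case (elim \<zeta>)
                show ?case
                proof (cases "\<zeta> \<in> K")
                  case True
                  then have e: "w \<zeta> = w' \<zeta>" "0 \<le> w' \<zeta>" using elim K\<Omega> by auto
                  have nn: "0 \<le> w' \<zeta> * XX\<phi> \<zeta>" using e(2) XX0 by (intro mult_nonneg_nonneg) auto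
                  have "ennreal (G z \<zeta>) * ennreal (w' \<zeta> * XX\<phi> \<zeta>) = ennreal (G z \<zeta> * (w' \<zeta> * XX\<phi> \<zeta>))"
                    by (rule ennreal_mult[OF G_nonneg nn, symmetric])
                  also have "\<dots> \<le> ennreal (\<Gamma> z \<zeta> * (w' \<zeta> * XX\<phi> \<zeta>))"
                    by (intro ennreal_leI mult_right_mono G\<Gamma> nn)
                  also have "\<Gamma> z \<zeta> * (w' \<zeta> * XX\<phi> \<zeta>) = (\<Sum>j=1..m0. \<bar>vf_deriv (lift X j) (vf_deriv (lift X j) \<phi>) \<zeta>\<bar> * \<Gamma> z \<zeta> * w \<zeta>)"
                    unfolding XX\<phi>_def sum_distrib_left e(1) by (intro sum.cong refl) (simp only: mult_ac)
                  finally show ?thesis using True subsetD[OF KCr True] by simp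
                qed simp
              qed
            qed
            finally show "(\<integral>\<^sup>+\<zeta>. ennreal (G z \<zeta>) * (ennreal (w' \<zeta> * XX\<phi> \<zeta>) * indicator K \<zeta>) \<partial>lborel) \<le> a2 z" .
          qed
          also have "\<dots> \<le> ennreal \<iota>" by (rule a12[OF \<psi>nz(1)[OF that]])
          finally show ?thesis .
        qed
        show "AE z in lebesgue. (\<psi> n z)\<^sup>2 \<le> (wK z - \<iota>) * \<psi> n z"
          using ww'
        proof eventually_elim
          case (elim z)
          show ?case
          proof (cases "\<psi> n z = 0")
            case False
            have "wK z = w' z" using \<psi>nz(4)[OF False] elim K\<Omega> by (auto simp: wK_def)
            moreover have "\<psi> n z \<le> w' z - \<iota>"
              using \<psi>nz(3)[OF False] by (auto simp: \<psi>_def indicator_def min_def)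
            ultimately show ?thesis using psi_bounds(1)[of z] by (simp add: power2_eq_square mult_right_mono)
          qed simp
        qed
      qed (use K r lam \<iota> in auto)
      also have "\<dots> = B * ?Gw" using r by (simp add: B_def power_mult_distrib)
      finally have NB: "N \<le> B * ?Gw" .
      have "(\<integral>\<^sup>+z. ennreal ((\<psi> n z)\<^sup>2) \<partial>lborel) = ennreal N"
        using nn_N psi_bounds(1) by (simp add: ennreal_power)
      also have "\<dots> \<le> ennreal (B * ?Gw)" using NB by (rule ennreal_leI)
      also have "\<dots> = ennreal B * ennreal ?Gw" using B0 by (rule ennreal_mult')
      also have "\<dots> \<le> ennreal B * RH"
      proof (rule mult_left_mono)
        have "ennreal ?Gw \<le> (\<integral>\<^sup>+z. ennreal (indicat_real K z * (\<Sum>j=1..m0. (XK j z)\<^sup>2)) \<partial>lebesgue)"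
        proof (cases "integrable lebesgue (\<lambda>z. indicat_real K z * (\<Sum>j=1..m0. (XK j z)\<^sup>2))")
          case True
          have "0 \<le> indicat_real K z * (\<Sum>j=1..m0. (XK j z)\<^sup>2)" for z by (intro mult_nonneg_nonneg sum_nonneg) auto
          then show ?thesis using nn_integral_eq_integral[OF True] by simp
        qed (simp add: not_integrable_integral_eq)
        also have "\<dots> \<le> RH"
          unfolding RH_def
          by (intro nn_integral_mono) (use KCr in \<open>auto simp: indicator_def XK_def subset_iff\<close>)
        finally show "ennreal ?Gw \<le> RH" .
      qed simp
      finally show ?thesis .
    qed
    let ?g = "\<lambda>z. ennreal ((max 0 (w' z - \<iota>))\<^sup>2) * indicator Cs z"
    have [measurable]: "\<psi> n \<in> borel_measurable borel" for n
    proof -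
      have [measurable]: "{z :: 'n point. snd z \<le> - (1 / real (Suc n))} \<in> sets borel"
        by (intro borel_closed closed_Collect_le continuous_intros)
      show ?thesis unfolding \<psi>_def[abs_def] by measurable
    qed
    have "(\<integral>\<^sup>+z\<in>Cs. (e2ennreal (max 0 (ereal (w z) - I0)))\<^sup>2 \<partial>lebesgue) = (\<integral>\<^sup>+z. ?g z \<partial>lebesgue)"
    proof (rule nn_integral_cong_AE)
      show "AE z in lebesgue. (e2ennreal (max 0 (ereal (w z) - I0)))\<^sup>2 * indicator Cs z = ?g z"
        using ww'
      proof eventually_elim
        case (elim z)
        show ?case
        proof (cases "z \<in> Cs")
          case True
          have "z \<in> Cr"
          proof -
            have "\<theta> * r \<le> \<rho>" using \<rho>(3) theta(1) r mult_left_le_one_le[of r \<theta>] theta_pos by linarith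
            moreover have "(\<theta> * r)\<^sup>2 \<le> \<rho>\<^sup>2" using calculation r theta_pos by (intro power_mono) auto
            moreover have "(lam' * (\<theta> * r)) ^ \<alpha> j \<le> (lam' * \<rho>) ^ \<alpha> j" for j
              using calculation(1) r theta_pos lam' by (intro power_mono mult_left_mono) auto
            ultimately show ?thesis using True unfolding Cs_def Cr_def cyl_def by (fastforce intro: order_trans)
          qed
          then have "w z = w' z" using elim Cr\<Omega> by auto
          then have "max 0 (ereal (w z) - I0) = ereal (max 0 (w' z - \<iota>))" by (simp add: \<iota>(1) max_def)
          then have "e2ennreal (max 0 (ereal (w z) - I0)) = ennreal (max 0 (w' z - \<iota>))" by (simp only: e2ennreal_ereal)
          then show ?thesis by (simp add: ennreal_power)
        qed simp
      qed
    qed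
    also have "\<dots> = (\<integral>\<^sup>+z. ?g z \<partial>lborel)" by (rule nn_integral_completion)
    \<comment> \<open>At each point of the small cylinder the truncations are eventually constant in
      n, so Fatou's lemma transfers the uniform bound.\<close>
    also have "\<dots> \<le> (\<integral>\<^sup>+z. liminf (\<lambda>n. ennreal ((\<psi> n z)\<^sup>2)) \<partial>lborel)"
    proof (rule nn_integral_mono)
      fix z
      show "?g z \<le> liminf (\<lambda>n. ennreal ((\<psi> n z)\<^sup>2))"
      proof (cases "z \<in> Cs")
        case True
        obtain m :: nat where m: "max (max 0 (w' z - \<iota>)) (1 / (- snd z)) \<le> real m" using real_arch_simple by blast
        have "\<forall>\<^sub>F n in sequentially. ennreal ((\<psi> n z)\<^sup>2) = ?g z"
          using eventually_ge_at_top[of m]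
        proof eventually_elim
          case (elim n)
          have "1 / (- snd z) \<le> real (Suc n)" using m elim by simp
          then have "snd z \<le> - (1 / real (Suc n))" using Cs_time(1)[OF True] by (simp add: field_simps)
          moreover have "max 0 (w' z - \<iota>) \<le> real n" using m elim by simp
          then have "min (real n) (max 0 (w' z - \<iota>)) = max 0 (w' z - \<iota>)" by (rule min_absorb2)
          ultimately show ?case using True by (simp add: \<psi>_def)
        qed
        then have "(\<lambda>n. ennreal ((\<psi> n z)\<^sup>2)) \<longlonglongrightarrow> ?g z" by (rule tendsto_eventually)
        then show ?thesis by (simp add: lim_imp_Liminf)
      qed simp
    qed
    also have "\<dots> \<le> liminf (\<lambda>n. \<integral>\<^sup>+z. ennreal ((\<psi> n z)\<^sup>2) \<partial>lborel)"
      by (rule nn_integral_liminf) measurable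
    also have "\<dots> \<le> limsup (\<lambda>n. \<integral>\<^sup>+z. ennreal ((\<psi> n z)\<^sup>2) \<partial>lborel)"
      by (rule Liminf_le_Limsup) simp
    also have "\<dots> \<le> ennreal B * RH"
      by (rule Limsup_bounded) (use level in simp)
    finally show ?thesis .
  qed
  then show ?thesis by (simp add: Cs_def RH_def Cr_def \<rho>_def B_def)
qed

end

section \<open>Choice of the constants\<close>

text \<open>C and the threshold are fixed before the fields and the weights. This is possible
  because the gradient bound for \<phi> depends on the weights only through Q, by the count of
  monomials.\<close>

theorem lemma3p3:
  fixes m0 k Q :: nat and lam lam' C1 K :: real
  assumes "1 \<le> m0" and "m0 \<le> CARD('n::{finite,linorder})"
    and "lam > 0" and "lam' > 1" and "C1 > 1" and "K > 0"
  shows "\<exists>C>0. \<exists>\<theta>s. 0 < \<theta>s \<and> \<theta>s < 2 powr (- real Q) \<and>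
    (\<forall>(X :: nat \<Rightarrow> 'n space \<Rightarrow> 'n space) (a :: nat \<Rightarrow> nat \<Rightarrow> 'n point \<Rightarrow> real)
        (\<alpha> :: 'n \<Rightarrow> nat) (op :: 'n point \<Rightarrow> 'n point \<Rightarrow> 'n point) e iv \<Gamma> w Xw Yw r \<theta> h.
       assumption_A1 m0 lam a X \<longrightarrow>
       assumption_A2 m0 X op e iv \<alpha> \<longrightarrow>
       assumption_A3 m0 X \<longrightarrow>
       coefficient_structure m0 lam \<alpha> X \<longrightarrow>
       Q = (\<Sum>i\<in>UNIV. \<alpha> i) \<longrightarrow>
       k = \<alpha> (Max UNIV) \<longrightarrow>
       fundamental_solution m0 X op iv \<alpha> Q \<Gamma> \<longrightarrow>
       weak_subsolution m0 a X (interior (cyl m0 \<alpha> lam' 1)) w Xw Yw \<longrightarrow>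
       (AE z in lebesgue. z \<in> interior (cyl m0 \<alpha> lam' 1) \<longrightarrow> 0 \<le> w z) \<longrightarrow>
       0 < r \<longrightarrow> r < \<theta> \<longrightarrow> \<theta> < \<theta>s \<longrightarrow>
       admissible_C1 m0 \<alpha> Q X C1 r \<theta> \<longrightarrow>
       cutoff_profile Q K r \<theta> h \<longrightarrow>
       (let \<phi> = cutoff_phi m0 \<alpha> Q C1 r \<theta> h;
            I0 = (SUP z\<in>cyl m0 \<alpha> lam' (\<theta> * r).
                    I1_term X \<Gamma> (cyl m0 \<alpha> lam' (r / \<theta>)) w \<phi> z
                    + C2_term m0 X \<Gamma> (cyl m0 \<alpha> lam' (r / \<theta>)) w \<phi> z)
        in (\<integral>\<^sup>+z\<in>cyl m0 \<alpha> lam' (\<theta> * r). (e2ennreal (max 0 (ereal (w z) - I0)))\<^sup>2 \<partial>lebesgue)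
           \<le> ennreal (C * \<theta>\<^sup>2 * r\<^sup>2) *
             (\<integral>\<^sup>+z\<in>cyl m0 \<alpha> lam' (r / \<theta>). ennreal (\<Sum>j=1..m0. (Xw j z)\<^sup>2) \<partial>lebesgue)))"
proof -
  \<comment> \<open>The value that \<open>M\<close> takes in every later instance of the cut-off
    setting.\<close>
  define M0 where "M0 = 4 * real CARD('n) * lam + 8 * real CARD('n) * (lam * real (Q + 1) ^ CARD('n))"
  define C where "C = 2 * (1 + lam)\<^sup>2 * (2 + real m0 * M0\<^sup>2)"
  \<comment> \<open>Halving 2^(-Q) gives the strict inequality of the statement, and the bound by
    2^(-Q) yields a Q-th root below 1 / 2. The other two terms ensure lam' \<theta> \<le> 1 and (N +
    C1) \<theta> \<le> 1.\<close>
  define \<theta>s where "\<theta>s = min (2 powr (- real Q) / 2) (min (1 / lam') (1 / (real CARD('n) + C1)))"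
  have C: "C > 0" using assms by (auto simp: C_def intro!: mult_pos_pos add_pos_nonneg)
  have \<theta>s: "0 < \<theta>s" using assms by (simp add: \<theta>s_def add_nonneg_pos)
  have \<theta>s2: "\<theta>s < 2 powr (- real Q)"
  proof -
    have "\<theta>s \<le> 2 powr (- real Q) / 2" by (simp add: \<theta>s_def)
    also have "\<dots> < 2 powr (- real Q)" by simp
    finally show ?thesis .
  qed
  have main: "(\<integral>\<^sup>+z\<in>cyl m0 \<alpha> lam' (\<theta> * r). (e2ennreal (max 0 (ereal (w z) - (SUP z\<in>cyl m0 \<alpha> lam' (\<theta> * r).
          I1_term X \<Gamma> (cyl m0 \<alpha> lam' (r / \<theta>)) w (cutoff_phi m0 \<alpha> Q C1 r \<theta> h) z
          + C2_term m0 X \<Gamma> (cyl m0 \<alpha> lam' (r / \<theta>)) w (cutoff_phi m0 \<alpha> Q C1 r \<theta> h) z))))\<^sup>2 \<partial>lebesgue)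
      \<le> ennreal (C * \<theta>\<^sup>2 * r\<^sup>2) * (\<integral>\<^sup>+z\<in>cyl m0 \<alpha> lam' (r / \<theta>). ennreal (\<Sum>j=1..m0. (Xw j z)\<^sup>2) \<partial>lebesgue)"
    if A1: "assumption_A1 m0 lam a X" and A2: "assumption_A2 m0 X op e iv \<alpha>"
      and coeff: "coefficient_structure m0 lam \<alpha> X" and Q: "Q = (\<Sum>i\<in>UNIV. \<alpha> i)"
      and fund: "fundamental_solution m0 X op iv \<alpha> Q \<Gamma>"
      and ws: "weak_subsolution m0 a X (interior (cyl m0 \<alpha> lam' 1)) w Xw Yw"
      and wn: "AE z in lebesgue. z \<in> interior (cyl m0 \<alpha> lam' 1) \<longrightarrow> 0 \<le> w z"
      and r: "0 < r" "r < \<theta>" and th: "\<theta> < \<theta>s"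
      and adm: "admissible_C1 m0 \<alpha> Q X C1 r \<theta>" and prof: "cutoff_profile Q K r \<theta> h"
    for X :: "nat \<Rightarrow> 'n space \<Rightarrow> 'n space" and a :: "nat \<Rightarrow> nat \<Rightarrow> 'n point \<Rightarrow> real" and \<alpha> :: "'n \<Rightarrow> nat"
      and op :: "'n point \<Rightarrow> 'n point \<Rightarrow> 'n point" and e iv \<Gamma> w Xw Yw r \<theta> h
  proof -
    have alpha: "1 \<le> \<alpha> i" for i using A2 by (auto simp: assumption_A2_def homogeneous_Lie_group_def)
    have "0 < \<alpha> undefined" using alpha[of undefined] by simp
    moreover have "\<alpha> undefined \<le> Q" unfolding Q by (rule member_le_sum) auto
    ultimately have Qp: "0 < Q" by simp
    have t: "0 < \<theta>" "\<theta> < 2 powr (- real Q)" "\<theta> < 1 / lam'" "\<theta> < 1 / (real CARD('n) + C1)"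
      using r th by (auto simp: \<theta>s_def min_def split: if_splits)
    interpret cutoff m0 Q \<alpha> X C1 r \<theta> K lam lam' h
    proof
      have "lam' * \<theta> < 1" using t(3) assms(4) by (simp add: field_simps)
      then show "lam' * \<theta> \<le> 1" by simp
      have "1 * \<theta> \<le> lam' * \<theta>" using assms(4) t(1) by (intro mult_right_mono) auto
      then show "\<theta> < 1" using \<open>lam' * \<theta> < 1\<close> by linarith
      show "(real CARD('n) + C1) * \<theta> \<le> 1"
        using t(4) assms(5) by (simp add: pos_less_divide_eq add_nonneg_pos mult.commute less_imp_le)
      have "2 powr (- real Q) = (1 / 2) ^ Q" by (simp add: powr_minus powr_realpow power_one_over inverse_eq_divide)
      then have "root Q \<theta> < root Q ((1 / 2) ^ Q)" using t(2) Qp by simp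
      also have "\<dots> = 1 / 2" using Qp by (simp add: real_root_power_cancel)
      finally show "root Q \<theta> < 1 / 2" .
    qed (use r assms alpha Q coeff adm prof in auto)
    have "M = M0" by (simp add: M_def M0_def)
    with oscillation_estimate[OF A1 A2 fund ws wn] show ?thesis by (simp add: C_def)
  qed
  show ?thesis
    unfolding Let_def
    by (intro exI[of _ C] exI[of _ \<theta>s] conjI allI impI C \<theta>s \<theta>s2) (rule main)
qed

end
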